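(* Let $k\ge 0$ be an integer and $r=k+1$. Let $u$ be the solution of the Burgers problem $u_t+uu_x-\nu u_{xx}=0$ in $I\times J$, $u(x,0)=g(x)$ for $x\in I$, $u(0,t)=u(1,t)=0$ for $t\in J$, and assume $u\in H^1(0,T;H^{1+r}(I))$. For a partition $I_h$ of $I$ with mesh size $h$, let $u_h(t)\in S_h^0$ be a solution of the semi-discrete weak Galerkin problem $$\big((u_h^0)_t,v^0\big)_h+\nu(d_{w,r}u_h,d_{w,r}v)_h+\tfrac13(u_h^0\,d_{w,r}u_h,v^0)_h-\tfrac13(u_h^0u_h^0,d_{w,r}v)_h=0,\quad \forall v\in S_h^0,\ t\in J,$$ with initial value $u_h(\cdot,0)=g_h=Q_hg$. Then there exists a constant $C$, independent of the partition $I_h$ (in particular of $h$) and of $t$, such that for all $t\in J$ $$\|u_x(t)-d_{w,r}u_h(t)\|_h^2\le Ch^{2(k+1)}\Big(\|u(0)\|_{k+2}^2+\int_0^t\|u_t(s)\|_{k+2}^2\,ds\Big).$$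
   Context: $I=(0,1)$, $J=(0,T]$ with $0<T<\infty$, and $\nu>0$ is a constant (inverse Reynolds number). $\|\cdot\|_s$ is the norm of the Sobolev space $H^s(I)$. $H^l(0,T;H^s(I))$ is the usual space of functions of $t\in(0,T)$ with values in $H^s(I)$ whose time derivatives up to order $l$ are square integrable in time with values in $H^s(I)$. Partition: $I_h:\ 0=x_1<x_2<\dots<x_N=1$, $I_i=(x_i,x_{i+1})$, $h_i=x_{i+1}-x_i$, $h=\max_i h_i$. $P_m(I_i)$ denotes polynomials of degree at most $m$ on $I_i$. Weak functions: $S_h$ is the space of $v$ consisting of an interior part $v^0$ with $v^0|_{I_i}\in P_k(I_i)$ for each $i=1,\dots,N-1$ (no continuity between elements required), together with one real nodal value $v^i$ at each node $x_i$, $i=1,\dots,N$ (not necessarily related to traces of $v^0$). $S_h^0=\{v\in S_h: v^1=v^N=0\}$. Discrete weak derivative: for $v\in S_h$, $d_{w,r}v$ is the piecewise polynomial with $d_{w,r}v|_{I_i}\in P_r(I_i)$ determined on each element by $\int_{I_i}(d_{w,r}v)\,q\,dx=-\int_{I_i}v^0q'\,dx+v^{i+1}q(x_{i+1})-v^iq(x_i)$ for all $q\in P_r(I_i)$. Discrete inner product: $(u,v)_h=\sum_{i=1}^{N-1}\int_{I_i}uv\,dx$, $\|u\|_h^2=(u,u)_h$. Projection: for $w\in H^1(I)$, $Q_hw\in S_h$ has interior part $Q_h^0w$ equal on each $I_i$ to the $L^2(I_i)$-orthogonal projection of $w$ onto $P_k(I_i)$, and nodal values $(Q_hw)^i=w(x_i)$.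 For a solution $u_h$ of the semi-discrete problem, the interior part $u_h^0$ is understood to be continuous in time on $[0,T]$ and continuously differentiable in time on $J$. The constant $C$ may depend on $u$, $\nu$, $T$, $k$. *)

theory Defs
  imports "HOL-Analysis.Analysis" "HOL-Computational_Algebra.Polynomial"
begin

text \<open>Elements of $L^2$ and $H^s$ are represented by functions; equality of classes is equality
  almost everywhere.\<close>

definition L2_on :: "real set \<Rightarrow> (real \<Rightarrow> real) set" where
  "L2_on S = {f. f \<in> borel_measurable (lebesgue_on S) \<and> integrable (lebesgue_on S) (\<lambda>x. (f x)\<^sup>2)}"

definition test_functions :: "real \<Rightarrow> real \<Rightarrow> (real \<Rightarrow> real) set" where
  "test_functions a b = {\<phi>. (\<forall>n. (deriv ^^ n) \<phi> differentiable_on UNIV) \<and>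
     (\<exists>c d. a < c \<and> d < b \<and> (\<forall>x. x \<notin> {c..d} \<longrightarrow> \<phi> x = 0))}"

definition is_weak_deriv :: "nat \<Rightarrow> (real \<Rightarrow> real) \<Rightarrow> (real \<Rightarrow> real) \<Rightarrow> bool" where
  "is_weak_deriv j f g \<longleftrightarrow> f \<in> L2_on {0<..<1} \<and> g \<in> L2_on {0<..<1} \<and>
     (\<forall>\<phi>\<in>test_functions 0 1.
        (LINT x|lebesgue_on {0<..<1}. f x * (deriv ^^ j) \<phi> x) =
        (-1) ^ j * (LINT x|lebesgue_on {0<..<1}. g x * \<phi> x))"

text \<open>An arbitrary representative of the weak derivative of order \<open>j\<close>; it is only ever used under
  an integral sign or almost everywhere.\<close>

definition wderiv :: "nat \<Rightarrow> (real \<Rightarrow> real) \<Rightarrow> real \<Rightarrow> real" where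
  "wderiv j f = (SOME g. is_weak_deriv j f g)"

definition sobolev :: "nat \<Rightarrow> (real \<Rightarrow> real) set" where
  "sobolev s = {f. \<forall>j\<le>s. \<exists>g. is_weak_deriv j f g}"

definition sobolev_norm :: "nat \<Rightarrow> (real \<Rightarrow> real) \<Rightarrow> real" where
  "sobolev_norm s f = sqrt (\<Sum>j\<le>s. LINT x|lebesgue_on {0<..<1}. (wderiv j f x)\<^sup>2)"

text \<open>A function of time and space is written \<open>u t x\<close>, so that \<open>u t\<close> is its value in $H^s(I)$.
  A simple function $\sum_m 1_{E_m} w_m$ is given by the list of the pairs $(E_m, w_m)$.\<close>

definition simple_data :: "real \<Rightarrow> nat \<Rightarrow> (real set \<times> (real \<Rightarrow> real)) list set" where
  "simple_data T s = {L. \<forall>(E, w)\<in>set L. E \<in> sets lebesgue \<and> E \<subseteq> {0<..<T} \<and> w \<in> sobolev s}"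

definition simple_fun :: "(real set \<times> (real \<Rightarrow> real)) list \<Rightarrow> real \<Rightarrow> real \<Rightarrow> real" where
  "simple_fun L t x = (\<Sum>(E, w)\<leftarrow>L. indicator E t * w x)"

definition simple_int :: "(real set \<times> (real \<Rightarrow> real)) list \<Rightarrow> real \<Rightarrow> real" where
  "simple_int L x = (\<Sum>(E, w)\<leftarrow>L. measure lebesgue E * w x)"

definition strongly_measurable :: "real \<Rightarrow> nat \<Rightarrow> (real \<Rightarrow> real \<Rightarrow> real) \<Rightarrow> bool" where
  "strongly_measurable T s u \<longleftrightarrow>
     (AE t in lebesgue_on {0<..<T}. u t \<in> sobolev s) \<and>
     (\<exists>L. (\<forall>n. L n \<in> simple_data T s) \<and>
        (AE t in lebesgue_on {0<..<T}.
           (\<lambda>n. sobolev_norm s (\<lambda>x. u t x - simple_fun (L n) t x)) \<longlonglongrightarrow> 0))"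

text \<open>\<open>w\<close> is the Bochner integral of \<open>u\<close> over $(0,T)$ in $H^s(I)$.\<close>

definition has_sobolev_integral ::
  "real \<Rightarrow> nat \<Rightarrow> (real \<Rightarrow> real \<Rightarrow> real) \<Rightarrow> (real \<Rightarrow> real) \<Rightarrow> bool" where
  "has_sobolev_integral T s u w \<longleftrightarrow> strongly_measurable T s u \<and> w \<in> sobolev s \<and>
     (\<exists>L. (\<forall>n. L n \<in> simple_data T s \<and>
             integrable (lebesgue_on {0<..<T})
               (\<lambda>t. sobolev_norm s (\<lambda>x. u t x - simple_fun (L n) t x))) \<and>
        (\<lambda>n. LINT t|lebesgue_on {0<..<T}.
               sobolev_norm s (\<lambda>x. u t x - simple_fun (L n) t x)) \<longlonglongrightarrow> 0 \<and>
        (\<lambda>n. sobolev_norm s (\<lambda>x. simple_int (L n) x - w x)) \<longlonglongrightarrow> 0)"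

definition L2_sobolev :: "real \<Rightarrow> nat \<Rightarrow> (real \<Rightarrow> real \<Rightarrow> real) set" where
  "L2_sobolev T s = {u. strongly_measurable T s u \<and>
     integrable (lebesgue_on {0<..<T}) (\<lambda>t. (sobolev_norm s (u t))\<^sup>2)}"

text \<open>\<open>u\<close> belongs to $H^1(0,T;H^s(I))$ and its weak time derivative is \<open>ut\<close>.\<close>

definition is_H1_sobolev_with_deriv ::
  "real \<Rightarrow> nat \<Rightarrow> (real \<Rightarrow> real \<Rightarrow> real) \<Rightarrow> (real \<Rightarrow> real \<Rightarrow> real) \<Rightarrow> bool" where
  "is_H1_sobolev_with_deriv T s u ut \<longleftrightarrow> u \<in> L2_sobolev T s \<and> ut \<in> L2_sobolev T s \<and>
     (\<forall>\<phi>\<in>test_functions 0 T. \<exists>w.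
        has_sobolev_integral T s (\<lambda>t x. deriv \<phi> t * u t x) w \<and>
        has_sobolev_integral T s (\<lambda>t x. \<phi> t * ut t x) (\<lambda>x. - w x))"

text \<open>The representative of \<open>u\<close> given by the embeddings
  $H^1(0,T;H^s(I)) \subset C([0,T];H^s(I))$ and $H^s(I) \subset C([0,1])$ (for $s \ge 1$), which
  gives a meaning to \<open>u t\<close> for every $t \in [0,T]$ and to \<open>u t x\<close> for every $x \in [0,1]$.\<close>

definition continuous_representative :: "real \<Rightarrow> nat \<Rightarrow> (real \<Rightarrow> real \<Rightarrow> real) \<Rightarrow> bool" where
  "continuous_representative T s u \<longleftrightarrow>
     (\<forall>t\<in>{0..T}. u t \<in> sobolev s \<and> continuous_on {0..1} (u t) \<and>
        ((\<lambda>t'. sobolev_norm s (\<lambda>x. u t' x - u t x)) \<longlongrightarrow> 0) (at t within {0..T}))"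

text \<open>The equation is an identity between elements of $L^2(I)$ for almost every time, because in
  general $u_t$ and $u_{xx}$ are no more than such elements.\<close>

definition burgers_solution ::
  "real \<Rightarrow> real \<Rightarrow> (real \<Rightarrow> real) \<Rightarrow> (real \<Rightarrow> real \<Rightarrow> real) \<Rightarrow> (real \<Rightarrow> real \<Rightarrow> real) \<Rightarrow> bool" where
  "burgers_solution \<nu> T g u ut \<longleftrightarrow>
     (AE t in lebesgue_on {0<..<T}. AE x in lebesgue_on {0<..<1}.
        ut t x + u t x * wderiv 1 (u t) x - \<nu> * wderiv 2 (u t) x = 0) \<and>
     (\<forall>x\<in>{0<..<1}. u 0 x = g x) \<and>
     (\<forall>t\<in>{0<..T}. u t 0 = 0 \<and> u t 1 = 0)"

text \<open>The nodes are \<open>x 1, \<dots>, x N\<close> and the elements $(x_i,x_{i+1})$ are numbered by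
  \<open>i \<in> {1..<N}\<close>; values at other indices are never used.\<close>

definition is_mesh :: "nat \<Rightarrow> (nat \<Rightarrow> real) \<Rightarrow> bool" where
  "is_mesh N x \<longleftrightarrow> N \<ge> 2 \<and> x 1 = 0 \<and> x N = 1 \<and> (\<forall>i\<in>{1..<N}. x i < x (i + 1))"

definition mesh_size :: "nat \<Rightarrow> (nat \<Rightarrow> real) \<Rightarrow> real" where
  "mesh_size N x = Max ((\<lambda>i. x (i + 1) - x i) ` {1..<N})"

datatype weak_fun = Weak_Fun (interior_part: "nat \<Rightarrow> real poly") (nodal_value: "nat \<Rightarrow> real")

definition S_h :: "nat \<Rightarrow> nat \<Rightarrow> weak_fun set" where
  "S_h k N = {v. \<forall>i\<in>{1..<N}. degree (interior_part v i) \<le> k}"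

definition S_h0 :: "nat \<Rightarrow> nat \<Rightarrow> weak_fun set" where
  "S_h0 k N = {v \<in> S_h k N. nodal_value v 1 = 0 \<and> nodal_value v N = 0}"

abbreviation element :: "(nat \<Rightarrow> real) \<Rightarrow> nat \<Rightarrow> real set" where
  "element x i \<equiv> {x i<..<x (i + 1)}"

definition weak_derivative :: "nat \<Rightarrow> (nat \<Rightarrow> real) \<Rightarrow> weak_fun \<Rightarrow> nat \<Rightarrow> real poly" where
  "weak_derivative r x v i = (THE d. degree d \<le> r \<and>
     (\<forall>q. degree q \<le> r \<longrightarrow>
        (LINT y|lebesgue_on (element x i). poly d y * poly q y) =
        - (LINT y|lebesgue_on (element x i). poly (interior_part v i) y * poly (pderiv q) y)
        + nodal_value v (i + 1) * poly q (x (i + 1)) - nodal_value v i * poly q (x i)))"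

definition L2_projection :: "nat \<Rightarrow> (nat \<Rightarrow> real) \<Rightarrow> (real \<Rightarrow> real) \<Rightarrow> nat \<Rightarrow> real poly" where
  "L2_projection k x w i = (THE p. degree p \<le> k \<and>
     (\<forall>q. degree q \<le> k \<longrightarrow>
        (LINT y|lebesgue_on (element x i). (w y - poly p y) * poly q y) = 0))"

text \<open>The nodal values require \<open>w\<close> to be the continuous representative on $[0,1]$.\<close>

definition Q_h :: "nat \<Rightarrow> (nat \<Rightarrow> real) \<Rightarrow> (real \<Rightarrow> real) \<Rightarrow> weak_fun" where
  "Q_h k x w = Weak_Fun (L2_projection k x w) (\<lambda>i. w (x i))"

text \<open>A function on the union of the elements is a family \<open>f i\<close>, where \<open>f i\<close> is its restriction to
  the \<open>i\<close>-th element.\<close>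

definition inner_h ::
  "nat \<Rightarrow> (nat \<Rightarrow> real) \<Rightarrow> (nat \<Rightarrow> real \<Rightarrow> real) \<Rightarrow> (nat \<Rightarrow> real \<Rightarrow> real) \<Rightarrow> real" where
  "inner_h N x f g = (\<Sum>i\<in>{1..<N}. LINT y|lebesgue_on (element x i). f i y * g i y)"

definition norm_h :: "nat \<Rightarrow> (nat \<Rightarrow> real) \<Rightarrow> (nat \<Rightarrow> real \<Rightarrow> real) \<Rightarrow> real" where
  "norm_h N x f = sqrt (inner_h N x f f)"

text \<open>\<open>p\<close> is continuous on $[0,T]$ and continuously differentiable on $(0,T]$ with derivative \<open>dp\<close>,
  as a function of time with values in a finite-dimensional space of polynomials.\<close>

definition poly_C1_in_time :: "real \<Rightarrow> (real \<Rightarrow> real poly) \<Rightarrow> (real \<Rightarrow> real poly) \<Rightarrow> bool" where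
  "poly_C1_in_time T p dp \<longleftrightarrow> (\<forall>j.
     continuous_on {0..T} (\<lambda>t. coeff (p t) j) \<and>
     (\<forall>t\<in>{0<..T}. ((\<lambda>s. coeff (p s) j) has_real_derivative coeff (dp t) j) (at t within {0<..T})) \<and>
     continuous_on {0<..T} (\<lambda>t. coeff (dp t) j))"

text \<open>No regularity in time is imposed on the nodal values.\<close>

definition wg_solution ::
  "nat \<Rightarrow> nat \<Rightarrow> real \<Rightarrow> real \<Rightarrow> (real \<Rightarrow> real) \<Rightarrow> nat \<Rightarrow> (nat \<Rightarrow> real) \<Rightarrow> (real \<Rightarrow> weak_fun) \<Rightarrow> bool"
where
  "wg_solution k r \<nu> T g N x uh \<longleftrightarrow>
     (\<forall>t\<in>{0..T}. uh t \<in> S_h0 k N) \<and>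
     (\<forall>i\<in>{1..<N}. interior_part (uh 0) i = interior_part (Q_h k x g) i) \<and>
     (\<forall>i\<in>{1..N}. nodal_value (uh 0) i = nodal_value (Q_h k x g) i) \<and>
     (\<exists>duh. (\<forall>i\<in>{1..<N}. poly_C1_in_time T (\<lambda>t. interior_part (uh t) i) (\<lambda>t. duh t i)) \<and>
        (\<forall>t\<in>{0<..T}. \<forall>v\<in>S_h0 k N.
           inner_h N x (\<lambda>i. poly (duh t i)) (\<lambda>i. poly (interior_part v i))
           + \<nu> * inner_h N x (\<lambda>i. poly (weak_derivative r x (uh t) i))
                             (\<lambda>i. poly (weak_derivative r x v i))
           + 1/3 * inner_h N x
               (\<lambda>i y. poly (interior_part (uh t) i) y * poly (weak_derivative r x (uh t) i) y)
               (\<lambda>i. poly (interior_part v i))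
           - 1/3 * inner_h N x
               (\<lambda>i y. poly (interior_part (uh t) i) y * poly (interior_part (uh t) i) y)
               (\<lambda>i. poly (weak_derivative r x v i)) = 0))"

end

theory Submission
  imports Defs
begin

text \<open>Testing the scheme with the nodal values shows that the piecewise projection $\sigma$ of
  $\nu d_{w,r} u_h - (u_h^0)^2/3$ to degree $k+1$ is continuous; it is a discrete flux, and the scheme says that
  $(u_h^0)_t$ is the projection of $\sigma' - u_h^0 d_{w,r} u_h/3$ to degree $k$. The interpolant $G$ of the exact flux
  $\nu u_x - u^2/3$ commutes with this structure, so that the errors $e = Q_h^0 u - u_h^0$,
  $E = Q u_x - d_{w,r} u_h$ and $\tau = G - \sigma$ satisfy closed relations with consistency terms of order
  $H = h^{k+1}$, where $Q$ is the projection to degree $k+1$.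

  The antisymmetric form of the convection gives the energy estimate
  $(e,e)_t + \nu (E,E) \le K((e,e) + H^2)$, hence $e = O(H)$ and a bound for the time integral of $(E,E)$.
  In the relation for $\nu E$ the nodal errors are primitives of quantities bounded by $\tau$ and $H$; this
  bounds the supremum of $e$, and then $E$, by a multiple of $\Vert\tau\Vert + H$ on every mesh, however coarse.
  Differentiating the relation in time gives
  $(\tau,\tau)_t \le C (1 + (E,E) + \Vert u_t\Vert)((\tau,\tau) + H^2)$, and Gronwall's inequality
  applies because the coefficient is integrable in time and $\tau(0) = O(H)$. As neither the solution nor the
  nodal values are smooth in time, all differential inequalities are replaced by inequalities between
  difference quotients from the left.

  The right-hand side of the bound dominates a fixed multiple of $h^{2(k+1)}$ unless $u(0)$ vanishes; in
  that case $u$ vanishes identically and the estimate holds with every $H > 0$ in place of $h^{k+1}$.\<close>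

section \<open>Integrals over open intervals\<close>

text \<open>The constant has to serve every partition, so inverse inequalities that lose powers of
  the mesh size are useless, and no smallness of the mesh may be assumed. In the coefficient of
  Gronwall's inequality the discrete solution is bounded pointwise by A(1 + 2 ||E||) and not through
  the flux error, which would make the inequality superlinear. The flux error is propagated instead
  of \<open>E\<close> because this needs no time derivative of nodal values: its derivative
  \<open>\<tau>'\<close> has degree k, hence is admissible in the evolution equation, which then
  supplies the dissipative term -2 \<nu> (\<tau>',\<tau>'). The time integral of (E,E) is never
  formed; the decrease of (e,e) between two times pays for it.\<close>

abbreviation ioint :: "real \<Rightarrow> real \<Rightarrow> (real \<Rightarrow> real) \<Rightarrow> real" where
  "ioint a b f \<equiv> LINT y|lebesgue_on {a<..<b}. f y"

abbreviation iointegrable :: "real \<Rightarrow> real \<Rightarrow> (real \<Rightarrow> real) \<Rightarrow> bool" where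
  "iointegrable a b f \<equiv> integrable (lebesgue_on {a<..<b}) f"

lemma Cauchy_Schwarz_integral:
  fixes f g :: "'a \<Rightarrow> real"
  assumes [measurable]: "f \<in> borel_measurable M" "g \<in> borel_measurable M"
    and f: "integrable M (\<lambda>x. (f x)\<^sup>2)" and g: "integrable M (\<lambda>x. (g x)\<^sup>2)"
  shows integrable_mult_square_integrable: "integrable M (\<lambda>x. f x * g x)"
    and "\<bar>LINT x|M. f x * g x\<bar> \<le> sqrt (LINT x|M. (f x)\<^sup>2) * sqrt (LINT x|M. (g x)\<^sup>2)"
proof -
  show i: "integrable M (\<lambda>x. f x * g x)"
  proof (rule Bochner_Integration.integrable_bound[OF Bochner_Integration.integrable_add[OF f g]])
    show "AE x in M. norm (f x * g x) \<le> norm ((f x)\<^sup>2 + (g x)\<^sup>2)"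
    proof (rule AE_I2)
      fix x
      have "2 * (\<bar>f x\<bar> * \<bar>g x\<bar>) \<le> (f x)\<^sup>2 + (g x)\<^sup>2"
        using sum_squares_bound[of "\<bar>f x\<bar>" "\<bar>g x\<bar>"] by simp
      moreover have "0 \<le> \<bar>f x\<bar> * \<bar>g x\<bar>" by simp
      ultimately have "\<bar>f x\<bar> * \<bar>g x\<bar> \<le> (f x)\<^sup>2 + (g x)\<^sup>2" by linarith
      then show "norm (f x * g x) \<le> norm ((f x)\<^sup>2 + (g x)\<^sup>2)"
        by (simp add: abs_mult)
    qed
  qed simp
  define a b c where "a = (LINT x|M. (f x)\<^sup>2)" and "b = (LINT x|M. (g x)\<^sup>2)" and "c = (LINT x|M. f x * g x)"
  have ab: "0 \<le> a" "0 \<le> b" unfolding a_def b_def by (auto intro!: integral_nonneg_AE)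
  have q: "0 \<le> s\<^sup>2 * a + 2 * s * c + b" for s
  proof -
    have "0 \<le> (LINT x|M. (s * f x + g x)\<^sup>2)" by (intro integral_nonneg_AE) auto
    also have "\<dots> = (LINT x|M. s\<^sup>2 * (f x)\<^sup>2 + 2 * s * (f x * g x) + (g x)\<^sup>2)"
      by (intro Bochner_Integration.integral_cong) (auto simp: power2_eq_square algebra_simps)
    also have "\<dots> = s\<^sup>2 * a + 2 * s * c + b"
      using f g i by (simp add: a_def b_def c_def)
    finally show ?thesis .
  qed
  have "c\<^sup>2 \<le> a * b"
  proof (cases "a = 0")
    case True
    have "c = 0"
    proof (rule ccontr)
      assume "c \<noteq> 0"
      \<comment> \<open>For a = 0 the quadratic is affine in s, and this value of s would make it
        equal to -1.\<close>
      then have "0 \<le> - (b + 1) + b" using q[of "- (b + 1) / (2 * c)"] True by (simp add: field_simps)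
      then show False by simp
    qed
    then show ?thesis using True by simp
  next
    case False
    then have "0 \<le> b - c\<^sup>2 / a"
      using q[of "- c / a"] by (simp add: power2_eq_square)
    then show ?thesis using False ab by (simp add: field_simps)
  qed
  then have "sqrt (c\<^sup>2) \<le> sqrt (a * b)" by (rule real_sqrt_le_mono)
  then show "\<bar>LINT x|M. f x * g x\<bar> \<le> sqrt (LINT x|M. (f x)\<^sup>2) * sqrt (LINT x|M. (g x)\<^sup>2)"
    by (simp add: a_def b_def c_def real_sqrt_mult)
qed

lemma iointegrable_iff: "iointegrable a b f \<longleftrightarrow> integrable lebesgue (\<lambda>y. indicator {a<..<b} y * f y)"
  by (subst integrable_restrict_space) auto

lemma ioint_eq: "ioint a b f = (LINT y|lebesgue. indicator {a<..<b} y * f y)"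
  by (subst integral_restrict_space) auto

lemma iointegrable_subinterval:
  assumes "iointegrable a b f" "a \<le> c" "d \<le> b"
  shows "iointegrable c d f"
proof -
  have "integrable lebesgue (\<lambda>y. indicator {c<..<d} y *\<^sub>R (indicator {a<..<b} y * f y))"
    using assms(1) unfolding iointegrable_iff by (rule integrable_mult_indicator[rotated]) auto
  then show ?thesis unfolding iointegrable_iff
    by (rule back_subst[of "integrable lebesgue"]) (use assms in \<open>auto simp: indicator_def fun_eq_iff\<close>)
qed

lemma ioint_eq_integral:
  assumes "iointegrable a b f"
  shows "ioint a b f = integral {a..b} f" "f integrable_on {a..b}"
  using lebesgue_integral_eq_integral[OF assms] integrable_on_lebesgue_on[OF assms]
  by (auto simp: integral_open_interval_real integrable_on_open_interval_real)

lemma ioint_combine: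
  assumes "iointegrable a c f" "a \<le> b" "b \<le> c"
  shows "ioint a c f = ioint a b f + ioint b c f"
proof -
  have 1: "iointegrable a b f" "iointegrable b c f"
    using iointegrable_subinterval[OF assms(1)] assms by auto
  show ?thesis
    using Henstock_Kurzweil_Integration.integral_combine[OF assms(2,3) ioint_eq_integral(2)[OF assms(1)]]
    by (simp add: ioint_eq_integral(1)[OF assms(1)] ioint_eq_integral(1)[OF 1(1)] ioint_eq_integral(1)[OF 1(2)])
qed

lemma continuous_on_ioint:
  assumes "iointegrable a b f"
  shows "continuous_on {a..b} (\<lambda>y. ioint a y f)"
proof -
  have "continuous_on {a..b} (\<lambda>y. integral {a..y} f)"
    by (rule indefinite_integral_continuous_1[OF ioint_eq_integral(2)[OF assms]])
  moreover have "ioint a y f = integral {a..y} f" if "y \<in> {a..b}" for y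
    by (rule ioint_eq_integral(1), rule iointegrable_subinterval[OF assms]) (use that in auto)
  ultimately show ?thesis by (metis (no_types, lifting) continuous_on_cong)
qed

lemma continuous_iointegrable:
  assumes "continuous_on {a..b} f"
  shows "iointegrable a b f"
proof -
  have "set_integrable lebesgue {a<..<b} f"
    by (rule set_integrable_subset[OF absolutely_integrable_continuous_real[OF assms]]) auto
  then show ?thesis unfolding iointegrable_iff set_integrable_def by simp
qed

lemma measurable_lebesgue_on_subset:
  assumes "f \<in> borel_measurable (lebesgue_on S)" "T \<subseteq> S"
  shows "f \<in> borel_measurable (lebesgue_on T)"
  using measurable_restrict_mono[OF assms] .

lemma continuous_on_measurable_Ioo:
  fixes f :: "real \<Rightarrow> real"
  assumes "continuous_on {a..b} f"
  shows "f \<in> borel_measurable (lebesgue_on {a<..<b})"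
  by (rule measurable_lebesgue_on_subset[OF continuous_imp_measurable_on_sets_lebesgue[OF assms]]) auto

lemma ioint_mono:
  assumes "iointegrable a b f" "iointegrable a b g" "\<And>y. a < y \<Longrightarrow> y < b \<Longrightarrow> f y \<le> g y"
  shows "ioint a b f \<le> ioint a b g"
  by (rule integral_mono[OF assms(1,2)]) (use assms(3) in auto)

lemma abs_ioint_le: "\<bar>ioint a b f\<bar> \<le> ioint a b (\<lambda>y. \<bar>f y\<bar>)"
  using integral_norm_bound[of "lebesgue_on {a<..<b}" f] by simp

lemma ioint_nonneg: "(\<And>y. a < y \<Longrightarrow> y < b \<Longrightarrow> 0 \<le> f y) \<Longrightarrow> 0 \<le> ioint a b f"
  by (intro integral_nonneg_AE) (auto intro!: AE_I2)

lemma ioint_mono_interval: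
  assumes "iointegrable a b f" "a \<le> c" "c \<le> d" "d \<le> b" "\<And>y. a < y \<Longrightarrow> y < b \<Longrightarrow> 0 \<le> f y"
  shows "ioint c d f \<le> ioint a b f"
proof -
  have "ioint a b f = ioint a c f + ioint c d f + ioint d b f"
    using ioint_combine[OF assms(1), of c] ioint_combine[OF iointegrable_subinterval[OF assms(1), of c b], of d] assms by auto
  moreover have "0 \<le> ioint a c f" "0 \<le> ioint d b f"
    by (rule ioint_nonneg; use assms in auto)+
  ultimately show ?thesis by simp
qed

lemma ioint_const [simp]: "a \<le> b \<Longrightarrow> ioint a b (\<lambda>y. c) = c * (b - a)"
  by (simp add: measure_restrict_space)

lemma ioint_cong: "(\<And>y. a < y \<Longrightarrow> y < b \<Longrightarrow> f y = g y) \<Longrightarrow> ioint a b f = ioint a b g"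
  by (intro Bochner_Integration.integral_cong) auto

lemma iointegrable_cong: "(\<And>y. a < y \<Longrightarrow> y < b \<Longrightarrow> f y = g y) \<Longrightarrow> iointegrable a b f \<longleftrightarrow> iointegrable a b g"
  by (intro Bochner_Integration.integrable_cong) auto

lemma iointegrable_const [simp, intro]: "iointegrable a b (\<lambda>y. c)"
  by (rule continuous_iointegrable) auto

lemma iointegrable_bounded_mult:
  assumes "iointegrable a b f" "g \<in> borel_measurable (lebesgue_on {a<..<b})"
    and "\<And>y. a < y \<Longrightarrow> y < b \<Longrightarrow> \<bar>g y\<bar> \<le> B"
  shows "iointegrable a b (\<lambda>y. g y * f y)"
proof (rule Bochner_Integration.integrable_bound[of _ "\<lambda>y. B * f y"])
  show "AE x in lebesgue_on {a<..<b}. norm (g x * f x) \<le> norm (B * f x)"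
  proof (rule AE_I2)
    fix y assume "y \<in> space (lebesgue_on {a<..<b})"
    then have "\<bar>g y\<bar> \<le> \<bar>B\<bar>" using assms(3)[of y] by auto
    then show "norm (g y * f y) \<le> norm (B * f y)"
      by (simp add: abs_mult mult_right_mono)
  qed
qed (use assms in \<open>auto intro: borel_measurable_integrable\<close>)

lemma ioint_initial:
  assumes "iointegrable a b f" "a \<le> t" "t \<le> b"
  shows "ioint a t f = (LINT s|lebesgue_on {a<..<b}. indicator {..<t} s * f s)"
  unfolding ioint_eq by (intro Bochner_Integration.integral_cong) (use assms in \<open>auto simp: indicator_def\<close>)

text \<open>A single point is a null set. Both the open and the closed half line are needed, because
  of the two triangles into which the square is cut one contains the diagonal and the other does
  not.\<close>

lemma ioint_initial':
  assumes "iointegrable a b f" "a \<le> t" "t \<le> b"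
  shows "ioint a t f = (LINT s|lebesgue_on {a<..<b}. indicator {..t} s * f s)"
proof -
  have [measurable]: "f \<in> borel_measurable (lebesgue_on {a<..<b})" using assms by auto
  have "AE s in lebesgue. s \<noteq> t"
    by (rule AE_completion[OF AE_lborel_singleton])
  then have "AE s in lebesgue_on {a<..<b}. s \<noteq> t"
    by (subst AE_restrict_space_iff) auto
  then have *: "AE s in lebesgue_on {a<..<b}. indicator {..t} s * f s = indicator {..<t} s * f s"
    by eventually_elim (auto simp: indicator_def)
  have [measurable]: "{..<t} \<in> sets borel" "{..t} \<in> sets borel" by auto
  have [measurable]: "(\<lambda>s. indicator A s :: real) \<in> borel_measurable (lebesgue_on {a<..<b})" if "A \<in> sets borel" for A
    using that by (intro measurable_restrict_space1 measurable_completion) auto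
  show ?thesis unfolding ioint_initial[OF assms]
  proof (rule integral_cong_AE)
    show "AE s in lebesgue_on {a<..<b}. indicator {..<t} s * f s = indicator {..t} s * f s"
      using * by eventually_elim auto
  qed measurable
qed

lemma bounded_on_Icc:
  fixes F :: "real \<Rightarrow> real"
  assumes "continuous_on {a..b} F"
  obtains B where "\<And>y. y \<in> {a..b} \<Longrightarrow> \<bar>F y\<bar> \<le> B" "0 \<le> B"
proof -
  obtain B where "\<forall>y\<in>{a..b}. \<bar>F y\<bar> \<le> B"
    using compact_imp_bounded[OF compact_continuous_image[OF assms compact_Icc]]
    unfolding bounded_iff by (auto simp: image_iff)
  then show ?thesis using that[of "max B 0"] by (auto simp: le_max_iff_disj)
qed

lemma continuous_mult_iointegrable:
  assumes "continuous_on {a..b} F" "iointegrable a b g"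
  shows "iointegrable a b (\<lambda>y. F y * g y)"
proof -
  obtain B where "\<And>y. y \<in> {a..b} \<Longrightarrow> \<bar>F y\<bar> \<le> B" using bounded_on_Icc[OF assms(1)] by blast
  then show ?thesis
    by (intro iointegrable_bounded_mult[OF assms(2) continuous_on_measurable_Ioo[OF assms(1)], of B]) auto
qed

text \<open>Fubini, applied to $f(s)g(t)$ on the two triangles \<open>s \<le> t\<close> and \<open>t < s\<close>.\<close>

lemma ioint_primitives:
  assumes f: "iointegrable a b f" and g: "iointegrable a b g" and ab: "a \<le> b"
  shows "ioint a b (\<lambda>y. f y * ioint a y g + ioint a y f * g y) = ioint a b f * ioint a b g"
proof -
  let ?M = "lebesgue_on {a<..<b}"
  interpret M: finite_measure ?M
    by (rule finite_measure_lebesgue_on) (simp flip: box_real)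
  interpret P: pair_sigma_finite ?M ?M ..
  have [measurable]: "f \<in> borel_measurable ?M" "g \<in> borel_measurable ?M" using f g by auto
  have id[measurable]: "(\<lambda>x. x) \<in> borel_measurable ?M"
    by (rule continuous_on_measurable_Ioo) auto
  have fs[measurable]: "(\<lambda>x. fst x) \<in> borel_measurable (?M \<Otimes>\<^sub>M ?M)" "(\<lambda>x. snd x) \<in> borel_measurable (?M \<Otimes>\<^sub>M ?M)"
    using measurable_compose[OF measurable_fst id] measurable_compose[OF measurable_snd id] by auto
  have int: "integrable (?M \<Otimes>\<^sub>M ?M) (\<lambda>(s,t). f s * g t)"
  proof (rule P.Fubini_integrable)
    show "(\<lambda>(s,t). f s * g t) \<in> borel_measurable (?M \<Otimes>\<^sub>M ?M)" by measurable
    show "integrable ?M (\<lambda>x. LINT y|?M. norm (case (x, y) of (s, t) \<Rightarrow> f s * g t))"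
      using f by (simp add: abs_mult)
    show "AE x in ?M. integrable ?M (\<lambda>y. case (x, y) of (s, t) \<Rightarrow> f s * g t)"
      using g by simp
  qed
  have intI: "integrable (?M \<Otimes>\<^sub>M ?M) (\<lambda>(s,t). f s * g t * (if s \<le> t then 1 else 0))"
             "integrable (?M \<Otimes>\<^sub>M ?M) (\<lambda>(s,t). f s * g t * (if s \<le> t then 0 else 1))"
    by (rule Bochner_Integration.integrable_bound[OF int], measurable, simp add: split_beta)+
  have F: "(LINT s|?M. f s * (if s \<le> t then 1 else 0)) = ioint a t f" if "t \<in> {a<..<b}" for t
    using ioint_initial'[OF f, of t] that
    by (subst Bochner_Integration.integral_cong[OF refl, of _ _ "\<lambda>s. indicator {..t} s * f s"])
       (auto simp: indicator_def)
  have G: "(LINT t|?M. g t * (if s \<le> t then 0 else 1)) = ioint a s g" if "s \<in> {a<..<b}" for s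
    using ioint_initial[OF g, of s] that
    by (subst Bochner_Integration.integral_cong[OF refl, of _ _ "\<lambda>t. indicator {..<s} t * g t"])
       (auto simp: indicator_def)
  have i1: "integrable ?M (\<lambda>y. ioint a y f * g y)"
    by (rule continuous_mult_iointegrable[OF continuous_on_ioint[OF f] g])
  have i2: "integrable ?M (\<lambda>y. ioint a y g * f y)"
    by (rule continuous_mult_iointegrable[OF continuous_on_ioint[OF g] f])
  have "ioint a b f * ioint a b g = (LINT s|?M. LINT t|?M. f s * g t)"
    by simp
  also have "\<dots> = integral\<^sup>L (?M \<Otimes>\<^sub>M ?M) (\<lambda>(s,t). f s * g t)"
    using P.integral_fst[OF int] by simp
  also have "\<dots> = integral\<^sup>L (?M \<Otimes>\<^sub>M ?M) (\<lambda>x. (case x of (s,t) \<Rightarrow> f s * g t * (if s \<le> t then 1 else 0)) + (case x of (s,t) \<Rightarrow> f s * g t * (if s \<le> t then 0 else 1)))"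
    by (rule Bochner_Integration.integral_cong) auto
  also have "\<dots> = integral\<^sup>L (?M \<Otimes>\<^sub>M ?M) (\<lambda>(s,t). f s * g t * (if s \<le> t then 1 else 0)) + integral\<^sup>L (?M \<Otimes>\<^sub>M ?M) (\<lambda>(s,t). f s * g t * (if s \<le> t then 0 else 1))"
    by (rule Bochner_Integration.integral_add[OF intI])
  also have "integral\<^sup>L (?M \<Otimes>\<^sub>M ?M) (\<lambda>(s,t). f s * g t * (if s \<le> t then 1 else 0)) = (LINT t|?M. LINT s|?M. g t * (f s * (if s \<le> t then 1 else 0)))"
    using P.integral_snd[of "\<lambda>s t. f s * g t * (if s \<le> t then 1 else 0)"] intI by (simp add: ac_simps)
  also have "\<dots> = (LINT t|?M. ioint a t f * g t)"
    by (rule Bochner_Integration.integral_cong) (auto simp: F)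
  also have "integral\<^sup>L (?M \<Otimes>\<^sub>M ?M) (\<lambda>(s,t). f s * g t * (if s \<le> t then 0 else 1)) = (LINT s|?M. LINT t|?M. f s * (g t * (if s \<le> t then 0 else 1)))"
    using P.integral_fst[of "\<lambda>s t. f s * g t * (if s \<le> t then 0 else 1)"] intI by (simp add: ac_simps)
  also have "\<dots> = (LINT s|?M. f s * ioint a s g)"
    by (rule Bochner_Integration.integral_cong) (auto simp: G)
  finally show ?thesis using i1 i2 by (simp add: mult.commute add.commute)
qed

subsection \<open>Primitives of integrable functions\<close>

text \<open>Absolute continuity with density \<open>f\<close>, expressed through integrals: the
  density may be any representative, and no differentiation almost everywhere is needed for products
  or for uniqueness.\<close>

definition is_primitive :: "real \<Rightarrow> real \<Rightarrow> (real \<Rightarrow> real) \<Rightarrow> (real \<Rightarrow> real) \<Rightarrow> bool" where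
  "is_primitive a b F f \<longleftrightarrow> iointegrable a b f \<and> (\<forall>y\<in>{a..b}. ioint a y f = F y - F a)"

lemma is_primitiveD: "is_primitive a b F f \<Longrightarrow> iointegrable a b f"
  by (simp add: is_primitive_def)

lemma is_primitive_integral:
  assumes "is_primitive a b F f" "a \<le> c" "c \<le> d" "d \<le> b"
  shows "ioint c d f = F d - F c"
proof -
  have "ioint a d f = ioint a c f + ioint c d f"
    by (rule ioint_combine[OF iointegrable_subinterval[OF is_primitiveD[OF assms(1)]]]) (use assms in auto)
  then show ?thesis using assms unfolding is_primitive_def by auto
qed

lemma is_primitive_subinterval:
  assumes "is_primitive a b F f" "a \<le> c" "d \<le> b"
  shows "is_primitive c d F f"
  using is_primitive_integral[OF assms(1)] iointegrable_subinterval[OF is_primitiveD[OF assms(1)]] assms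
  unfolding is_primitive_def by auto

lemma is_primitive_continuous:
  assumes "is_primitive a b F f"
  shows "continuous_on {a..b} F"
proof -
  have "continuous_on {a..b} (\<lambda>y. F a + ioint a y f)"
    by (rule continuous_on_add[OF continuous_on_const continuous_on_ioint[OF is_primitiveD[OF assms]]])
  moreover have "F y = F a + ioint a y f" if "y \<in> {a..b}" for y
    using assms that unfolding is_primitive_def by auto
  ultimately show ?thesis by (metis (no_types, lifting) continuous_on_cong)
qed

lemma is_primitive_ioint:
  "iointegrable a b f \<Longrightarrow> is_primitive a b (\<lambda>y. c + ioint a y f) f"
  by (simp add: is_primitive_def)

lemma is_primitive_add:
  assumes "is_primitive a b F f" "is_primitive a b G g"
  shows "is_primitive a b (\<lambda>y. F y + G y) (\<lambda>y. f y + g y)"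
proof -
  have "ioint a y (\<lambda>y. f y + g y) = ioint a y f + ioint a y g" if "y \<in> {a..b}" for y
    using that iointegrable_subinterval[OF is_primitiveD[OF assms(1)], of a y]
      iointegrable_subinterval[OF is_primitiveD[OF assms(2)], of a y] by simp
  then show ?thesis using assms unfolding is_primitive_def by auto
qed

lemma is_primitive_cmult:
  assumes "is_primitive a b F f"
  shows "is_primitive a b (\<lambda>y. c * F y) (\<lambda>y. c * f y)"
  using assms unfolding is_primitive_def by (auto simp flip: right_diff_distrib)

lemma is_primitive_diff:
  assumes "is_primitive a b F f" "is_primitive a b G g"
  shows "is_primitive a b (\<lambda>y. F y - G y) (\<lambda>y. f y - g y)"
  using is_primitive_add[OF assms(1) is_primitive_cmult[OF assms(2), of "-1"]] by simp

text \<open>Once the constants \<open>F a\<close> and \<open>G a\<close> are split off, the product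
  rule is the Fubini identity \<open>ioint_primitives\<close>.\<close>

lemma is_primitive_mult:
  assumes F: "is_primitive a b F f" and G: "is_primitive a b G g"
  shows "is_primitive a b (\<lambda>y. F y * G y) (\<lambda>y. f y * G y + F y * g y)"
  unfolding is_primitive_def
proof (intro conjI ballI)
  have i: "iointegrable a b f" "iointegrable a b g" using F G is_primitiveD by auto
  have iG: "iointegrable a b (\<lambda>y. f y * G y)" "iointegrable a b (\<lambda>y. F y * g y)"
    using continuous_mult_iointegrable[OF is_primitive_continuous[OF G] i(1)]
      continuous_mult_iointegrable[OF is_primitive_continuous[OF F] i(2)] by (auto simp: mult.commute)
  then show "iointegrable a b (\<lambda>y. f y * G y + F y * g y)" by simp
  fix t assume t: "t \<in> {a..b}"
  have it: "iointegrable a t f" "iointegrable a t g"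
    by (rule iointegrable_subinterval[OF i(1)], use t in auto)
       (rule iointegrable_subinterval[OF i(2)], use t in auto)
  have eq: "F y = F a + ioint a y f" "G y = G a + ioint a y g" if "a < y" "y < t" for y
    using F G t that unfolding is_primitive_def by (auto simp: algebra_simps)
  have ii: "iointegrable a t (\<lambda>y. f y * ioint a y g)" "iointegrable a t (\<lambda>y. ioint a y f * g y)"
    using continuous_mult_iointegrable[OF continuous_on_ioint[OF it(1)] it(2)]
      continuous_mult_iointegrable[OF continuous_on_ioint[OF it(2)] it(1)] by (auto simp: mult.commute)
  have "ioint a t (\<lambda>y. f y * G y + F y * g y)
      = ioint a t (\<lambda>y. (G a * f y + F a * g y) + (f y * ioint a y g + ioint a y f * g y))"
    by (rule ioint_cong) (simp add: eq algebra_simps)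
  also have "\<dots> = G a * ioint a t f + F a * ioint a t g + ioint a t f * ioint a t g"
    using ioint_primitives[OF it] it ii t by simp
  finally have calculation: "ioint a t (\<lambda>y. f y * G y + F y * g y) = G a * ioint a t f + F a * ioint a t g + ioint a t f * ioint a t g" .
  show "ioint a t (\<lambda>y. f y * G y + F y * g y) = F t * G t - F a * G a"
  proof -
    have "ioint a t f = F t - F a" "ioint a t g = G t - G a"
      using F G t unfolding is_primitive_def by auto
    then have "F t = F a + ioint a t f" "G t = G a + ioint a t g" by simp_all
    then show ?thesis unfolding calculation by (simp only: algebra_simps)
  qed
qed

lemma is_primitive_C1:
  assumes "\<And>y. y \<in> {a..b} \<Longrightarrow> (F has_real_derivative f y) (at y within {a..b})" "continuous_on {a..b} f"
  shows "is_primitive a b F f"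
  unfolding is_primitive_def
proof (intro conjI ballI)
  show i: "iointegrable a b f" by (rule continuous_iointegrable[OF assms(2)])
  fix t assume t: "t \<in> {a..b}"
  have "(f has_integral (F t - F a)) {a..t}"
  proof (rule fundamental_theorem_of_calculus)
    fix y assume "y \<in> {a..t}"
    then show "(F has_vector_derivative f y) (at y within {a..t})"
      using assms(1)[of y] t unfolding has_real_derivative_iff_has_vector_derivative
      by (auto intro: has_vector_derivative_within_subset)
  qed (use t in auto)
  then have "integral {a..t} f = F t - F a" by (rule integral_unique)
  moreover have "ioint a t f = integral {a..t} f"
    by (rule ioint_eq_integral(1)[OF iointegrable_subinterval[OF i]]) (use t in auto)
  ultimately show "ioint a t f = F t - F a" by simp
qed

lemma is_primitive_poly: "is_primitive a b (poly p) (poly (pderiv p))"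
  by (rule is_primitive_C1) (auto intro: poly_DERIV has_field_derivative_at_within intro!: continuous_intros)

text \<open>The half lines are stable under intersection and generate the Borel sets, so the
  integrals over all Borel sets vanish by a Dynkin class argument; then h has the density of the
  zero measure.\<close>

lemma lborel_AE_zero:
  fixes h :: "real \<Rightarrow> real"
  assumes h: "integrable lborel h" and 0: "\<And>t. (LINT x:{..t}|lborel. h x) = 0"
    and tot: "(LINT x|lborel. h x) = 0"
  shows "AE x in lborel. h x = 0"
proof -
  have si: "set_integrable lborel A h" if "A \<in> sets lborel" for A
    unfolding set_integrable_def by (rule integrable_mult_indicator[OF that h])
  have sb: "sets (lborel :: real measure) = sigma_sets UNIV (range atMost)"
    by (simp add: borel_eq_atMost sets_measure_of)
  have "(LINT x:A|lborel. h x) = 0" if "A \<in> sets lborel" for A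
  proof -
    have "Int_stable (range (atMost :: real \<Rightarrow> real set))"
      by (auto simp: Int_stable_def min_def simp flip: inf_min)
    moreover have "range atMost \<subseteq> Pow (UNIV :: real set)" by simp
    moreover have "A \<in> sigma_sets UNIV (range atMost)" using that sb by simp
    ultimately show ?thesis
    proof (induction A rule: sigma_sets_induct_disjoint)
      case (compl A)
      then have A: "A \<in> sets lborel" using sb by simp
      have "(LINT x:A \<union> (UNIV - A)|lborel. h x) = (LINT x:A|lborel. h x) + (LINT x:(UNIV - A)|lborel. h x)"
        by (rule set_integral_Un) (use A in \<open>auto intro!: si\<close>)
      moreover have "A \<union> (UNIV - A) = UNIV" by auto
      ultimately show ?case using compl tot by (simp add: set_lebesgue_integral_def)
    next
      case (union A)
      have A: "range A \<subseteq> sets lborel" using union sb by simp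
      have "(LINT x:(\<Union>i. A i)|lborel. h x) = (\<Sum>i. (LINT x:(A i)|lborel. h x))"
        by (rule lebesgue_integral_countable_add)
           (use union A sets.countable_UN[OF A] in \<open>auto intro!: si simp: disjoint_family_on_def\<close>)
      then show ?case using union by simp
    qed (use 0 in \<open>auto simp: set_lebesgue_integral_def\<close>)
  qed
  then show ?thesis
    by (intro density_unique_real[OF h]) (auto simp: set_lebesgue_integral_def)
qed

text \<open>The function, cut off outside the interval, is replaced by a Borel representative; its
  integral over a half line is the integral of \<open>f\<close> over an initial interval, so the
  statement about Borel functions applies.\<close>

lemma ioint_zero_AE:
  assumes "iointegrable a b f" "\<And>t. a \<le> t \<Longrightarrow> t \<le> b \<Longrightarrow> ioint a t f = 0"
  shows "AE x in lebesgue_on {a<..<b}. f x = 0"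
proof (cases "a < b")
  case True
  let ?h = "\<lambda>x. indicator {a<..<b} x * f x"
  have h: "integrable lebesgue ?h" using assms(1) by (simp add: iointegrable_iff)
  then have "?h \<in> borel_measurable (completion lborel)" by simp
  then obtain g where g: "g \<in> borel_measurable lborel" "AE x in lborel. ?h x = g x"
    using completion_ex_borel_measurable_real by blast
  have gh: "AE x in lebesgue. ?h x = g x" using g(2) by (rule AE_completion)
  have gl: "g \<in> borel_measurable lebesgue" using g(1) by (rule measurable_completion)
  have ig: "integrable lebesgue g"
    using h gh gl by (subst integrable_cong_AE[of g _ ?h]) auto
  then have ig': "integrable lborel g" using g(1) by (simp add: integrable_completion)
  have t: "(LINT x:{..t}|lborel. g x) = ioint a (min t b) f" for t
  proof -
    have "(LINT x:{..t}|lborel. g x) = (LINT x|lebesgue. indicator {..t} x * g x)"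
      unfolding set_lebesgue_integral_def using g(1) by (subst integral_completion) auto
    also have "\<dots> = (LINT x|lebesgue. indicator {a<..<min t b} x * f x)"
    proof (rule integral_cong_AE)
      have "AE x in lebesgue. x \<noteq> t" by (rule AE_completion[OF AE_lborel_singleton])
      then show "AE x in lebesgue. indicator {..t} x * g x = indicator {a<..<min t b} x * f x"
        using gh by eventually_elim (auto simp: indicator_def)
      show "(\<lambda>x. indicator {a<..<min t b} x * f x) \<in> borel_measurable lebesgue"
        using iointegrable_subinterval[OF assms(1), of a "min t b"] unfolding iointegrable_iff by auto
      show "(\<lambda>x. indicator {..t} x * g x) \<in> borel_measurable lebesgue"
        using gl by (intro borel_measurable_times borel_measurable_indicator) auto
    qed
    finally show ?thesis by (simp add: ioint_eq)
  qed
  have "ioint a (min t b) f = 0" for t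
    using assms(2)[of "min t b"] True by (cases "a \<le> t") (auto simp: ioint_eq min_def)
  then have "AE x in lborel. g x = 0"
  proof (intro lborel_AE_zero ig')
    have "(LINT x|lborel. g x) = (LINT x|lebesgue. ?h x)"
      using g(1) gl gh h by (subst integral_completion[symmetric]) (auto intro!: integral_cong_AE)
    then show "(LINT x|lborel. g x) = 0" using assms(2)[of b] True by (simp add: ioint_eq)
  qed (simp add: t)
  then have "AE x in lebesgue. g x = 0" by (rule AE_completion)
  then have "AE x in lebesgue. ?h x = 0" using gh by eventually_elim simp
  then show ?thesis by (subst AE_restrict_space_iff) (auto simp: indicator_def split: if_splits)
next
  case False
  then have "{a<..<b} = {}" by auto
  then show ?thesis by (simp add: AE_restrict_space_iff)
qed

section \<open>Test functions\<close>

text \<open>Splitting off the first derivative, and not the last one, lets closure under sums and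
  products be proved by induction with arbitrary functions.\<close>

fun diff_times :: "nat \<Rightarrow> (real \<Rightarrow> real) \<Rightarrow> bool" where
  "diff_times 0 f = True"
| "diff_times (Suc n) f = (f differentiable_on UNIV \<and> diff_times n (deriv f))"

lemma diff_times_iff: "diff_times n f \<longleftrightarrow> (\<forall>m<n. (deriv ^^ m) f differentiable_on UNIV)"
proof (induction n arbitrary: f)
  case (Suc n)
  have "(\<forall>m<Suc n. (deriv ^^ m) f differentiable_on UNIV) \<longleftrightarrow>
      f differentiable_on UNIV \<and> (\<forall>m<n. (deriv ^^ Suc m) f differentiable_on UNIV)"
    by (auto simp: all_conj_distrib less_Suc_eq_0_disj)
  then show ?case using Suc by (simp add: funpow_swap1)
qed simp

definition smooth :: "(real \<Rightarrow> real) \<Rightarrow> bool" where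
  "smooth f \<longleftrightarrow> (\<forall>n. diff_times n f)"

lemma smooth_iff: "smooth f \<longleftrightarrow> (\<forall>n. (deriv ^^ n) f differentiable_on UNIV)"
  unfolding smooth_def diff_times_iff by auto

lemma smooth_coinduct:
  assumes "K f" "\<And>f. K f \<Longrightarrow> f differentiable_on UNIV \<and> K (deriv f)"
  shows "smooth f"
proof -
  have "diff_times n f" if "K f" for n f
    using that by (induction n arbitrary: f) (use assms(2) in auto)
  then show ?thesis using assms(1) by (simp add: smooth_def)
qed

lemma smooth_deriv: "smooth f \<Longrightarrow> smooth (deriv f)"
  unfolding smooth_def by (metis diff_times.simps(2))

lemma smooth_DERIV: "smooth f \<Longrightarrow> (f has_real_derivative deriv f x) (at x)"
  unfolding smooth_def
  by (metis DERIV_deriv_iff_real_differentiable diff_times.simps(2) differentiable_on_def UNIV_I)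

lemma smooth_continuous: "smooth f \<Longrightarrow> continuous_on S f"
  by (meson DERIV_isCont continuous_at_imp_continuous_on smooth_DERIV)

lemma diff_times_Suc: "diff_times (Suc n) f \<Longrightarrow> diff_times n f"
  by (simp add: diff_times_iff)

lemma diff_times_add: "diff_times n f \<Longrightarrow> diff_times n g \<Longrightarrow> diff_times n (\<lambda>x. f x + g x)"
proof (induction n arbitrary: f g)
  case (Suc n)
  then have d: "(f has_real_derivative deriv f x) (at x)" "(g has_real_derivative deriv g x) (at x)" for x
    by (simp_all add: DERIV_deriv_iff_real_differentiable differentiable_on_def)
  have "deriv (\<lambda>x. f x + g x) = (\<lambda>x. deriv f x + deriv g x)"
    by (intro ext DERIV_imp_deriv DERIV_add d)
  moreover have "diff_times n (\<lambda>x. deriv f x + deriv g x)" using Suc by simp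
  ultimately show ?case using Suc by (simp add: differentiable_on_add)
qed simp

lemma diff_times_mult: "diff_times n f \<Longrightarrow> diff_times n g \<Longrightarrow> diff_times n (\<lambda>x. f x * g x)"
proof (induction n arbitrary: f g)
  case (Suc n)
  then have d: "(f has_real_derivative deriv f x) (at x)" "(g has_real_derivative deriv g x) (at x)" for x
    by (simp_all add: DERIV_deriv_iff_real_differentiable differentiable_on_def)
  have "deriv (\<lambda>x. f x * g x) = (\<lambda>x. deriv f x * g x + deriv g x * f x)"
    by (intro ext DERIV_imp_deriv DERIV_mult d)
  moreover have "diff_times n (\<lambda>x. deriv f x * g x + deriv g x * f x)"
    using Suc diff_times_Suc[OF Suc.prems(1)] diff_times_Suc[OF Suc.prems(2)]
    by (intro diff_times_add) (auto simp: Suc.IH)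
  ultimately show ?case using Suc by (simp add: differentiable_on_mult)
qed simp

lemma smooth_const: "smooth (\<lambda>x. c)"
proof (rule smooth_coinduct[of "\<lambda>f. \<exists>c. f = (\<lambda>x. c)"])
  fix f :: "real \<Rightarrow> real" assume "\<exists>c. f = (\<lambda>x. c)"
  then obtain c where "f = (\<lambda>x. c)" by blast
  then show "f differentiable_on UNIV \<and> (\<exists>c. deriv f = (\<lambda>x. c))" by auto
qed blast

lemma smooth_add: "smooth f \<Longrightarrow> smooth g \<Longrightarrow> smooth (\<lambda>x. f x + g x)"
  by (simp add: smooth_def diff_times_add)

lemma smooth_mult: "smooth f \<Longrightarrow> smooth g \<Longrightarrow> smooth (\<lambda>x. f x * g x)"
  by (simp add: smooth_def diff_times_mult)

lemma poly_exp_tendsto_0: "((\<lambda>y::real. poly p y * exp (- y)) \<longlongrightarrow> 0) at_top"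
proof -
  have "((\<lambda>y::real. \<Sum>i\<le>degree p. coeff p i * (y ^ i / exp y)) \<longlongrightarrow> (\<Sum>i\<le>degree p. coeff p i * 0)) at_top"
    by (intro tendsto_intros tendsto_power_div_exp_0)
  then show ?thesis by (simp add: poly_altdef exp_minus sum_distrib_right divide_inverse mult.assoc)
qed

text \<open>The functions $p(1/y)e^{-1/y}$ of $y = \alpha x + \beta$, extended by $0$ to $y \le 0$,
  form a class that is closed under differentiation.\<close>

definition exp_bump :: "real \<Rightarrow> real \<Rightarrow> real poly \<Rightarrow> real \<Rightarrow> real" where
  "exp_bump \<alpha> \<beta> p x = (if \<alpha> * x + \<beta> > 0 then poly p (1 / (\<alpha> * x + \<beta>)) * exp (- (1 / (\<alpha> * x + \<beta>))) else 0)"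

text \<open>With y = 1/(\<alpha> x + \<beta>) one has y' = -\<alpha> y^2, so p(y) exp(-y) has the
  derivative \<alpha> y^2 (p - p')(y) exp(-y). The point where \<alpha> x + \<beta> = 0 is the only
  one at which a difference quotient has to be examined.\<close>

lemma exp_bump_DERIV:
  "(exp_bump \<alpha> \<beta> p has_real_derivative exp_bump \<alpha> \<beta> (smult \<alpha> ([:0,0,1:] * (p - pderiv p))) x) (at x)"
proof (cases "\<alpha> * x + \<beta> = 0")
  case False
  show ?thesis
  proof (cases "\<alpha> * x + \<beta> > 0")
    case True
    have "((\<lambda>x. poly p (1 / (\<alpha> * x + \<beta>)) * exp (- (1 / (\<alpha> * x + \<beta>)))) has_real_derivative
        exp_bump \<alpha> \<beta> (smult \<alpha> ([:0,0,1:] * (p - pderiv p))) x) (at x)"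
    proof -
      define z where "z = \<alpha> * x + \<beta>"
      have "((\<lambda>x. 1 / (\<alpha> * x + \<beta>)) has_real_derivative - (\<alpha> / z\<^sup>2)) (at x)"
        using True unfolding z_def
        by (auto intro!: derivative_eq_intros simp: power2_eq_square)
      note D = DERIV_mult[OF DERIV_chain'[OF this poly_DERIV[of p]] DERIV_chain'[OF DERIV_minus[OF this] DERIV_exp]]
      show ?thesis
        by (rule DERIV_cong[OF D]) (use True in \<open>unfold exp_bump_def z_def[symmetric], simp add: power2_eq_square algebra_simps\<close>)
    qed
    moreover have "\<forall>\<^sub>F y in nhds x. poly p (1 / (\<alpha> * y + \<beta>)) * exp (- (1 / (\<alpha> * y + \<beta>))) = exp_bump \<alpha> \<beta> p y"
    proof -
      have "open {y. \<alpha> * y + \<beta> > 0}" by (intro open_Collect_less continuous_intros)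
      then show ?thesis using True unfolding eventually_nhds
        by (intro exI[of _ "{y. \<alpha> * y + \<beta> > 0}"]) (auto simp: exp_bump_def)
    qed
    ultimately show ?thesis using DERIV_cong_ev[OF refl _ refl] by fastforce
  next
    case n: False
    have "open {y. \<alpha> * y + \<beta> < 0}" by (intro open_Collect_less continuous_intros)
    then have "\<forall>\<^sub>F y in nhds x. 0 = exp_bump \<alpha> \<beta> p y"
      using n False unfolding eventually_nhds
      by (intro exI[of _ "{y. \<alpha> * y + \<beta> < 0}"]) (auto simp: exp_bump_def)
    moreover have "((\<lambda>x. 0) has_real_derivative exp_bump \<alpha> \<beta> (smult \<alpha> ([:0,0,1:] * (p - pderiv p))) x) (at x)"
      using n by (auto simp: exp_bump_def)
    ultimately show ?thesis using DERIV_cong_ev[OF refl _ refl] by fastforce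
  qed
next
  case True
  have \<beta>: "\<alpha> * (x + h) + \<beta> = \<alpha> * h" for h using True by (simp add: algebra_simps)
  have "((\<lambda>h. (exp_bump \<alpha> \<beta> p (x + h) - exp_bump \<alpha> \<beta> p x) / h) \<longlongrightarrow> 0) (at 0)"
  proof (rule tendstoI)
    fix e :: real assume e: "0 < e"
    have "\<forall>\<^sub>F y in at_top. dist (poly ([:0,1:] * p) y * exp (- y)) 0 < e / (\<bar>\<alpha>\<bar> + 1)"
      by (rule tendstoD[OF poly_exp_tendsto_0]) (use e in auto)
    then obtain Y where Y: "\<And>y. y \<ge> Y \<Longrightarrow> \<bar>poly ([:0,1:] * p) y * exp (- y)\<bar> < e / (\<bar>\<alpha>\<bar> + 1)"
      unfolding eventually_at_top_linorder by auto
    \<comment> \<open>For y = 1/(\<alpha> h) > 0 the difference quotient is \<alpha> y p(y) exp(-y),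
      which tends to 0 as y grows; this d ensures y \<ge> |Y| + 1 whenever |h| < d.\<close>
    define d where "d = 1 / ((\<bar>\<alpha>\<bar> + 1) * (\<bar>Y\<bar> + 1))"
    have d: "0 < d" by (simp add: d_def)
    show "\<forall>\<^sub>F h in at 0. dist ((exp_bump \<alpha> \<beta> p (x + h) - exp_bump \<alpha> \<beta> p x) / h) 0 < e"
      unfolding eventually_at
    proof (intro exI[of _ d] conjI d ballI impI)
      fix h :: real assume h: "h \<noteq> 0 \<and> dist h 0 < d"
      show "dist ((exp_bump \<alpha> \<beta> p (x + h) - exp_bump \<alpha> \<beta> p x) / h) 0 < e"
      proof (cases "\<alpha> * h > 0")
        case pos: True
        define y where "y = 1 / (\<alpha> * h)"
        have "\<alpha> * h \<le> (\<bar>\<alpha>\<bar> + 1) * \<bar>h\<bar>"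
        proof -
          have "\<alpha> * h \<le> \<bar>\<alpha>\<bar> * \<bar>h\<bar>" by (metis abs_ge_self abs_mult)
          then show ?thesis by (simp add: algebra_simps)
        qed
        also have "\<dots> \<le> (\<bar>\<alpha>\<bar> + 1) * d" using h by (intro mult_left_mono) auto
        also have "\<dots> = 1 / (\<bar>Y\<bar> + 1)" by (simp add: d_def)
        finally have "\<bar>Y\<bar> + 1 \<le> y" unfolding y_def using pos by (simp add: field_simps)
        then have "\<bar>poly ([:0,1:] * p) y * exp (- y)\<bar> < e / (\<bar>\<alpha>\<bar> + 1)" by (intro Y) auto
        then have "\<bar>\<alpha>\<bar> * \<bar>poly ([:0,1:] * p) y * exp (- y)\<bar> \<le> \<bar>\<alpha>\<bar> * (e / (\<bar>\<alpha>\<bar> + 1))"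
          by (intro mult_left_mono) auto
        also have "\<dots> < e" using e by (simp add: field_simps)
        finally have *: "\<bar>\<alpha>\<bar> * \<bar>poly ([:0,1:] * p) y * exp (- y)\<bar> < e" .
        have "(exp_bump \<alpha> \<beta> p (x + h) - exp_bump \<alpha> \<beta> p x) / h = \<alpha> * (poly ([:0,1:] * p) y * exp (- y))"
        proof -
          have "exp_bump \<alpha> \<beta> p (x + h) = poly p y * exp (- y)"
            unfolding exp_bump_def \<beta> using pos by (simp add: y_def)
          moreover have "exp_bump \<alpha> \<beta> p x = 0" using True by (simp add: exp_bump_def)
          moreover have "1 / h = \<alpha> * y" using pos h by (auto simp: y_def zero_less_mult_iff)
          ultimately show ?thesis by (simp add: divide_inverse)
        qed
        then show ?thesis using * by (simp only: dist_real_def diff_0_right abs_mult)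
      next
        case n: False
        then show ?thesis using e True unfolding exp_bump_def \<beta> by simp
      qed
    qed
  qed
  moreover have "exp_bump \<alpha> \<beta> (smult \<alpha> ([:0,0,1:] * (p - pderiv p))) x = 0"
    using True by (simp add: exp_bump_def)
  ultimately show ?thesis unfolding DERIV_def by simp
qed

lemma smooth_exp_bump: "smooth (exp_bump \<alpha> \<beta> p)"
proof (rule smooth_coinduct[of "\<lambda>f. \<exists>p. f = exp_bump \<alpha> \<beta> p"])
  fix f assume "\<exists>p. f = exp_bump \<alpha> \<beta> p"
  then obtain p where f: "f = exp_bump \<alpha> \<beta> p" by blast
  have "deriv f = exp_bump \<alpha> \<beta> (smult \<alpha> ([:0,0,1:] * (p - pderiv p)))"
    unfolding f by (intro ext DERIV_imp_deriv exp_bump_DERIV)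
  moreover have "f differentiable_on UNIV"
    unfolding f differentiable_on_def using exp_bump_DERIV real_differentiable_def by blast
  ultimately show "f differentiable_on UNIV \<and> (\<exists>p. deriv f = exp_bump \<alpha> \<beta> p)" by blast
qed auto

text \<open>A product of a rising and a falling flank; the parameter n steepens both, so that the
  functions tend pointwise to the indicator of (c,d) while staying between 0 and 1.\<close>

definition bump :: "real \<Rightarrow> real \<Rightarrow> nat \<Rightarrow> real \<Rightarrow> real" where
  "bump c d n x = exp_bump (real n) (- (real n * c)) 1 x * exp_bump (- real n) (real n * d) 1 x"

lemma bump_eq: "bump c d n x = (if n > 0 \<and> c < x \<and> x < d then exp (- (1 / (n * (x - c)))) * exp (- (1 / (n * (d - x)))) else 0)"
proof -
  have "0 < real n * x + - (real n * c) \<longleftrightarrow> 0 < n \<and> c < x" "0 < - real n * x + real n * d \<longleftrightarrow> 0 < n \<and> x < d"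
    using zero_less_mult_iff[of "real n" "x - c"] zero_less_mult_iff[of "real n" "d - x"]
    by (auto simp: algebra_simps)
  then show ?thesis unfolding bump_def exp_bump_def by (auto simp: algebra_simps)
qed

lemma bump_bounds: "0 \<le> bump c d n x" "bump c d n x \<le> 1"
  by (auto simp: bump_eq intro!: mult_le_one)

lemma bump_tendsto: "(\<lambda>n. bump c d n x) \<longlonglongrightarrow> indicator {c<..<d} x"
proof (cases "c < x \<and> x < d")
  case True
  have "(\<lambda>n. exp (- (1 / (real n * (x - c)))) * exp (- (1 / (real n * (d - x))))) \<longlonglongrightarrow> exp (- 0) * exp (- 0)"
    using True
    by (intro tendsto_intros tendsto_divide_0[OF tendsto_const] filterlim_at_top_imp_at_infinity
        filterlim_tendsto_pos_mult_at_top[OF tendsto_const _ filterlim_real_sequentially, THEN filterlim_cong[OF refl refl, THEN iffD1, rotated]])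
       (auto simp: mult.commute)
  moreover have "\<forall>\<^sub>F n in sequentially. exp (- (1 / (real n * (x - c)))) * exp (- (1 / (real n * (d - x)))) = bump c d n x"
    using eventually_gt_at_top[of 0] by eventually_elim (use True in \<open>auto simp: bump_eq\<close>)
  ultimately have "(\<lambda>n. bump c d n x) \<longlonglongrightarrow> 1" by (simp add: filterlim_cong)
  then show ?thesis using True by simp
qed (auto simp: bump_eq indicator_def)

lemma test_functions_iff:
  "\<phi> \<in> test_functions a b \<longleftrightarrow> smooth \<phi> \<and> (\<exists>c d. a < c \<and> d < b \<and> (\<forall>x. x \<notin> {c..d} \<longrightarrow> \<phi> x = 0))"
  unfolding test_functions_def smooth_iff by simp

lemma bump_test: "a < c \<Longrightarrow> d < b \<Longrightarrow> bump c d n \<in> test_functions a b"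
  unfolding test_functions_iff
proof (intro conjI)
  show "smooth (bump c d n)"
    unfolding bump_def[abs_def] by (intro smooth_mult smooth_exp_bump)
  show "a < c \<Longrightarrow> d < b \<Longrightarrow> \<exists>c' d'. a < c' \<and> d' < b \<and> (\<forall>x. x \<notin> {c'..d'} \<longrightarrow> bump c d n x = 0)"
    by (rule exI[of _ c], rule exI[of _ d]) (auto simp: bump_eq)
qed

lemma test_smooth: "\<phi> \<in> test_functions a b \<Longrightarrow> smooth \<phi>"
  by (simp add: test_functions_iff)

lemma test_zero: "\<phi> \<in> test_functions a b \<Longrightarrow> x \<notin> {a<..<b} \<Longrightarrow> \<phi> x = 0"
  by (force simp: test_functions_iff)

lemma test_cmult: "\<phi> \<in> test_functions a b \<Longrightarrow> (\<lambda>x. k * \<phi> x) \<in> test_functions a b"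
  unfolding test_functions_iff by (fastforce intro: smooth_mult smooth_const)

lemma test_add:
  assumes "\<phi> \<in> test_functions a b" "\<psi> \<in> test_functions a b"
  shows "(\<lambda>x. \<phi> x + \<psi> x) \<in> test_functions a b"
proof -
  obtain c d c' d' where "a < c" "d < b" "\<forall>x. x \<notin> {c..d} \<longrightarrow> \<phi> x = 0"
    "a < c'" "d' < b" "\<forall>x. x \<notin> {c'..d'} \<longrightarrow> \<psi> x = 0"
    using assms unfolding test_functions_iff by blast
  then have "a < min c c'" "max d d' < b" "\<forall>x. x \<notin> {min c c'..max d d'} \<longrightarrow> \<phi> x + \<psi> x = 0"
    by (auto simp: min_le_iff_disj le_max_iff_disj not_le)
  then show ?thesis using assms smooth_add unfolding test_functions_iff by blast
qed

lemma test_deriv: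
  assumes "\<phi> \<in> test_functions a b"
  shows "deriv \<phi> \<in> test_functions a b"
proof -
  obtain c d where cd: "a < c" "d < b" "\<forall>x. x \<notin> {c..d} \<longrightarrow> \<phi> x = 0"
    using assms unfolding test_functions_iff by blast
  have "deriv \<phi> x = 0" if x: "x \<notin> {c..d}" for x
  proof -
    have "\<forall>\<^sub>F y in nhds x. 0 = \<phi> y"
      using x cd(3) unfolding eventually_nhds by (intro exI[of _ "- {c..d}"]) auto
    then have "(\<phi> has_real_derivative 0) (at x)"
      using DERIV_cong_ev[OF refl, of "\<lambda>_. 0" \<phi> x 0 0] by auto
    then show ?thesis by (rule DERIV_imp_deriv)
  qed
  then show ?thesis using cd test_smooth[OF assms] smooth_deriv unfolding test_functions_iff by blast
qed

text \<open>The primitive from \<open>a\<close> vanishes to the left of the support trivially and to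
  the right of it because the total integral is zero.\<close>

lemma test_primitive:
  assumes w: "w \<in> test_functions a b" and 0: "ioint a b w = 0" and ab: "a < b"
  obtains \<phi> where "\<phi> \<in> test_functions a b" "deriv \<phi> = w"
proof -
  obtain c d where cd: "a < c" "d < b" "\<And>x. x \<notin> {c..d} \<Longrightarrow> w x = 0"
    using w unfolding test_functions_iff by blast
  have cont: "continuous_on S w" for S by (rule smooth_continuous[OF test_smooth[OF w]])
  have int: "iointegrable x y w" for x y by (rule continuous_iointegrable[OF cont])
  define \<phi> where "\<phi> = (\<lambda>x. ioint a x w)"
  have z: "\<phi> x = 0" if "x \<le> c" for x
    unfolding \<phi>_def using that cd by (subst ioint_cong[of a x w "\<lambda>_. 0"]) auto
  have z': "\<phi> x = 0" if x: "d \<le> x" "a \<le> x" for x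
  proof -
    have "ioint (min x b) (max x b) w = 0"
      using cd(2) x by (subst ioint_cong[of _ _ w "\<lambda>_. 0"]) (auto intro!: cd(3))
    moreover have "ioint a (max x b) w = ioint a (min x b) w + ioint (min x b) (max x b) w"
      by (rule ioint_combine[OF int]) (use x ab in auto)
    ultimately have "ioint a (max x b) w = ioint a (min x b) w" by simp
    then show ?thesis using 0 unfolding \<phi>_def by (cases "x \<le> b") (auto simp: max_def min_def)
  qed
  have D: "(\<phi> has_real_derivative w x) (at x)" for x
  proof (cases "x < c")
    case True
    have "\<forall>\<^sub>F y in nhds x. 0 = \<phi> y"
      using True z unfolding eventually_nhds by (intro exI[of _ "{..<c}"]) auto
    then have "(\<phi> has_real_derivative 0) (at x)"
      using DERIV_cong_ev[OF refl, of "\<lambda>_. 0" \<phi> x 0 0] by auto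
    then show ?thesis using cd True by simp
  next
    case False
    have "((\<lambda>y. integral {a..y} w) has_real_derivative w x) (at x within {a..x+1})"
      by (rule integral_has_real_derivative[OF cont]) (use False cd in auto)
    then have "((\<lambda>y. integral {a..y} w) has_real_derivative w x) (at x)"
      using at_within_Icc_at[of a x "x+1"] False cd by auto
    then show ?thesis unfolding \<phi>_def by (simp add: ioint_eq_integral(1)[OF int])
  qed
  have dw: "deriv \<phi> = w" by (intro ext DERIV_imp_deriv D)
  have "smooth \<phi>"
    unfolding smooth_def
  proof
    fix n show "diff_times n \<phi>"
    proof (cases n)
      case (Suc m)
      have "\<phi> differentiable_on UNIV" unfolding differentiable_on_def using D real_differentiable_def by blast
      then show ?thesis using Suc dw test_smooth[OF w] by (simp add: smooth_def)
    qed simp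
  qed
  moreover have "\<forall>x. x \<notin> {c..max d c} \<longrightarrow> \<phi> x = 0" using z z' cd by (auto simp: not_le)
  \<comment> \<open>The definition of test functions does not force c \<le> d, nor that either point
    lies in (a,b). Including the midpoint gives an admissible interval, and every point to its right
    also lies above \<open>a\<close>, as \<open>z'\<close> requires.\<close>
  moreover have "a < min c ((a+b)/2)" "max d ((a+b)/2) < b" using cd ab by auto
  moreover have "\<forall>x. x \<notin> {min c ((a+b)/2)..max d ((a+b)/2)} \<longrightarrow> \<phi> x = 0"
  proof (intro allI impI)
    fix x assume "x \<notin> {min c ((a+b)/2)..max d ((a+b)/2)}"
    then have "x < c \<or> d \<le> x \<and> a \<le> x"
      using ab by (auto simp: min_def max_def field_simps split: if_splits)
    then show "\<phi> x = 0" using z z' by auto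
  qed
  ultimately have "\<phi> \<in> test_functions a b" unfolding test_functions_iff by blast
  then show ?thesis using dw that by blast
qed

lemma test_iointegrable_mult:
  assumes "iointegrable c d f" "\<phi> \<in> test_functions a b"
  shows "iointegrable c d (\<lambda>x. f x * \<phi> x)"
  using continuous_mult_iointegrable[OF smooth_continuous[OF test_smooth[OF assms(2)]] assms(1)]
  by (simp add: mult.commute)

subsection \<open>The fundamental lemma of the calculus of variations\<close>

lemma ioint_bump_tendsto:
  assumes f: "iointegrable a b f" and cd: "a \<le> c" "d \<le> b"
  shows "(\<lambda>n. ioint a b (\<lambda>x. f x * bump c d n x)) \<longlonglongrightarrow> ioint c d f"
proof -
  have sm: "smooth (bump c d n)" for n
    using bump_test[of "c - 1" c d "d + 1" n] by (intro test_smooth) auto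
  have [measurable]: "bump c d n \<in> borel_measurable (lebesgue_on {a<..<b})" for n
    by (rule continuous_on_measurable_Ioo[OF smooth_continuous[OF sm]])
  have [measurable]: "f \<in> borel_measurable (lebesgue_on {a<..<b})" using f by auto
  have [measurable]: "(\<lambda>s. indicator {c<..<d} s :: real) \<in> borel_measurable (lebesgue_on {a<..<b})"
    by (intro measurable_restrict_space1 measurable_completion) auto
  have "(\<lambda>n. ioint a b (\<lambda>x. f x * bump c d n x)) \<longlonglongrightarrow> ioint a b (\<lambda>x. f x * indicator {c<..<d} x)"
  proof (rule integral_dominated_convergence)
    show "integrable (lebesgue_on {a<..<b}) (\<lambda>x. \<bar>f x\<bar>)" using f by simp
    show "AE x in lebesgue_on {a<..<b}. (\<lambda>n. f x * bump c d n x) \<longlonglongrightarrow> f x * indicator {c<..<d} x"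
      by (intro AE_I2 tendsto_intros bump_tendsto)
    show "AE x in lebesgue_on {a<..<b}. norm (f x * bump c d n x) \<le> \<bar>f x\<bar>" for n
      by (intro AE_I2) (auto simp: abs_mult bump_bounds intro!: mult_left_le)
  qed measurable
  also have "ioint a b (\<lambda>x. f x * indicator {c<..<d} x) = ioint c d f"
    unfolding ioint_eq by (intro Bochner_Integration.integral_cong) (use cd in \<open>auto simp: indicator_def\<close>)
  finally show ?thesis .
qed

text \<open>Bump functions show that the integral over every interval strictly inside (a,b)
  vanishes. Hence the primitive from \<open>a\<close> is constant on the open interval, by
  continuity on the closed one, and its value at \<open>a\<close> is 0.\<close>

lemma fundamental_lemma:
  assumes f: "iointegrable a b f" and ab: "a < b"
    and 0: "\<And>\<psi>. \<psi> \<in> test_functions a b \<Longrightarrow> ioint a b (\<lambda>x. f x * \<psi> x) = 0"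
  shows "AE x in lebesgue_on {a<..<b}. f x = 0"
proof (rule ioint_zero_AE[OF f])
  have cd: "ioint c d f = 0" if "a < c" "d < b" for c d
  proof -
    have "ioint a b (\<lambda>x. f x * bump c d n x) = 0" for n by (rule 0[OF bump_test]) (use that in auto)
    then show ?thesis using LIMSEQ_unique[OF ioint_bump_tendsto[OF f, of c d] ] that by fastforce
  qed
  define m where "m = (a + b) / 2"
  have m: "a < m" "m < b" using ab by (auto simp: m_def)
  have const: "ioint a t f = ioint a m f" if t: "t \<in> {a<..<b}" for t
  proof (cases "t \<le> m")
    case True
    have "ioint a m f = ioint a t f + ioint t m f"
      by (rule ioint_combine[OF iointegrable_subinterval[OF f]]) (use t m True in auto)
    then show ?thesis using cd[of t m] t m by simp
  next
    case False
    have "ioint a t f = ioint a m f + ioint m t f"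
      by (rule ioint_combine[OF iointegrable_subinterval[OF f]]) (use t m False in auto)
    then show ?thesis using cd[of m t] t m by simp
  qed
  have cl: "closure {a<..<b} = {a..b}" using ab by simp
  have all: "ioint a t f = ioint a m f" if "t \<in> {a..b}" for t
    using continuous_constant_on_closure[of "{a<..<b}" "\<lambda>t. ioint a t f" "ioint a m f" t]
      continuous_on_ioint[OF f] const that unfolding cl by auto
  fix t assume "a \<le> t" "t \<le> b"
  then show "ioint a t f = 0" using all[of t] all[of a] ab by simp
qed

text \<open>Subtracting the primitive of \<open>g\<close> leaves a function \<open>h\<close> whose
  weak derivative is zero. A test function \<theta> of integral 1 corrects any test function to one
  of integral zero, which is a derivative of a test function; so h minus the constant (h,\<theta>)
  is orthogonal to all test functions.\<close>

lemma du_Bois_Reymond: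
  assumes f: "iointegrable a b f" and g: "iointegrable a b g" and ab: "a < b"
    and weak: "\<And>\<phi>. \<phi> \<in> test_functions a b \<Longrightarrow> ioint a b (\<lambda>x. f x * deriv \<phi> x) = - ioint a b (\<lambda>x. g x * \<phi> x)"
  obtains c where "AE x in lebesgue_on {a<..<b}. f x = c + ioint a x g"
proof -
  define h where "h = (\<lambda>x. f x - ioint a x g)"
  have G: "is_primitive a b (\<lambda>x. ioint a x g) g" using is_primitive_ioint[OF g, of 0] by simp
  have iG: "iointegrable a b (\<lambda>x. ioint a x g)" by (rule continuous_iointegrable[OF continuous_on_ioint[OF g]])
  have h: "iointegrable a b h" unfolding h_def using f iG by simp
  have h0: "ioint a b (\<lambda>x. h x * deriv \<phi> x) = 0" if \<phi>: "\<phi> \<in> test_functions a b" for \<phi>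
  proof -
    note sm = test_smooth[OF \<phi>]
    have P: "is_primitive a b \<phi> (deriv \<phi>)"
      by (rule is_primitive_C1) (auto intro: has_field_derivative_at_within smooth_DERIV[OF sm] smooth_continuous smooth_deriv sm)
    have "ioint a b (\<lambda>x. g x * \<phi> x + ioint a x g * deriv \<phi> x) = 0"
      using is_primitive_integral[OF is_primitive_mult[OF G P], of a b] ab test_zero[OF \<phi>, of a] test_zero[OF \<phi>, of b] by simp
    then have "ioint a b (\<lambda>x. g x * \<phi> x) + ioint a b (\<lambda>x. ioint a x g * deriv \<phi> x) = 0"
      by (subst (asm) Bochner_Integration.integral_add)
         (auto intro!: test_iointegrable_mult[OF g \<phi>] test_iointegrable_mult[OF iG test_deriv[OF \<phi>]])
    moreover have "ioint a b (\<lambda>x. h x * deriv \<phi> x) = ioint a b (\<lambda>x. f x * deriv \<phi> x) - ioint a b (\<lambda>x. ioint a x g * deriv \<phi> x)"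
      unfolding h_def left_diff_distrib
      by (rule Bochner_Integration.integral_diff)
         (auto intro!: test_iointegrable_mult[OF f test_deriv[OF \<phi>]] test_iointegrable_mult[OF iG test_deriv[OF \<phi>]])
    ultimately show ?thesis using weak[OF \<phi>] by simp
  qed
  define c d where "c = a + (b - a) / 4" and "d = b - (b - a) / 4"
  have cd: "a < c" "d < b" "c < d" using ab by (auto simp: c_def d_def field_simps)
  have "(\<lambda>n. ioint a b (\<lambda>x. 1 * bump c d n x)) \<longlonglongrightarrow> ioint c d (\<lambda>x. 1)"
    by (rule ioint_bump_tendsto) (use cd in auto)
  then have "(\<lambda>n. ioint a b (bump c d n)) \<longlonglongrightarrow> d - c"
    using ioint_const[OF less_imp_le[OF cd(3)], of 1] by (simp only: mult_1)
  then have "\<forall>\<^sub>F n in sequentially. ioint a b (bump c d n) > 0"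
    by (rule order_tendstoD) (use cd in auto)
  then obtain n where n: "ioint a b (bump c d n) > 0" using eventually_happens'[OF sequentially_bot] by blast
  define \<theta> where "\<theta> = (\<lambda>x. (1 / ioint a b (bump c d n)) * bump c d n x)"
  have \<theta>: "\<theta> \<in> test_functions a b" unfolding \<theta>_def by (intro test_cmult bump_test cd)
  have i\<theta>: "ioint a b \<theta> = 1" using n unfolding \<theta>_def by simp
  define k where "k = ioint a b (\<lambda>x. h x * \<theta> x)"
  have "AE x in lebesgue_on {a<..<b}. h x - k = 0"
  proof (rule fundamental_lemma[OF _ ab])
    show "iointegrable a b (\<lambda>x. h x - k)" using h by simp
    fix \<psi> assume \<psi>: "\<psi> \<in> test_functions a b"
    define m where "m = ioint a b \<psi>"
    have i: "iointegrable a b \<psi>" "iointegrable a b \<theta>"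
      using \<psi> \<theta> by (auto intro: continuous_iointegrable smooth_continuous test_smooth)
    have w: "(\<lambda>x. \<psi> x + (- m) * \<theta> x) \<in> test_functions a b"
      by (intro test_add test_cmult \<psi> \<theta>)
    have "ioint a b (\<lambda>x. \<psi> x + (- m) * \<theta> x) = 0"
      using i i\<theta> by (simp add: m_def)
    then obtain \<phi> where \<phi>: "\<phi> \<in> test_functions a b" "deriv \<phi> = (\<lambda>x. \<psi> x + (- m) * \<theta> x)"
      using test_primitive[OF w _ ab] by blast
    note ii = test_iointegrable_mult[OF h \<psi>] test_iointegrable_mult[OF h \<theta>]
    have "0 = ioint a b (\<lambda>x. h x * \<psi> x - m * (h x * \<theta> x))"
      using h0[OF \<phi>(1)] unfolding \<phi>(2) by (simp add: algebra_simps)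
    also have "\<dots> = ioint a b (\<lambda>x. h x * \<psi> x) - m * k"
      using ii by (simp add: k_def)
    finally have "ioint a b (\<lambda>x. h x * \<psi> x) = m * k" by simp
    moreover have "ioint a b (\<lambda>x. h x * \<psi> x - k * \<psi> x) = ioint a b (\<lambda>x. h x * \<psi> x) - k * m"
      using ii i by (simp add: m_def)
    ultimately show "ioint a b (\<lambda>x. (h x - k) * \<psi> x) = 0"
      by (simp only: left_diff_distrib) simp
  qed
  then have "AE x in lebesgue_on {a<..<b}. f x = k + ioint a x g"
    by eventually_elim (simp add: h_def)
  then show ?thesis using that by blast
qed

section \<open>Square integrable functions\<close>

lemma measure_Ioo [simp]: "a \<le> b \<Longrightarrow> measure (lebesgue_on {a<..<b}) {a<..<b} = (b - a :: real)"
  by (simp add: measure_restrict_space)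

lemma L2_onD:
  assumes "f \<in> L2_on S"
  shows "f \<in> borel_measurable (lebesgue_on S)" "integrable (lebesgue_on S) (\<lambda>x. (f x)\<^sup>2)"
  using assms by (auto simp: L2_on_def)

lemma L2_on_mult_integrable:
  assumes "f \<in> L2_on S" "g \<in> L2_on S"
  shows "integrable (lebesgue_on S) (\<lambda>x. f x * g x)"
  by (rule integrable_mult_square_integrable[OF L2_onD(1)[OF assms(1)] L2_onD(1)[OF assms(2)]
      L2_onD(2)[OF assms(1)] L2_onD(2)[OF assms(2)]])

lemma L2_on_cmult: "f \<in> L2_on S \<Longrightarrow> (\<lambda>x. c * f x) \<in> L2_on S"
  by (auto simp: L2_on_def power_mult_distrib)

lemma L2_on_add:
  assumes "f \<in> L2_on S" "g \<in> L2_on S"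
  shows "(\<lambda>x. f x + g x) \<in> L2_on S"
proof -
  have "integrable (lebesgue_on S) (\<lambda>x. (f x)\<^sup>2 + (g x)\<^sup>2 + 2 * (f x * g x))"
    using L2_on_mult_integrable[OF assms] L2_onD[OF assms(1)] L2_onD[OF assms(2)] by auto
  then show ?thesis using assms by (auto simp: L2_on_def power2_eq_square algebra_simps)
qed

lemma L2_on_diff:
  assumes "f \<in> L2_on S" "g \<in> L2_on S"
  shows "(\<lambda>x. f x - g x) \<in> L2_on S"
  using L2_on_add[OF assms(1) L2_on_cmult[OF assms(2), of "-1"]] by simp

lemma L2_on_bounded_mult:
  assumes f: "f \<in> L2_on {a<..<b}" and g: "g \<in> borel_measurable (lebesgue_on {a<..<b})"
    and B: "\<And>y. a < y \<Longrightarrow> y < b \<Longrightarrow> \<bar>g y\<bar> \<le> B"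
  shows "(\<lambda>y. g y * f y) \<in> L2_on {a<..<b}"
proof -
  have "iointegrable a b (\<lambda>y. (g y)\<^sup>2 * (f y)\<^sup>2)"
  proof (rule iointegrable_bounded_mult[OF L2_onD(2)[OF f]])
    show "(\<lambda>y. (g y)\<^sup>2) \<in> borel_measurable (lebesgue_on {a<..<b})" using g by simp
    fix y assume "a < y" "y < b"
    then have "\<bar>g y\<bar>\<^sup>2 \<le> B\<^sup>2" by (intro power_mono B) auto
    then show "\<bar>(g y)\<^sup>2\<bar> \<le> B\<^sup>2" by simp
  qed
  then show ?thesis using L2_onD(1)[OF f] g by (auto simp: L2_on_def power_mult_distrib)
qed

lemma L2_on_continuous:
  assumes "continuous_on {a..b} f"
  shows "f \<in> L2_on {a<..<b}"
  unfolding L2_on_def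
  using continuous_on_measurable_Ioo[OF assms] continuous_iointegrable[OF continuous_on_power[OF assms, of 2]]
  by auto

lemma L2_on_integrable:
  assumes "f \<in> L2_on {a<..<b}"
  shows "iointegrable a b f"
  using L2_on_mult_integrable[OF assms L2_on_continuous[of a b "\<lambda>_. 1"]] by simp

lemma L2_on_subinterval:
  assumes "f \<in> L2_on {a<..<b}" "a \<le> c" "d \<le> b"
  shows "f \<in> L2_on {c<..<d}"
proof -
  have "{c<..<d} \<subseteq> {a<..<b}" using assms(2,3) by auto
  then show ?thesis
    using iointegrable_subinterval[OF L2_onD(2)[OF assms(1)] assms(2,3)]
      measurable_lebesgue_on_subset[OF L2_onD(1)[OF assms(1)]] by (auto simp: L2_on_def)
qed

lemma L2_on_AE:
  assumes "f \<in> L2_on {a<..<b}" "g \<in> borel_measurable (lebesgue_on {a<..<b})"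
    "AE x in lebesgue_on {a<..<b}. f x = g x"
  shows "g \<in> L2_on {a<..<b}"
proof -
  have "AE x in lebesgue_on {a<..<b}. (g x)\<^sup>2 = (f x)\<^sup>2" using assms(3) by eventually_elim simp
  then have "iointegrable a b (\<lambda>x. (g x)\<^sup>2)"
    using assms L2_onD[OF assms(1)] by (subst integrable_cong_AE[of _ _ "\<lambda>x. (f x)\<^sup>2"]) auto
  then show ?thesis using assms by (simp add: L2_on_def)
qed

lemma L2_Cauchy_Schwarz:
  assumes "f \<in> L2_on S" "g \<in> L2_on S"
  shows "\<bar>LINT x|lebesgue_on S. f x * g x\<bar> \<le> sqrt (LINT x|lebesgue_on S. (f x)\<^sup>2) * sqrt (LINT x|lebesgue_on S. (g x)\<^sup>2)"
  by (rule Cauchy_Schwarz_integral(2)[OF L2_onD(1)[OF assms(1)] L2_onD(1)[OF assms(2)]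
      L2_onD(2)[OF assms(1)] L2_onD(2)[OF assms(2)]])

lemma L2_on_abs: "f \<in> L2_on S \<Longrightarrow> (\<lambda>x. \<bar>f x\<bar>) \<in> L2_on S"
  by (auto simp: L2_on_def)

lemma ioint_abs_le_L2:
  assumes "f \<in> L2_on {a<..<b}" "a \<le> b"
  shows "ioint a b (\<lambda>x. \<bar>f x\<bar>) \<le> sqrt (b - a) * sqrt (ioint a b (\<lambda>x. (f x)\<^sup>2))"
  using L2_Cauchy_Schwarz[OF L2_on_continuous[of a b "\<lambda>_. 1"] L2_on_abs[OF assms(1)]]
    ioint_const[OF assms(2), of 1] by (simp add: integral_nonneg_AE)

section \<open>The norm of square integrable functions on the unit interval\<close>

abbreviation L2 :: "(real \<Rightarrow> real) set" where
  "L2 \<equiv> L2_on {0<..<1}"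

definition l2norm :: "(real \<Rightarrow> real) \<Rightarrow> real" where
  "l2norm f = sqrt (ioint 0 1 (\<lambda>x. (f x)\<^sup>2))"

lemma l2norm_nonneg [simp]: "0 \<le> l2norm f"
  unfolding l2norm_def by (intro real_sqrt_ge_zero ioint_nonneg) auto

lemma l2norm_square: "(l2norm f)\<^sup>2 = ioint 0 1 (\<lambda>x. (f x)\<^sup>2)"
  unfolding l2norm_def by (intro real_sqrt_pow2 ioint_nonneg) auto

lemma ioint_le_l2norm: "f \<in> L2 \<Longrightarrow> g \<in> L2 \<Longrightarrow> \<bar>ioint 0 1 (\<lambda>x. f x * g x)\<bar> \<le> l2norm f * l2norm g"
  unfolding l2norm_def by (rule L2_Cauchy_Schwarz)

lemma ioint_abs_le_l2norm: "f \<in> L2 \<Longrightarrow> ioint 0 1 (\<lambda>x. \<bar>f x\<bar>) \<le> l2norm f"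
  unfolding l2norm_def using ioint_abs_le_L2[of f 0 1] by simp

lemma l2norm_cmult: "l2norm (\<lambda>x. c * f x) = \<bar>c\<bar> * l2norm f"
  unfolding l2norm_def by (simp add: power_mult_distrib real_sqrt_mult)

lemma l2norm_le_bounded:
  assumes f: "f \<in> L2" and g: "g \<in> borel_measurable (lebesgue_on {0<..<1})"
    and B: "\<And>y. 0 < y \<Longrightarrow> y < 1 \<Longrightarrow> \<bar>g y\<bar> \<le> B * \<bar>f y\<bar>" and "0 \<le> B"
  shows "g \<in> L2" "l2norm g \<le> B * l2norm f"
proof -
  have le: "(g y)\<^sup>2 \<le> B\<^sup>2 * (f y)\<^sup>2" if "0 < y" "y < 1" for y
    using power_mono[OF B[OF that], of 2] by (simp add: power_mult_distrib)
  have i: "iointegrable 0 1 (\<lambda>y. B\<^sup>2 * (f y)\<^sup>2)" using L2_onD[OF f] by simp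
  have ig: "iointegrable 0 1 (\<lambda>y. (g y)\<^sup>2)"
    by (rule Bochner_Integration.integrable_bound[OF i])
       (use g le in \<open>auto simp: abs_of_nonneg intro!: AE_I2\<close>)
  then show "g \<in> L2" using g by (simp add: L2_on_def)
  have "ioint 0 1 (\<lambda>y. (g y)\<^sup>2) \<le> B\<^sup>2 * ioint 0 1 (\<lambda>y. (f y)\<^sup>2)"
    using ioint_mono[OF ig i le] by simp
  then have "sqrt (ioint 0 1 (\<lambda>y. (g y)\<^sup>2)) \<le> sqrt (B\<^sup>2 * ioint 0 1 (\<lambda>y. (f y)\<^sup>2))"
    by (rule real_sqrt_le_mono)
  then show "l2norm g \<le> B * l2norm f" using \<open>0 \<le> B\<close> by (simp add: l2norm_def real_sqrt_mult)
qed

lemma l2norm_le_sup: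
  assumes g: "g \<in> borel_measurable (lebesgue_on {0<..<1})"
    and B: "\<And>y. 0 < y \<Longrightarrow> y < 1 \<Longrightarrow> \<bar>g y\<bar> \<le> B" and "0 \<le> B"
  shows "g \<in> L2" "l2norm g \<le> B"
  using l2norm_le_bounded[OF L2_on_continuous[of 0 1 "\<lambda>_. 1"] g _ \<open>0 \<le> B\<close>] B by (auto simp: l2norm_def)

lemma l2norm_AE:
  assumes "AE x in lebesgue_on {0<..<1}. f x = g x"
    "f \<in> borel_measurable (lebesgue_on {0<..<1})" "g \<in> borel_measurable (lebesgue_on {0<..<1})"
  shows "l2norm f = l2norm g"
proof -
  have "AE x in lebesgue_on {0<..<1}. (f x)\<^sup>2 = (g x)\<^sup>2" using assms(1) by eventually_elim simp
  then show ?thesis unfolding l2norm_def using assms(2,3) by (subst integral_cong_AE[of _ _ "\<lambda>x. (g x)\<^sup>2"]) auto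
qed

lemma l2norm_triangle:
  assumes f: "f \<in> L2" and g: "g \<in> L2"
  shows "l2norm (\<lambda>x. f x + g x) \<le> l2norm f + l2norm g"
proof -
  note i = L2_onD(2)[OF f] L2_onD(2)[OF g] L2_on_mult_integrable[OF f g]
  have "(l2norm (\<lambda>x. f x + g x))\<^sup>2 = ioint 0 1 (\<lambda>x. (f x)\<^sup>2 + (g x)\<^sup>2 + 2 * (f x * g x))"
    unfolding l2norm_square by (intro ioint_cong) (simp add: power2_eq_square algebra_simps)
  also have "\<dots> = (l2norm f)\<^sup>2 + (l2norm g)\<^sup>2 + 2 * ioint 0 1 (\<lambda>x. f x * g x)"
    using i by (simp add: l2norm_square)
  also have "\<dots> \<le> (l2norm f)\<^sup>2 + (l2norm g)\<^sup>2 + 2 * (l2norm f * l2norm g)"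
    using ioint_le_l2norm[OF f g] by linarith
  also have "\<dots> = (l2norm f + l2norm g)\<^sup>2" by (simp add: power2_eq_square algebra_simps)
  finally show ?thesis by (rule power2_le_imp_le) simp
qed

lemma l2norm_triangle_diff:
  assumes f: "f \<in> L2" and g: "g \<in> L2"
  shows "l2norm (\<lambda>x. f x - g x) \<le> l2norm f + l2norm g"
  using l2norm_triangle[OF f L2_on_cmult[OF g, of "-1"]] l2norm_cmult[of "-1" g] by simp

lemma l2norm_zero_AE:
  assumes f: "f \<in> L2" and 0: "l2norm f = 0"
  shows "AE x in lebesgue_on {0<..<1}. f x = 0"
proof -
  have "ioint 0 1 (\<lambda>x. (f x)\<^sup>2) = 0" using 0 l2norm_square[of f] by simp
  then have "AE x in lebesgue_on {0<..<1}. (f x)\<^sup>2 = 0"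
    using integral_nonneg_eq_0_iff_AE[OF L2_onD(2)[OF f]] by simp
  then show ?thesis by simp
qed

text \<open>The primitive of the difference is constantly zero, and at interior points its
  derivative is the continuous difference itself.\<close>

lemma AE_eq_continuous:
  fixes a b :: real and f g :: "real \<Rightarrow> real"
  assumes ae: "AE x in lebesgue_on {a<..<b}. f x = g x" and ab: "a < b"
    and cont: "continuous_on {a..b} f" "continuous_on {a..b} g"
  shows "\<forall>x\<in>{a..b}. f x = g x"
proof -
  have cd: "continuous_on {a..b} (\<lambda>x. f x - g x)" using cont by (intro continuous_intros)
  have int: "iointegrable a b (\<lambda>x. f x - g x)" by (rule continuous_iointegrable[OF cd])
  have z: "integral {a..t} (\<lambda>x. f x - g x) = 0" if "t \<in> {a..b}" for t
  proof -
    have "AE x in lebesgue. x \<in> {a<..<b} \<longrightarrow> f x = g x"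
      using ae by (subst (asm) AE_restrict_space_iff) auto
    then have "AE x in lebesgue. indicator {a<..<t} x * (f x - g x) = 0"
      by eventually_elim (use that in \<open>auto simp: indicator_def\<close>)
    then have "ioint a t (\<lambda>x. f x - g x) = 0"
      unfolding ioint_eq by (rule integral_eq_zero_AE)
    then show ?thesis
      using ioint_eq_integral(1)[OF iointegrable_subinterval[OF int, of a t]] that by simp
  qed
  have "f t - g t = 0" if t: "t \<in> {a<..<b}" for t
  proof -
    have "((\<lambda>t. integral {a..t} (\<lambda>x. f x - g x)) has_real_derivative f t - g t) (at t within {a..b})"
      by (rule integral_has_real_derivative[OF cd]) (use t in auto)
    then have 1: "((\<lambda>t. integral {a..t} (\<lambda>x. f x - g x)) has_real_derivative f t - g t) (at t)"
      using at_within_Icc_at[of a t b] t by auto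
    have "\<forall>\<^sub>F s in nhds t. integral {a..s} (\<lambda>x. f x - g x) = 0"
      unfolding eventually_nhds by (rule exI[of _ "{a<..<b}"]) (use z t in auto)
    then have "((\<lambda>t. 0) has_real_derivative f t - g t) (at t)"
      using DERIV_cong_ev[OF refl _ refl, of "\<lambda>t. integral {a..t} (\<lambda>x. f x - g x)" "\<lambda>t. 0"] 1 by simp
    then show ?thesis using DERIV_unique[OF _ DERIV_const] by blast
  qed
  then have "f x - g x = 0" if "x \<in> {a..b}" for x
    using continuous_constant_on_closure[of "{a<..<b}" "\<lambda>x. f x - g x" 0 x] cd that ab by auto
  then show ?thesis by simp
qed

section \<open>Sobolev functions\<close>

text \<open>\<open>Hbound m B f\<close>: \<open>f\<close> is $m$ times absolutely differentiable on $[0,1]$ with $f^{(m)} \in L^2$,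
  where \<open>B\<close> bounds $|f^{(j)}(0)|$ for \<open>j < m\<close> and the norm of $f^{(m)}$.\<close>

fun Hbound :: "nat \<Rightarrow> real \<Rightarrow> (real \<Rightarrow> real) \<Rightarrow> bool" where
  "Hbound 0 B f \<longleftrightarrow> f \<in> L2 \<and> l2norm f \<le> B"
| "Hbound (Suc m) B f \<longleftrightarrow> \<bar>f 0\<bar> \<le> B \<and> (\<exists>f'. is_primitive 0 1 f f' \<and> Hbound m B f')"

lemma Hbound_nonneg: "Hbound m B f \<Longrightarrow> 0 \<le> B"
  by (cases m) (auto intro: order_trans[OF l2norm_nonneg] order_trans[OF abs_ge_zero])

lemma Hbound_mono: "Hbound m B f \<Longrightarrow> B \<le> B' \<Longrightarrow> Hbound m B' f"
  by (induction m arbitrary: f) force+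

lemma is_primitive_abs_le:
  assumes "is_primitive 0 1 F f" "f \<in> L2" "x \<in> {0..1}" "y \<in> {0..1}"
  shows "\<bar>F x - F y\<bar> \<le> l2norm f"
proof -
  have *: "\<bar>F d - F c\<bar> \<le> l2norm f" if "0 \<le> c" "c \<le> d" "d \<le> 1" for c d
  proof -
    have "\<bar>F d - F c\<bar> = \<bar>ioint c d f\<bar>" using is_primitive_integral[OF assms(1) that] by simp
    also have "\<dots> \<le> ioint c d (\<lambda>x. \<bar>f x\<bar>)" by (rule abs_ioint_le)
    also have "\<dots> \<le> ioint 0 1 (\<lambda>x. \<bar>f x\<bar>)"
      by (rule ioint_mono_interval) (use that L2_on_integrable[OF assms(2)] in auto)
    also have "\<dots> \<le> l2norm f" by (rule ioint_abs_le_l2norm[OF assms(2)])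
    finally show ?thesis .
  qed
  show ?thesis using *[of x y] *[of y x] assms(3,4) by (cases "x \<le> y") auto
qed

text \<open>Every integration adds one value at 0, bounded by B, to the previous bound, so the
  factor grows by one with each order. The pointwise bound at order m + 1 rests on the norm bound at
  order m, which it in turn yields at order m + 1.\<close>

lemma Hbound_l2: "Hbound m B f \<Longrightarrow> f \<in> L2 \<and> l2norm f \<le> (real m + 1) * B"
  and Hbound_sup: "Hbound (Suc m) B f \<Longrightarrow> y \<in> {0..1} \<Longrightarrow> \<bar>f y\<bar> \<le> (real m + 2) * B"
proof -
  have sup: "\<bar>f y\<bar> \<le> (real m + 2) * B"
    if h: "Hbound (Suc m) B f" "y \<in> {0..1}"
      "\<And>f. Hbound m B f \<Longrightarrow> f \<in> L2 \<and> l2norm f \<le> (real m + 1) * B" for m f y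
  proof -
    obtain f' where f': "is_primitive 0 1 f f'" "Hbound m B f'" using h(1) by auto
    have "\<bar>f y - f 0\<bar> \<le> l2norm f'"
      by (rule is_primitive_abs_le[OF f'(1)]) (use that(2) that(3)[OF f'(2)] in auto)
    moreover have "l2norm f' \<le> (real m + 1) * B" using that(3)[OF f'(2)] by simp
    moreover have "\<bar>f 0\<bar> \<le> B" using that(1) by simp
    ultimately show ?thesis by (simp add: algebra_simps)
  qed
  have l2: "f \<in> L2 \<and> l2norm f \<le> (real m + 1) * B" if "Hbound m B f" for m f
    using that
  proof (induction m arbitrary: f)
    case (Suc m)
    have c: "continuous_on {0..1} f" using Suc.prems is_primitive_continuous by auto
    have "l2norm f \<le> (real m + 2) * B"
      using sup[OF Suc.prems _ Suc.IH] Hbound_nonneg[OF Suc.prems]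
      by (intro l2norm_le_sup continuous_on_measurable_Ioo c) auto
    then show ?case using L2_on_continuous[OF c] by (simp add: algebra_simps)
  qed simp
  show "Hbound m B f \<Longrightarrow> f \<in> L2 \<and> l2norm f \<le> (real m + 1) * B" by (rule l2)
  show "Hbound (Suc m) B f \<Longrightarrow> y \<in> {0..1} \<Longrightarrow> \<bar>f y\<bar> \<le> (real m + 2) * B" by (rule sup[OF _ _ l2])
qed

lemma Hbound_continuous: "Hbound (Suc m) B f \<Longrightarrow> continuous_on {0..1} f"
  using is_primitive_continuous by auto

lemma Hbound_lower: "Hbound (Suc m) B f \<Longrightarrow> Hbound m ((real m + 2) * B) f"
proof (induction m arbitrary: f)
  case 0
  have "l2norm f \<le> 2 * B"
    using Hbound_sup[OF 0] Hbound_nonneg[OF 0]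
    by (intro l2norm_le_sup continuous_on_measurable_Ioo Hbound_continuous[OF 0]) auto
  then show ?case using L2_on_continuous[OF Hbound_continuous[OF 0]] by simp
next
  case (Suc m)
  obtain f' where f': "is_primitive 0 1 f f'" "Hbound (Suc m) B f'" using Suc.prems by auto
  have B: "0 \<le> B" using Hbound_nonneg[OF Suc.prems] .
  have "Hbound m ((real (Suc m) + 2) * B) f'"
    by (rule Hbound_mono[OF Suc.IH[OF f'(2)]]) (use B in \<open>simp add: mult_right_mono\<close>)
  moreover have "\<bar>f 0\<bar> \<le> (real (Suc m) + 2) * B"
    using Suc.prems B mult_right_mono[of 1 "real (Suc m) + 2" B] by auto
  ultimately show ?case using f'(1) by auto
qed

lemma Hbound_add: "Hbound m A f \<Longrightarrow> Hbound m B g \<Longrightarrow> Hbound m (A + B) (\<lambda>x. f x + g x)"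
proof (induction m arbitrary: f g)
  case 0
  then show ?case using L2_on_add[of f _ g] l2norm_triangle[of f g] by auto
next
  case (Suc m)
  then show ?case using is_primitive_add by (fastforce simp: abs_triangle_ineq[THEN order_trans])
qed

lemma Hbound_cmult: "Hbound m B f \<Longrightarrow> Hbound m (\<bar>c\<bar> * B) (\<lambda>x. c * f x)"
proof (induction m arbitrary: f)
  case 0
  then show ?case using L2_on_cmult[of f] l2norm_cmult[of c f] by (auto intro: mult_left_mono)
next
  case (Suc m)
  then show ?case using is_primitive_cmult by (fastforce simp: abs_mult intro: mult_left_mono)
qed

text \<open>The second factor carries one order more, so that the induction ends with a square
  integrable function times a bounded one. In both terms of the Leibniz rule one factor can be
  lowered until the orders are again m and m + 1.\<close>

lemma Hbound_mult:
  "\<exists>C\<ge>0. \<forall>f g A B. Hbound m A f \<longrightarrow> Hbound (Suc m) B g \<longrightarrow> Hbound m (C * (A * B)) (\<lambda>x. f x * g x)"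
proof (induction m)
  case 0
  have *: "Hbound 0 (2 * (A * B)) (\<lambda>x. f x * g x)" if f: "Hbound 0 A f" and g: "Hbound (Suc 0) B g" for f g A B
  proof -
    have B: "0 \<le> B" using Hbound_nonneg[OF g] .
    have m: "(\<lambda>x. f x * g x) \<in> borel_measurable (lebesgue_on {0<..<1})"
      using f continuous_on_measurable_Ioo[OF Hbound_continuous[OF g]] by (auto simp: L2_on_def)
    have le: "\<bar>f y * g y\<bar> \<le> (2 * B) * \<bar>f y\<bar>" if "0 < y" "y < 1" for y
      using mult_right_mono[OF Hbound_sup[OF g, of y], of "\<bar>f y\<bar>"] that by (simp add: abs_mult mult.commute)
    have "(\<lambda>x. f x * g x) \<in> L2 \<and> l2norm (\<lambda>x. f x * g x) \<le> (2 * B) * l2norm f"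
      using l2norm_le_bounded[OF _ m le] f B by auto
    moreover have "(2 * B) * l2norm f \<le> 2 * (A * B)"
      using mult_left_mono[of "l2norm f" A "2 * B"] f B by (simp add: mult.commute mult.left_commute)
    ultimately show ?thesis by auto
  qed
  show ?case by (intro exI[of _ 2] conjI allI impI *) simp
next
  case (Suc m)
  then obtain C where C: "0 \<le> C"
    "\<And>f g A B. Hbound m A f \<Longrightarrow> Hbound (Suc m) B g \<Longrightarrow> Hbound m (C * (A * B)) (\<lambda>x. f x * g x)" by blast
  \<comment> \<open>Lowering \<open>g\<close> costs the factor m + 3 and lowering \<open>g'\<close>
    the factor m + 2, together 2 m + 5; the summand 1 accounts for the value of the product at
    0.\<close>
  have "Hbound (Suc m) ((C * (2 * real m + 5) + 1) * (A * B)) (\<lambda>x. f x * g x)"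
    if f: "Hbound (Suc m) A f" and g: "Hbound (Suc (Suc m)) B g" for f g A B
  proof -
    obtain f' where f': "is_primitive 0 1 f f'" "Hbound m A f'" using f by auto
    obtain g' where g': "is_primitive 0 1 g g'" "Hbound (Suc m) B g'" using g by auto
    have AB: "0 \<le> A" "0 \<le> B" using Hbound_nonneg[OF f] Hbound_nonneg[OF g] by auto
    have 1: "Hbound m (C * (A * ((real (Suc m) + 2) * B))) (\<lambda>x. f' x * g x)"
      by (rule C(2)[OF f'(2) Hbound_lower[OF g]])
    have 2: "Hbound m (C * (((real m + 2) * B) * A)) (\<lambda>x. g' x * f x)"
      by (rule C(2)[OF Hbound_lower[OF g'(2)] f])
    have 3: "Hbound m ((C * (2 * real m + 5)) * (A * B)) (\<lambda>x. f' x * g x + f x * g' x)"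
      using Hbound_add[OF 1 2] by (simp add: algebra_simps)
    have "Hbound m ((C * (2 * real m + 5) + 1) * (A * B)) (\<lambda>x. f' x * g x + f x * g' x)"
      by (rule Hbound_mono[OF 3]) (use AB in \<open>simp add: mult_right_mono\<close>)
    moreover have "is_primitive 0 1 (\<lambda>x. f x * g x) (\<lambda>x. f' x * g x + f x * g' x)"
      by (rule is_primitive_mult[OF f'(1) g'(1)])
    moreover have "\<bar>f 0 * g 0\<bar> \<le> (C * (2 * real m + 5) + 1) * (A * B)"
    proof -
      have "\<bar>f 0 * g 0\<bar> \<le> A * B" using f g AB by (auto simp: abs_mult intro!: mult_mono)
      also have "\<dots> \<le> (C * (2 * real m + 5) + 1) * (A * B)"
        using mult_right_mono[of 1 "C * (2 * real m + 5) + 1" "A * B"] C(1) AB by simp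
      finally show ?thesis .
    qed
    ultimately show ?thesis by auto
  qed
  then show ?case using C(1) by (intro exI[of _ "C * (2 * real m + 5) + 1"]) auto
qed

subsection \<open>Weak derivatives\<close>

lemma weak_deriv_unique:
  assumes "is_weak_deriv j f g" "is_weak_deriv j f h"
  shows "AE x in lebesgue_on {0<..<1}. g x = h x"
proof -
  have g: "iointegrable 0 1 g" and h: "iointegrable 0 1 h"
    using assms L2_on_integrable by (auto simp: is_weak_deriv_def)
  have "AE x in lebesgue_on {0<..<1}. g x - h x = 0"
  proof (rule fundamental_lemma)
    fix \<phi> assume \<phi>: "\<phi> \<in> test_functions 0 1"
    have "(-1) ^ j * ioint 0 1 (\<lambda>x. g x * \<phi> x) = (-1) ^ j * ioint 0 1 (\<lambda>x. h x * \<phi> x)"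
    proof -
      have "ioint 0 1 (\<lambda>x. f x * (deriv ^^ j) \<phi> x) = (-1) ^ j * ioint 0 1 (\<lambda>x. g x * \<phi> x)"
        "ioint 0 1 (\<lambda>x. f x * (deriv ^^ j) \<phi> x) = (-1) ^ j * ioint 0 1 (\<lambda>x. h x * \<phi> x)"
        using assms \<phi> unfolding is_weak_deriv_def by blast+
      then show ?thesis by (rule subst)
    qed
    then have "ioint 0 1 (\<lambda>x. g x * \<phi> x) = ioint 0 1 (\<lambda>x. h x * \<phi> x)" by simp
    then have "ioint 0 1 (\<lambda>x. g x * \<phi> x - h x * \<phi> x) = 0"
      using test_iointegrable_mult[OF g \<phi>] test_iointegrable_mult[OF h \<phi>] by simp
    then show "ioint 0 1 (\<lambda>x. (g x - h x) * \<phi> x) = 0" by (simp add: left_diff_distrib)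
  qed (use g h in auto)
  then show ?thesis by simp
qed

lemma is_weak_deriv_lincomb:
  assumes "is_weak_deriv j f f'" "is_weak_deriv j g g'"
  shows "is_weak_deriv j (\<lambda>x. a * f x + b * g x) (\<lambda>x. a * f' x + b * g' x)"
  unfolding is_weak_deriv_def
proof (intro conjI ballI)
  have l: "f \<in> L2" "g \<in> L2" "f' \<in> L2" "g' \<in> L2" using assms by (auto simp: is_weak_deriv_def)
  then show "(\<lambda>x. a * f x + b * g x) \<in> L2" "(\<lambda>x. a * f' x + b * g' x) \<in> L2"
    by (auto intro: L2_on_add L2_on_cmult)
  fix \<phi> assume \<phi>: "\<phi> \<in> test_functions 0 1"
  have \<phi>j: "(deriv ^^ j) \<phi> \<in> test_functions 0 1" by (induction j) (auto intro: \<phi> test_deriv)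
  have eq: "ioint 0 1 (\<lambda>x. (a * p x + b * q x) * r x) = a * ioint 0 1 (\<lambda>x. p x * r x) + b * ioint 0 1 (\<lambda>x. q x * r x)"
    if "p \<in> L2" "q \<in> L2" "r \<in> test_functions 0 1" for p q r
    using test_iointegrable_mult[OF L2_on_integrable[OF that(1)] that(3)]
      test_iointegrable_mult[OF L2_on_integrable[OF that(2)] that(3)]
    by (simp add: distrib_right mult.assoc)
  show "ioint 0 1 (\<lambda>x. (a * f x + b * g x) * (deriv ^^ j) \<phi> x) = (-1) ^ j * ioint 0 1 (\<lambda>x. (a * f' x + b * g' x) * \<phi> x)"
    unfolding eq[OF l(1,2) \<phi>j] eq[OF l(3,4) \<phi>] using assms \<phi>
    by (simp add: is_weak_deriv_def algebra_simps)
qed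

lemma sobolev_wderiv: "f \<in> sobolev s \<Longrightarrow> j \<le> s \<Longrightarrow> is_weak_deriv j f (wderiv j f)"
  unfolding wderiv_def sobolev_def by (rule someI_ex[of "is_weak_deriv j f"]) simp

lemma sobolev_lincomb: "f \<in> sobolev s \<Longrightarrow> g \<in> sobolev s \<Longrightarrow> (\<lambda>x. a * f x + b * g x) \<in> sobolev s"
  unfolding sobolev_def using is_weak_deriv_lincomb by blast

lemma wderiv_lincomb:
  assumes "f \<in> sobolev s" "g \<in> sobolev s" "j \<le> s"
  shows "AE x in lebesgue_on {0<..<1}. wderiv j (\<lambda>x. a * f x + b * g x) x = a * wderiv j f x + b * wderiv j g x"
  by (rule weak_deriv_unique[OF sobolev_wderiv[OF sobolev_lincomb]
        is_weak_deriv_lincomb[OF sobolev_wderiv sobolev_wderiv]]) (use assms in auto)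

lemma wderiv_L2: "f \<in> sobolev s \<Longrightarrow> j \<le> s \<Longrightarrow> wderiv j f \<in> L2"
  using sobolev_wderiv by (auto simp: is_weak_deriv_def)

lemma sobolev_norm_nonneg [simp]: "0 \<le> sobolev_norm s f"
  unfolding sobolev_norm_def by (intro real_sqrt_ge_zero sum_nonneg ioint_nonneg) auto

lemma wderiv_l2norm_le: "j \<le> s \<Longrightarrow> l2norm (wderiv j f) \<le> sobolev_norm s f"
  unfolding sobolev_norm_def l2norm_def
  by (intro real_sqrt_le_mono member_le_sum) (auto intro!: integral_nonneg_AE)

lemma sobolev_norm_le:
  assumes "\<And>j. j \<le> s \<Longrightarrow> l2norm (wderiv j f) \<le> B"
  shows "sobolev_norm s f \<le> (real s + 1) * B"
proof -
  have B: "0 \<le> B" using assms[of 0] l2norm_nonneg order_trans by blast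
  have "(\<Sum>j\<le>s. ioint 0 1 (\<lambda>x. (wderiv j f x)\<^sup>2)) \<le> (\<Sum>j\<le>s. B\<^sup>2)"
    by (intro sum_mono) (use assms in \<open>auto simp flip: l2norm_square intro!: power_mono\<close>)
  also have "\<dots> \<le> ((real s + 1) * B)\<^sup>2"
    using B by (simp add: power_mult_distrib power2_eq_square mult_right_mono algebra_simps)
  finally have "sobolev_norm s f \<le> sqrt (((real s + 1) * B)\<^sup>2)" unfolding sobolev_norm_def by (rule real_sqrt_le_mono)
  then show ?thesis using B by simp
qed

lemma is_weak_deriv_0: "f \<in> L2 \<Longrightarrow> is_weak_deriv 0 f f"
  by (simp add: is_weak_deriv_def)

lemma wderiv_0_AE: "f \<in> L2 \<Longrightarrow> AE x in lebesgue_on {0<..<1}. wderiv 0 f x = f x"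
  by (metis is_weak_deriv_0 someI wderiv_def weak_deriv_unique)

lemma is_weak_deriv_step:
  assumes "is_weak_deriv j f g" "is_weak_deriv (Suc j) f h" "\<phi> \<in> test_functions 0 1"
  shows "ioint 0 1 (\<lambda>x. g x * deriv \<phi> x) = - ioint 0 1 (\<lambda>x. h x * \<phi> x)"
proof -
  have "(-1) ^ j * ioint 0 1 (\<lambda>x. g x * deriv \<phi> x) = ioint 0 1 (\<lambda>x. f x * (deriv ^^ j) (deriv \<phi>) x)"
    using assms(1) test_deriv[OF assms(3)] by (simp add: is_weak_deriv_def)
  also have "\<dots> = (-1) ^ j * - ioint 0 1 (\<lambda>x. h x * \<phi> x)"
    using assms(2,3) by (simp add: is_weak_deriv_def funpow_swap1)
  finally have "(-1) ^ j * (ioint 0 1 (\<lambda>x. g x * deriv \<phi> x) + ioint 0 1 (\<lambda>x. h x * \<phi> x)) = 0"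
    by (simp add: distrib_left)
  then have "ioint 0 1 (\<lambda>x. g x * deriv \<phi> x) + ioint 0 1 (\<lambda>x. h x * \<phi> x) = 0" by simp
  then show ?thesis by (simp add: eq_neg_iff_add_eq_0)
qed

lemma is_primitive_weak:
  assumes "is_primitive 0 1 f g" "\<phi> \<in> test_functions 0 1"
  shows "ioint 0 1 (\<lambda>x. f x * deriv \<phi> x) = - ioint 0 1 (\<lambda>x. g x * \<phi> x)"
proof -
  note sm = test_smooth[OF assms(2)]
  have P: "is_primitive 0 1 \<phi> (deriv \<phi>)"
    by (rule is_primitive_C1) (auto intro: has_field_derivative_at_within smooth_DERIV[OF sm] smooth_continuous smooth_deriv sm)
  have "ioint 0 1 (\<lambda>x. g x * \<phi> x + f x * deriv \<phi> x) = 0"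
    using is_primitive_integral[OF is_primitive_mult[OF assms(1) P], of 0 1]
      test_zero[OF assms(2), of 0] test_zero[OF assms(2), of 1] by simp
  then have "ioint 0 1 (\<lambda>x. g x * \<phi> x) + ioint 0 1 (\<lambda>x. f x * deriv \<phi> x) = 0"
    by (subst (asm) Bochner_Integration.integral_add)
       (auto intro!: test_iointegrable_mult[OF is_primitiveD[OF assms(1)] assms(2)]
         test_iointegrable_mult[OF continuous_iointegrable[OF is_primitive_continuous[OF assms(1)]] test_deriv[OF assms(2)]])
  then show ?thesis by simp
qed

lemma is_weak_deriv_primitive:
  assumes "is_primitive 0 1 f g" "g \<in> L2"
  shows "is_weak_deriv 1 f g"
  unfolding is_weak_deriv_def using assms is_primitive_weak[OF assms(1)]
    L2_on_continuous[OF is_primitive_continuous[OF assms(1)]] by simp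

lemma is_weak_deriv_primitive2:
  assumes "is_primitive 0 1 f g" "is_primitive 0 1 g h" "h \<in> L2"
  shows "is_weak_deriv 2 f h"
  unfolding is_weak_deriv_def using assms is_primitive_weak[OF assms(1) test_deriv] is_primitive_weak[OF assms(2)]
    L2_on_continuous[OF is_primitive_continuous[OF assms(1)]] by (simp add: numeral_2_eq_2)

text \<open>Induction downwards from the highest derivative: by du Bois-Reymond the weak derivative
  of order j agrees almost everywhere with a primitive of the absolutely continuous representative
  of the next one.\<close>

lemma sobolev_Hbound_AE:
  assumes f: "f \<in> sobolev s" and j: "j \<le> s"
  shows "\<exists>F. (AE x in lebesgue_on {0<..<1}. F x = wderiv j f x) \<and> Hbound (s - j) (2 * sobolev_norm s f) F"
  using j
proof (induction "s - j" arbitrary: j)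
  case 0
  then have "j = s" by simp
  moreover have "l2norm (wderiv s f) \<le> 2 * sobolev_norm s f"
    using wderiv_l2norm_le[of s s f] sobolev_norm_nonneg[of s f] by linarith
  ultimately show ?case using wderiv_L2[OF f, of s]
    by (intro exI[of _ "wderiv s f"]) auto
next
  case (Suc m)
  then have j: "Suc j \<le> s" and m: "s - Suc j = m" "s - j = Suc m" by auto
  obtain G where G: "AE x in lebesgue_on {0<..<1}. G x = wderiv (Suc j) f x" "Hbound m (2 * sobolev_norm s f) G"
    using Suc.hyps(1)[of "Suc j"] j m by auto
  have GL: "G \<in> L2" using Hbound_l2[OF G(2)] by simp
  note w = wderiv_L2[OF f Suc_leD[OF j]] wderiv_L2[OF f j]
  have "ioint 0 1 (\<lambda>x. wderiv j f x * deriv \<phi> x) = - ioint 0 1 (\<lambda>x. wderiv (Suc j) f x * \<phi> x)"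
    if "\<phi> \<in> test_functions 0 1" for \<phi>
    by (rule is_weak_deriv_step[OF sobolev_wderiv sobolev_wderiv that]) (use f j in auto)
  then obtain c where c: "AE x in lebesgue_on {0<..<1}. wderiv j f x = c + ioint 0 x (wderiv (Suc j) f)"
    using du_Bois_Reymond[OF L2_on_integrable[OF w(1)] L2_on_integrable[OF w(2)]] by auto
  define F where "F = (\<lambda>x. c + ioint 0 x (wderiv (Suc j) f))"
  have eq: "ioint 0 x (wderiv (Suc j) f) = ioint 0 x G" if "x \<in> {0..1}" for x
  proof -
    have "AE x in lebesgue. x \<in> {0<..<1} \<longrightarrow> G x = wderiv (Suc j) f x"
      using G(1) by (subst (asm) AE_restrict_space_iff) auto
    then have ae: "AE y in lebesgue. y \<in> {0<..<x} \<longrightarrow> wderiv (Suc j) f y = G y"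
      by eventually_elim (use that in auto)
    show ?thesis
    proof (rule integral_cong_AE)
      show "wderiv (Suc j) f \<in> borel_measurable (lebesgue_on {0<..<x})" "G \<in> borel_measurable (lebesgue_on {0<..<x})"
        using that
        by (auto intro!: measurable_lebesgue_on_subset[OF L2_onD(1)[OF w(2)]] measurable_lebesgue_on_subset[OF L2_onD(1)[OF GL]])
      show "AE y in lebesgue_on {0<..<x}. wderiv (Suc j) f y = G y"
        using ae by (subst AE_restrict_space_iff) auto
    qed
  qed
  have P: "is_primitive 0 1 F G"
    unfolding is_primitive_def F_def using L2_on_integrable[OF GL] eq by auto
  have FL: "F \<in> L2" by (rule L2_on_continuous[OF is_primitive_continuous[OF P]])
  have ae: "AE x in lebesgue_on {0<..<1}. F x = wderiv j f x" using c by (simp add: F_def eq_commute)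
  have N: "l2norm F \<le> sobolev_norm s f" "l2norm G \<le> sobolev_norm s f"
    using l2norm_AE[OF ae L2_onD(1)[OF FL] L2_onD(1)[OF w(1)]] wderiv_l2norm_le[of j s f]
      l2norm_AE[OF G(1) L2_onD(1)[OF GL] L2_onD(1)[OF w(2)]] wderiv_l2norm_le[of "Suc j" s f] j by auto
  \<comment> \<open>No value of F at a point is known beforehand; averaging over y bounds F(0) by
    the norms of F and G. Each is at most the Sobolev norm, hence the factor 2 in the
    statement.\<close>
  have "\<bar>F 0\<bar> \<le> \<bar>F y\<bar> + l2norm G" if "0 < y" "y < 1" for y
    using is_primitive_abs_le[OF P GL, of y 0] that by auto
  then have "ioint 0 1 (\<lambda>y. \<bar>F 0\<bar>) \<le> ioint 0 1 (\<lambda>y. \<bar>F y\<bar> + l2norm G)"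
    using L2_on_integrable[OF L2_on_abs[OF FL]] by (intro ioint_mono) auto
  also have "\<dots> = ioint 0 1 (\<lambda>y. \<bar>F y\<bar>) + l2norm G"
    using L2_on_integrable[OF L2_on_abs[OF FL]] ioint_const[of 0 1 "l2norm G"] by (simp del: integral_const)
  also have "\<dots> \<le> 2 * sobolev_norm s f" using ioint_abs_le_l2norm[OF FL] N by simp
  finally have "\<bar>F 0\<bar> \<le> 2 * sobolev_norm s f" using ioint_const[of 0 1 "\<bar>F 0\<bar>"] by (simp del: integral_const)
  then show ?case unfolding m using ae P G(2) by (intro exI[of _ F]) auto
qed

lemma sobolev_Hbound:
  assumes f: "f \<in> sobolev (Suc s)" and c: "continuous_on {0..1} f"
  shows "Hbound (Suc s) (2 * sobolev_norm (Suc s) f) f"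
proof -
  obtain F where F: "AE x in lebesgue_on {0<..<1}. F x = wderiv 0 f x" "Hbound (Suc s) (2 * sobolev_norm (Suc s) f) F"
    using sobolev_Hbound_AE[OF f, of 0] by auto
  have "AE x in lebesgue_on {0<..<1}. F x = f x"
    using F(1) wderiv_0_AE[OF L2_on_continuous[OF c]] by eventually_elim simp
  then have eq: "\<forall>x\<in>{0..1}. F x = f x"
    by (rule AE_eq_continuous) (use Hbound_continuous[OF F(2)] c in auto)
  obtain F' where F': "is_primitive 0 1 F F'" "Hbound s (2 * sobolev_norm (Suc s) f) F'" using F(2) by auto
  have "is_primitive 0 1 f F'" using F'(1) eq unfolding is_primitive_def by auto
  then show ?thesis using F' F(2) eq by auto
qed

section \<open>Regularity of the exact solution in time\<close>

text \<open>Lebesgue measure is complete, so the limit function may be changed on the exceptional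
  null set.\<close>

lemma borel_measurable_AE_limit:
  fixes f :: "real \<Rightarrow> real"
  assumes g: "\<And>n. g n \<in> borel_measurable (lebesgue_on {a<..<b})"
    and lim: "AE t in lebesgue_on {a<..<b}. (\<lambda>n. g n t) \<longlonglongrightarrow> f t"
  shows "f \<in> borel_measurable (lebesgue_on {a<..<b})"
proof -
  have "(\<lambda>t. lim (\<lambda>n. g n t)) \<in> borel_measurable (lebesgue_on {a<..<b})"
    using g by (intro borel_measurable_lim_metric)
  then have m: "(\<lambda>t. indicator {a<..<b} t * lim (\<lambda>n. g n t)) \<in> borel_measurable lebesgue"
    by (subst (asm) borel_measurable_restrict_space_iff) auto
  have "AE t in lebesgue. t \<in> {a<..<b} \<longrightarrow> (\<lambda>n. g n t) \<longlonglongrightarrow> f t"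
    using lim by (subst (asm) AE_restrict_space_iff) auto
  then have "AE t in lebesgue. indicator {a<..<b} t * lim (\<lambda>n. g n t) = indicator {a<..<b} t * f t"
    by eventually_elim (auto simp: indicator_def limI)
  then have "(\<lambda>t. indicator {a<..<b} t * f t) \<in> borel_measurable lebesgue"
    by (rule borel_measurable_AE[OF m])
  then show ?thesis by (subst borel_measurable_restrict_space_iff) auto
qed

text \<open>The functional \<open>f \<mapsto> (f\<^sup>(\<^sup>j\<^sup>), \<phi>)\<close> on $H^s$, through which Bochner integrals are tested.\<close>

definition pairing :: "nat \<Rightarrow> (real \<Rightarrow> real) \<Rightarrow> (real \<Rightarrow> real) \<Rightarrow> real" where
  "pairing j \<phi> f = ioint 0 1 (\<lambda>x. wderiv j f x * \<phi> x)"

lemma pairing_lincomb: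
  assumes f: "f \<in> sobolev s" and g: "g \<in> sobolev s" and j: "j \<le> s" and \<phi>: "\<phi> \<in> L2"
  shows "pairing j \<phi> (\<lambda>x. a * f x + b * g x) = a * pairing j \<phi> f + b * pairing j \<phi> g"
proof -
  note L = wderiv_L2[OF f j] wderiv_L2[OF g j] wderiv_L2[OF sobolev_lincomb[OF f g] j, of a b]
  have "ioint 0 1 (\<lambda>x. wderiv j (\<lambda>x. a * f x + b * g x) x * \<phi> x)
      = ioint 0 1 (\<lambda>x. a * (wderiv j f x * \<phi> x) + b * (wderiv j g x * \<phi> x))"
  proof (rule integral_cong_AE)
    show "AE x in lebesgue_on {0<..<1}. wderiv j (\<lambda>x. a * f x + b * g x) x * \<phi> x = a * (wderiv j f x * \<phi> x) + b * (wderiv j g x * \<phi> x)"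
      using wderiv_lincomb[OF f g j, of a b] by eventually_elim (simp add: algebra_simps)
  qed (use L2_onD(1)[OF L(1)] L2_onD(1)[OF L(2)] L2_onD(1)[OF L(3)] L2_onD(1)[OF \<phi>] in auto)
  then show ?thesis
    using L2_on_mult_integrable[OF L(1) \<phi>] L2_on_mult_integrable[OF L(2) \<phi>] by (simp add: pairing_def)
qed

lemma zero_sobolev: "(\<lambda>x. 0) \<in> sobolev s"
proof -
  have "(\<lambda>x. 0) \<in> L2" by (rule L2_on_continuous) auto
  then have "is_weak_deriv j (\<lambda>x. 0) (\<lambda>x. 0)" for j by (simp add: is_weak_deriv_def)
  then show ?thesis unfolding sobolev_def by blast
qed

lemma sobolev_diff: "f \<in> sobolev s \<Longrightarrow> g \<in> sobolev s \<Longrightarrow> (\<lambda>x. f x - g x) \<in> sobolev s"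
  using sobolev_lincomb[of f s g 1 "-1"] by simp

lemma pairing_diff:
  "f \<in> sobolev s \<Longrightarrow> g \<in> sobolev s \<Longrightarrow> j \<le> s \<Longrightarrow> \<phi> \<in> L2 \<Longrightarrow>
    pairing j \<phi> (\<lambda>x. f x - g x) = pairing j \<phi> f - pairing j \<phi> g"
  using pairing_lincomb[of f s g j \<phi> 1 "-1"] by simp

lemma pairing_cmult:
  "f \<in> sobolev s \<Longrightarrow> j \<le> s \<Longrightarrow> \<phi> \<in> L2 \<Longrightarrow> pairing j \<phi> (\<lambda>x. c * f x) = c * pairing j \<phi> f"
  using pairing_lincomb[of f s f j \<phi> c 0] by simp

lemma pairing_le:
  assumes "f \<in> sobolev s" "j \<le> s" "\<phi> \<in> L2"
  shows "\<bar>pairing j \<phi> f\<bar> \<le> sobolev_norm s f * l2norm \<phi>"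
  using ioint_le_l2norm[OF wderiv_L2[OF assms(1,2)] assms(3)]
    mult_right_mono[OF wderiv_l2norm_le[OF assms(2), of f] l2norm_nonneg[of \<phi>]]
  by (simp add: pairing_def)

lemma pairing_sum_list:
  assumes "\<forall>(E, w)\<in>set L. w \<in> sobolev s" "j \<le> s" "\<phi> \<in> L2"
  shows "(\<lambda>x. \<Sum>(E, w)\<leftarrow>L. c E * w x) \<in> sobolev s"
    "pairing j \<phi> (\<lambda>x. \<Sum>(E, w)\<leftarrow>L. c E * w x) = (\<Sum>(E, w)\<leftarrow>L. c E * pairing j \<phi> w)"
proof -
  have "(\<lambda>x. \<Sum>(E, w)\<leftarrow>L. c E * w x) \<in> sobolev s \<and>
    pairing j \<phi> (\<lambda>x. \<Sum>(E, w)\<leftarrow>L. c E * w x) = (\<Sum>(E, w)\<leftarrow>L. c E * pairing j \<phi> w)"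
    using assms(1)
  proof (induction L)
    case Nil
    then show ?case using zero_sobolev[of s] pairing_cmult[OF zero_sobolev assms(2,3), of 0] by simp
  next
    case (Cons p L)
    obtain E w where p: "p = (E, w)" by fastforce
    have IH: "(\<lambda>x. \<Sum>(E, w)\<leftarrow>L. c E * w x) \<in> sobolev s"
      "pairing j \<phi> (\<lambda>x. \<Sum>(E, w)\<leftarrow>L. c E * w x) = (\<Sum>(E, w)\<leftarrow>L. c E * pairing j \<phi> w)"
      using Cons by auto
    have w: "w \<in> sobolev s" using Cons.prems p by simp
    show ?case
      using sobolev_lincomb[OF w IH(1), of "c E" 1] pairing_lincomb[OF w IH(1) assms(2,3), of "c E" 1] IH(2)
      by (simp add: p)
  qed
  then show "(\<lambda>x. \<Sum>(E, w)\<leftarrow>L. c E * w x) \<in> sobolev s"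
    "pairing j \<phi> (\<lambda>x. \<Sum>(E, w)\<leftarrow>L. c E * w x) = (\<Sum>(E, w)\<leftarrow>L. c E * pairing j \<phi> w)" by auto
qed

lemma simple_data_pairing:
  assumes L: "L \<in> simple_data T s" and T: "0 < T" and j: "j \<le> s" and \<phi>: "\<phi> \<in> L2"
  shows "simple_fun L t \<in> sobolev s" "simple_int L \<in> sobolev s"
    "integrable (lebesgue_on {0<..<T}) (\<lambda>t. pairing j \<phi> (simple_fun L t))"
    "ioint 0 T (\<lambda>t. pairing j \<phi> (simple_fun L t)) = pairing j \<phi> (simple_int L)"
proof -
  have w: "\<forall>(E, w)\<in>set L. w \<in> sobolev s" and E: "\<forall>(E, w)\<in>set L. E \<in> sets lebesgue \<and> E \<subseteq> {0<..<T}"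
    using L unfolding simple_data_def by auto
  note ps = pairing_sum_list[OF w j \<phi>]
  have f: "simple_fun L t = (\<lambda>x. \<Sum>(E, w)\<leftarrow>L. indicator E t * w x)" for t
    by (simp add: simple_fun_def fun_eq_iff)
  have i: "simple_int L = (\<lambda>x. \<Sum>(E, w)\<leftarrow>L. measure lebesgue E * w x)"
    by (simp add: simple_int_def fun_eq_iff)
  show "simple_fun L t \<in> sobolev s" "simple_int L \<in> sobolev s" unfolding f i by (rule ps(1))+
  have "integrable (lebesgue_on {0<..<T}) (\<lambda>t. \<Sum>(E, w)\<leftarrow>L. indicator E t * pairing j \<phi> w) \<and>
      ioint 0 T (\<lambda>t. \<Sum>(E, w)\<leftarrow>L. indicator E t * pairing j \<phi> w) = (\<Sum>(E, w)\<leftarrow>L. measure lebesgue E * pairing j \<phi> w)"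
    using E
  proof (induction L)
    case (Cons p L)
    obtain E w where p: "p = (E, w)" by fastforce
    have E: "E \<in> sets lebesgue" "E \<subseteq> {0<..<T}" using Cons.prems p by auto
    have s: "E \<in> sets (lebesgue_on {0<..<T})" using E by (auto simp: sets_restrict_space_iff)
    have m: "emeasure (lebesgue_on {0<..<T}) E = emeasure lebesgue E"
      by (rule emeasure_restrict_space) (use E in auto)
    have "emeasure lebesgue E \<le> emeasure lebesgue {0<..<T}" by (rule emeasure_mono) (use E in auto)
    then have fin: "emeasure (lebesgue_on {0<..<T}) E < \<infinity>" using T m by (simp add: le_less_trans)
    have EE: "E \<inter> {0<..<T} = E" using E by auto
    then have iE: "integrable (lebesgue_on {0<..<T}) (indicator E :: real \<Rightarrow> real)"
      using s fin by (simp add: integrable_indicator_iff)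
    have IE: "ioint 0 T (indicator E) = measure lebesgue E"
      using s E by (simp add: EE measure_restrict_space)
    show ?case using Cons iE IE by (simp add: p)
  qed simp
  then show "integrable (lebesgue_on {0<..<T}) (\<lambda>t. pairing j \<phi> (simple_fun L t))"
    "ioint 0 T (\<lambda>t. pairing j \<phi> (simple_fun L t)) = pairing j \<phi> (simple_int L)"
    unfolding f i ps(2) by auto
qed

lemma strongly_measurable_pairing:
  assumes v: "strongly_measurable T s v" and T: "0 < T" and j: "j \<le> s" and \<phi>: "\<phi> \<in> L2"
  shows "(\<lambda>t. pairing j \<phi> (v t)) \<in> borel_measurable (lebesgue_on {0<..<T})"
proof -
  obtain L where L: "\<And>n. L n \<in> simple_data T s"
    and lim: "AE t in lebesgue_on {0<..<T}. (\<lambda>n. sobolev_norm s (\<lambda>x. v t x - simple_fun (L n) t x)) \<longlonglongrightarrow> 0"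
    and vs: "AE t in lebesgue_on {0<..<T}. v t \<in> sobolev s"
    using v unfolding strongly_measurable_def by auto
  note sd = simple_data_pairing[OF L T j \<phi>]
  show ?thesis
  proof (rule borel_measurable_AE_limit)
    show "(\<lambda>t. pairing j \<phi> (simple_fun (L n) t)) \<in> borel_measurable (lebesgue_on {0<..<T})" for n
      using sd(3) by auto
    show "AE t in lebesgue_on {0<..<T}. (\<lambda>n. pairing j \<phi> (simple_fun (L n) t)) \<longlonglongrightarrow> pairing j \<phi> (v t)"
      using lim vs
    proof eventually_elim
      case (elim t)
      have "(\<lambda>n. pairing j \<phi> (v t) - pairing j \<phi> (simple_fun (L n) t)) \<longlonglongrightarrow> 0"
      proof (rule tendsto_0_le[OF elim(1)])
        show "\<forall>\<^sub>F n in sequentially. norm (pairing j \<phi> (v t) - pairing j \<phi> (simple_fun (L n) t)) \<le> norm (sobolev_norm s (\<lambda>x. v t x - simple_fun (L n) t x)) * l2norm \<phi>"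
          using pairing_le[OF sobolev_diff[OF elim(2) sd(1)] j \<phi>] pairing_diff[OF elim(2) sd(1) j \<phi>]
          by (intro always_eventually allI) simp
      qed
      from tendsto_diff[OF tendsto_const[of "pairing j \<phi> (v t)"] this] show ?case by simp
    qed
  qed
qed

text \<open>A bounded functional commutes with the Bochner integral: it does so on simple functions,
  and both sides are continuous along the approximating sequence.\<close>

lemma sobolev_integral_pairing:
  assumes W: "has_sobolev_integral T s v W" and T: "0 < T" and j: "j \<le> s" and \<phi>: "\<phi> \<in> L2"
    and int: "iointegrable 0 T (\<lambda>t. pairing j \<phi> (v t))"
  shows "ioint 0 T (\<lambda>t. pairing j \<phi> (v t)) = pairing j \<phi> W"
proof -
  obtain L where L: "\<And>n. L n \<in> simple_data T s"
    and ii: "\<And>n. iointegrable 0 T (\<lambda>t. sobolev_norm s (\<lambda>x. v t x - simple_fun (L n) t x))"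
    and l1: "(\<lambda>n. ioint 0 T (\<lambda>t. sobolev_norm s (\<lambda>x. v t x - simple_fun (L n) t x))) \<longlonglongrightarrow> 0"
    and l2: "(\<lambda>n. sobolev_norm s (\<lambda>x. simple_int (L n) x - W x)) \<longlonglongrightarrow> 0"
    and vs: "AE t in lebesgue_on {0<..<T}. v t \<in> sobolev s" and Ws: "W \<in> sobolev s"
    using W unfolding has_sobolev_integral_def strongly_measurable_def by auto
  note sd = simple_data_pairing[OF L T j \<phi>]
  have le: "norm (ioint 0 T (\<lambda>t. pairing j \<phi> (v t)) - pairing j \<phi> (simple_int (L n)))
      \<le> norm (ioint 0 T (\<lambda>t. sobolev_norm s (\<lambda>x. v t x - simple_fun (L n) t x))) * l2norm \<phi>" for n
  proof -
    have "norm (ioint 0 T (\<lambda>t. pairing j \<phi> (v t)) - pairing j \<phi> (simple_int (L n)))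
        = norm (ioint 0 T (\<lambda>t. pairing j \<phi> (v t) - pairing j \<phi> (simple_fun (L n) t)))"
      using int sd(3,4) by simp
    also have "\<dots> \<le> ioint 0 T (\<lambda>t. norm (pairing j \<phi> (v t) - pairing j \<phi> (simple_fun (L n) t)))"
      by (rule integral_norm_bound)
    also have "\<dots> \<le> ioint 0 T (\<lambda>t. sobolev_norm s (\<lambda>x. v t x - simple_fun (L n) t x) * l2norm \<phi>)"
    proof (rule integral_mono_AE)
      show "AE t in lebesgue_on {0<..<T}. norm (pairing j \<phi> (v t) - pairing j \<phi> (simple_fun (L n) t)) \<le> sobolev_norm s (\<lambda>x. v t x - simple_fun (L n) t x) * l2norm \<phi>"
        using vs
      proof eventually_elim
        case (elim t)
        show ?case
          using pairing_le[OF sobolev_diff[OF elim sd(1)] j \<phi>] pairing_diff[OF elim sd(1) j \<phi>] by simp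
      qed
    qed (use int sd(3) ii in auto)
    finally show ?thesis using ioint_nonneg[of 0 T "\<lambda>t. sobolev_norm s (\<lambda>x. v t x - simple_fun (L n) t x)"] by simp
  qed
  have "(\<lambda>n. ioint 0 T (\<lambda>t. pairing j \<phi> (v t)) - pairing j \<phi> (simple_int (L n))) \<longlonglongrightarrow> 0"
    by (rule tendsto_0_le[OF l1 always_eventually[OF allI[OF le]]])
  then have 1: "(\<lambda>n. pairing j \<phi> (simple_int (L n))) \<longlonglongrightarrow> ioint 0 T (\<lambda>t. pairing j \<phi> (v t))"
    using tendsto_diff[OF tendsto_const[of "ioint 0 T (\<lambda>t. pairing j \<phi> (v t))"]] by fastforce
  have "(\<lambda>n. pairing j \<phi> (simple_int (L n)) - pairing j \<phi> W) \<longlonglongrightarrow> 0"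
  proof (rule tendsto_0_le[OF l2])
    show "\<forall>\<^sub>F n in sequentially. norm (pairing j \<phi> (simple_int (L n)) - pairing j \<phi> W) \<le> norm (sobolev_norm s (\<lambda>x. simple_int (L n) x - W x)) * l2norm \<phi>"
      using pairing_le[OF sobolev_diff[OF sd(2) Ws] j \<phi>] pairing_diff[OF sd(2) Ws j \<phi>]
      by (intro always_eventually allI) simp
  qed
  then have 2: "(\<lambda>n. pairing j \<phi> (simple_int (L n))) \<longlonglongrightarrow> pairing j \<phi> W" by (simp add: LIM_zero_cancel)
  show ?thesis by (rule LIMSEQ_unique[OF 1 2])
qed

lemma L2_sobolev_norm_integrable:
  assumes "v \<in> L2_sobolev T s"
  shows "iointegrable 0 T (\<lambda>t. sobolev_norm s (v t))"
proof -
  have i: "iointegrable 0 T (\<lambda>t. (sobolev_norm s (v t))\<^sup>2)" using assms by (simp add: L2_sobolev_def)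
  then have "(\<lambda>t. sqrt ((sobolev_norm s (v t))\<^sup>2)) \<in> borel_measurable (lebesgue_on {0<..<T})" by measurable
  then have "(\<lambda>t. sobolev_norm s (v t)) \<in> borel_measurable (lebesgue_on {0<..<T})" by simp
  then show ?thesis using i by (intro L2_on_integrable) (simp add: L2_on_def)
qed

text \<open>Pairing with a fixed function turns the vector-valued weak derivative into a scalar one.
  Du Bois-Reymond then makes the scalar function a primitive for almost every time, and continuity
  of the representative extends this to every time.\<close>

lemma H1_sobolev_pairing:
  assumes H1: "is_H1_sobolev_with_deriv T s u ut" and cr: "continuous_representative T s u"
    and T: "0 < T" and j: "j \<le> s" and \<phi>: "\<phi> \<in> L2"
  shows "iointegrable 0 T (\<lambda>t. pairing j \<phi> (ut t))"
    and "\<And>a b. 0 \<le> a \<Longrightarrow> a \<le> b \<Longrightarrow> b \<le> T \<Longrightarrow>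
      pairing j \<phi> (u b) - pairing j \<phi> (u a) = ioint a b (\<lambda>t. pairing j \<phi> (ut t))"
proof -
  have us: "u t \<in> sobolev s" if "t \<in> {0..T}" for t using cr that by (auto simp: continuous_representative_def)
  have utL: "ut \<in> L2_sobolev T s" using H1 by (simp add: is_H1_sobolev_with_deriv_def)
  then have sm: "strongly_measurable T s ut" by (simp add: L2_sobolev_def)
  have uts: "AE t in lebesgue_on {0<..<T}. ut t \<in> sobolev s" using sm by (simp add: strongly_measurable_def)
  have cont: "continuous_on {0..T} (\<lambda>t. pairing j \<phi> (u t))"
    unfolding continuous_on_def
  proof
    fix t assume t: "t \<in> {0..T}"
    have l: "((\<lambda>t'. sobolev_norm s (\<lambda>x. u t' x - u t x)) \<longlongrightarrow> 0) (at t within {0..T})"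
      using cr t by (auto simp: continuous_representative_def)
    have "((\<lambda>t'. pairing j \<phi> (u t') - pairing j \<phi> (u t)) \<longlongrightarrow> 0) (at t within {0..T})"
    proof (rule tendsto_0_le[OF l])
      show "\<forall>\<^sub>F t' in at t within {0..T}. norm (pairing j \<phi> (u t') - pairing j \<phi> (u t)) \<le> norm (sobolev_norm s (\<lambda>x. u t' x - u t x)) * l2norm \<phi>"
        unfolding eventually_at_topological
        using pairing_le[OF sobolev_diff[OF us us[OF t]] j \<phi>] pairing_diff[OF us us[OF t] j \<phi>]
        by (intro exI[of _ UNIV]) auto
    qed
    then show "((\<lambda>t. pairing j \<phi> (u t)) \<longlongrightarrow> pairing j \<phi> (u t)) (at t within {0..T})" by (simp add: LIM_zero_cancel)
  qed
  show i: "iointegrable 0 T (\<lambda>t. pairing j \<phi> (ut t))"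
  proof (rule Bochner_Integration.integrable_bound)
    show "iointegrable 0 T (\<lambda>t. sobolev_norm s (ut t) * l2norm \<phi>)" using L2_sobolev_norm_integrable[OF utL] by simp
    show "(\<lambda>t. pairing j \<phi> (ut t)) \<in> borel_measurable (lebesgue_on {0<..<T})"
      by (rule strongly_measurable_pairing[OF sm T j \<phi>])
    show "AE t in lebesgue_on {0<..<T}. norm (pairing j \<phi> (ut t)) \<le> norm (sobolev_norm s (ut t) * l2norm \<phi>)"
      using uts by eventually_elim (use pairing_le[OF _ j \<phi>] in auto)
  qed
  have iu: "iointegrable 0 T (\<lambda>t. pairing j \<phi> (u t))" by (rule continuous_iointegrable[OF cont])
  have "ioint 0 T (\<lambda>t. pairing j \<phi> (u t) * deriv \<psi> t) = - ioint 0 T (\<lambda>t. pairing j \<phi> (ut t) * \<psi> t)"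
    if \<psi>: "\<psi> \<in> test_functions 0 T" for \<psi>
  proof -
    obtain W where W: "has_sobolev_integral T s (\<lambda>t x. deriv \<psi> t * u t x) W"
      "has_sobolev_integral T s (\<lambda>t x. \<psi> t * ut t x) (\<lambda>x. - W x)"
      using H1 \<psi> unfolding is_H1_sobolev_with_deriv_def by blast
    have Ws: "W \<in> sobolev s" using W(1) by (simp add: has_sobolev_integral_def)
    have e1: "pairing j \<phi> (\<lambda>x. deriv \<psi> t * u t x) = pairing j \<phi> (u t) * deriv \<psi> t" if "0 < t" "t < T" for t
      using pairing_cmult[OF us j \<phi>, of t] that by simp
    have i1: "iointegrable 0 T (\<lambda>t. pairing j \<phi> (\<lambda>x. deriv \<psi> t * u t x))"
      using test_iointegrable_mult[OF iu test_deriv[OF \<psi>]] iointegrable_cong[OF e1, of 0 T] by simp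
    have I1: "ioint 0 T (\<lambda>t. pairing j \<phi> (u t) * deriv \<psi> t) = pairing j \<phi> W"
      using sobolev_integral_pairing[OF W(1) T j \<phi> i1] ioint_cong[OF e1, of 0 T] by simp
    have e2: "AE t in lebesgue_on {0<..<T}. pairing j \<phi> (ut t) * \<psi> t = pairing j \<phi> (\<lambda>x. \<psi> t * ut t x)"
      using uts by eventually_elim (use pairing_cmult[OF _ j \<phi>] in simp)
    have ip: "iointegrable 0 T (\<lambda>t. pairing j \<phi> (ut t) * \<psi> t)" by (rule test_iointegrable_mult[OF i \<psi>])
    have m2: "(\<lambda>t. pairing j \<phi> (\<lambda>x. \<psi> t * ut t x)) \<in> borel_measurable (lebesgue_on {0<..<T})"
      by (rule strongly_measurable_pairing[OF _ T j \<phi>]) (use W(2) in \<open>simp add: has_sobolev_integral_def\<close>)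
    have i2: "iointegrable 0 T (\<lambda>t. pairing j \<phi> (\<lambda>x. \<psi> t * ut t x))"
      using integrable_cong_AE_imp[OF ip m2] e2 by (simp add: eq_commute)
    have "ioint 0 T (\<lambda>t. pairing j \<phi> (ut t) * \<psi> t) = ioint 0 T (\<lambda>t. pairing j \<phi> (\<lambda>x. \<psi> t * ut t x))"
      by (rule integral_cong_AE[OF _ m2 e2]) (use ip in auto)
    also have "\<dots> = pairing j \<phi> (\<lambda>x. - W x)" by (rule sobolev_integral_pairing[OF W(2) T j \<phi> i2])
    also have "\<dots> = - pairing j \<phi> W" using pairing_cmult[OF Ws j \<phi>, of "-1"] by simp
    finally show ?thesis using I1 by simp
  qed
  then obtain c where c: "AE t in lebesgue_on {0<..<T}. pairing j \<phi> (u t) = c + ioint 0 t (\<lambda>t. pairing j \<phi> (ut t))"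
    using du_Bois_Reymond[OF iu i T] by blast
  have P: "is_primitive 0 T (\<lambda>t. c + ioint 0 t (\<lambda>t. pairing j \<phi> (ut t))) (\<lambda>t. pairing j \<phi> (ut t))"
    by (rule is_primitive_ioint[OF i])
  have eq: "\<forall>t\<in>{0..T}. pairing j \<phi> (u t) = c + ioint 0 t (\<lambda>t. pairing j \<phi> (ut t))"
    by (rule AE_eq_continuous[OF c T cont is_primitive_continuous[OF P]])
  fix a b assume ab: "0 \<le> a" "a \<le> b" "b \<le> T"
  show "pairing j \<phi> (u b) - pairing j \<phi> (u a) = ioint a b (\<lambda>t. pairing j \<phi> (ut t))"
    using is_primitive_integral[OF P ab] eq ab by simp
qed

text \<open>Duality: each derivative of the increment is paired with itself, which turns the square
  of its norm into a time integral bounded by the norm of \<open>ut\<close> times the norm of the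
  increment. The factor s + 1 comes from collecting the orders j \<le> s.\<close>

lemma H1_sobolev_increment:
  assumes H1: "is_H1_sobolev_with_deriv T s u ut" and cr: "continuous_representative T s u"
    and T: "0 < T" and ab: "0 \<le> a" "a \<le> b" "b \<le> T"
  shows "sobolev_norm s (\<lambda>x. u b x - u a x) \<le> (real s + 1) * ioint a b (\<lambda>t. sobolev_norm s (ut t))"
proof (rule sobolev_norm_le)
  fix j assume j: "j \<le> s"
  have us: "u t \<in> sobolev s" if "t \<in> {0..T}" for t using cr that by (auto simp: continuous_representative_def)
  have d: "(\<lambda>x. u b x - u a x) \<in> sobolev s" using ab by (intro sobolev_diff us) auto
  define \<phi> where "\<phi> = wderiv j (\<lambda>x. u b x - u a x)"
  have \<phi>: "\<phi> \<in> L2" unfolding \<phi>_def by (rule wderiv_L2[OF d j])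
  have utL: "ut \<in> L2_sobolev T s" using H1 by (simp add: is_H1_sobolev_with_deriv_def)
  then have uts: "AE t in lebesgue_on {0<..<T}. ut t \<in> sobolev s" by (simp add: L2_sobolev_def strongly_measurable_def)
  have uts': "AE t in lebesgue_on {a<..<b}. ut t \<in> sobolev s"
  proof -
    have "AE t in lebesgue. t \<in> {0<..<T} \<longrightarrow> ut t \<in> sobolev s"
      using uts by (subst (asm) AE_restrict_space_iff) auto
    then have "AE t in lebesgue. t \<in> {a<..<b} \<longrightarrow> ut t \<in> sobolev s"
      by eventually_elim (use ab in auto)
    then show ?thesis by (subst AE_restrict_space_iff) auto
  qed
  have n: "iointegrable a b (\<lambda>t. sobolev_norm s (ut t))"
    by (rule iointegrable_subinterval[OF L2_sobolev_norm_integrable[OF utL]]) (use ab in auto)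
  have "(l2norm \<phi>)\<^sup>2 = ioint 0 1 (\<lambda>x. (\<phi> x)\<^sup>2)" by (rule l2norm_square)
  also have "\<dots> = pairing j \<phi> (\<lambda>x. u b x - u a x)"
    unfolding pairing_def \<phi>_def power2_eq_square ..
  also have "\<dots> = pairing j \<phi> (u b) - pairing j \<phi> (u a)"
    by (rule pairing_diff[OF us us j \<phi>]) (use ab in auto)
  also have "\<dots> = ioint a b (\<lambda>t. pairing j \<phi> (ut t))" by (rule H1_sobolev_pairing(2)[OF H1 cr T j \<phi> ab])
  also have "\<dots> \<le> ioint a b (\<lambda>t. sobolev_norm s (ut t) * l2norm \<phi>)"
  proof (rule integral_mono_AE)
    show "iointegrable a b (\<lambda>t. pairing j \<phi> (ut t))"
      by (rule iointegrable_subinterval[OF H1_sobolev_pairing(1)[OF H1 cr T j \<phi>]]) (use ab in auto)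
    show "AE t in lebesgue_on {a<..<b}. pairing j \<phi> (ut t) \<le> sobolev_norm s (ut t) * l2norm \<phi>"
      using uts' by eventually_elim (use pairing_le[OF _ j \<phi>] abs_le_D1 in blast)
  qed (use n in simp)
  also have "\<dots> = ioint a b (\<lambda>t. sobolev_norm s (ut t)) * l2norm \<phi>" by simp
  finally have "l2norm \<phi> * l2norm \<phi> \<le> ioint a b (\<lambda>t. sobolev_norm s (ut t)) * l2norm \<phi>"
    by (simp add: power2_eq_square)
  moreover have "0 \<le> ioint a b (\<lambda>t. sobolev_norm s (ut t))" by (rule ioint_nonneg) simp
  ultimately show "l2norm (wderiv j (\<lambda>x. u b x - u a x)) \<le> ioint a b (\<lambda>t. sobolev_norm s (ut t))"
    unfolding \<phi>_def[symmetric] using l2norm_nonneg[of \<phi>] mult_right_le_imp_le by (cases "l2norm \<phi> = 0") auto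
qed

section \<open>The exact solution at every single time\<close>

lemma is_primitive_AE_unique:
  assumes "is_primitive a b F f" "is_primitive a b F g"
  shows "AE x in lebesgue_on {a<..<b}. f x = g x"
proof -
  have i: "iointegrable a b f" "iointegrable a b g" using assms is_primitiveD by auto
  have "AE x in lebesgue_on {a<..<b}. f x - g x = 0"
  proof (rule ioint_zero_AE)
    fix t assume t: "a \<le> t" "t \<le> b"
    have "iointegrable a t f" "iointegrable a t g" using iointegrable_subinterval i t by blast+
    then show "ioint a t (\<lambda>x. f x - g x) = 0" using assms t by (simp add: is_primitive_def)
  qed (use i in simp)
  then show ?thesis by simp
qed

lemma Hbound_cong:
  assumes "Hbound (Suc m) B f" "\<And>x. x \<in> {0..1} \<Longrightarrow> f x = g x"
  shows "Hbound (Suc m) B g"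
proof -
  obtain f' where f': "is_primitive 0 1 f f'" "Hbound m B f'" using assms by auto
  have "is_primitive 0 1 g f'" using f'(1) assms(2) unfolding is_primitive_def by auto
  moreover have "\<bar>g 0\<bar> \<le> B" using assms(1) assms(2)[of 0] by auto
  ultimately show ?thesis using f'(2) by auto
qed

text \<open>The derivative hidden in \<open>Hbound\<close> agrees with \<open>g\<close> only almost
  everywhere. This suffices for m = 0; for larger m the values at 0 matter, and continuity makes the
  two functions equal everywhere.\<close>

lemma Hbound_deriv:
  assumes f: "Hbound (Suc m) B f" and g: "is_primitive 0 1 f g" and c: "0 < m \<Longrightarrow> continuous_on {0..1} g"
  shows "Hbound m B g"
proof -
  obtain f' where f': "is_primitive 0 1 f f'" "Hbound m B f'" using f by auto
  have ae: "AE x in lebesgue_on {0<..<1}. f' x = g x" by (rule is_primitive_AE_unique[OF f'(1) g])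
  show ?thesis
  proof (cases m)
    case 0
    have gm: "g \<in> borel_measurable (lebesgue_on {0<..<1})" using is_primitiveD[OF g] by auto
    have f'L: "f' \<in> L2" "l2norm f' \<le> B" using f'(2) 0 by auto
    show ?thesis using L2_on_AE[OF f'L(1) gm ae] l2norm_AE[OF ae L2_onD(1)[OF f'L(1)] gm] f'L(2) 0 by simp
  next
    case (Suc n)
    have "\<forall>x\<in>{0..1}. f' x = g x"
      by (rule AE_eq_continuous[OF ae]) (use f'(2) Suc Hbound_continuous c in auto)
    then show ?thesis using Hbound_cong f'(2) Suc by blast
  qed
qed

text \<open>Difference quotients must converge at every time, whereas \<open>ut\<close> is tied to
  the equation only almost everywhere. Hence \<open>w\<close> is defined by the equation as \<nu>
  u_xx - u u_x; it exists at all times of [0,T] and is continuous in time in L2, which gives the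
  left derivative of \<open>u\<close>. The nondecreasing function \<open>M\<close> measures all
  increments at once.\<close>

lemma burgers_regularity:
  assumes \<nu>: "\<nu> > 0" and T: "T > 0"
    and H1: "is_H1_sobolev_with_deriv T (k + 2) u ut"
    and cr: "continuous_representative T (k + 2) u"
    and sol: "burgers_solution \<nu> T g u ut"
  obtains B M v w where "0 \<le> B"
    "\<And>t. t \<in> {0..T} \<Longrightarrow> Hbound (k + 2) B (u t)"
    "\<And>t. t \<in> {0..T} \<Longrightarrow> u t 0 = 0 \<and> u t 1 = 0"
    "\<And>t. t \<in> {0..T} \<Longrightarrow> is_primitive 0 1 (u t) (v t)"
    "\<And>t. t \<in> {0..T} \<Longrightarrow> Hbound (k + 1) B (v t)"
    "\<And>t. t \<in> {0..T} \<Longrightarrow> is_primitive 0 1 (v t) (\<lambda>y. (w t y + u t y * v t y) / \<nu>)"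
    "\<And>t. t \<in> {0..T} \<Longrightarrow> AE y in lebesgue_on {0<..<1}. wderiv 1 (u t) y = v t y"
    "\<And>t. t \<in> {0..T} \<Longrightarrow> w t \<in> L2"
    "continuous_on {0..T} M"
    "\<And>a b. 0 \<le> a \<Longrightarrow> a \<le> b \<Longrightarrow> b \<le> T \<Longrightarrow> M a \<le> M b"
    "\<And>a b. 0 \<le> a \<Longrightarrow> a \<le> b \<Longrightarrow> b \<le> T \<Longrightarrow> Hbound (k + 2) (M b - M a) (\<lambda>y. u b y - u a y)"
    "\<And>a b. 0 \<le> a \<Longrightarrow> a \<le> b \<Longrightarrow> b \<le> T \<Longrightarrow> Hbound (k + 1) (M b - M a) (\<lambda>y. v b y - v a y)"
    "\<And>b e. 0 < b \<Longrightarrow> b \<le> T \<Longrightarrow> 0 < e \<Longrightarrow> \<forall>\<^sub>F a in at_left b.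
        l2norm (\<lambda>y. u b y - u a y - (b - a) * w b y) \<le> e * (b - a)"
proof -
  let ?s = "k + 2"
  have us: "u t \<in> sobolev ?s" and uc: "continuous_on {0..1} (u t)" if "t \<in> {0..T}" for t
    using cr that by (auto simp: continuous_representative_def)
  have utL: "ut \<in> L2_sobolev T ?s" using H1 by (simp add: is_H1_sobolev_with_deriv_def)
  \<comment> \<open>The factor 2 comes from \<open>sobolev_Hbound\<close>, the factor s + 1 from
    \<open>H1_sobolev_increment\<close>.\<close>
  define c where "c = 2 * (real ?s + 1)"
  define M where "M = (\<lambda>t. c * ioint 0 t (\<lambda>t. sobolev_norm ?s (ut t)))"
  have c0: "0 \<le> c" by (simp add: c_def)
  have nint: "iointegrable 0 T (\<lambda>t. sobolev_norm ?s (ut t))" by (rule L2_sobolev_norm_integrable[OF utL])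
  have Mc: "continuous_on {0..T} M"
    unfolding M_def by (intro continuous_on_mult_left continuous_on_ioint[OF nint])
  have PM: "is_primitive 0 T (\<lambda>t. 0 + ioint 0 t (\<lambda>t. sobolev_norm ?s (ut t))) (\<lambda>t. sobolev_norm ?s (ut t))"
    by (rule is_primitive_ioint[OF nint])
  have MM: "M b - M a = c * ioint a b (\<lambda>t. sobolev_norm ?s (ut t))" if "0 \<le> a" "a \<le> b" "b \<le> T" for a b
    using is_primitive_integral[OF PM that] by (simp add: M_def right_diff_distrib)
  have Mm: "M a \<le> M b" if "0 \<le> a" "a \<le> b" "b \<le> T" for a b
    using MM[OF that] ioint_nonneg[of a b "\<lambda>t. sobolev_norm ?s (ut t)"] mult_nonneg_nonneg[OF c0] by fastforce
  have D2: "Hbound ?s (M b - M a) (\<lambda>y. u b y - u a y)" if "0 \<le> a" "a \<le> b" "b \<le> T" for a b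
  proof -
    have "Hbound (Suc (k + 1)) (2 * sobolev_norm (Suc (k + 1)) (\<lambda>y. u b y - u a y)) (\<lambda>y. u b y - u a y)"
      by (rule sobolev_Hbound) (use us uc that in \<open>auto intro!: sobolev_diff continuous_intros\<close>)
    moreover have "2 * sobolev_norm (Suc (k + 1)) (\<lambda>y. u b y - u a y) \<le> M b - M a"
      using H1_sobolev_increment[OF H1 cr T that] MM[OF that] by (simp add: c_def algebra_simps)
    ultimately have "Hbound (Suc (k + 1)) (M b - M a) (\<lambda>y. u b y - u a y)" by (rule Hbound_mono)
    then show ?thesis by (simp del: Hbound.simps)
  qed
  define B where "B = 2 * sobolev_norm ?s (u 0) + (M T - M 0)"
  have HB: "Hbound ?s B (u t)" if t: "t \<in> {0..T}" for t
  proof -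
    have 0: "Hbound ?s (2 * sobolev_norm ?s (u 0)) (u 0)"
      using sobolev_Hbound[of "u 0" "k + 1"] us[of 0] uc[of 0] T by simp
    have "Hbound ?s (2 * sobolev_norm ?s (u 0) + (M t - M 0)) (\<lambda>y. u 0 y + (u t y - u 0 y))"
      by (rule Hbound_add[OF 0 D2]) (use t in auto)
    then have "Hbound ?s (2 * sobolev_norm ?s (u 0) + (M t - M 0)) (u t)" by simp
    then show ?thesis by (rule Hbound_mono) (use Mm[of t T] t in \<open>simp add: B_def\<close>)
  qed
  have "\<exists>v. is_primitive 0 1 (u t) v \<and> Hbound (k + 1) B v" if "t \<in> {0..T}" for t
    using HB[OF that] by (simp add: numeral_2_eq_2)
  then obtain v where v: "\<And>t. t \<in> {0..T} \<Longrightarrow> is_primitive 0 1 (u t) (v t)"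
    "\<And>t. t \<in> {0..T} \<Longrightarrow> Hbound (k + 1) B (v t)" by metis
  have "\<exists>z. is_primitive 0 1 (v t) z \<and> Hbound k B z" if "t \<in> {0..T}" for t
    using v(2)[OF that] by simp
  then obtain z where z: "\<And>t. t \<in> {0..T} \<Longrightarrow> is_primitive 0 1 (v t) (z t)"
    "\<And>t. t \<in> {0..T} \<Longrightarrow> Hbound k B (z t)" by metis
  have vc: "continuous_on {0..1} (v t)" if "t \<in> {0..T}" for t using is_primitive_continuous[OF z(1)[OF that]] .
  have zL: "z t \<in> L2" if "t \<in> {0..T}" for t using Hbound_l2[OF z(2)[OF that]] by simp
  define w where "w = (\<lambda>t y. \<nu> * z t y - u t y * v t y)"
  have wL: "w t \<in> L2" if "t \<in> {0..T}" for t
    unfolding w_def using that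
    by (intro L2_on_diff L2_on_cmult zL L2_on_continuous continuous_intros uc vc)
  have weq: "(\<lambda>y. (w t y + u t y * v t y) / \<nu>) = z t" for t using \<nu> by (auto simp: w_def)
  have D1: "Hbound (k + 1) (M b - M a) (\<lambda>y. v b y - v a y)" if "0 \<le> a" "a \<le> b" "b \<le> T" for a b
    by (rule Hbound_deriv[of _ _ "\<lambda>y. u b y - u a y"])
       (use D2[OF that] v vc that in \<open>auto intro!: is_primitive_diff continuous_intros\<close>)
  have D0: "Hbound k (M b - M a) (\<lambda>y. z b y - z a y)" if ab: "0 \<le> a" "a \<le> b" "b \<le> T" for a b
  proof (rule Hbound_deriv[of _ _ "\<lambda>y. v b y - v a y"])
    show "Hbound (Suc k) (M b - M a) (\<lambda>y. v b y - v a y)" using D1[OF ab] by simp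
    show "is_primitive 0 1 (\<lambda>y. v b y - v a y) (\<lambda>y. z b y - z a y)" using z ab by (auto intro!: is_primitive_diff)
    assume "0 < k"
    then obtain n where "k = Suc n" by (cases k) auto
    then have "continuous_on {0..1} (z t)" if "t \<in> {0..T}" for t using Hbound_continuous z(2)[OF that] by blast
    then show "continuous_on {0..1} (\<lambda>y. z b y - z a y)" using ab by (auto intro!: continuous_intros)
  qed
  have wd1: "AE y in lebesgue_on {0<..<1}. wderiv 1 (u t) y = v t y" if "t \<in> {0..T}" for t
    by (rule weak_deriv_unique[OF sobolev_wderiv[OF us] is_weak_deriv_primitive[OF v(1)]])
       (use that vc L2_on_continuous in auto)
  have wd2: "AE y in lebesgue_on {0<..<1}. wderiv 2 (u t) y = z t y" if "t \<in> {0..T}" for t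
    by (rule weak_deriv_unique[OF sobolev_wderiv[OF us] is_weak_deriv_primitive2[OF v(1) z(1) zL]])
       (use that in auto)
  have utw: "AE t in lebesgue_on {0<..<T}. AE y in lebesgue_on {0<..<1}. wderiv 0 (ut t) y = w t y"
  proof -
    have 1: "AE t in lebesgue_on {0<..<T}. AE y in lebesgue_on {0<..<1}.
        ut t y + u t y * wderiv 1 (u t) y - \<nu> * wderiv 2 (u t) y = 0"
      using sol by (simp add: burgers_solution_def)
    have 2: "AE t in lebesgue_on {0<..<T}. ut t \<in> sobolev ?s" using utL by (simp add: L2_sobolev_def strongly_measurable_def)
    have 3: "AE t in lebesgue_on {0<..<T}. t \<in> {0..T}" by (rule AE_I2) auto
    show ?thesis using 1 2 3
    proof eventually_elim
      case (elim t)
      have "ut t \<in> L2" using sobolev_wderiv[OF elim(2), of 0] by (simp add: is_weak_deriv_def)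
      from wderiv_0_AE[OF this] elim(1) wd1[OF elim(3)] wd2[OF elim(3)]
      show ?case by eventually_elim (simp add: w_def)
    qed
  qed
  \<comment> \<open>The boundary condition is imposed for t > 0 only; at t = 0 it follows from the
    uniform continuity in time that M expresses.\<close>
  have u0: "u 0 y = 0" if y: "y \<in> {0, 1}" for y
  proof -
    have le: "\<bar>u 0 y\<bar> \<le> (real k + 3) * (M t - M 0)" if "0 < t" "t \<le> T" for t
    proof -
      have "\<bar>u t y - u 0 y\<bar> \<le> (real (k + 1) + 2) * (M t - M 0)"
        by (rule Hbound_sup) (use D2[of 0 t] that y in auto)
      moreover have "u t y = 0" using sol that y by (auto simp: burgers_solution_def)
      ultimately show ?thesis by (simp add: add.commute)
    qed
    have "(M \<longlongrightarrow> M 0) (at 0 within {0..T})" using Mc T by (auto simp: continuous_on_def)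
    then have "(M \<longlongrightarrow> M 0) (at_right 0)" using at_within_Icc_at_right[OF T] by simp
    then have "((\<lambda>t. (real k + 3) * (M t - M 0)) \<longlongrightarrow> (real k + 3) * (M 0 - M 0)) (at_right 0)"
      by (intro tendsto_intros)
    moreover have "\<forall>\<^sub>F t in at_right 0. \<bar>u 0 y\<bar> \<le> (real k + 3) * (M t - M 0)"
      using eventually_at_right_real[OF T] by eventually_elim (use le in auto)
    ultimately have "\<bar>u 0 y\<bar> \<le> (real k + 3) * (M 0 - M 0)"
      by (rule tendsto_lowerbound) simp
    then show ?thesis by simp
  qed
  have bc: "u t 0 = 0 \<and> u t 1 = 0" if "t \<in> {0..T}" for t
    using u0 sol that unfolding burgers_solution_def by (cases "t = 0") auto
  have B0: "0 \<le> B" using Hbound_nonneg[OF HB[of 0]] T by simp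
  have sd: "\<forall>\<^sub>F a in at_left b. l2norm (\<lambda>y. u b y - u a y - (b - a) * w b y) \<le> e * (b - a)"
    if b: "0 < b" "b \<le> T" and e: "0 < e" for b e
  proof -
    \<comment> \<open>A Lipschitz constant of \<open>w\<close> with respect to M: the increment of
      \<nu> u_xx contributes the first summand, and the product u u_x contributes two terms, each a
      bounded function times an increment.\<close>
    define K where "K = \<nu> * (real k + 1) + 2 * ((real k + 3) * B) * (real k + 3)"
    have K0: "0 \<le> K" using \<nu> B0 by (simp add: K_def)
    have s2: "\<bar>f y\<bar> \<le> (real k + 3) * C" if f: "Hbound ?s C f" and y: "0 < y" "y < 1" for f C y
    proof -
      have "Hbound (Suc (k + 1)) C f" using f by simp
      from Hbound_sup[OF this, of y] show ?thesis using y by (simp add: add.commute del: Hbound.simps)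
    qed
    have s1: "\<bar>f y\<bar> \<le> (real k + 3) * C" if f: "Hbound (k + 1) C f" and y: "0 < y" "y < 1" for f C y
    proof -
      have "Hbound (Suc k) C f" using f by simp
      from Hbound_sup[OF this, of y] have "\<bar>f y\<bar> \<le> (real k + 2) * C" using y by (simp add: add.commute del: Hbound.simps)
      also have "\<dots> \<le> (real k + 3) * C" by (intro mult_right_mono Hbound_nonneg[OF f]) simp
      finally show ?thesis .
    qed
    have wd: "l2norm (\<lambda>y. w t y - w b y) \<le> K * (M b - M t)" if t: "0 \<le> t" "t \<le> b" for t
    proof -
      have tT: "t \<in> {0..T}" "b \<in> {0..T}" using t b by auto
      note D = D0[OF t b(2)] D1[OF t b(2)] D2[OF t b(2)]
      have m0: "0 \<le> M b - M t" by (rule Hbound_nonneg[OF D(1)])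
      have eq: "(\<lambda>y. w t y - w b y) = (\<lambda>y. (- \<nu>) * (z b y - z t y) + ((u b y - u t y) * v b y + u t y * (v b y - v t y)))"
        by (auto simp: w_def algebra_simps)
      have 1: "l2norm (\<lambda>y. (- \<nu>) * (z b y - z t y)) \<le> \<nu> * ((real k + 1) * (M b - M t))"
        using Hbound_l2[OF D(1)] \<nu> unfolding l2norm_cmult by simp
      have cc: "continuous_on {0..1} (\<lambda>y. (u b y - u t y) * v b y + u t y * (v b y - v t y))"
        using tT by (intro continuous_intros uc vc)
      have 2: "l2norm (\<lambda>y. (u b y - u t y) * v b y + u t y * (v b y - v t y)) \<le> 2 * ((real k + 3) * B) * ((real k + 3) * (M b - M t))"
      proof (rule l2norm_le_sup(2)[OF continuous_on_measurable_Ioo[OF cc]])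
        fix y :: real assume y: "0 < y" "y < 1"
        have "\<bar>u b y - u t y\<bar> \<le> (real k + 3) * (M b - M t)"
          by (rule s2[OF D(3) y])
        moreover have "\<bar>v b y\<bar> \<le> (real k + 3) * B"
          by (rule s1[OF v(2)[OF tT(2)] y])
        moreover have "\<bar>u t y\<bar> \<le> (real k + 3) * B"
          by (rule s2[OF HB[OF tT(1)] y])
        moreover have "\<bar>v b y - v t y\<bar> \<le> (real k + 3) * (M b - M t)"
          by (rule s1[OF D(2) y])
        ultimately have "\<bar>(u b y - u t y) * v b y\<bar> \<le> ((real k + 3) * (M b - M t)) * ((real k + 3) * B)"
          "\<bar>u t y * (v b y - v t y)\<bar> \<le> ((real k + 3) * B) * ((real k + 3) * (M b - M t))"
          unfolding abs_mult by (intro mult_mono; use m0 B0 in simp)+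
        then show "\<bar>(u b y - u t y) * v b y + u t y * (v b y - v t y)\<bar> \<le> 2 * ((real k + 3) * B) * ((real k + 3) * (M b - M t))"
          by (simp add: algebra_simps)
      qed (use m0 B0 in simp)
      have "l2norm (\<lambda>y. w t y - w b y) \<le> \<nu> * ((real k + 1) * (M b - M t)) + 2 * ((real k + 3) * B) * ((real k + 3) * (M b - M t))"
        unfolding eq
        by (rule order_trans[OF l2norm_triangle[OF L2_on_cmult[OF L2_on_diff[OF zL zL]] L2_on_continuous[OF cc]] add_mono[OF 1 2]])
           (use tT in auto)
      then show ?thesis by (simp add: K_def algebra_simps)
    qed
    have main: "l2norm (\<lambda>y. u b y - u a y - (b - a) * w b y) \<le> (K * (M b - M a)) * (b - a)" if a: "0 \<le> a" "a < b" for a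
    proof -
      \<comment> \<open>The remainder is paired with itself: (u b - u a, R) becomes the time
        integral of (u_t, R), and u_t stays within K (M b - M a) of \<open>w b\<close> on (a,b).
        Continuity of M then makes the remainder o(b - a).\<close>
      define R where "R = (\<lambda>y. u b y - u a y - (b - a) * w b y)"
      have aT: "a \<in> {0..T}" "b \<in> {0..T}" using a b by auto
      have dL: "(\<lambda>y. u b y - u a y) \<in> L2" using aT by (intro L2_on_continuous continuous_intros uc)
      have RL: "R \<in> L2" unfolding R_def by (intro L2_on_diff[OF dL] L2_on_cmult wL aT)
      have ab: "0 \<le> a" "a \<le> b" "b \<le> T" using a b by auto
      have "ioint 0 1 (\<lambda>y. (u b y - u a y) * R y) = pairing 0 R (\<lambda>y. u b y - u a y)"
        unfolding pairing_def
      proof (rule integral_cong_AE)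
        have s: "(\<lambda>y. u b y - u a y) \<in> sobolev ?s" using aT by (intro sobolev_diff us)
        show "AE y in lebesgue_on {0<..<1}. (u b y - u a y) * R y = wderiv 0 (\<lambda>y. u b y - u a y) y * R y"
          using wderiv_0_AE[OF dL] by eventually_elim simp
        show "(\<lambda>y. (u b y - u a y) * R y) \<in> borel_measurable (lebesgue_on {0<..<1})"
          "(\<lambda>y. wderiv 0 (\<lambda>y. u b y - u a y) y * R y) \<in> borel_measurable (lebesgue_on {0<..<1})"
          using L2_onD(1)[OF dL] L2_onD(1)[OF RL] L2_onD(1)[OF wderiv_L2[OF s, of 0]] by auto
      qed
      also have "\<dots> = pairing 0 R (u b) - pairing 0 R (u a)"
        by (rule pairing_diff[OF us us _ RL]) (use aT in auto)
      also have "\<dots> = ioint a b (\<lambda>t. pairing 0 R (ut t))"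
        by (rule H1_sobolev_pairing(2)[OF H1 cr T _ RL ab]) simp
      finally have 1: "ioint 0 1 (\<lambda>y. (u b y - u a y) * R y) = ioint a b (\<lambda>t. pairing 0 R (ut t))" .
      have ip: "iointegrable a b (\<lambda>t. pairing 0 R (ut t))"
        by (rule iointegrable_subinterval[OF H1_sobolev_pairing(1)[OF H1 cr T _ RL]]) (use ab in auto)
      define q where "q = ioint 0 1 (\<lambda>y. w b y * R y)"
      have le: "AE t in lebesgue_on {a<..<b}. norm (pairing 0 R (ut t) - q) \<le> K * (M b - M a) * l2norm R"
      proof -
        have 1: "AE t in lebesgue. t \<in> {0<..<T} \<longrightarrow> (AE y in lebesgue_on {0<..<1}. wderiv 0 (ut t) y = w t y)"
          using utw by (subst (asm) AE_restrict_space_iff) auto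
        have 2: "AE t in lebesgue. t \<in> {0<..<T} \<longrightarrow> ut t \<in> sobolev ?s"
          using utL by (subst AE_restrict_space_iff[symmetric]) (auto simp: L2_sobolev_def strongly_measurable_def)
        from 1 2 have "AE t in lebesgue. t \<in> {a<..<b} \<longrightarrow> norm (pairing 0 R (ut t) - q) \<le> K * (M b - M a) * l2norm R"
        proof eventually_elim
          case (elim t)
          show ?case
          proof
            assume t: "t \<in> {a<..<b}"
            then have tT: "t \<in> {0<..<T}" "t \<in> {0..T}" using ab by auto
            have m: "(\<lambda>y. wderiv 0 (ut t) y * R y) \<in> borel_measurable (lebesgue_on {0<..<1})"
              "(\<lambda>y. w t y * R y) \<in> borel_measurable (lebesgue_on {0<..<1})"
              using L2_onD(1)[OF wderiv_L2[of "ut t" ?s 0]] elim(2) L2_onD(1)[OF RL] L2_onD(1)[OF wL[OF tT(2)]] tT by auto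
            have ae: "AE y in lebesgue_on {0<..<1}. wderiv 0 (ut t) y * R y = w t y * R y"
              using elim(1)[rule_format, OF tT(1)] by eventually_elim simp
            have "pairing 0 R (ut t) = ioint 0 1 (\<lambda>y. w t y * R y)"
              unfolding pairing_def by (rule integral_cong_AE[OF m ae])
            then have "pairing 0 R (ut t) - q = ioint 0 1 (\<lambda>y. (w t y - w b y) * R y)"
              using L2_on_mult_integrable[OF wL[OF tT(2)] RL] L2_on_mult_integrable[OF wL[OF aT(2)] RL]
              by (simp add: q_def left_diff_distrib)
            then have "norm (pairing 0 R (ut t) - q) \<le> l2norm (\<lambda>y. w t y - w b y) * l2norm R"
              using ioint_le_l2norm[OF L2_on_diff[OF wL[OF tT(2)] wL[OF aT(2)]] RL] by simp
            also have "\<dots> \<le> (K * (M b - M t)) * l2norm R"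
              by (rule mult_right_mono[OF wd]) (use t ab in auto)
            also have "\<dots> \<le> (K * (M b - M a)) * l2norm R"
              using Mm[of a t] t ab K0 by (intro mult_right_mono mult_left_mono) auto
            finally show "norm (pairing 0 R (ut t) - q) \<le> K * (M b - M a) * l2norm R" .
          qed
        qed
        then show ?thesis by (subst AE_restrict_space_iff) auto
      qed
      have "(l2norm R)\<^sup>2 = ioint 0 1 (\<lambda>y. (u b y - u a y) * R y - (b - a) * (w b y * R y))"
        unfolding l2norm_square by (rule ioint_cong) (simp add: R_def power2_eq_square algebra_simps)
      also have "\<dots> = ioint a b (\<lambda>t. pairing 0 R (ut t)) - (b - a) * q"
        using L2_on_mult_integrable[OF dL RL] L2_on_mult_integrable[OF wL[OF aT(2)] RL] 1 by (simp add: q_def)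
      also have "\<dots> = ioint a b (\<lambda>t. pairing 0 R (ut t) - q)"
        using ip ab by simp
      also have "\<dots> \<le> ioint a b (\<lambda>t. K * (M b - M a) * l2norm R)"
        by (rule integral_mono_AE) (use ip le in \<open>auto elim!: eventually_mono\<close>)
      also have "\<dots> = K * (M b - M a) * (b - a) * l2norm R" using ab by simp
      finally have "l2norm R * l2norm R \<le> K * (M b - M a) * (b - a) * l2norm R" by (simp add: power2_eq_square)
      moreover have "0 \<le> K * (M b - M a) * (b - a)" using K0 Mm[OF ab] ab by simp
      ultimately have "l2norm R \<le> K * (M b - M a) * (b - a)"
        using l2norm_nonneg[of R] mult_right_le_imp_le by (cases "l2norm R = 0") auto
      then show ?thesis by (simp add: R_def)
    qed
    have "(M \<longlongrightarrow> M b) (at b within {0..T})" using Mc b by (auto simp: continuous_on_def)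
    then have "(M \<longlongrightarrow> M b) (at b within {0..b})" by (rule tendsto_within_subset) (use b in auto)
    then have "(M \<longlongrightarrow> M b) (at_left b)" using at_within_Icc_at_left[OF b(1)] by simp
    then have "((\<lambda>a. K * (M b - M a)) \<longlongrightarrow> K * (M b - M b)) (at_left b)" by (intro tendsto_intros)
    then have "\<forall>\<^sub>F a in at_left b. K * (M b - M a) < e" using e by (auto dest: order_tendstoD(2))
    then show ?thesis using eventually_at_left_real[OF b(1)]
    proof eventually_elim
      case (elim a)
      then have "l2norm (\<lambda>y. u b y - u a y - (b - a) * w b y) \<le> (K * (M b - M a)) * (b - a)"
        by (intro main) auto
      also have "\<dots> \<le> e * (b - a)" using elim by (intro mult_right_mono) auto
      finally show ?case .
    qed
  qed
  show ?thesis
    by (rule that[of B v w M]; (fact B0 Mc | (rule HB bc v wd1 wL Mm D1 D2 sd; assumption) | (unfold weq, rule z, assumption)))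
qed

section \<open>Polynomials on an interval\<close>

text \<open>Degree strictly below n in terms of coefficients: for n = 0 this means the zero
  polynomial, which \<open>degree\<close> cannot express, and inductions may start there.\<close>

definition poly_lt :: "nat \<Rightarrow> real poly \<Rightarrow> bool" where
  "poly_lt n p \<longleftrightarrow> (\<forall>i\<ge>n. coeff p i = 0)"

lemma poly_lt_Suc: "poly_lt (Suc m) p \<longleftrightarrow> degree p \<le> m"
proof
  show "poly_lt (Suc m) p \<Longrightarrow> degree p \<le> m" by (rule degree_le) (auto simp: poly_lt_def)
  show "degree p \<le> m \<Longrightarrow> poly_lt (Suc m) p" by (auto simp: poly_lt_def intro: coeff_eq_0)
qed

lemma poly_lt_degree: "poly_lt n p \<Longrightarrow> n \<le> Suc m \<Longrightarrow> degree p \<le> m"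
  unfolding poly_lt_Suc[symmetric] by (auto simp: poly_lt_def)

lemma poly_antiderivative:
  assumes "poly_lt n p"
  obtains P where "pderiv P = p" "poly_lt (Suc n) P"
proof
  define P where "P = (\<Sum>i<n. monom (coeff p i / (real i + 1)) (Suc i))"
  show "poly_lt (Suc n) P"
    by (auto simp: P_def poly_lt_def coeff_sum intro!: sum.neutral)
  have "coeff P (Suc i) = (if i < n then coeff p i / (real i + 1) else 0)" for i
    by (simp add: P_def coeff_sum)
  then have "coeff (pderiv P) i = coeff p i" for i
    using assms by (cases "i < n") (auto simp: coeff_pderiv poly_lt_def add.commute)
  then show "pderiv P = p" by (rule poly_eqI)
qed

lemma poly_L2 [simp, intro]: "poly p \<in> L2_on {a<..<b}"
  by (rule L2_on_continuous) (intro continuous_intros)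

lemma poly_iointegrable [simp, intro]: "iointegrable a b (\<lambda>y. poly p y * poly q y)"
  by (rule continuous_iointegrable) (intro continuous_intros)

lemma poly_ioint_pos:
  assumes "a < b" "p \<noteq> 0"
  shows "0 < ioint a b (\<lambda>y. poly p y * poly p y)"
proof (rule ccontr)
  assume "\<not> ?thesis"
  moreover have "0 \<le> ioint a b (\<lambda>y. poly p y * poly p y)" by (rule ioint_nonneg) simp
  ultimately have "ioint a b (\<lambda>y. poly p y * poly p y) = 0" by simp
  then have "AE y in lebesgue_on {a<..<b}. poly p y * poly p y = 0"
    using integral_nonneg_eq_0_iff_AE[of "lebesgue_on {a<..<b}" "\<lambda>y. poly p y * poly p y"] by simp
  then have "AE y in lebesgue_on {a<..<b}. poly p y = poly 0 y" by simp
  then have "\<forall>y\<in>{a..b}. poly p y = poly 0 y"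
    by (rule AE_eq_continuous) (use assms in \<open>auto intro: continuous_intros\<close>)
  then have "{a..b} \<subseteq> {y. poly p y = 0}" by auto
  then have "finite {a..b}" using poly_roots_finite[OF assms(2)] finite_subset by blast
  then show False using assms(1) by (simp add: infinite_Icc)
qed

lemma poly_ioint_lincomb:
  "ioint a b (\<lambda>y. poly (p + smult c q) y * poly r y)
    = ioint a b (\<lambda>y. poly p y * poly r y) + c * ioint a b (\<lambda>y. poly q y * poly r y)"
  by (simp add: distrib_right mult.assoc)

lemma poly_split:
  assumes "poly_lt (Suc n) e" "coeff e n = 1" "poly_lt (Suc n) q"
  shows "poly_lt n (q - smult (coeff q n) e)"
  unfolding poly_lt_def
proof (intro allI impI)
  fix i assume "n \<le> i"
  then consider "i = n" | "Suc n \<le> i" by linarith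
  then show "coeff (q - smult (coeff q n) e) i = 0"
    using assms by cases (auto simp: poly_lt_def)
qed

text \<open>Gram-Schmidt by induction on n: \<open>e\<close> is the monomial of degree n minus its
  projection to lower degrees, and orthogonality forces the coefficient of \<open>e\<close> in the
  representing polynomial to be l(e)/(e,e).\<close>

lemma poly_riesz:
  assumes ab: "a < b"
    and l: "\<And>p q. l (p + q) = l p + l q" "\<And>c p. l (smult c p) = c * l p"
  shows "\<exists>d. poly_lt n d \<and> (\<forall>q. poly_lt n q \<longrightarrow> ioint a b (\<lambda>y. poly d y * poly q y) = l q)"
  using l
proof (induction n arbitrary: l)
  case 0
  have "l 0 = 0" using 0(2)[of 0 0] by simp
  moreover have "q = 0" if "poly_lt 0 q" for q using that by (auto simp: poly_lt_def intro: poly_eqI)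
  ultimately show ?case by (intro exI[of _ 0]) (auto simp: poly_lt_def)
next
  case (Suc n)
  obtain \<pi> where \<pi>: "poly_lt n \<pi>"
    "\<And>q. poly_lt n q \<Longrightarrow> ioint a b (\<lambda>y. poly \<pi> y * poly q y) = ioint a b (\<lambda>y. poly (monom 1 n) y * poly q y)"
    using Suc.IH[of "\<lambda>q. ioint a b (\<lambda>y. poly (monom 1 n) y * poly q y)"] by (auto simp: distrib_left mult.left_commute)
  define e where "e = monom 1 n + smult (-1) \<pi>"
  have e: "poly_lt (Suc n) e" "coeff e n = 1" using \<pi>(1) by (auto simp: e_def poly_lt_def)
  have orth: "ioint a b (\<lambda>y. poly e y * poly q y) = 0" if "poly_lt n q" for q
    unfolding e_def poly_ioint_lincomb using \<pi>(2)[OF that] by simp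
  have "e \<noteq> 0" using e(2) by auto
  note pos = poly_ioint_pos[OF ab this]
  obtain d where d: "poly_lt n d" "\<And>q. poly_lt n q \<Longrightarrow> ioint a b (\<lambda>y. poly d y * poly q y) = l q"
    using Suc.IH[OF Suc.prems] by blast
  define c where "c = l e / ioint a b (\<lambda>y. poly e y * poly e y)"
  have "ioint a b (\<lambda>y. poly (d + smult c e) y * poly q y) = l q" if q: "poly_lt (Suc n) q" for q
  proof -
    define q' where "q' = q - smult (coeff q n) e"
    have q': "poly_lt n q'" unfolding q'_def by (rule poly_split[OF e q])
    have qe: "q = q' + smult (coeff q n) e" by (simp add: q'_def)
    have sw: "ioint a b (\<lambda>y. poly r y * poly q y) = ioint a b (\<lambda>y. poly r y * poly q' y) + coeff q n * ioint a b (\<lambda>y. poly e y * poly r y)" for r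
    proof -
      have "ioint a b (\<lambda>y. poly r y * poly q y) = ioint a b (\<lambda>y. poly (q' + smult (coeff q n) e) y * poly r y)"
        by (simp only: qe[symmetric] mult.commute)
      then show ?thesis unfolding poly_ioint_lincomb by (simp only: mult.commute)
    qed
    have ed: "ioint a b (\<lambda>y. poly e y * poly d y) = 0" by (rule orth[OF d(1)])
    have "l q = l q' + coeff q n * l e" by (subst qe) (simp only: Suc.prems)
    then show ?thesis
      unfolding poly_ioint_lincomb sw ed d(2)[OF q'] orth[OF q'] using pos by (simp add: c_def)
  qed
  moreover have "poly_lt (Suc n) (d + smult c e)" using d(1) e(1) by (auto simp: poly_lt_def)
  ultimately show ?case by blast
qed

text \<open>This gives meaning to the definite descriptions by which \<open>weak_derivative\<close>
  and \<open>L2_projection\<close> are defined.\<close>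

lemma poly_riesz_ex1:
  assumes ab: "a < b"
    and l: "\<And>p q. l (p + q) = l p + l q" "\<And>c p. l (smult c p) = c * l p"
  shows "\<exists>!d. degree d \<le> m \<and> (\<forall>q. degree q \<le> m \<longrightarrow> ioint a b (\<lambda>y. poly d y * poly q y) = l q)"
proof -
  obtain d where d: "degree d \<le> m" "\<And>q. degree q \<le> m \<Longrightarrow> ioint a b (\<lambda>y. poly d y * poly q y) = l q"
    using poly_riesz[of a b l "Suc m", OF ab l] unfolding poly_lt_Suc by blast
  show ?thesis
  proof (rule ex1I[of _ d])
    show "degree d \<le> m \<and> (\<forall>q. degree q \<le> m \<longrightarrow> ioint a b (\<lambda>y. poly d y * poly q y) = l q)" using d by blast
    fix d' assume "degree d' \<le> m \<and> (\<forall>q. degree q \<le> m \<longrightarrow> ioint a b (\<lambda>y. poly d' y * poly q y) = l q)"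
    then have d': "degree d' \<le> m" "\<And>q. degree q \<le> m \<Longrightarrow> ioint a b (\<lambda>y. poly d' y * poly q y) = l q" by auto
    show "d' = d"
    proof (rule ccontr)
      assume "d' \<noteq> d"
      then have ne: "d' + smult (-1) d \<noteq> 0" by simp
      have "degree (d' + smult (-1) d) \<le> m" using d(1) d'(1) by (intro degree_add_le) auto
      moreover have "ioint a b (\<lambda>y. poly (d' + smult (-1) d) y * poly q y) = 0" if "degree q \<le> m" for q
        unfolding poly_ioint_lincomb using d(2)[OF that] d'(2)[OF that] by simp
      ultimately have "ioint a b (\<lambda>y. poly (d' + smult (-1) d) y * poly (d' + smult (-1) d) y) = 0" by blast
      then show False using poly_ioint_pos[OF ab ne] by simp
    qed
  qed
qed

text \<open>Linear maps on a finite-dimensional space are bounded. The orthogonal splitting p = q +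
  c e makes both parts at most as large as p, so the constant grows by the bound of l(e). It depends
  on the interval without control; with the identity on (0,1) it can still be rescaled.\<close>

lemma poly_linear_map_sup_le:
  assumes ab: "a < b"
    and l: "\<And>p q. l (p + q) = l p + l q" "\<And>c p. l (smult c p) = smult c (l p)"
  shows "\<exists>C\<ge>0. \<forall>p. poly_lt n p \<longrightarrow> (\<forall>y\<in>{a..b}. \<bar>poly (l p) y\<bar> \<le> C * sqrt (ioint a b (\<lambda>y. poly p y * poly p y)))"
proof (induction n)
  case 0
  have z: "p = 0" if "poly_lt 0 p" for p using that by (auto simp: poly_lt_def intro: poly_eqI)
  have "l 0 = 0" using l(2)[of 0 0] by simp
  then show ?case by (intro exI[of _ 0]) (auto dest!: z)
next
  case (Suc n)
  then obtain C where C: "0 \<le> C" "\<And>p y. poly_lt n p \<Longrightarrow> y \<in> {a..b} \<Longrightarrow> \<bar>poly (l p) y\<bar> \<le> C * sqrt (ioint a b (\<lambda>y. poly p y * poly p y))"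
    by blast
  obtain \<pi> where \<pi>: "poly_lt n \<pi>"
    "\<And>q. poly_lt n q \<Longrightarrow> ioint a b (\<lambda>y. poly \<pi> y * poly q y) = ioint a b (\<lambda>y. poly (monom 1 n) y * poly q y)"
    using poly_riesz[OF ab, of "\<lambda>q. ioint a b (\<lambda>y. poly (monom 1 n) y * poly q y)" n] by (auto simp: distrib_left mult.left_commute)
  define e where "e = monom 1 n + smult (-1) \<pi>"
  have e: "poly_lt (Suc n) e" "coeff e n = 1" using \<pi>(1) by (auto simp: e_def poly_lt_def)
  have orth: "ioint a b (\<lambda>y. poly e y * poly q y) = 0" if "poly_lt n q" for q
    unfolding e_def poly_ioint_lincomb using \<pi>(2)[OF that] by simp
  have "e \<noteq> 0" using e(2) by auto
  note pos = poly_ioint_pos[OF ab this]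
  define E where "E = sqrt (ioint a b (\<lambda>y. poly e y * poly e y))"
  have E: "0 < E" using pos by (simp add: E_def)
  obtain S where S: "\<And>y. y \<in> {a..b} \<Longrightarrow> \<bar>poly (l e) y\<bar> \<le> S" "0 \<le> S"
  proof -
    have "continuous_on {a..b} (poly (l e))" by (intro continuous_intros)
    then show ?thesis using bounded_on_Icc that by blast
  qed
  have "\<bar>poly (l p) y\<bar> \<le> (S / E + C) * sqrt (ioint a b (\<lambda>y. poly p y * poly p y))" if p: "poly_lt (Suc n) p" and y: "y \<in> {a..b}" for p y
  proof -
    define q where "q = p - smult (coeff p n) e"
    define c where "c = coeff p n"
    have q: "poly_lt n q" unfolding q_def by (rule poly_split[OF e p])
    have pe: "p = q + smult c e" by (simp add: q_def c_def)
    have "ioint a b (\<lambda>y. poly p y * poly p y) = ioint a b (\<lambda>y. poly q y * poly q y + (2 * c) * (poly e y * poly q y) + c\<^sup>2 * (poly e y * poly e y))"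
      by (rule ioint_cong) (simp add: pe power2_eq_square algebra_simps)
    also have "\<dots> = ioint a b (\<lambda>y. poly q y * poly q y) + c\<^sup>2 * ioint a b (\<lambda>y. poly e y * poly e y)"
      using orth[OF q] by simp
    finally have eq: "ioint a b (\<lambda>y. poly p y * poly p y) = ioint a b (\<lambda>y. poly q y * poly q y) + c\<^sup>2 * ioint a b (\<lambda>y. poly e y * poly e y)" .
    have nn: "0 \<le> ioint a b (\<lambda>y. poly q y * poly q y)" by (rule ioint_nonneg) simp
    have 1: "sqrt (ioint a b (\<lambda>y. poly q y * poly q y)) \<le> sqrt (ioint a b (\<lambda>y. poly p y * poly p y))"
      unfolding eq using pos by (intro real_sqrt_le_mono) simp
    have "sqrt (c\<^sup>2 * ioint a b (\<lambda>y. poly e y * poly e y)) \<le> sqrt (ioint a b (\<lambda>y. poly p y * poly p y))"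
      unfolding eq using nn by (intro real_sqrt_le_mono) simp
    then have 2: "\<bar>c\<bar> * E \<le> sqrt (ioint a b (\<lambda>y. poly p y * poly p y))" by (simp add: real_sqrt_mult E_def)
    have "\<bar>poly (l p) y\<bar> \<le> \<bar>poly (l q) y\<bar> + \<bar>c\<bar> * \<bar>poly (l e) y\<bar>" unfolding pe l by (simp add: abs_mult[symmetric] abs_triangle_ineq)
    also have "\<dots> \<le> C * sqrt (ioint a b (\<lambda>y. poly q y * poly q y)) + \<bar>c\<bar> * S"
      by (intro add_mono C(2) q y mult_left_mono S) simp
    also have "\<bar>c\<bar> * S = (S / E) * (\<bar>c\<bar> * E)" using E by simp
    also have "C * sqrt (ioint a b (\<lambda>y. poly q y * poly q y)) + (S / E) * (\<bar>c\<bar> * E) \<le> C * sqrt (ioint a b (\<lambda>y. poly p y * poly p y)) + (S / E) * sqrt (ioint a b (\<lambda>y. poly p y * poly p y))"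
      by (intro add_mono mult_left_mono 1 2) (use C(1) S(2) E in auto)
    finally show ?thesis by (simp add: algebra_simps)
  qed
  then show ?case using C(1) S(2) E by (intro exI[of _ "S / E + C"]) auto
qed

lemma ioint_affine:
  fixes a b :: real
  assumes ab: "a < b" and f: "continuous_on {a..b} f"
  shows "ioint 0 1 (\<lambda>\<xi>. f (a + (b - a) * \<xi>)) = ioint a b f / (b - a)"
proof -
  have c: "continuous_on {0..1} (\<lambda>\<xi>. f (a + (b - a) * \<xi>))"
  proof (rule continuous_on_compose2[OF f])
    show "(\<lambda>\<xi>. a + (b - a) * \<xi>) ` {0..1} \<subseteq> {a..b}"
    proof clarsimp
      fix \<xi> :: real assume "0 \<le> \<xi>" "\<xi> \<le> 1"
      then have "(b - a) * \<xi> \<le> (b - a) * 1" using ab by (intro mult_left_mono) auto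
      then have "a + (b - a) * \<xi> \<le> a + (b - a) * 1" by (rule add_left_mono)
      also have "a + (b - a) * 1 = b" by simp
      finally have "a + (b - a) * \<xi> \<le> b" .
      then show "0 \<le> (b - a) * \<xi> \<and> a + (b - a) * \<xi> \<le> b" using ab \<open>0 \<le> \<xi>\<close> by simp
    qed
  qed (intro continuous_intros)
  have "(f has_integral ioint a b f) (cbox a b)"
    using ioint_eq_integral[OF continuous_iointegrable[OF f]] by (simp add: has_integral_integral)
  from has_integral_affinity[OF this, of "b - a" a]
  have h: "((\<lambda>\<xi>. f ((b - a) * \<xi> + a)) has_integral (ioint a b f / (b - a))) ((\<lambda>x. (1 / (b - a)) * x + - (a / (b - a))) ` {a..b})"
    using ab by (simp add: field_simps)
  have im: "(\<lambda>x. (1 / (b - a)) * x + - (a / (b - a))) ` {a..b} = {0..1}"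
    using ab by (subst image_affinity_atLeastAtMost) (auto simp: diff_divide_distrib[symmetric])
  have "integral {0..1} (\<lambda>\<xi>. f (a + (b - a) * \<xi>)) = ioint a b f / (b - a)"
    using h unfolding im by (simp add: integral_unique add.commute)
  then show ?thesis using ioint_eq_integral(1)[OF continuous_iointegrable[OF c]] by simp
qed

text \<open>Transport to the unit interval frees K of the interval and leaves the factor 1 / sqrt(b
  - a). Taking the maximum with 1 is a mere normalisation.\<close>

lemma poly_inverse_estimate:
  obtains K where "1 \<le> K"
    "\<And>a b (p :: real poly) y. a < b \<Longrightarrow> degree p \<le> m \<Longrightarrow> y \<in> {a..b} \<Longrightarrow>
      \<bar>poly p y\<bar> \<le> K / sqrt (b - a) * sqrt (ioint a b (\<lambda>y. (poly p y)\<^sup>2))"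
proof -
  obtain C where C: "0 \<le> C" "\<And>p y. poly_lt (Suc m) p \<Longrightarrow> y \<in> {0..1} \<Longrightarrow> \<bar>poly p y\<bar> \<le> C * sqrt (ioint 0 1 (\<lambda>y. poly p y * poly p y))"
    using poly_linear_map_sup_le[of 0 1 "\<lambda>p. p" "Suc m"] by auto
  show ?thesis
  proof (rule that[of "max 1 C"])
    fix a b y :: real and p :: "real poly" assume ab: "a < b" and p: "degree p \<le> m" and y: "y \<in> {a..b}"
    define q where "q = pcompose p [:a, b - a:]"
    have q: "poly q \<xi> = poly p (a + (b - a) * \<xi>)" for \<xi> by (simp add: q_def poly_pcompose mult.commute)
    have "degree [:a, b - a:] = 1" using ab by simp
    then have "degree q \<le> m" unfolding q_def degree_pcompose using p by simp
    then have "\<bar>poly q ((y - a) / (b - a))\<bar> \<le> C * sqrt (ioint 0 1 (\<lambda>y. poly q y * poly q y))"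
      using ab y by (intro C(2)) (auto simp: poly_lt_Suc)
    moreover have "poly q ((y - a) / (b - a)) = poly p y" unfolding q using ab by simp
    moreover have "ioint 0 1 (\<lambda>y. poly q y * poly q y) = ioint a b (\<lambda>y. (poly p y)\<^sup>2) / (b - a)"
      unfolding q power2_eq_square by (rule ioint_affine[OF ab]) (intro continuous_intros)
    ultimately have "\<bar>poly p y\<bar> \<le> C * (sqrt (ioint a b (\<lambda>y. (poly p y)\<^sup>2)) / sqrt (b - a))"
      by (simp add: real_sqrt_divide)
    also have "\<dots> \<le> max 1 C * (sqrt (ioint a b (\<lambda>y. (poly p y)\<^sup>2)) / sqrt (b - a))"
      using ab by (intro mult_right_mono) (auto intro!: ioint_nonneg)
    finally show "\<bar>poly p y\<bar> \<le> max 1 C / sqrt (b - a) * sqrt (ioint a b (\<lambda>y. (poly p y)\<^sup>2))" by simp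
  qed simp
qed

section \<open>Characterisation of projections and discrete derivatives, and polynomial
  approximation\<close>

lemma L2_projection_spec:
  assumes "x i < x (i + 1)" and f: "f \<in> L2_on (element x i)"
  shows "degree (L2_projection m x f i) \<le> m"
    and "degree q \<le> m \<Longrightarrow> ioint (x i) (x (i + 1)) (\<lambda>y. (f y - poly (L2_projection m x f i) y) * poly q y) = 0"
proof -
  have fi: "iointegrable (x i) (x (i + 1)) (\<lambda>y. f y * poly q y)" for q by (rule L2_on_mult_integrable[OF f]) simp
  have eq: "ioint (x i) (x (i + 1)) (\<lambda>y. (f y - poly p y) * poly q y) = 0 \<longleftrightarrow>
      ioint (x i) (x (i + 1)) (\<lambda>y. poly p y * poly q y) = ioint (x i) (x (i + 1)) (\<lambda>y. f y * poly q y)" for p q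
    using fi[of q] by (auto simp: left_diff_distrib)
  have "\<exists>!p. degree p \<le> m \<and> (\<forall>q. degree q \<le> m \<longrightarrow> ioint (x i) (x (i + 1)) (\<lambda>y. (f y - poly p y) * poly q y) = 0)"
    unfolding eq
  proof (rule poly_riesz_ex1[OF assms(1)])
    show "ioint (x i) (x (i + 1)) (\<lambda>y. f y * poly (p + q) y) = ioint (x i) (x (i + 1)) (\<lambda>y. f y * poly p y) + ioint (x i) (x (i + 1)) (\<lambda>y. f y * poly q y)" for p q
      using fi[of p] fi[of q] by (simp add: distrib_left)
    show "ioint (x i) (x (i + 1)) (\<lambda>y. f y * poly (smult c p) y) = c * ioint (x i) (x (i + 1)) (\<lambda>y. f y * poly p y)" for c p
      using fi[of p] by (simp add: mult.left_commute)
  qed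
  from theI'[OF this] show "degree (L2_projection m x f i) \<le> m"
    "degree q \<le> m \<Longrightarrow> ioint (x i) (x (i + 1)) (\<lambda>y. (f y - poly (L2_projection m x f i) y) * poly q y) = 0"
    unfolding L2_projection_def by auto
qed

lemma weak_derivative_spec:
  assumes "x i < x (i + 1)"
  shows "degree (weak_derivative r x v i) \<le> r"
    and "degree q \<le> r \<Longrightarrow> ioint (x i) (x (i + 1)) (\<lambda>y. poly (weak_derivative r x v i) y * poly q y) =
      - ioint (x i) (x (i + 1)) (\<lambda>y. poly (interior_part v i) y * poly (pderiv q) y)
      + nodal_value v (i + 1) * poly q (x (i + 1)) - nodal_value v i * poly q (x i)"
proof -
  have "\<exists>!d. degree d \<le> r \<and> (\<forall>q. degree q \<le> r \<longrightarrow> ioint (x i) (x (i + 1)) (\<lambda>y. poly d y * poly q y) =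
      - ioint (x i) (x (i + 1)) (\<lambda>y. poly (interior_part v i) y * poly (pderiv q) y)
      + nodal_value v (i + 1) * poly q (x (i + 1)) - nodal_value v i * poly q (x i))"
    by (rule poly_riesz_ex1[OF assms(1)])
       (simp_all add: pderiv_add pderiv_smult distrib_left right_diff_distrib mult.left_commute)
  from theI'[OF this] show "degree (weak_derivative r x v i) \<le> r"
    "degree q \<le> r \<Longrightarrow> ioint (x i) (x (i + 1)) (\<lambda>y. poly (weak_derivative r x v i) y * poly q y) =
      - ioint (x i) (x (i + 1)) (\<lambda>y. poly (interior_part v i) y * poly (pderiv q) y)
      + nodal_value v (i + 1) * poly q (x (i + 1)) - nodal_value v i * poly q (x i)"
    unfolding weak_derivative_def by auto
qed

text \<open>The constants of the Taylor estimate are $1$: each integration gains a factor \<open>b - a\<close>.\<close>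

lemma ioint_square_primitive_le:
  assumes P: "is_primitive a b f f'" and 0: "f a = 0" and ab: "a \<le> b" and f': "f' \<in> L2_on {a<..<b}"
  shows "\<And>y. y \<in> {a..b} \<Longrightarrow> \<bar>f y\<bar> \<le> sqrt (b - a) * sqrt (ioint a b (\<lambda>y. (f' y)\<^sup>2))"
    and "sqrt (ioint a b (\<lambda>y. (f y)\<^sup>2)) \<le> (b - a) * sqrt (ioint a b (\<lambda>y. (f' y)\<^sup>2))"
proof -
  have "ioint a y f' = f y" if "y \<in> {a..b}" for y using P that 0 by (auto simp: is_primitive_def)
  moreover have "\<bar>ioint a y f'\<bar> \<le> ioint a b (\<lambda>y. \<bar>f' y\<bar>)" if "y \<in> {a..b}" for y
    by (rule order_trans[OF abs_ioint_le ioint_mono_interval]) (use that L2_on_integrable[OF f'] in auto)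
  ultimately show le: "\<bar>f y\<bar> \<le> sqrt (b - a) * sqrt (ioint a b (\<lambda>y. (f' y)\<^sup>2))" if "y \<in> {a..b}" for y
    using ioint_abs_le_L2[OF f' ab] that by force
  have nn: "0 \<le> ioint a b (\<lambda>y. (f' y)\<^sup>2)" by (rule ioint_nonneg) simp
  have "(f y)\<^sup>2 \<le> (b - a) * ioint a b (\<lambda>y. (f' y)\<^sup>2)" if "a < y" "y < b" for y
    using power_mono[OF le, of y 2] that ab nn by (simp add: power_mult_distrib)
  moreover have "iointegrable a b (\<lambda>y. (f y)\<^sup>2)"
    by (rule continuous_iointegrable[OF continuous_on_power[OF is_primitive_continuous[OF P]]])
  ultimately have "ioint a b (\<lambda>y. (f y)\<^sup>2) \<le> ioint a b (\<lambda>y. (b - a) * ioint a b (\<lambda>y. (f' y)\<^sup>2))"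
    by (intro ioint_mono) auto
  also have "\<dots> = (b - a)\<^sup>2 * ioint a b (\<lambda>y. (f' y)\<^sup>2)" using ab by (simp add: power2_eq_square)
  finally have "sqrt (ioint a b (\<lambda>y. (f y)\<^sup>2)) \<le> sqrt ((b - a)\<^sup>2 * ioint a b (\<lambda>y. (f' y)\<^sup>2))" by (rule real_sqrt_le_mono)
  then show "sqrt (ioint a b (\<lambda>y. (f y)\<^sup>2)) \<le> (b - a) * sqrt (ioint a b (\<lambda>y. (f' y)\<^sup>2))"
    using ab by (simp add: real_sqrt_mult)
qed

text \<open>The approximation of f' is integrated and matched with f at the left end of the
  interval. The function g, in effect the derivative of order m, is the same for all intervals, so
  that bounds on the elements can be added up.\<close>

lemma Hbound_taylor:
  assumes "Hbound m B f"
  obtains g where "g \<in> L2" "l2norm g \<le> B"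
    "\<And>a b. 0 \<le> a \<Longrightarrow> a < b \<Longrightarrow> b \<le> 1 \<Longrightarrow> \<exists>p. poly_lt m p \<and>
      sqrt (ioint a b (\<lambda>y. (f y - poly p y)\<^sup>2)) \<le> (b - a) ^ m * sqrt (ioint a b (\<lambda>y. (g y)\<^sup>2))"
proof -
  have "\<exists>g\<in>L2. l2norm g \<le> B \<and> (\<forall>a b. 0 \<le> a \<longrightarrow> a < b \<longrightarrow> b \<le> 1 \<longrightarrow> (\<exists>p. poly_lt m p \<and>
      sqrt (ioint a b (\<lambda>y. (f y - poly p y)\<^sup>2)) \<le> (b - a) ^ m * sqrt (ioint a b (\<lambda>y. (g y)\<^sup>2))))"
    using assms
  proof (induction m arbitrary: f)
    case 0
    have "poly_lt 0 0" by (simp add: poly_lt_def)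
    then show ?case using 0 by (intro bexI[of _ f] conjI allI impI exI[of _ 0]) auto
  next
    case (Suc m)
    obtain f' where f': "is_primitive 0 1 f f'" "Hbound m B f'" using Suc.prems by auto
    obtain g where g: "g \<in> L2" "l2norm g \<le> B" "\<And>a b. 0 \<le> a \<Longrightarrow> a < b \<Longrightarrow> b \<le> 1 \<Longrightarrow> \<exists>p. poly_lt m p \<and>
      sqrt (ioint a b (\<lambda>y. (f' y - poly p y)\<^sup>2)) \<le> (b - a) ^ m * sqrt (ioint a b (\<lambda>y. (g y)\<^sup>2))"
      using Suc.IH[OF f'(2)] by blast
    show ?case
    proof (intro bexI[OF _ g(1)] conjI g(2) allI impI)
      fix a b :: real assume ab: "0 \<le> a" "a < b" "b \<le> 1"
      obtain p where p: "poly_lt m p" "sqrt (ioint a b (\<lambda>y. (f' y - poly p y)\<^sup>2)) \<le> (b - a) ^ m * sqrt (ioint a b (\<lambda>y. (g y)\<^sup>2))"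
        using g(3)[OF ab] by blast
      obtain P where P: "pderiv P = p" "poly_lt (Suc m) P" using poly_antiderivative[OF p(1)] .
      define Q where "Q = P + [:f a - poly P a:]"
      have Q: "pderiv Q = p" "poly Q a = f a" by (auto simp: Q_def pderiv_add P(1) pderiv_pCons)
      have Qlt: "poly_lt (Suc m) Q" using P(2) by (auto simp: Q_def poly_lt_def coeff_pCons split: nat.splits)
      have pr: "is_primitive a b (\<lambda>y. f y - poly Q y) (\<lambda>y. f' y - poly p y)"
        using is_primitive_diff[OF is_primitive_subinterval[OF f'(1)] is_primitive_poly[of a b Q]] ab Q(1) by simp
      have "(\<lambda>y. f' y - poly p y) \<in> L2_on {a<..<b}"
        by (rule L2_on_diff[OF L2_on_subinterval[of f' 0 1] poly_L2]) (use Hbound_l2[OF f'(2)] ab in auto)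
      from ioint_square_primitive_le(2)[OF pr _ _ this] Q(2) ab
      have "sqrt (ioint a b (\<lambda>y. (f y - poly Q y)\<^sup>2)) \<le> (b - a) * sqrt (ioint a b (\<lambda>y. (f' y - poly p y)\<^sup>2))" by simp
      also have "\<dots> \<le> (b - a) * ((b - a) ^ m * sqrt (ioint a b (\<lambda>y. (g y)\<^sup>2)))"
        by (rule mult_left_mono[OF p(2)]) (use ab in simp)
      finally show "\<exists>p. poly_lt (Suc m) p \<and> sqrt (ioint a b (\<lambda>y. (f y - poly p y)\<^sup>2)) \<le> (b - a) ^ Suc m * sqrt (ioint a b (\<lambda>y. (g y)\<^sup>2))"
        using Qlt by (auto simp: mult.assoc)
    qed
  qed
  then show ?thesis using that by blast
qed

section \<open>Piecewise polynomials on a mesh\<close>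

locale mesh =
  fixes N :: nat and x :: "nat \<Rightarrow> real"
  assumes mesh: "is_mesh N x"
begin

lemma N2: "2 \<le> N" and x1 [simp]: "x (Suc 0) = 0" and xN [simp]: "x N = 1"
  using mesh by (auto simp: is_mesh_def)

lemma elem_less: "i \<in> {1..<N} \<Longrightarrow> x i < x (i + 1)"
  using mesh by (auto simp: is_mesh_def)

lemma node_mono:
  assumes "1 \<le> i" "i \<le> j" "j \<le> N"
  shows "x i \<le> x j"
  using assms(2,3)
proof (induction j rule: dec_induct)
  case (step n)
  then show ?case using elem_less[of n] assms(1) by auto
qed simp

lemma node_bounds: "1 \<le> i \<Longrightarrow> i \<le> N \<Longrightarrow> 0 \<le> x i \<and> x i \<le> 1"
  using node_mono[of 1 i] node_mono[of i N] N2 by auto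

lemma elem_bounds: "i \<in> {1..<N} \<Longrightarrow> 0 \<le> x i \<and> x (i + 1) \<le> 1"
  using node_bounds[of i] node_bounds[of "i + 1"] by auto

lemma elem_size: "i \<in> {1..<N} \<Longrightarrow> x (i + 1) - x i \<le> mesh_size N x"
  unfolding mesh_size_def by (intro Max_ge) auto

lemma mesh_size_pos: "0 < mesh_size N x"
  using elem_size[of 1] elem_less[of 1] N2 by fastforce

lemma mesh_size_le: "mesh_size N x \<le> 1"
proof -
  have "{1..<N} \<noteq> {}" using N2 by auto
  then show ?thesis unfolding mesh_size_def using elem_bounds by (subst Max_le_iff) force+
qed

lemma elem_subset: "i \<in> {1..<N} \<Longrightarrow> element x i \<subseteq> {0<..<1}"
  using elem_bounds[of i] by auto

lemma ioint_elements:
  assumes f: "iointegrable 0 1 f"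
  shows "ioint 0 1 f = (\<Sum>i\<in>{1..<N}. ioint (x i) (x (i + 1)) f)"
proof -
  have "ioint 0 (x n) f = (\<Sum>i\<in>{1..<n}. ioint (x i) (x (i + 1)) f)" if "1 \<le> n" "n \<le> N" for n
    using that
  proof (induction n rule: dec_induct)
    case (step n)
    have "ioint 0 (x (Suc n)) f = ioint 0 (x n) f + ioint (x n) (x (Suc n)) f"
      by (rule ioint_combine[OF iointegrable_subinterval[OF f]])
         (use step node_bounds[of n] node_bounds[of "Suc n"] elem_less[of n] in auto)
    then show ?case using step by simp
  qed simp
  from this[of N] show ?thesis using N2 by simp
qed

text \<open>A single function on the real line, with value 0 at the nodes and outside (0,1); since
  the nodes form a null set, sums over elements become integrals over (0,1).\<close>

definition pw :: "(nat \<Rightarrow> real poly) \<Rightarrow> real \<Rightarrow> real" where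
  "pw p y = (\<Sum>i\<in>{1..<N}. indicator (element x i) y * poly (p i) y)"

lemma pw_elem:
  assumes i: "i \<in> {1..<N}" and y: "y \<in> element x i"
  shows "pw p y = poly (p i) y"
proof -
  have "indicator (element x j) y = (0 :: real)" if "j \<in> {1..<N}" "j \<noteq> i" for j
  proof (cases "j < i")
    case True
    then show ?thesis using node_mono[of "j + 1" i] i that y by auto
  next
    case False
    then show ?thesis using node_mono[of "i + 1" j] i that y by auto
  qed
  then have "pw p y = (\<Sum>j\<in>{1..<N}. if j = i then poly (p i) y else 0)"
    unfolding pw_def using y by (intro sum.cong) auto
  then show ?thesis using i by simp
qed

lemma pw_cases:
  obtains i where "i \<in> {1..<N}" "y \<in> element x i" "\<And>p. pw p y = poly (p i) y"
  | "\<And>p. pw p y = 0"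
proof (cases "\<exists>i\<in>{1..<N}. y \<in> element x i")
  case True
  then show ?thesis using that(1) pw_elem by blast
next
  case False
  then have "pw p y = 0" for p unfolding pw_def by (intro sum.neutral) auto
  then show ?thesis using that(2) by blast
qed

lemma pw_diff: "pw (\<lambda>i. p i - q i) y = pw p y - pw q y"
  by (cases y rule: pw_cases) auto

lemma pw_smult: "pw (\<lambda>i. smult c (p i)) y = c * pw p y"
  by (cases y rule: pw_cases) auto

lemma pw_le:
  assumes "\<And>i y. i \<in> {1..<N} \<Longrightarrow> y \<in> element x i \<Longrightarrow> \<bar>poly (p i) y\<bar> \<le> B" "0 \<le> B"
  shows "\<bar>pw p y\<bar> \<le> B"
  by (cases y rule: pw_cases) (use assms in auto)

lemma pw_le_coeffs:
  assumes "\<And>i. i \<in> {1..<N} \<Longrightarrow> degree (p i) \<le> m"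
  shows "\<bar>pw p y\<bar> \<le> (\<Sum>i\<in>{1..<N}. \<Sum>j\<le>m. \<bar>coeff (p i) j\<bar>)"
proof (rule pw_le)
  fix i y assume i: "i \<in> {1..<N}" and y: "y \<in> element x i"
  have y01: "0 < y" "y < 1" using elem_subset[OF i] y by auto
  have "\<bar>poly (p i) y\<bar> = \<bar>\<Sum>j\<le>m. coeff (p i) j * y ^ j\<bar>"
  proof -
    have "(\<Sum>j\<le>degree (p i). coeff (p i) j * y ^ j) = (\<Sum>j\<le>m. coeff (p i) j * y ^ j)"
      by (rule sum.mono_neutral_left) (use assms[OF i] in \<open>auto intro: coeff_eq_0\<close>)
    then show ?thesis by (simp add: poly_altdef)
  qed
  also have "\<dots> \<le> (\<Sum>j\<le>m. \<bar>coeff (p i) j * y ^ j\<bar>)" by (rule sum_abs)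
  also have "\<dots> \<le> (\<Sum>j\<le>m. \<bar>coeff (p i) j\<bar>)"
    using y01 by (intro sum_mono) (simp add: abs_mult mult_left_le power_le_one)
  also have "\<dots> \<le> (\<Sum>i\<in>{1..<N}. \<Sum>j\<le>m. \<bar>coeff (p i) j\<bar>)"
    by (rule member_le_sum[OF i]) (auto intro: sum_nonneg)
  finally show "\<bar>poly (p i) y\<bar> \<le> (\<Sum>i\<in>{1..<N}. \<Sum>j\<le>m. \<bar>coeff (p i) j\<bar>)" .
qed (auto intro: sum_nonneg)

lemma pw_bounded: obtains B where "0 \<le> B" "\<And>y. \<bar>pw p y\<bar> \<le> B"
proof -
  define m where "m = Max (insert 0 ((\<lambda>i. degree (p i)) ` {1..<N}))"
  have "degree (p i) \<le> m" if "i \<in> {1..<N}" for i unfolding m_def using that by (intro Max_ge) auto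
  then show ?thesis using pw_le_coeffs[of p m] that[of "\<Sum>i\<in>{1..<N}. \<Sum>j\<le>m. \<bar>coeff (p i) j\<bar>"]
    by (force intro: sum_nonneg)
qed

lemma pw_measurable [measurable]: "pw p \<in> borel_measurable (lebesgue_on {0<..<1})"
proof -
  have "(\<lambda>s. indicator (element x i) s :: real) \<in> borel_measurable (lebesgue_on {0<..<1})" for i
    by (intro measurable_restrict_space1 measurable_completion) auto
  moreover have "poly (p i) \<in> borel_measurable (lebesgue_on {0<..<1})" for i
    by (rule continuous_on_measurable_Ioo) (intro continuous_intros)
  ultimately show ?thesis unfolding pw_def[abs_def] by (intro borel_measurable_sum borel_measurable_times)
qed

lemma pw_L2 [simp, intro]: "pw p \<in> L2"
proof -
  obtain B where "0 \<le> B" "\<And>y. \<bar>pw p y\<bar> \<le> B" using pw_bounded[of p] by metis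
  then show ?thesis by (intro l2norm_le_sup(1)[OF pw_measurable])
qed

lemma pw_mult_L2 [simp, intro]: "f \<in> L2 \<Longrightarrow> (\<lambda>y. pw p y * f y) \<in> L2"
proof -
  obtain B where B: "0 \<le> B" "\<And>y. \<bar>pw p y\<bar> \<le> B" using pw_bounded[of p] by metis
  show "f \<in> L2 \<Longrightarrow> (\<lambda>y. pw p y * f y) \<in> L2" by (rule L2_on_bounded_mult[OF _ pw_measurable B(2)])
qed

lemma ioint_pw:
  assumes f: "f \<in> L2"
  shows "ioint 0 1 (\<lambda>y. f y * pw q y) = (\<Sum>i\<in>{1..<N}. ioint (x i) (x (i + 1)) (\<lambda>y. f y * poly (q i) y))"
proof -
  have "ioint (x i) (x (i + 1)) (\<lambda>y. f y * pw q y) = ioint (x i) (x (i + 1)) (\<lambda>y. f y * poly (q i) y)"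
    if "i \<in> {1..<N}" for i
    by (rule ioint_cong) (use pw_elem[OF that] in auto)
  then show ?thesis unfolding ioint_elements[OF L2_on_mult_integrable[OF f pw_L2]] by (intro sum.cong) auto
qed

lemma inner_h_eq:
  assumes "iointegrable 0 1 h" "\<And>i y. i \<in> {1..<N} \<Longrightarrow> y \<in> element x i \<Longrightarrow> f i y * g i y = h y"
  shows "inner_h N x f g = ioint 0 1 h"
  unfolding inner_h_def ioint_elements[OF assms(1)]
  by (intro sum.cong refl ioint_cong) (use assms(2) in auto)

subsection \<open>Projections\<close>

text \<open>A relation and not a function of f, because projections also arise as differences of
  projections and as derivatives of interpolants.\<close>

definition is_proj :: "nat \<Rightarrow> (real \<Rightarrow> real) \<Rightarrow> (nat \<Rightarrow> real poly) \<Rightarrow> bool" where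
  "is_proj m f p \<longleftrightarrow> (\<forall>i\<in>{1..<N}. degree (p i) \<le> m \<and>
     (\<forall>q. degree q \<le> m \<longrightarrow> ioint (x i) (x (i + 1)) (\<lambda>y. (f y - poly (p i) y) * poly q y) = 0))"

lemma L2_elem: "f \<in> L2 \<Longrightarrow> i \<in> {1..<N} \<Longrightarrow> f \<in> L2_on (element x i)"
  using L2_on_subinterval[of f 0 1 "x i" "x (i + 1)"] elem_bounds[of i] by auto

lemma is_proj_exists:
  assumes "f \<in> L2"
  shows "is_proj m f (L2_projection m x f)"
  unfolding is_proj_def
  using L2_projection_spec[where x = x and f = f and m = m] elem_less L2_elem[OF assms] by auto

lemma is_proj_orth:
  assumes p: "is_proj m f p" and f: "f \<in> L2" and q: "\<And>i. i \<in> {1..<N} \<Longrightarrow> degree (q i) \<le> m"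
  shows "ioint 0 1 (\<lambda>y. (f y - pw p y) * pw q y) = 0"
proof -
  have "ioint (x i) (x (i + 1)) (\<lambda>y. (f y - pw p y) * poly (q i) y) = 0" if i: "i \<in> {1..<N}" for i
  proof -
    have "ioint (x i) (x (i + 1)) (\<lambda>y. (f y - pw p y) * poly (q i) y) = ioint (x i) (x (i + 1)) (\<lambda>y. (f y - poly (p i) y) * poly (q i) y)"
      by (rule ioint_cong) (use pw_elem[OF i] in auto)
    then show ?thesis using p q[OF i] i by (auto simp: is_proj_def)
  qed
  then show ?thesis unfolding ioint_pw[OF L2_on_diff[OF f pw_L2]] by (intro sum.neutral) auto
qed

lemma is_proj_diff:
  assumes "is_proj m f p" "is_proj m g q" "f \<in> L2" "g \<in> L2"
  shows "is_proj m (\<lambda>y. f y - g y) (\<lambda>i. p i - q i)"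
  unfolding is_proj_def
proof (intro ballI conjI allI impI)
  fix i assume i: "i \<in> {1..<N}"
  show "degree (p i - q i) \<le> m" using assms(1,2) i by (auto simp: is_proj_def intro!: degree_diff_le)
  fix s :: "real poly" assume s: "degree s \<le> m"
  have 1: "iointegrable (x i) (x (i + 1)) (\<lambda>y. (f y - poly (p i) y) * poly s y)"
    "iointegrable (x i) (x (i + 1)) (\<lambda>y. (g y - poly (q i) y) * poly s y)"
    by (rule L2_on_mult_integrable[OF L2_on_diff poly_L2]; use assms L2_elem i in auto)+
  have "ioint (x i) (x (i + 1)) (\<lambda>y. (f y - g y - poly (p i - q i) y) * poly s y)
      = ioint (x i) (x (i + 1)) (\<lambda>y. (f y - poly (p i) y) * poly s y - (g y - poly (q i) y) * poly s y)"
    by (rule ioint_cong) (simp add: algebra_simps)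
  also have "\<dots> = 0" using 1 assms(1,2) i s by (simp add: is_proj_def)
  finally show "ioint (x i) (x (i + 1)) (\<lambda>y. (f y - g y - poly (p i - q i) y) * poly s y) = 0" .
qed

lemma is_proj_AE:
  assumes p: "is_proj m f p" and ae: "AE y in lebesgue_on {0<..<1}. f y = g y" and f: "f \<in> L2" and g: "g \<in> L2"
  shows "is_proj m g p"
proof -
  have "ioint (x i) (x (i + 1)) (\<lambda>y. (g y - poly (p i) y) * poly s y) = ioint (x i) (x (i + 1)) (\<lambda>y. (f y - poly (p i) y) * poly s y)"
    if i: "i \<in> {1..<N}" for i s
  proof (rule integral_cong_AE)
    show "(\<lambda>y. (g y - poly (p i) y) * poly s y) \<in> borel_measurable (lebesgue_on (element x i))"
      "(\<lambda>y. (f y - poly (p i) y) * poly s y) \<in> borel_measurable (lebesgue_on (element x i))"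
      using L2_on_mult_integrable[OF L2_on_diff[OF L2_elem[OF f i] poly_L2] poly_L2]
        L2_on_mult_integrable[OF L2_on_diff[OF L2_elem[OF g i] poly_L2] poly_L2] by auto
    have "AE y in lebesgue. y \<in> {0<..<1} \<longrightarrow> f y = g y"
      using ae by (subst (asm) AE_restrict_space_iff) auto
    then have "AE y in lebesgue. y \<in> element x i \<longrightarrow> (g y - poly (p i) y) * poly s y = (f y - poly (p i) y) * poly s y"
      by eventually_elim (use elem_subset[OF i] in auto)
    then show "AE y in lebesgue_on (element x i). (g y - poly (p i) y) * poly s y = (f y - poly (p i) y) * poly s y"
      by (subst AE_restrict_space_iff) auto
  qed
  then show ?thesis using p by (simp add: is_proj_def)
qed

lemma is_proj_best:
  assumes p: "is_proj m f p" and f: "f \<in> L2" and i: "i \<in> {1..<N}" and q: "degree q \<le> m"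
  shows "ioint (x i) (x (i + 1)) (\<lambda>y. (f y - poly (p i) y)\<^sup>2) \<le> ioint (x i) (x (i + 1)) (\<lambda>y. (f y - poly q y)\<^sup>2)"
    and "ioint (x i) (x (i + 1)) (\<lambda>y. (poly (p i) y)\<^sup>2) \<le> ioint (x i) (x (i + 1)) (\<lambda>y. (f y)\<^sup>2)"
proof -
  note fL = L2_elem[OF f i]
  have dp: "degree (p i) \<le> m" using p i by (simp add: is_proj_def)
  have o: "ioint (x i) (x (i + 1)) (\<lambda>y. (f y - poly (p i) y) * poly s y) = 0" if "degree s \<le> m" for s
    using p i that by (simp add: is_proj_def)
  have I: "iointegrable (x i) (x (i + 1)) (\<lambda>y. (f y - poly (p i) y)\<^sup>2)"
    "iointegrable (x i) (x (i + 1)) (\<lambda>y. (poly s y)\<^sup>2)"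
    "iointegrable (x i) (x (i + 1)) (\<lambda>y. (f y - poly (p i) y) * poly s y)" for s
    using L2_onD(2)[OF L2_on_diff[OF fL poly_L2]] L2_onD(2)[OF poly_L2] L2_on_mult_integrable[OF L2_on_diff[OF fL poly_L2] poly_L2] by auto
  have pyth: "ioint (x i) (x (i + 1)) (\<lambda>y. (f y - poly (p i) y + poly s y)\<^sup>2)
      = ioint (x i) (x (i + 1)) (\<lambda>y. (f y - poly (p i) y)\<^sup>2) + ioint (x i) (x (i + 1)) (\<lambda>y. (poly s y)\<^sup>2)"
    if "degree s \<le> m" for s
  proof -
    have "ioint (x i) (x (i + 1)) (\<lambda>y. (f y - poly (p i) y + poly s y)\<^sup>2)
      = ioint (x i) (x (i + 1)) (\<lambda>y. (f y - poly (p i) y)\<^sup>2 + (poly s y)\<^sup>2 + 2 * ((f y - poly (p i) y) * poly s y))"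
      by (rule ioint_cong) (simp add: power2_eq_square algebra_simps)
    then show ?thesis using I o[OF that] by simp
  qed
  have nn: "0 \<le> ioint (x i) (x (i + 1)) (\<lambda>y. (h y)\<^sup>2)" for h by (rule ioint_nonneg) simp
  show "ioint (x i) (x (i + 1)) (\<lambda>y. (f y - poly (p i) y)\<^sup>2) \<le> ioint (x i) (x (i + 1)) (\<lambda>y. (f y - poly q y)\<^sup>2)"
    using pyth[of "p i - q"] nn[of "poly (p i - q)"] dp q by (simp add: degree_diff_le)
  show "ioint (x i) (x (i + 1)) (\<lambda>y. (poly (p i) y)\<^sup>2) \<le> ioint (x i) (x (i + 1)) (\<lambda>y. (f y)\<^sup>2)"
    using pyth[of "p i"] nn[of "\<lambda>y. f y - poly (p i) y"] dp by simp
qed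

lemma l2norm_elements:
  assumes f: "f \<in> L2" and g: "g \<in> L2" and c: "0 \<le> c"
    and le: "\<And>i. i \<in> {1..<N} \<Longrightarrow> sqrt (ioint (x i) (x (i + 1)) (\<lambda>y. (f y)\<^sup>2)) \<le> c * sqrt (ioint (x i) (x (i + 1)) (\<lambda>y. (g y)\<^sup>2))"
  shows "l2norm f \<le> c * l2norm g"
proof -
  have nn: "0 \<le> ioint a b (\<lambda>y. (h y)\<^sup>2)" for h a b by (rule ioint_nonneg) simp
  have "ioint (x i) (x (i + 1)) (\<lambda>y. (f y)\<^sup>2) \<le> c\<^sup>2 * ioint (x i) (x (i + 1)) (\<lambda>y. (g y)\<^sup>2)" if "i \<in> {1..<N}" for i
    using power_mono[OF le[OF that], of 2] nn by (simp add: power_mult_distrib)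
  then have "(l2norm f)\<^sup>2 \<le> c\<^sup>2 * (l2norm g)\<^sup>2"
    unfolding l2norm_square ioint_elements[OF L2_onD(2)[OF f]] ioint_elements[OF L2_onD(2)[OF g]] sum_distrib_left
    by (rule sum_mono)
  then have "(l2norm f)\<^sup>2 \<le> (c * l2norm g)\<^sup>2" by (simp add: power_mult_distrib)
  then show ?thesis by (rule power2_le_imp_le) (use c in simp)
qed

lemma L2_minus_pw: "f \<in> L2 \<Longrightarrow> (\<lambda>y. f y - pw p y) \<in> L2"
  by (rule L2_on_diff[OF _ pw_L2])

lemma is_proj_error:
  assumes p: "is_proj m f p" and f: "Hbound n B f" and n: "n \<le> Suc m"
  shows "l2norm (\<lambda>y. f y - pw p y) \<le> mesh_size N x ^ n * B"
proof -
  obtain g where g: "g \<in> L2" "l2norm g \<le> B"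
    "\<And>a b. 0 \<le> a \<Longrightarrow> a < b \<Longrightarrow> b \<le> 1 \<Longrightarrow> \<exists>p. poly_lt n p \<and>
      sqrt (ioint a b (\<lambda>y. (f y - poly p y)\<^sup>2)) \<le> (b - a) ^ n * sqrt (ioint a b (\<lambda>y. (g y)\<^sup>2))"
    using Hbound_taylor[OF f] by blast
  have fL: "f \<in> L2" using Hbound_l2[OF f] by simp
  have "l2norm (\<lambda>y. f y - pw p y) \<le> mesh_size N x ^ n * l2norm g"
  proof (rule l2norm_elements[OF L2_minus_pw[OF fL] g(1)])
    fix i assume i: "i \<in> {1..<N}"
    obtain q where q: "poly_lt n q"
      "sqrt (ioint (x i) (x (i + 1)) (\<lambda>y. (f y - poly q y)\<^sup>2)) \<le> (x (i + 1) - x i) ^ n * sqrt (ioint (x i) (x (i + 1)) (\<lambda>y. (g y)\<^sup>2))"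
      using g(3)[of "x i" "x (i + 1)"] elem_less[OF i] elem_bounds[OF i] by auto
    have "ioint (x i) (x (i + 1)) (\<lambda>y. (f y - pw p y)\<^sup>2) = ioint (x i) (x (i + 1)) (\<lambda>y. (f y - poly (p i) y)\<^sup>2)"
      by (rule ioint_cong) (use pw_elem[OF i] in auto)
    then have "sqrt (ioint (x i) (x (i + 1)) (\<lambda>y. (f y - pw p y)\<^sup>2)) \<le> sqrt (ioint (x i) (x (i + 1)) (\<lambda>y. (f y - poly q y)\<^sup>2))"
      using is_proj_best(1)[OF p fL i poly_lt_degree[OF q(1) n]] by simp
    also note q(2)
    also have "(x (i + 1) - x i) ^ n * sqrt (ioint (x i) (x (i + 1)) (\<lambda>y. (g y)\<^sup>2)) \<le> mesh_size N x ^ n * sqrt (ioint (x i) (x (i + 1)) (\<lambda>y. (g y)\<^sup>2))"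
      using elem_less[OF i] elem_size[OF i] by (intro mult_right_mono power_mono) (auto intro!: ioint_nonneg)
    finally show "sqrt (ioint (x i) (x (i + 1)) (\<lambda>y. (f y - pw p y)\<^sup>2)) \<le> mesh_size N x ^ n * sqrt (ioint (x i) (x (i + 1)) (\<lambda>y. (g y)\<^sup>2))" .
  qed (use mesh_size_pos in simp)
  also have "\<dots> \<le> mesh_size N x ^ n * B" using g(2) mesh_size_pos by (intro mult_left_mono) auto
  finally show "l2norm (\<lambda>y. f y - pw p y) \<le> mesh_size N x ^ n * B" .
qed

text \<open>Stability of the projection in the maximum norm on any mesh: on an element of length d
  the norm of a function bounded by B is at most B sqrt(d), which cancels the factor 1 / sqrt(d) of
  the inverse estimate.\<close>

lemma is_proj_sup:
  assumes K: "\<And>a b p y. a < b \<Longrightarrow> degree p \<le> m \<Longrightarrow> y \<in> {a..b} \<Longrightarrow>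
      \<bar>poly p y\<bar> \<le> K / sqrt (b - a) * sqrt (ioint a b (\<lambda>y. (poly p y)\<^sup>2))" and K0: "0 \<le> K"
    and p: "is_proj m f p" and f: "f \<in> L2" and B: "\<And>y. 0 < y \<Longrightarrow> y < 1 \<Longrightarrow> \<bar>f y\<bar> \<le> B" "0 \<le> B"
  shows "\<bar>pw p y\<bar> \<le> K * B"
proof (rule pw_le)
  fix i y assume i: "i \<in> {1..<N}" and y: "y \<in> element x i"
  note h = elem_less[OF i]
  have "ioint (x i) (x (i + 1)) (\<lambda>y. (f y)\<^sup>2) \<le> ioint (x i) (x (i + 1)) (\<lambda>y. B\<^sup>2)"
  proof (rule ioint_mono)
    fix y assume "x i < y" "y < x (i + 1)"
    then have "\<bar>f y\<bar> \<le> B" using elem_bounds[OF i] by (intro B) auto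
    then show "(f y)\<^sup>2 \<le> B\<^sup>2" using power_mono[of "\<bar>f y\<bar>" B 2] by simp
  qed (use L2_onD(2)[OF L2_elem[OF f i]] in auto)
  also have "\<dots> = B\<^sup>2 * (x (i + 1) - x i)" using h by simp
  finally have "ioint (x i) (x (i + 1)) (\<lambda>y. (poly (p i) y)\<^sup>2) \<le> B\<^sup>2 * (x (i + 1) - x i)"
    using is_proj_best(2)[OF p f i, of 0] by simp
  then have "sqrt (ioint (x i) (x (i + 1)) (\<lambda>y. (poly (p i) y)\<^sup>2)) \<le> B * sqrt (x (i + 1) - x i)"
    using real_sqrt_le_mono[of _ "B\<^sup>2 * (x (i + 1) - x i)"] B(2) by (simp add: real_sqrt_mult)
  then have "K / sqrt (x (i + 1) - x i) * sqrt (ioint (x i) (x (i + 1)) (\<lambda>y. (poly (p i) y)\<^sup>2)) \<le> K / sqrt (x (i + 1) - x i) * (B * sqrt (x (i + 1) - x i))"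
    using K0 h by (intro mult_left_mono) auto
  also have "\<dots> = K * B" using h by simp
  finally show "\<bar>poly (p i) y\<bar> \<le> K * B"
    using K[OF h, of "p i" y] p i y by (force simp: is_proj_def)
qed (use K0 B in simp)

text \<open>Here C depends on the mesh in an uncontrolled way but not on q. It may therefore enter
  only arguments in which something tends to zero at a fixed mesh.\<close>

lemma pw_deriv_inverse:
  obtains C where "0 \<le> C"
    "\<And>q. (\<And>i. i \<in> {1..<N} \<Longrightarrow> degree (q i) \<le> m) \<Longrightarrow> l2norm (pw (\<lambda>i. pderiv (q i))) \<le> C * l2norm (pw q)"
proof -
  have "\<exists>C\<ge>0. \<forall>p. degree p \<le> m \<longrightarrow> (\<forall>y\<in>{x i..x (i + 1)}. \<bar>poly (pderiv p) y\<bar> \<le> C * sqrt (ioint (x i) (x (i + 1)) (\<lambda>y. poly p y * poly p y)))"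
    if i: "i \<in> {1..<N}" for i
    using poly_linear_map_sup_le[OF elem_less[OF i], of pderiv "Suc m"] by (simp add: pderiv_add pderiv_smult poly_lt_Suc)
  then have "\<forall>i\<in>{1..<N}. \<exists>C. 0 \<le> C \<and> (\<forall>p. degree p \<le> m \<longrightarrow> (\<forall>y\<in>{x i..x (i + 1)}. \<bar>poly (pderiv p) y\<bar> \<le> C * sqrt (ioint (x i) (x (i + 1)) (\<lambda>y. poly p y * poly p y))))"
    by blast
  from bchoice[OF this] obtain c where "\<forall>i\<in>{1..<N}. 0 \<le> c i \<and> (\<forall>p. degree p \<le> m \<longrightarrow> (\<forall>y\<in>{x i..x (i + 1)}. \<bar>poly (pderiv p) y\<bar> \<le> c i * sqrt (ioint (x i) (x (i + 1)) (\<lambda>y. poly p y * poly p y))))" ..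
  then have c: "\<And>i. i \<in> {1..<N} \<Longrightarrow> 0 \<le> c i"
    "\<And>i p y. i \<in> {1..<N} \<Longrightarrow> degree p \<le> m \<Longrightarrow> y \<in> {x i..x (i + 1)} \<Longrightarrow>
      \<bar>poly (pderiv p) y\<bar> \<le> c i * sqrt (ioint (x i) (x (i + 1)) (\<lambda>y. poly p y * poly p y))" by blast+
  define C where "C = (\<Sum>i\<in>{1..<N}. c i)"
  have C: "c i \<le> C" if "i \<in> {1..<N}" for i unfolding C_def by (rule member_le_sum) (use that c(1) in auto)
  have C0: "0 \<le> C" unfolding C_def by (rule sum_nonneg) (use c(1) in auto)
  show ?thesis
  proof (rule that[OF C0])
    fix q :: "nat \<Rightarrow> real poly" assume q: "\<And>i. i \<in> {1..<N} \<Longrightarrow> degree (q i) \<le> m"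
    show "l2norm (pw (\<lambda>i. pderiv (q i))) \<le> C * l2norm (pw q)"
    proof (rule l2norm_elements[OF pw_L2 pw_L2 C0])
      fix i assume i: "i \<in> {1..<N}"
      define s where "s = sqrt (ioint (x i) (x (i + 1)) (\<lambda>y. poly (q i) y * poly (q i) y))"
      have s0: "0 \<le> s" unfolding s_def by (auto intro!: ioint_nonneg)
      have eq: "sqrt (ioint (x i) (x (i + 1)) (\<lambda>y. (pw q y)\<^sup>2)) = s"
        unfolding s_def by (intro arg_cong[of _ _ sqrt] ioint_cong) (use pw_elem[OF i] in \<open>auto simp: power2_eq_square\<close>)
      have le: "\<bar>poly (pderiv (q i)) y\<bar> \<le> C * s" if "x i < y" "y < x (i + 1)" for y
      proof -
        have "\<bar>poly (pderiv (q i)) y\<bar> \<le> c i * s" unfolding s_def by (rule c(2)[OF i q[OF i]]) (use that in auto)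
        also have "\<dots> \<le> C * s" by (rule mult_right_mono[OF C[OF i] s0])
        finally show ?thesis .
      qed
      have "ioint (x i) (x (i + 1)) (\<lambda>y. (pw (\<lambda>i. pderiv (q i)) y)\<^sup>2) \<le> ioint (x i) (x (i + 1)) (\<lambda>y. (C * s)\<^sup>2)"
      proof (rule ioint_mono)
        show "iointegrable (x i) (x (i + 1)) (\<lambda>y. (pw (\<lambda>i. pderiv (q i)) y)\<^sup>2)"
          by (rule L2_onD(2)[OF L2_elem[OF pw_L2 i]])
        fix y assume y: "x i < y" "y < x (i + 1)"
        then show "(pw (\<lambda>i. pderiv (q i)) y)\<^sup>2 \<le> (C * s)\<^sup>2"
          using power_mono[OF le[OF y], of 2] pw_elem[OF i, of y] by simp
      qed simp
      also have "\<dots> = (C * s)\<^sup>2 * (x (i + 1) - x i)" using elem_less[OF i] by simp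
      also have "\<dots> \<le> (C * s)\<^sup>2 * 1" using elem_bounds[OF i] by (intro mult_left_mono) auto
      finally have "sqrt (ioint (x i) (x (i + 1)) (\<lambda>y. (pw (\<lambda>i. pderiv (q i)) y)\<^sup>2)) \<le> sqrt ((C * s)\<^sup>2)"
        by (intro real_sqrt_le_mono) simp
      then show "sqrt (ioint (x i) (x (i + 1)) (\<lambda>y. (pw (\<lambda>i. pderiv (q i)) y)\<^sup>2)) \<le> C * sqrt (ioint (x i) (x (i + 1)) (\<lambda>y. (pw q y)\<^sup>2))"
        unfolding eq using C0 s0 by simp
    qed
  qed
qed

text \<open>The values at the right ends of the elements are also those of \<open>F\<close>, because the projection of \<open>F'\<close>
  preserves its means.\<close>

definition is_interp :: "nat \<Rightarrow> (real \<Rightarrow> real) \<Rightarrow> (nat \<Rightarrow> real poly) \<Rightarrow> bool" where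
  "is_interp k F G \<longleftrightarrow> (\<forall>i\<in>{1..<N}. poly (G i) (x i) = F (x i)) \<and>
     (\<exists>F'\<in>L2. is_primitive 0 1 F F' \<and> is_proj k F' (\<lambda>i. pderiv (G i)))"

lemma is_interp_exists:
  assumes "is_primitive 0 1 F F'" "F' \<in> L2"
  obtains G where "is_interp k F G"
proof -
  have "\<exists>P. pderiv P = L2_projection k x F' i \<and> poly P (x i) = F (x i)" if i: "i \<in> {1..<N}" for i
  proof -
    have "degree (L2_projection k x F' i) \<le> k" using is_proj_exists[OF assms(2), of k] i by (simp add: is_proj_def)
    then obtain P where P: "pderiv P = L2_projection k x F' i" using poly_antiderivative[of "Suc k"] by (metis poly_lt_Suc)
    have "pderiv (P + [:F (x i) - poly P (x i):]) = L2_projection k x F' i" by (simp add: pderiv_add P pderiv_pCons)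
    then show ?thesis by (intro exI[of _ "P + [:F (x i) - poly P (x i):]"]) simp
  qed
  then obtain G where G: "\<And>i. i \<in> {1..<N} \<Longrightarrow> pderiv (G i) = L2_projection k x F' i \<and> poly (G i) (x i) = F (x i)" by metis
  have "is_proj k F' (\<lambda>i. pderiv (G i))"
    using is_proj_exists[OF assms(2), of k] G by (simp add: is_proj_def)
  then show ?thesis using that[of G] assms G by (auto simp: is_interp_def)
qed

lemma is_interp_proj:
  assumes "is_interp k F G" "is_primitive 0 1 F F'" "F' \<in> L2"
  shows "is_proj k F' (\<lambda>i. pderiv (G i))"
proof -
  obtain F1 where F1: "F1 \<in> L2" "is_primitive 0 1 F F1" "is_proj k F1 (\<lambda>i. pderiv (G i))"
    using assms(1) unfolding is_interp_def by blast
  show ?thesis by (rule is_proj_AE[OF F1(3) is_primitive_AE_unique[OF F1(2) assms(2)] F1(1) assms(3)])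
qed

lemma is_interp_degree:
  assumes "is_interp k F G" "i \<in> {1..<N}"
  shows "degree (G i) \<le> k + 1"
proof -
  have "degree (pderiv (G i)) \<le> k" using assms unfolding is_interp_def is_proj_def by blast
  then show ?thesis by (simp add: degree_pderiv)
qed

lemma is_interp_error_elem:
  assumes G: "is_interp k F G" and F: "is_primitive 0 1 F F'" and F': "F' \<in> L2" and i: "i \<in> {1..<N}"
  shows "poly (G i) (x (i + 1)) = F (x (i + 1))"
    and "sqrt (ioint (x i) (x (i + 1)) (\<lambda>y. (F y - poly (G i) y)\<^sup>2))
      \<le> mesh_size N x * sqrt (ioint (x i) (x (i + 1)) (\<lambda>y. (F' y - poly (pderiv (G i)) y)\<^sup>2))"
proof -
  have P: "is_primitive (x i) (x (i + 1)) (\<lambda>y. F y - poly (G i) y) (\<lambda>y. F' y - poly (pderiv (G i)) y)"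
    by (rule is_primitive_diff[OF is_primitive_subinterval[OF F] is_primitive_poly]) (use elem_bounds[OF i] in auto)
  have 0: "F (x i) - poly (G i) (x i) = 0" using G i by (simp add: is_interp_def)
  have "ioint (x i) (x (i + 1)) (\<lambda>y. (F' y - poly (pderiv (G i)) y) * poly 1 y) = 0"
  proof -
    have "\<forall>q. degree q \<le> k \<longrightarrow> ioint (x i) (x (i + 1)) (\<lambda>y. (F' y - poly (pderiv (G i)) y) * poly q y) = 0"
      using is_interp_proj[OF G F F'] i unfolding is_proj_def by blast
    then show ?thesis by (rule allE[of _ 1]) simp
  qed
  then show "poly (G i) (x (i + 1)) = F (x (i + 1))"
    using is_primitive_integral[OF P, of "x i" "x (i + 1)"] elem_less[OF i] 0 by simp
  have L: "(\<lambda>y. F' y - poly (pderiv (G i)) y) \<in> L2_on (element x i)"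
    by (rule L2_on_diff[OF L2_elem[OF F' i] poly_L2])
  have "sqrt (ioint (x i) (x (i + 1)) (\<lambda>y. (F y - poly (G i) y)\<^sup>2))
      \<le> (x (i + 1) - x i) * sqrt (ioint (x i) (x (i + 1)) (\<lambda>y. (F' y - poly (pderiv (G i)) y)\<^sup>2))"
    using ioint_square_primitive_le(2)[OF P 0 _ L] elem_less[OF i] by simp
  also have "\<dots> \<le> mesh_size N x * sqrt (ioint (x i) (x (i + 1)) (\<lambda>y. (F' y - poly (pderiv (G i)) y)\<^sup>2))"
    by (rule mult_right_mono[OF elem_size[OF i]]) (auto intro!: ioint_nonneg)
  finally show "sqrt (ioint (x i) (x (i + 1)) (\<lambda>y. (F y - poly (G i) y)\<^sup>2))
      \<le> mesh_size N x * sqrt (ioint (x i) (x (i + 1)) (\<lambda>y. (F' y - poly (pderiv (G i)) y)\<^sup>2))" .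
qed

lemma is_interp_continuous:
  assumes G: "is_interp k F G" and i: "i \<in> {1..<N}" "i + 1 \<in> {1..<N}"
  shows "poly (G i) (x (i + 1)) = poly (G (i + 1)) (x (i + 1))"
proof -
  obtain F' where F': "is_primitive 0 1 F F'" "F' \<in> L2" using G by (auto simp: is_interp_def)
  show ?thesis using is_interp_error_elem(1)[OF G F' i(1)] G i(2) by (simp add: is_interp_def)
qed

text \<open>The projection error of F' is of order k, and the difference of F and its interpolant
  vanishes at the left end of each element, so that integrating it gains one more factor of the mesh
  size.\<close>

lemma is_interp_error:
  assumes G: "is_interp k F G" and F: "Hbound (k + 1) B F"
  shows "l2norm (\<lambda>y. F y - pw G y) \<le> mesh_size N x ^ (k + 1) * B"
proof -
  obtain F' where F': "is_primitive 0 1 F F'" "Hbound k B F'" using F by auto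
  have F'L: "F' \<in> L2" using Hbound_l2[OF F'(2)] by simp
  have FL: "F \<in> L2" using Hbound_l2[OF F] by simp
  have "l2norm (\<lambda>y. F y - pw G y) \<le> mesh_size N x * l2norm (\<lambda>y. F' y - pw (\<lambda>i. pderiv (G i)) y)"
  proof (rule l2norm_elements[OF L2_minus_pw[OF FL] L2_minus_pw[OF F'L]])
    fix i assume i: "i \<in> {1..<N}"
    have "ioint (x i) (x (i + 1)) (\<lambda>y. (F y - pw G y)\<^sup>2) = ioint (x i) (x (i + 1)) (\<lambda>y. (F y - poly (G i) y)\<^sup>2)"
      "ioint (x i) (x (i + 1)) (\<lambda>y. (F' y - pw (\<lambda>i. pderiv (G i)) y)\<^sup>2) = ioint (x i) (x (i + 1)) (\<lambda>y. (F' y - poly (pderiv (G i)) y)\<^sup>2)"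
      by (rule ioint_cong; use pw_elem[OF i] in auto)+
    then show "sqrt (ioint (x i) (x (i + 1)) (\<lambda>y. (F y - pw G y)\<^sup>2)) \<le> mesh_size N x * sqrt (ioint (x i) (x (i + 1)) (\<lambda>y. (F' y - pw (\<lambda>i. pderiv (G i)) y)\<^sup>2))"
      using is_interp_error_elem(2)[OF G F'(1) F'L i] by simp
  qed (use mesh_size_pos in simp)
  also have "\<dots> \<le> mesh_size N x * (mesh_size N x ^ k * B)"
    by (rule mult_left_mono[OF is_proj_error[OF is_interp_proj[OF G F'(1) F'L] F'(2)]]) (use mesh_size_pos in auto)
  finally show ?thesis by (simp add: mult.assoc)
qed

lemma is_interp_diff:
  assumes "is_interp k F G" "is_interp k F1 G1"
  shows "is_interp k (\<lambda>y. F y - F1 y) (\<lambda>i. G i - G1 i)"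
proof -
  obtain F' where F': "is_primitive 0 1 F F'" "F' \<in> L2" "is_proj k F' (\<lambda>i. pderiv (G i))" using assms(1) by (auto simp: is_interp_def)
  obtain F1' where F1': "is_primitive 0 1 F1 F1'" "F1' \<in> L2" "is_proj k F1' (\<lambda>i. pderiv (G1 i))" using assms(2) by (auto simp: is_interp_def)
  have "is_proj k (\<lambda>y. F' y - F1' y) (\<lambda>i. pderiv (G i - G1 i))"
    using is_proj_diff[OF F'(3) F1'(3) F'(2) F1'(2)] by (simp add: pderiv_diff)
  then show ?thesis
    using assms is_primitive_diff[OF F'(1) F1'(1)] L2_on_diff[OF F'(2) F1'(2)] by (auto simp: is_interp_def)
qed

subsection \<open>Integration by parts on the mesh\<close>

definition continuous_pw :: "(nat \<Rightarrow> real poly) \<Rightarrow> bool" where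
  "continuous_pw q \<longleftrightarrow> (\<forall>i. 1 \<le> i \<longrightarrow> i + 1 < N \<longrightarrow> poly (q i) (x (i + 1)) = poly (q (i + 1)) (x (i + 1)))"

lemma continuous_pw_diff: "continuous_pw p \<Longrightarrow> continuous_pw q \<Longrightarrow> continuous_pw (\<lambda>i. p i - q i)"
  by (simp add: continuous_pw_def)

text \<open>Continuity of q makes the contributions of each interior node cancel; what remains are
  the two boundary nodes, where c vanishes.\<close>

lemma nodal_telescope:
  assumes q: "continuous_pw q" and c: "c 1 = 0" "c N = 0"
  shows "(\<Sum>i\<in>{1..<N}. c (i + 1) * poly (q i) (x (i + 1)) - c i * poly (q i) (x i)) = (0 :: real)"
proof -
  have "c (i + 1) * poly (q i) (x (i + 1)) = c (i + 1) * poly (q (i + 1)) (x (i + 1))" if "i \<in> {1..<N}" for i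
    using q c(2) that unfolding continuous_pw_def by (cases "i + 1 = N") auto
  then have "(\<Sum>i\<in>{1..<N}. c (i + 1) * poly (q i) (x (i + 1)) - c i * poly (q i) (x i))
      = (\<Sum>i\<in>{1..<N}. c (Suc i) * poly (q (Suc i)) (x (Suc i)) - c i * poly (q i) (x i))"
    by (intro sum.cong) auto
  also have "\<dots> = c N * poly (q N) (x N) - c 1 * poly (q 1) (x 1)"
    using N2 by (intro sum_Suc_diff') auto
  finally show ?thesis using c by simp
qed

lemma green_elem:
  assumes P: "is_primitive 0 1 u v" and i: "i \<in> {1..<N}"
  shows "ioint (x i) (x (i + 1)) (\<lambda>y. v y * poly q y) = - ioint (x i) (x (i + 1)) (\<lambda>y. u y * poly (pderiv q) y)
     + u (x (i + 1)) * poly q (x (i + 1)) - u (x i) * poly q (x i)"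
proof -
  have Pi: "is_primitive (x i) (x (i + 1)) u v" by (rule is_primitive_subinterval[OF P]) (use elem_bounds[OF i] in auto)
  have cq: "continuous_on {x i..x (i + 1)} (poly q)" by (intro continuous_intros)
  have i1: "iointegrable (x i) (x (i + 1)) (\<lambda>y. v y * poly q y)"
    using continuous_mult_iointegrable[OF cq is_primitiveD[OF Pi]] by (simp add: mult.commute)
  have i2: "iointegrable (x i) (x (i + 1)) (\<lambda>y. u y * poly (pderiv q) y)"
    by (rule continuous_iointegrable) (intro continuous_intros is_primitive_continuous[OF Pi])
  show ?thesis
    using is_primitive_integral[OF is_primitive_mult[OF Pi is_primitive_poly[of _ _ q]], of "x i" "x (i + 1)"]
      elem_less[OF i] i1 i2 by simp
qed

lemma green:
  assumes P: "is_primitive 0 1 u v" and v: "v \<in> L2" and u: "u 0 = 0" "u 1 = 0" and q: "continuous_pw q"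
  shows "ioint 0 1 (\<lambda>y. v y * pw q y) = - ioint 0 1 (\<lambda>y. u y * pw (\<lambda>i. pderiv (q i)) y)"
proof -
  have uL: "u \<in> L2" by (rule L2_on_continuous[OF is_primitive_continuous[OF P]])
  show ?thesis
    unfolding ioint_pw[OF v] ioint_pw[OF uL] green_elem[OF P]
    using nodal_telescope[OF q, of "\<lambda>i. u (x i)"] u green_elem[OF P]
    by (simp add: sum.distrib sum_subtractf sum_negf)
qed

subsection \<open>The semi-discrete scheme at a fixed time\<close>

text \<open>Against a continuous piecewise polynomial the nodal values of \<open>V\<close> drop out,
  exactly as boundary terms do for the exact solution. This is how quantities without any regularity
  in time are eliminated.\<close>

lemma green_weak:
  assumes V: "V \<in> S_h0 k N" and q: "continuous_pw q" "\<And>i. i \<in> {1..<N} \<Longrightarrow> degree (q i) \<le> r"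
  shows "ioint 0 1 (\<lambda>y. pw (weak_derivative r x V) y * pw q y) = - ioint 0 1 (\<lambda>y. pw (interior_part V) y * pw (\<lambda>i. pderiv (q i)) y)"
proof -
  have el: "ioint (x i) (x (i + 1)) (\<lambda>y. pw a y * poly b y) = ioint (x i) (x (i + 1)) (\<lambda>y. poly (a i) y * poly b y)"
    if "i \<in> {1..<N}" for i a b
    by (rule ioint_cong) (use pw_elem[OF that] in auto)
  have "(\<Sum>i\<in>{1..<N}. ioint (x i) (x (i + 1)) (\<lambda>y. pw (weak_derivative r x V) y * poly (q i) y))
    = (\<Sum>i\<in>{1..<N}. - ioint (x i) (x (i + 1)) (\<lambda>y. pw (interior_part V) y * poly (pderiv (q i)) y)
      + (nodal_value V (i + 1) * poly (q i) (x (i + 1)) - nodal_value V i * poly (q i) (x i)))"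
  proof (intro sum.cong refl)
    fix i assume i: "i \<in> {1..<N}"
    show "ioint (x i) (x (i + 1)) (\<lambda>y. pw (weak_derivative r x V) y * poly (q i) y)
      = - ioint (x i) (x (i + 1)) (\<lambda>y. pw (interior_part V) y * poly (pderiv (q i)) y)
      + (nodal_value V (i + 1) * poly (q i) (x (i + 1)) - nodal_value V i * poly (q i) (x i))"
      unfolding el[OF i] weak_derivative_spec(2)[OF elem_less[OF i] q(2)[OF i]] by simp
  qed
  then show ?thesis
    unfolding ioint_pw[OF pw_L2] using nodal_telescope[OF q(1), of "nodal_value V"] V
    by (simp add: sum.distrib sum_negf sum_subtractf S_h0_def)
qed

lemma scheme_flux:
  assumes V: "V \<in> S_h0 k N"
    and eq: "\<And>v. v \<in> S_h0 k N \<Longrightarrow>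
       inner_h N x (\<lambda>i. poly (dU i)) (\<lambda>i. poly (interior_part v i))
       + \<nu> * inner_h N x (\<lambda>i. poly (weak_derivative r x V i)) (\<lambda>i. poly (weak_derivative r x v i))
       + 1/3 * inner_h N x (\<lambda>i y. poly (interior_part V i) y * poly (weak_derivative r x V i) y) (\<lambda>i. poly (interior_part v i))
       - 1/3 * inner_h N x (\<lambda>i y. poly (interior_part V i) y * poly (interior_part V i) y) (\<lambda>i. poly (weak_derivative r x v i)) = 0"
  obtains \<sigma> where "\<And>i. i \<in> {1..<N} \<Longrightarrow> degree (\<sigma> i) \<le> r" "continuous_pw \<sigma>"
    "\<And>q. (\<And>i. i \<in> {1..<N} \<Longrightarrow> degree (q i) \<le> r) \<Longrightarrow> ioint 0 1 (\<lambda>y. pw \<sigma> y * pw q y)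
        = ioint 0 1 (\<lambda>y. (\<nu> * pw (weak_derivative r x V) y - (pw (interior_part V) y)\<^sup>2 / 3) * pw q y)"
    "\<And>q. (\<And>i. i \<in> {1..<N} \<Longrightarrow> degree (q i) \<le> k) \<Longrightarrow> ioint 0 1 (\<lambda>y. (pw dU y - pw (\<lambda>i. pderiv (\<sigma> i)) y
        + pw (interior_part V) y * pw (weak_derivative r x V) y / 3) * pw q y) = 0"
proof -
  let ?U = "interior_part V" and ?D = "weak_derivative r x V"
  define f where "f = (\<lambda>y. \<nu> * pw ?D y - (pw ?U y)\<^sup>2 / 3)"
  have UU: "(\<lambda>y. (pw ?U y)\<^sup>2 / 3) \<in> L2"
    using L2_on_cmult[OF pw_mult_L2[OF pw_L2[of ?U], of ?U], of "1/3"] by (simp add: power2_eq_square)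
  have fL: "f \<in> L2" unfolding f_def by (intro L2_on_diff L2_on_cmult pw_L2 UU)
  define \<sigma> where "\<sigma> = L2_projection r x f"
  have pr: "is_proj r f \<sigma>" unfolding \<sigma>_def by (rule is_proj_exists[OF fL])
  have deg: "degree (\<sigma> i) \<le> r" if "i \<in> {1..<N}" for i using pr that by (simp add: is_proj_def)
  have orth: "ioint 0 1 (\<lambda>y. pw \<sigma> y * pw q y) = ioint 0 1 (\<lambda>y. f y * pw q y)"
    if "\<And>i. i \<in> {1..<N} \<Longrightarrow> degree (q i) \<le> r" for q
    using is_proj_orth[where q = q, OF pr fL that] L2_on_mult_integrable[OF fL pw_L2[of q]] L2_on_mult_integrable[OF pw_L2[of \<sigma>] pw_L2[of q]]
    by (simp add: left_diff_distrib)
  have Ui: "iointegrable 0 1 (\<lambda>y. pw a y * pw b y * pw c y)" for a b c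
    using L2_on_mult_integrable[OF pw_mult_L2[OF pw_L2[of b], of a] pw_L2[of c]] .
  \<comment> \<open>The projected flux \<sigma> has degree at most r, so it may replace the flux
    against the weak derivative of v, and it is itself admissible in the definition of that weak
    derivative. The scheme is thereby rewritten in terms of the free data of v.\<close>
  have scheme: "ioint 0 1 (\<lambda>y. (pw dU y + pw ?U y * pw ?D y / 3) * pw (interior_part v) y)
      + (\<Sum>i\<in>{1..<N}. - ioint (x i) (x (i + 1)) (\<lambda>y. poly (interior_part v i) y * poly (pderiv (\<sigma> i)) y)
        + (nodal_value v (i + 1) * poly (\<sigma> i) (x (i + 1)) - nodal_value v i * poly (\<sigma> i) (x i))) = 0"
    if v: "v \<in> S_h0 k N" for v
  proof -
    let ?v = "interior_part v" and ?d = "weak_derivative r x v"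
    have d: "degree (?d i) \<le> r" if "i \<in> {1..<N}" for i by (rule weak_derivative_spec(1)[OF elem_less[OF that]])
    have e1: "inner_h N x (\<lambda>i. poly (dU i)) (\<lambda>i. poly (?v i)) = ioint 0 1 (\<lambda>y. pw dU y * pw ?v y)"
      by (rule inner_h_eq) (use L2_on_mult_integrable[OF pw_L2 pw_L2] pw_elem in auto)
    have e2: "inner_h N x (\<lambda>i. poly (?D i)) (\<lambda>i. poly (?d i)) = ioint 0 1 (\<lambda>y. pw ?D y * pw ?d y)"
      by (rule inner_h_eq) (use L2_on_mult_integrable[OF pw_L2 pw_L2] pw_elem in auto)
    have e3: "inner_h N x (\<lambda>i y. poly (?U i) y * poly (?D i) y) (\<lambda>i. poly (?v i)) = ioint 0 1 (\<lambda>y. pw ?U y * pw ?D y * pw ?v y)"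
      by (rule inner_h_eq) (use Ui pw_elem in auto)
    have e4: "inner_h N x (\<lambda>i y. poly (?U i) y * poly (?U i) y) (\<lambda>i. poly (?d i)) = ioint 0 1 (\<lambda>y. pw ?U y * pw ?U y * pw ?d y)"
      by (rule inner_h_eq) (use Ui pw_elem in auto)
    have s: "ioint 0 1 (\<lambda>y. pw \<sigma> y * pw ?d y) = \<nu> * ioint 0 1 (\<lambda>y. pw ?D y * pw ?d y) - 1/3 * ioint 0 1 (\<lambda>y. pw ?U y * pw ?U y * pw ?d y)"
    proof -
      have "ioint 0 1 (\<lambda>y. f y * pw ?d y) = ioint 0 1 (\<lambda>y. \<nu> * (pw ?D y * pw ?d y) - 1/3 * (pw ?U y * pw ?U y * pw ?d y))"
        by (rule ioint_cong) (simp add: f_def power2_eq_square algebra_simps)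
      moreover have "ioint 0 1 (\<lambda>y. pw \<sigma> y * pw ?d y) = ioint 0 1 (\<lambda>y. f y * pw ?d y)"
        by (rule orth) (rule d)
      ultimately show ?thesis using Ui[of ?U ?U ?d] L2_on_mult_integrable[OF pw_L2[of ?D] pw_L2[of ?d]] by simp
    qed
    have "ioint 0 1 (\<lambda>y. pw \<sigma> y * pw ?d y) = (\<Sum>i\<in>{1..<N}. ioint (x i) (x (i + 1)) (\<lambda>y. pw \<sigma> y * poly (?d i) y))"
      by (rule ioint_pw[OF pw_L2])
    also have "\<dots> = (\<Sum>i\<in>{1..<N}. ioint (x i) (x (i + 1)) (\<lambda>y. poly (?d i) y * poly (\<sigma> i) y))"
      by (intro sum.cong refl ioint_cong) (use pw_elem in \<open>auto simp: mult.commute\<close>)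
    also have "\<dots> = (\<Sum>i\<in>{1..<N}. - ioint (x i) (x (i + 1)) (\<lambda>y. poly (?v i) y * poly (pderiv (\<sigma> i)) y)
        + (nodal_value v (i + 1) * poly (\<sigma> i) (x (i + 1)) - nodal_value v i * poly (\<sigma> i) (x i)))"
    proof (intro sum.cong refl)
      fix i assume i: "i \<in> {1..<N}"
      show "ioint (x i) (x (i + 1)) (\<lambda>y. poly (?d i) y * poly (\<sigma> i) y)
        = - ioint (x i) (x (i + 1)) (\<lambda>y. poly (?v i) y * poly (pderiv (\<sigma> i)) y)
        + (nodal_value v (i + 1) * poly (\<sigma> i) (x (i + 1)) - nodal_value v i * poly (\<sigma> i) (x i))"
        unfolding weak_derivative_spec(2)[OF elem_less[OF i] deg[OF i]] by simp
    qed
    finally have sum: "ioint 0 1 (\<lambda>y. pw \<sigma> y * pw ?d y) = \<dots>" .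
    have "ioint 0 1 (\<lambda>y. (pw dU y + pw ?U y * pw ?D y / 3) * pw ?v y)
        = ioint 0 1 (\<lambda>y. pw dU y * pw ?v y + 1/3 * (pw ?U y * pw ?D y * pw ?v y))"
      by (rule ioint_cong) (simp add: algebra_simps)
    also have "\<dots> = ioint 0 1 (\<lambda>y. pw dU y * pw ?v y) + 1/3 * ioint 0 1 (\<lambda>y. pw ?U y * pw ?D y * pw ?v y)"
      using Ui[of ?U ?D ?v] L2_on_mult_integrable[OF pw_L2[of dU] pw_L2[of ?v]] by simp
    finally show ?thesis using eq[OF v] unfolding e1 e2 e3 e4 sum[symmetric] s by simp
  qed
  have cont: "continuous_pw \<sigma>"
    unfolding continuous_pw_def
  proof (intro allI impI)
    fix i assume i: "1 \<le> i" "i + 1 < N"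
    \<comment> \<open>A weak function whose only nonzero datum is the value 1 at an interior node
      reduces the scheme to the jump of \<sigma> there.\<close>
    define c where "c = (\<lambda>j. if j = i + 1 then 1 else (0::real))"
    define v where "v = Weak_Fun (\<lambda>_. 0) c"
    have v: "v \<in> S_h0 k N" using i by (auto simp: v_def c_def S_h0_def S_h_def)
    have "(\<Sum>j\<in>{1..<N}. c (j + 1) * poly (\<sigma> j) (x (j + 1)) - c j * poly (\<sigma> j) (x j)) = 0"
      using scheme[OF v] by (simp add: v_def pw_def)
    moreover have "(\<Sum>j\<in>{1..<N}. c (j + 1) * poly (\<sigma> j) (x (j + 1))) = (\<Sum>j\<in>{1..<N}. if j = i then poly (\<sigma> i) (x (i + 1)) else 0)"
      by (intro sum.cong) (auto simp: c_def)
    moreover have "(\<Sum>j\<in>{1..<N}. c j * poly (\<sigma> j) (x j)) = (\<Sum>j\<in>{1..<N}. if j = i + 1 then poly (\<sigma> (i + 1)) (x (i + 1)) else 0)"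
      by (intro sum.cong) (auto simp: c_def)
    ultimately show "poly (\<sigma> i) (x (i + 1)) = poly (\<sigma> (i + 1)) (x (i + 1))"
      using i by (simp add: sum_subtractf)
  qed
  have F3: "ioint 0 1 (\<lambda>y. (pw dU y - pw (\<lambda>i. pderiv (\<sigma> i)) y + pw ?U y * pw ?D y / 3) * pw q y) = 0"
    if q: "\<And>i. i \<in> {1..<N} \<Longrightarrow> degree (q i) \<le> k" for q
  proof -
    \<comment> \<open>With vanishing nodal values only the interior part of the test function is
      left, and the derivative of \<sigma> appears.\<close>
    define v where "v = Weak_Fun q (\<lambda>_. 0)"
    have v: "v \<in> S_h0 k N" using q by (auto simp: v_def S_h0_def S_h_def)
    have "(\<Sum>i\<in>{1..<N}. ioint (x i) (x (i + 1)) (\<lambda>y. poly (q i) y * poly (pderiv (\<sigma> i)) y)) = ioint 0 1 (\<lambda>y. pw (\<lambda>i. pderiv (\<sigma> i)) y * pw q y)"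
      unfolding ioint_pw[OF pw_L2] by (intro sum.cong refl ioint_cong) (use pw_elem in \<open>auto simp: mult.commute\<close>)
    then have 1: "ioint 0 1 (\<lambda>y. (pw dU y + pw ?U y * pw ?D y / 3) * pw q y) - ioint 0 1 (\<lambda>y. pw (\<lambda>i. pderiv (\<sigma> i)) y * pw q y) = 0"
      using scheme[OF v] by (simp add: v_def sum_negf)
    have "(\<lambda>y. pw dU y + pw ?U y * pw ?D y / 3) \<in> L2"
      using L2_on_add[OF pw_L2[of dU] L2_on_cmult[OF pw_mult_L2[OF pw_L2[of ?D], of ?U], of "1/3"]] by simp
    from L2_on_mult_integrable[OF this pw_L2[of q]] 1
    have "ioint 0 1 (\<lambda>y. (pw dU y + pw ?U y * pw ?D y / 3) * pw q y - pw (\<lambda>i. pderiv (\<sigma> i)) y * pw q y) = 0"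
      using L2_on_mult_integrable[OF pw_L2[of "\<lambda>i. pderiv (\<sigma> i)"] pw_L2[of q]] by simp
    then show ?thesis by (simp add: algebra_simps)
  qed
  show ?thesis using that[OF deg cont _ F3] orth unfolding f_def by blast
qed

end

section \<open>Inner products and the error identities\<close>

abbreviation ip :: "(real \<Rightarrow> real) \<Rightarrow> (real \<Rightarrow> real) \<Rightarrow> real" where
  "ip f g \<equiv> ioint 0 1 (\<lambda>y. f y * g y)"

lemma ip_add: "f \<in> L2 \<Longrightarrow> g \<in> L2 \<Longrightarrow> h \<in> L2 \<Longrightarrow> ip (\<lambda>y. f y + g y) h = ip f h + ip g h"
  using L2_on_mult_integrable[of f _ h] L2_on_mult_integrable[of g _ h] by (simp add: distrib_right)

lemma ip_diff: "f \<in> L2 \<Longrightarrow> g \<in> L2 \<Longrightarrow> h \<in> L2 \<Longrightarrow> ip (\<lambda>y. f y - g y) h = ip f h - ip g h"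
  using L2_on_mult_integrable[of f _ h] L2_on_mult_integrable[of g _ h] by (simp add: left_diff_distrib)

lemma ip_cmult: "ip (\<lambda>y. c * f y) h = c * ip f h"
  by (simp add: mult.assoc)

lemma ip_commute: "ip f g = ip g f"
  by (simp add: mult.commute)

lemma l2norm_bounded_mult:
  assumes "f \<in> L2" "g \<in> borel_measurable (lebesgue_on {0<..<1})" "\<And>y. 0 < y \<Longrightarrow> y < 1 \<Longrightarrow> \<bar>g y\<bar> \<le> B" "0 \<le> B"
  shows "(\<lambda>y. g y * f y) \<in> L2" "l2norm (\<lambda>y. g y * f y) \<le> B * l2norm f"
proof -
  have m: "(\<lambda>y. g y * f y) \<in> borel_measurable (lebesgue_on {0<..<1})" using assms(1,2) L2_onD(1) by auto
  have le: "\<bar>g y * f y\<bar> \<le> B * \<bar>f y\<bar>" if "0 < y" "y < 1" for y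
    using mult_right_mono[OF assms(3)[OF that], of "\<bar>f y\<bar>"] by (simp add: abs_mult)
  show "(\<lambda>y. g y * f y) \<in> L2" "l2norm (\<lambda>y. g y * f y) \<le> B * l2norm f"
    using l2norm_le_bounded[OF assms(1) m le assms(4)] by auto
qed

text \<open>The exact flux and its interpolant satisfy the same two relations as the discrete
  solution and its flux, with the interpolation error of the flux as the only defect in the first
  relation and none in the second, since the derivative of the interpolant is a projection.
  Subtraction gives the identities with \<open>tF\<close> as \<open>G\<close> minus the discrete
  flux.\<close>

lemma (in mesh) flux_identities:
  assumes P: "is_primitive 0 1 u v" "is_primitive 0 1 v (\<lambda>y. (w y + u y * v y) / \<nu>)" and w: "w \<in> L2" and \<nu>: "0 < \<nu>"
    and G: "is_interp k (\<lambda>y. \<nu> * v y - (u y)\<^sup>2 / 3) G"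
    and V: "V \<in> S_h0 k N"
    and eq: "\<And>v. v \<in> S_h0 k N \<Longrightarrow>
       inner_h N x (\<lambda>i. poly (dU i)) (\<lambda>i. poly (interior_part v i))
       + \<nu> * inner_h N x (\<lambda>i. poly (weak_derivative (k + 1) x V i)) (\<lambda>i. poly (weak_derivative (k + 1) x v i))
       + 1/3 * inner_h N x (\<lambda>i y. poly (interior_part V i) y * poly (weak_derivative (k + 1) x V i) y) (\<lambda>i. poly (interior_part v i))
       - 1/3 * inner_h N x (\<lambda>i y. poly (interior_part V i) y * poly (interior_part V i) y) (\<lambda>i. poly (weak_derivative (k + 1) x v i)) = 0"
  obtains tF where "\<And>i. i \<in> {1..<N} \<Longrightarrow> degree (tF i) \<le> k + 1" "continuous_pw tF"
    "\<And>q :: nat \<Rightarrow> real poly. (\<And>i. i \<in> {1..<N} \<Longrightarrow> degree (q i) \<le> k + 1) \<Longrightarrow>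
        \<nu> * ip (\<lambda>y. v y - pw (weak_derivative (k + 1) x V) y) (pw q)
        = ip (\<lambda>y. (\<nu> * v y - (u y)\<^sup>2 / 3 - pw G y) + pw tF y + ((u y)\<^sup>2 - (pw (interior_part V) y)\<^sup>2) / 3) (pw q)"
    "\<And>q :: nat \<Rightarrow> real poly. (\<And>i. i \<in> {1..<N} \<Longrightarrow> degree (q i) \<le> k) \<Longrightarrow>
        ip (\<lambda>y. w y - pw dU y) (pw q)
        = ip (\<lambda>y. pw (\<lambda>i. pderiv (tF i)) y - (u y * v y - pw (interior_part V) y * pw (weak_derivative (k + 1) x V) y) / 3) (pw q)"
proof -
  let ?U = "interior_part V" and ?D = "weak_derivative (k + 1) x V"
  obtain \<sigma> where \<sigma>: "\<And>i. i \<in> {1..<N} \<Longrightarrow> degree (\<sigma> i) \<le> k + 1" "continuous_pw \<sigma>"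
    "\<And>q :: nat \<Rightarrow> real poly. (\<And>i. i \<in> {1..<N} \<Longrightarrow> degree (q i) \<le> k + 1) \<Longrightarrow> ip (pw \<sigma>) (pw q)
        = ip (\<lambda>y. \<nu> * pw ?D y - (pw ?U y)\<^sup>2 / 3) (pw q)"
    "\<And>q :: nat \<Rightarrow> real poly. (\<And>i. i \<in> {1..<N} \<Longrightarrow> degree (q i) \<le> k) \<Longrightarrow> ip (\<lambda>y. pw dU y - pw (\<lambda>i. pderiv (\<sigma> i)) y
        + pw ?U y * pw ?D y / 3) (pw q) = 0"
    using scheme_flux[OF V eq] by blast
  define tF where "tF = (\<lambda>i. G i - \<sigma> i)"
  have uc: "continuous_on {0..1} u" and vc: "continuous_on {0..1} v"
    using is_primitive_continuous P by blast+
  have uvL: "u \<in> L2" "v \<in> L2" "(\<lambda>y. (u y)\<^sup>2 / 3) \<in> L2" "(\<lambda>y. u y * v y / 3) \<in> L2"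
    by (rule L2_on_continuous, intro continuous_intros uc vc, (simp; fail)?)+
  have UU: "(\<lambda>y. (pw ?U y)\<^sup>2 / 3) \<in> L2"
    using L2_on_cmult[OF pw_mult_L2[OF pw_L2[of ?U], of ?U], of "1/3"] by (simp add: power2_eq_square)
  have UD: "(\<lambda>y. pw ?U y * pw ?D y / 3) \<in> L2"
    using L2_on_cmult[OF pw_mult_L2[OF pw_L2[of ?D], of ?U], of "1/3"] by simp
  have tpw: "pw tF y = pw G y - pw \<sigma> y" for y by (simp add: tF_def pw_diff)
  have t'pw: "pw (\<lambda>i. pderiv (tF i)) y = pw (\<lambda>i. pderiv (G i)) y - pw (\<lambda>i. pderiv (\<sigma> i)) y" for y
    by (simp add: tF_def pderiv_diff pw_diff)
  show ?thesis
  proof (rule that[of tF])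
    show "degree (tF i) \<le> k + 1" if "i \<in> {1..<N}" for i
      unfolding tF_def by (rule degree_diff_le[OF is_interp_degree[OF G that] \<sigma>(1)[OF that]])
    have "continuous_pw G" using is_interp_continuous[OF G] by (auto simp: continuous_pw_def)
    then show "continuous_pw tF" unfolding tF_def by (rule continuous_pw_diff[OF _ \<sigma>(2)])
    fix q :: "nat \<Rightarrow> real poly" assume q: "\<And>i. i \<in> {1..<N} \<Longrightarrow> degree (q i) \<le> k + 1"
    have 1: "(\<lambda>y. \<nu> * v y - \<nu> * pw ?D y) \<in> L2" "(\<lambda>y. \<nu> * pw ?D y - (pw ?U y)\<^sup>2 / 3) \<in> L2"
      by (intro L2_on_diff L2_on_cmult uvL pw_L2 UU)+
    have "ip (\<lambda>y. (\<nu> * v y - (u y)\<^sup>2 / 3 - pw G y) + pw tF y + ((u y)\<^sup>2 - (pw ?U y)\<^sup>2) / 3) (pw q)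
        = ip (\<lambda>y. (\<nu> * v y - \<nu> * pw ?D y) + ((\<nu> * pw ?D y - (pw ?U y)\<^sup>2 / 3) - pw \<sigma> y)) (pw q)"
      by (rule ioint_cong) (simp add: tpw field_simps)
    also have "\<dots> = ip (\<lambda>y. \<nu> * v y - \<nu> * pw ?D y) (pw q)"
      unfolding ip_add[OF 1(1) L2_on_diff[OF 1(2) pw_L2] pw_L2] ip_diff[OF 1(2) pw_L2 pw_L2] using \<sigma>(3)[OF q] by simp
    also have "\<dots> = \<nu> * ip (\<lambda>y. v y - pw ?D y) (pw q)"
      unfolding ip_cmult[symmetric] by (rule ioint_cong) (simp add: algebra_simps)
    finally show "\<nu> * ip (\<lambda>y. v y - pw ?D y) (pw q)
        = ip (\<lambda>y. (\<nu> * v y - (u y)\<^sup>2 / 3 - pw G y) + pw tF y + ((u y)\<^sup>2 - (pw ?U y)\<^sup>2) / 3) (pw q)" by simp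
  next
    fix q :: "nat \<Rightarrow> real poly" assume q: "\<And>i. i \<in> {1..<N} \<Longrightarrow> degree (q i) \<le> k"
    \<comment> \<open>This is the derivative of \<nu> v - u^2/3: the equation gives \<nu> v' = w + u
      v, from which 2/3 u v is subtracted. The remaining third matches the third of the convection
      term in the scheme.\<close>
    define F' where "F' = (\<lambda>y. w y + u y * v y / 3)"
    have F': "F' \<in> L2" unfolding F'_def by (intro L2_on_add w uvL)
    have "is_primitive 0 1 (\<lambda>y. \<nu> * v y - 1/3 * (u y * u y)) (\<lambda>y. \<nu> * ((w y + u y * v y) / \<nu>) - 1/3 * (v y * u y + u y * v y))"
      by (intro is_primitive_diff is_primitive_cmult is_primitive_mult P)
    moreover have "(\<lambda>y. \<nu> * ((w y + u y * v y) / \<nu>) - 1/3 * (v y * u y + u y * v y)) = F'"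
      using \<nu> by (auto simp: F'_def field_simps)
    ultimately have PF: "is_primitive 0 1 (\<lambda>y. \<nu> * v y - (u y)\<^sup>2 / 3) F'" by (simp add: power2_eq_square)
    have G0: "ip (\<lambda>y. F' y - pw (\<lambda>i. pderiv (G i)) y) (pw q) = 0"
      by (rule is_proj_orth[OF is_interp_proj[OF G PF F'] F' q])
    have 1: "(\<lambda>y. F' y - pw (\<lambda>i. pderiv (G i)) y) \<in> L2"
        "(\<lambda>y. pw dU y - pw (\<lambda>i. pderiv (\<sigma> i)) y + pw ?U y * pw ?D y / 3) \<in> L2"
      by (intro L2_on_diff L2_on_add F' UD pw_L2)+
    have 2: "(\<lambda>y. pw (\<lambda>i. pderiv (tF i)) y - (u y * v y - pw ?U y * pw ?D y) / 3) \<in> L2"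
      unfolding diff_divide_distrib by (intro L2_on_diff pw_L2 uvL UD)
    have "ip (\<lambda>y. w y - pw dU y) (pw q)
        = ip (\<lambda>y. (pw (\<lambda>i. pderiv (tF i)) y - (u y * v y - pw ?U y * pw ?D y) / 3)
            + ((F' y - pw (\<lambda>i. pderiv (G i)) y) - (pw dU y - pw (\<lambda>i. pderiv (\<sigma> i)) y + pw ?U y * pw ?D y / 3))) (pw q)"
      by (rule ioint_cong) (simp add: t'pw F'_def field_simps)
    also have "\<dots> = ip (\<lambda>y. pw (\<lambda>i. pderiv (tF i)) y - (u y * v y - pw ?U y * pw ?D y) / 3) (pw q)"
      unfolding ip_add[OF 2 L2_on_diff[OF 1(1,2)] pw_L2] ip_diff[OF 1(1,2) pw_L2] G0 using \<sigma>(4)[OF q] by simp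
    finally show "ip (\<lambda>y. w y - pw dU y) (pw q)
        = ip (\<lambda>y. pw (\<lambda>i. pderiv (tF i)) y - (u y * v y - pw ?U y * pw ?D y) / 3) (pw q)" .
  qed
qed

definition err :: "(nat \<Rightarrow> real poly) \<Rightarrow> (nat \<Rightarrow> real poly) \<Rightarrow> nat \<Rightarrow> real poly" where
  "err p q = (\<lambda>i. p i - q i)"

definition (in mesh) wd :: "nat \<Rightarrow> weak_fun \<Rightarrow> nat \<Rightarrow> real poly" where
  "wd k V = weak_derivative (k + 1) x V"

lemma (in mesh) wd_degree: "i \<in> {1..<N} \<Longrightarrow> degree (wd k V i) \<le> k + 1"
  unfolding wd_def by (rule weak_derivative_spec(1), rule elem_less)

lemma (in mesh) wd_spec:
  "i \<in> {1..<N} \<Longrightarrow> degree q \<le> k + 1 \<Longrightarrow> ioint (x i) (x (i + 1)) (\<lambda>y. poly (wd k V i) y * poly q y) =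
      - ioint (x i) (x (i + 1)) (\<lambda>y. poly (interior_part V i) y * poly (pderiv q) y)
      + nodal_value V (i + 1) * poly q (x (i + 1)) - nodal_value V i * poly q (x i)"
  unfolding wd_def by (rule weak_derivative_spec(2), rule elem_less)

lemma (in mesh) pw_err: "pw (err p q) y = pw p y - pw q y"
  unfolding err_def by (rule pw_diff)

section \<open>Error estimates at a fixed time\<close>

text \<open>The constant \<open>A\<close> depends on the exact solution only, and \<open>H\<close> stands for $h^{k+1}$; for the
  zero solution every \<open>H\<close> is admissible. The functions \<open>v\<close> and \<open>w\<close> are $u_x$ and $u_t$, \<open>V\<close> is $u_h$ and \<open>dU\<close> is
  $(u_h^0)_t$. The flux error \<open>tF\<close> is the difference of the interpolant \<open>G\<close> of $\nu u_x - u^2/3$ and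
  the discrete flux.\<close>

locale wg_static = mesh +
  fixes k :: nat and \<nu> A H :: real and u v w :: "real \<Rightarrow> real" and V :: weak_fun
    and dU Pu Pv G tF :: "nat \<Rightarrow> real poly"
  assumes \<nu>: "0 < \<nu>" "\<nu> \<le> A" "1 \<le> A * \<nu>" and A1: "1 \<le> A" and H: "0 < H" "H \<le> 1"
    and prim: "is_primitive 0 1 u v" and vc: "continuous_on {0..1} v" and wL: "w \<in> L2"
    and u01: "u 0 = 0" "u 1 = 0"
    and Pu: "is_proj k u Pu" and Pv: "is_proj (k + 1) v Pv"
    and sup: "\<And>y. y \<in> {0..1} \<Longrightarrow> \<bar>u y\<bar> \<le> A" "\<And>y. y \<in> {0..1} \<Longrightarrow> \<bar>v y\<bar> \<le> A"
      "\<And>y. \<bar>pw Pu y\<bar> \<le> A" "\<And>y. \<bar>pw Pv y\<bar> \<le> A"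
    and approx: "l2norm (\<lambda>y. u y - pw Pu y) \<le> A * H" "l2norm (\<lambda>y. v y - pw Pv y) \<le> A * H"
      "l2norm (\<lambda>y. \<nu> * v y - (u y)\<^sup>2 / 3 - pw G y) \<le> A * H"
    and inverse: "\<And>a b p y. a < b \<Longrightarrow> degree p \<le> k \<Longrightarrow> y \<in> {a..b} \<Longrightarrow>
      \<bar>poly p y\<bar> \<le> A / sqrt (b - a) * sqrt (ioint a b (\<lambda>y. (poly p y)\<^sup>2))"
    and V: "V \<in> S_h0 k N" and dU: "\<And>i. i \<in> {1..<N} \<Longrightarrow> degree (dU i) \<le> k"
    and tF: "\<And>i. i \<in> {1..<N} \<Longrightarrow> degree (tF i) \<le> k + 1" "continuous_pw tF"
    and flux: "\<And>q. (\<And>i. i \<in> {1..<N} \<Longrightarrow> degree (q i) \<le> k + 1) \<Longrightarrow>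
        \<nu> * ip (\<lambda>y. v y - pw (wd k V) y) (pw q)
        = ip (\<lambda>y. (\<nu> * v y - (u y)\<^sup>2 / 3 - pw G y) + pw tF y + ((u y)\<^sup>2 - (pw (interior_part V) y)\<^sup>2) / 3) (pw q)"
    and evol: "\<And>q. (\<And>i. i \<in> {1..<N} \<Longrightarrow> degree (q i) \<le> k) \<Longrightarrow>
        ip (\<lambda>y. w y - pw dU y) (pw q)
        = ip (\<lambda>y. pw (\<lambda>i. pderiv (tF i)) y - (u y * v y - pw (interior_part V) y * pw (wd k V) y) / 3) (pw q)"
begin

abbreviation "eF \<equiv> err Pu (interior_part V)"
abbreviation "EF \<equiv> err Pv (wd k V)"

abbreviation "U \<equiv> pw (interior_part V)"
abbreviation "D \<equiv> pw (wd k V)"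
abbreviation "e \<equiv> pw eF"
abbreviation "E \<equiv> pw EF"
abbreviation "\<tau> \<equiv> pw tF"
abbreviation "\<tau>' \<equiv> pw (\<lambda>i. pderiv (tF i))"
abbreviation "\<psi> \<equiv> (\<lambda>y. \<nu> * v y - (u y)\<^sup>2 / 3 - pw G y)"
abbreviation "\<zeta> \<equiv> (\<lambda>y. u y - U y)"
abbreviation "S \<equiv> (\<lambda>y. (u y)\<^sup>2 - (U y)\<^sup>2)"
abbreviation "g \<equiv> (\<lambda>y. u y * v y - U y * D y)"

lemma uc: "continuous_on {0..1} u" by (rule is_primitive_continuous[OF prim])

lemma L2s: "u \<in> L2" "v \<in> L2" "\<zeta> \<in> L2" "S \<in> L2" "g \<in> L2" "\<psi> \<in> L2"
proof -
  show "u \<in> L2" "v \<in> L2" by (rule L2_on_continuous[OF uc], rule L2_on_continuous[OF vc])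
  have uu: "(\<lambda>y. (u y)\<^sup>2) \<in> L2" "(\<lambda>y. u y * v y) \<in> L2" "(\<lambda>y. \<nu> * v y - (u y)\<^sup>2 / 3) \<in> L2"
    by (rule L2_on_continuous, intro continuous_intros uc vc, (simp; fail)?)+
  have UU: "(\<lambda>y. (U y)\<^sup>2) \<in> L2" using pw_mult_L2[OF pw_L2[of "interior_part V"]] by (simp add: power2_eq_square)
  show "\<zeta> \<in> L2" by (rule L2_on_diff[OF \<open>u \<in> L2\<close> pw_L2])
  show "S \<in> L2" by (rule L2_on_diff[OF uu(1) UU])
  show "g \<in> L2" by (rule L2_on_diff[OF uu(2) pw_mult_L2[OF pw_L2]])
  show "\<psi> \<in> L2" by (rule L2_on_diff[OF uu(3) pw_L2])
qed

lemma degV: "i \<in> {1..<N} \<Longrightarrow> degree (interior_part V i) \<le> k"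
  using V by (auto simp: S_h0_def S_h_def)

lemma deg_eF: "i \<in> {1..<N} \<Longrightarrow> degree (eF i) \<le> k"
  unfolding err_def using Pu degV by (intro degree_diff_le) (auto simp: is_proj_def)

lemma deg_EF: "i \<in> {1..<N} \<Longrightarrow> degree (EF i) \<le> k + 1"
  unfolding err_def using Pv wd_degree by (intro degree_diff_le) (auto simp: is_proj_def)

lemma deg_tF': "i \<in> {1..<N} \<Longrightarrow> degree (pderiv (tF i)) \<le> k"
  using tF(1)[of i] by (simp add: degree_pderiv)

lemma e_eq: "e y = pw Pu y - U y" and E_eq: "E y = pw Pv y - D y"
  by (rule pw_err)+

lemma ip_\<zeta>: "(\<And>i. i \<in> {1..<N} \<Longrightarrow> degree (q i) \<le> k) \<Longrightarrow> ip \<zeta> (pw q) = ip e (pw q)"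
proof -
  assume q: "\<And>i. i \<in> {1..<N} \<Longrightarrow> degree (q i) \<le> k"
  have "ip \<zeta> (pw q) = ip (\<lambda>y. (u y - pw Pu y) + e y) (pw q)" by (rule ioint_cong) (simp add: e_eq)
  also have "\<dots> = ip (\<lambda>y. u y - pw Pu y) (pw q) + ip e (pw q)" by (rule ip_add[OF L2_minus_pw[OF L2s(1)] pw_L2 pw_L2])
  also have "ip (\<lambda>y. u y - pw Pu y) (pw q) = 0" by (rule is_proj_orth[OF Pu L2s(1)]) (rule q)
  finally show ?thesis by simp
qed

lemma ip_vD: "(\<And>i. i \<in> {1..<N} \<Longrightarrow> degree (q i) \<le> k + 1) \<Longrightarrow> ip (\<lambda>y. v y - D y) (pw q) = ip E (pw q)"
proof -
  assume q: "\<And>i. i \<in> {1..<N} \<Longrightarrow> degree (q i) \<le> k + 1"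
  have "ip (\<lambda>y. v y - D y) (pw q) = ip (\<lambda>y. (v y - pw Pv y) + E y) (pw q)" by (rule ioint_cong) (simp add: E_eq)
  also have "\<dots> = ip (\<lambda>y. v y - pw Pv y) (pw q) + ip E (pw q)" by (rule ip_add[OF L2_minus_pw[OF L2s(2)] pw_L2 pw_L2])
  also have "ip (\<lambda>y. v y - pw Pv y) (pw q) = 0" by (rule is_proj_orth[OF Pv L2s(2)]) (rule q)
  finally show ?thesis by simp
qed

text \<open>Green's formula for the exact and for the discrete solution are subtracted; the nodal
  errors do not occur because q is continuous.\<close>

lemma green_error:
  assumes "continuous_pw q" "\<And>i. i \<in> {1..<N} \<Longrightarrow> degree (q i) \<le> k + 1"
  shows "ip (\<lambda>y. v y - D y) (pw q) = - ip \<zeta> (pw (\<lambda>i. pderiv (q i)))"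
proof -
  have "ip D (pw q) = - ip U (pw (\<lambda>i. pderiv (q i)))" unfolding wd_def by (rule green_weak[OF V assms(1)]) (rule assms(2))
  then show ?thesis
    unfolding ip_diff[OF L2s(2) pw_L2 pw_L2] ip_diff[OF L2s(1) pw_L2 pw_L2] green[OF prim L2s(2) u01 assms(1)] by simp
qed

lemma l2_E: "ip E E = (l2norm E)\<^sup>2" and l2_e: "ip e e = (l2norm e)\<^sup>2" and l2_\<tau>': "ip \<tau>' \<tau>' = (l2norm \<tau>')\<^sup>2"
  by (simp_all only: l2norm_square, simp_all only: power2_eq_square)

lemma l2_\<zeta>: "l2norm \<zeta> \<le> A * H + l2norm e"
proof -
  have "\<zeta> = (\<lambda>y. (u y - pw Pu y) + e y)" by (simp add: e_eq)
  then have "l2norm \<zeta> \<le> l2norm (\<lambda>y. u y - pw Pu y) + l2norm e"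
    using l2norm_triangle[OF L2_minus_pw[OF L2s(1)] pw_L2, of Pu eF] by simp
  then show ?thesis using approx(1) by simp
qed

lemma flux_E: "\<nu> * (l2norm E)\<^sup>2 = ip (\<lambda>y. \<psi> y + \<tau> y + S y / 3) E"
  using flux[of EF, OF deg_EF] ip_vD[of EF, OF deg_EF] l2_E by simp

text \<open>Testing the evolution with \<open>e\<close> produces (\<tau>',e) = -(E,\<tau>), and the
  flux relation tested with \<open>E\<close> expresses (\<tau>,E) by the dissipation and consistency
  terms, so the flux error cancels altogether.\<close>

lemma flux_\<tau>: "ip (\<lambda>y. w y - pw dU y) e = - \<nu> * (l2norm E)\<^sup>2 + ip (\<lambda>y. \<psi> y + S y / 3) E - ip g e / 3"
proof -
  have S3: "(\<lambda>y. S y / 3) \<in> L2" using L2_on_cmult[OF L2s(4), of "1/3"] by simp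
  have g3: "(\<lambda>y. g y / 3) \<in> L2" using L2_on_cmult[OF L2s(5), of "1/3"] by simp
  have "ip (\<lambda>y. w y - pw dU y) e = ip (\<lambda>y. \<tau>' y - g y / 3) e" by (rule evol) (rule deg_eF)
  also have "\<dots> = ip \<tau>' e - ip (\<lambda>y. g y / 3) e" by (rule ip_diff[OF pw_L2 g3 pw_L2])
  finally have "ip (\<lambda>y. w y - pw dU y) e = ip \<tau>' e - ip (\<lambda>y. g y / 3) e" .
  moreover have "ip (\<lambda>y. g y / 3) e = ip g e / 3" using ip_cmult[of "1/3" g e] by simp
  moreover have "ip \<tau>' e = - ip E \<tau>"
    using green_error[OF tF(2,1)] ip_vD[of tF, OF tF(1)] ip_\<zeta>[of "\<lambda>i. pderiv (tF i)", OF deg_tF']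
    by (simp add: mult.commute)
  moreover have "\<nu> * (l2norm E)\<^sup>2 = ip (\<lambda>y. \<psi> y + S y / 3) E + ip \<tau> E"
  proof -
    have "ip (\<lambda>y. \<psi> y + \<tau> y + S y / 3) E = ip (\<lambda>y. (\<psi> y + S y / 3) + \<tau> y) E"
      by (rule ioint_cong) (simp add: algebra_simps)
    then show ?thesis unfolding flux_E ip_add[OF L2_on_add[OF L2s(6) S3] pw_L2 pw_L2] by simp
  qed
  moreover have "ip E \<tau> = ip \<tau> E" by (rule ip_commute)
  ultimately show ?thesis by simp
qed

text \<open>The weight \<nu>/6 lets three products with \<open>E\<close> be absorbed while half of
  the dissipation is kept. In the other weight, A^2 bounds c^2 and the third factor A stands for
  1/\<nu>.\<close>

lemma young1:
  assumes "\<bar>c\<bar> \<le> A"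
  shows "c * y * a \<le> \<nu> / 6 * a\<^sup>2 + 3/2 * A ^ 3 * y\<^sup>2"
proof -
  have "0 \<le> (\<nu> * a - 3 * (c * y))\<^sup>2" by simp
  then have "6 * \<nu> * (c * y * a) \<le> \<nu> * \<nu> * a\<^sup>2 + 9 * (c\<^sup>2 * y\<^sup>2)"
    by (simp add: power2_eq_square algebra_simps)
  also have "c\<^sup>2 * y\<^sup>2 \<le> (A * A) * y\<^sup>2"
    using power_mono[OF assms, of 2] by (intro mult_right_mono) (auto simp: power2_eq_square)
  also have "(A * A) * y\<^sup>2 \<le> (A * \<nu>) * ((A * A) * y\<^sup>2)"
    using mult_right_mono[OF \<nu>(3), of "(A * A) * y\<^sup>2"] by simp
  finally have "\<nu> * (6 * (c * y * a)) \<le> \<nu> * (\<nu> * a\<^sup>2 + 9 * (A ^ 3 * y\<^sup>2))"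
    by (simp add: algebra_simps power3_eq_cube)
  then have "6 * (c * y * a) \<le> \<nu> * a\<^sup>2 + 9 * (A ^ 3 * y\<^sup>2)" using \<nu>(1) by (simp only: mult_le_cancel_left_pos)
  then show ?thesis by simp
qed

text \<open>For products without \<open>E\<close>; the weak constant A^3 is chosen only to have the
  same power as in the estimate with dissipation.\<close>

lemma young2:
  assumes "\<bar>c\<bar> \<le> A"
  shows "c * y * z \<le> A ^ 3 / 2 * (y\<^sup>2 + z\<^sup>2)"
proof -
  have "A ^ 1 \<le> A ^ 3" by (rule power_increasing) (use A1 in auto)
  then have c: "\<bar>c\<bar> \<le> A ^ 3" using assms by simp
  have yz: "\<bar>y * z\<bar> \<le> (y\<^sup>2 + z\<^sup>2) / 2"
    using sum_squares_bound[of "\<bar>y\<bar>" "\<bar>z\<bar>"] by (simp add: abs_mult)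
  have "c * (y * z) \<le> \<bar>c\<bar> * \<bar>y * z\<bar>" by (metis abs_ge_self abs_mult)
  also have "\<dots> \<le> A ^ 3 * ((y\<^sup>2 + z\<^sup>2) / 2)" by (rule mult_mono[OF c yz]) (use A1 in auto)
  finally show ?thesis by (simp add: mult.assoc)
qed

lemma energy_static:
  "ip (\<lambda>y. w y - pw dU y) e \<le> - \<nu> / 2 * (l2norm E)\<^sup>2 + 12 * A ^ 5 * ((l2norm e)\<^sup>2 + H\<^sup>2)"
proof -
  have A3: "0 \<le> A ^ 3" using A1 by simp
  let ?\<eta> = "\<lambda>y. u y - pw Pu y" and ?\<rho> = "\<lambda>y. v y - pw Pv y"
  have S3: "(\<lambda>y. S y / 3) \<in> L2" using L2_on_cmult[OF L2s(4), of "1/3"] by simp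
  have pt: "- \<nu> * (E y * E y) + (\<psi> y + S y / 3) * E y - 1/3 * (g y * e y)
      \<le> - \<nu> / 2 * (E y)\<^sup>2 + 4 * A ^ 3 * ((e y)\<^sup>2 + (?\<eta> y)\<^sup>2 + (?\<rho> y)\<^sup>2 + (\<psi> y)\<^sup>2)" if y: "0 < y" "y < 1" for y
  proof -
    define a b n p s P where "a = E y" and "b = e y" and "n = ?\<eta> y" and "p = ?\<rho> y" and "s = \<psi> y" and "P = pw Pu y"
    have bd: "\<bar>u y\<bar> \<le> A" "\<bar>v y\<bar> \<le> A" "\<bar>P\<bar> \<le> A" "\<bar>pw Pv y\<bar> \<le> A"
      using sup(1)[of y] sup(2)[of y] sup(3)[of y] sup(4)[of y] y by (auto simp: P_def)
    have U: "U y = P - b" "u y = P + n" and D: "D y = v y - p - a"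
      by (auto simp: a_def b_def n_def p_def P_def e_eq E_eq)
    have c: "\<bar>(u y + P) / 3\<bar> \<le> A" "\<bar>P / 3\<bar> \<le> A" "\<bar>- v y / 3\<bar> \<le> A" "\<bar>(p - v y) / 3\<bar> \<le> A" "\<bar>- P / 3\<bar> \<le> A" "\<bar>1\<bar> \<le> A"
      using bd A1 by (auto simp: p_def)
    \<comment> \<open>The point of the antisymmetric form: all terms cubic in a, b, n cancel, and
      the remaining coefficients are values of u, v and of their projections, which are bounded by
      A. Hence no bound on the discrete solution is needed for the energy estimate.\<close>
    have "- \<nu> * (a * a) + (s + S y / 3) * a - 1/3 * (g y * b)
      = - \<nu> * a\<^sup>2 + 1 * s * a + ((u y + P) / 3) * n * a + (P / 3) * b * a
        + (- v y / 3) * n * b + ((p - v y) / 3) * b * b + (- P / 3) * p * b"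
      unfolding D U by (simp add: field_simps power2_eq_square)
    also have "\<dots> \<le> - \<nu> * a\<^sup>2 + (\<nu> / 6 * a\<^sup>2 + 3/2 * A ^ 3 * s\<^sup>2) + (\<nu> / 6 * a\<^sup>2 + 3/2 * A ^ 3 * n\<^sup>2)
        + (\<nu> / 6 * a\<^sup>2 + 3/2 * A ^ 3 * b\<^sup>2) + A ^ 3 / 2 * (n\<^sup>2 + b\<^sup>2) + A ^ 3 / 2 * (b\<^sup>2 + b\<^sup>2) + A ^ 3 / 2 * (p\<^sup>2 + b\<^sup>2)"
      by (intro add_mono order_refl young1 young2 c)
    also have "\<dots> = - \<nu> / 2 * a\<^sup>2 + A ^ 3 * (3/2 * s\<^sup>2 + 2 * n\<^sup>2 + 7/2 * b\<^sup>2 + 1/2 * p\<^sup>2)" by (simp add: field_simps)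
    also have "\<dots> \<le> - \<nu> / 2 * a\<^sup>2 + A ^ 3 * (4 * (b\<^sup>2 + n\<^sup>2 + p\<^sup>2 + s\<^sup>2))"
    proof (intro add_left_mono mult_left_mono[OF _ A3])
      show "3/2 * s\<^sup>2 + 2 * n\<^sup>2 + 7/2 * b\<^sup>2 + 1/2 * p\<^sup>2 \<le> 4 * (b\<^sup>2 + n\<^sup>2 + p\<^sup>2 + s\<^sup>2)"
      proof -
        have gen: "3/2 * s' + 2 * n' + 7/2 * b' + 1/2 * p' \<le> 4 * (b' + n' + p' + s')"
          if "0 \<le> s'" "0 \<le> n'" "0 \<le> b'" "0 \<le> p'" for s' n' b' p' :: real
          using that by simp
        show ?thesis by (rule gen) simp_all
      qed
    qed
    also have "A ^ 3 * (4 * (b\<^sup>2 + n\<^sup>2 + p\<^sup>2 + s\<^sup>2)) = 4 * A ^ 3 * (b\<^sup>2 + n\<^sup>2 + p\<^sup>2 + s\<^sup>2)" by simp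
    finally show ?thesis by (simp only: a_def b_def n_def p_def s_def)
  qed
  have i: "iointegrable 0 1 (\<lambda>y. E y * E y)" "iointegrable 0 1 (\<lambda>y. (\<psi> y + S y / 3) * E y)" "iointegrable 0 1 (\<lambda>y. g y * e y)"
    by (intro L2_on_mult_integrable L2_on_add L2s S3 pw_L2)+
  have j: "iointegrable 0 1 (\<lambda>y. (E y)\<^sup>2)" "iointegrable 0 1 (\<lambda>y. (e y)\<^sup>2)" "iointegrable 0 1 (\<lambda>y. (?\<eta> y)\<^sup>2)"
      "iointegrable 0 1 (\<lambda>y. (?\<rho> y)\<^sup>2)" "iointegrable 0 1 (\<lambda>y. (\<psi> y)\<^sup>2)"
    using L2_onD(2)[OF pw_L2] L2_onD(2)[OF L2_minus_pw[OF L2s(1)]] L2_onD(2)[OF L2_minus_pw[OF L2s(2)]] L2_onD(2)[OF L2s(6)] by auto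
  have "ip (\<lambda>y. w y - pw dU y) e = ioint 0 1 (\<lambda>y. - \<nu> * (E y * E y) + (\<psi> y + S y / 3) * E y - 1/3 * (g y * e y))"
    unfolding flux_\<tau> l2_E[symmetric] using i by simp
  also have "\<dots> \<le> ioint 0 1 (\<lambda>y. - \<nu> / 2 * (E y)\<^sup>2 + 4 * A ^ 3 * ((e y)\<^sup>2 + (?\<eta> y)\<^sup>2 + (?\<rho> y)\<^sup>2 + (\<psi> y)\<^sup>2))"
    by (rule ioint_mono[OF _ _ pt]) (use i j in auto)
  also have "\<dots> = - \<nu> / 2 * (l2norm E)\<^sup>2 + 4 * A ^ 3 * ((l2norm e)\<^sup>2 + (l2norm ?\<eta>)\<^sup>2 + (l2norm ?\<rho>)\<^sup>2 + (l2norm \<psi>)\<^sup>2)"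
    unfolding l2norm_square using j by simp
  also have "\<dots> \<le> - \<nu> / 2 * (l2norm E)\<^sup>2 + 4 * A ^ 3 * ((l2norm e)\<^sup>2 + (A * H)\<^sup>2 + (A * H)\<^sup>2 + (A * H)\<^sup>2)"
    by (intro add_mono order_refl mult_left_mono power_mono approx l2norm_nonneg) (use A3 in simp)
  also have "\<dots> \<le> - \<nu> / 2 * (l2norm E)\<^sup>2 + 4 * A ^ 3 * (3 * A\<^sup>2 * ((l2norm e)\<^sup>2 + H\<^sup>2))"
  proof (intro add_left_mono mult_left_mono)
    have "1 * (l2norm e)\<^sup>2 \<le> (3 * A\<^sup>2) * (l2norm e)\<^sup>2"
    proof (rule mult_right_mono)
      show "1 \<le> 3 * A\<^sup>2" using one_le_power[OF A1, of 2] by linarith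
    qed simp
    then show "(l2norm e)\<^sup>2 + (A * H)\<^sup>2 + (A * H)\<^sup>2 + (A * H)\<^sup>2 \<le> 3 * A\<^sup>2 * ((l2norm e)\<^sup>2 + H\<^sup>2)"
      by (simp add: power_mult_distrib algebra_simps)
  qed (use A3 in simp)
  also have "\<dots> = - \<nu> / 2 * (l2norm E)\<^sup>2 + 12 * A ^ 5 * ((l2norm e)\<^sup>2 + H\<^sup>2)"
    by (simp add: power_numeral_reduce algebra_simps)
  finally show ?thesis .
qed

text \<open>The nodal errors are primitives of \<open>Z\<close>, and testing with a primitive of \<open>e\<close> transfers their bound to \<open>e\<close>.\<close>

lemma sup_error:
  assumes Z: "Z \<in> L2" and eq: "\<And>q. (\<And>i. i \<in> {1..<N} \<Longrightarrow> degree (q i) \<le> k + 1) \<Longrightarrow> ip (\<lambda>y. v y - D y) (pw q) = ip Z (pw q)"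
  shows "\<bar>e y\<bar> \<le> 2 * A * ioint 0 1 (\<lambda>y. \<bar>Z y\<bar>)"
proof -
  define z where "z = ioint 0 1 (\<lambda>y. \<bar>Z y\<bar>)"
  have z0: "0 \<le> z" unfolding z_def by (rule ioint_nonneg) simp
  have Zi: "iointegrable 0 1 Z" "iointegrable 0 1 (\<lambda>y. \<bar>Z y\<bar>)" using L2_on_integrable[OF Z] by auto
  define \<epsilon> where "\<epsilon> = (\<lambda>i. u (x i) - nodal_value V i)"
  have el: "- ioint (x i) (x (i + 1)) (\<lambda>y. \<zeta> y * poly (pderiv q) y) + \<epsilon> (i + 1) * poly q (x (i + 1)) - \<epsilon> i * poly q (x i)
      = ioint (x i) (x (i + 1)) (\<lambda>y. Z y * poly q y)" if i: "i \<in> {1..<N}" and q: "degree q \<le> k + 1" for i q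
  proof -
    \<comment> \<open>The test polynomials need not be continuous, so the identity can be localised
      to one element.\<close>
    let ?q = "\<lambda>j. if j = i then q else 0"
    have s: "ip f (pw ?q) = ioint (x i) (x (i + 1)) (\<lambda>y. f y * poly q y)" if f: "f \<in> L2" for f
    proof -
      have "ip f (pw ?q) = (\<Sum>j\<in>{1..<N}. if j = i then ioint (x i) (x (i + 1)) (\<lambda>y. f y * poly q y) else 0)"
        unfolding ioint_pw[OF f] by (intro sum.cong) auto
      then show ?thesis using i by simp
    qed
    have "ioint (x i) (x (i + 1)) (\<lambda>y. Z y * poly q y) = ioint (x i) (x (i + 1)) (\<lambda>y. (v y - D y) * poly q y)"
      using eq[of ?q] q unfolding s[OF Z] s[OF L2_minus_pw[OF L2s(2)]] by simp
    also have "\<dots> = ioint (x i) (x (i + 1)) (\<lambda>y. v y * poly q y - poly (wd k V i) y * poly q y)"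
      by (rule ioint_cong) (use pw_elem[OF i] in \<open>auto simp: left_diff_distrib\<close>)
    also have "\<dots> = ioint (x i) (x (i + 1)) (\<lambda>y. v y * poly q y) - ioint (x i) (x (i + 1)) (\<lambda>y. poly (wd k V i) y * poly q y)"
      by (rule Bochner_Integration.integral_diff[OF L2_on_mult_integrable[OF L2_elem[OF L2s(2) i] poly_L2] poly_iointegrable])
    also have "\<dots> = - (ioint (x i) (x (i + 1)) (\<lambda>y. u y * poly (pderiv q) y) - ioint (x i) (x (i + 1)) (\<lambda>y. poly (interior_part V i) y * poly (pderiv q) y))
        + \<epsilon> (i + 1) * poly q (x (i + 1)) - \<epsilon> i * poly q (x i)"
      unfolding green_elem[OF prim i] wd_spec[OF i q] by (simp add: \<epsilon>_def algebra_simps)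
    also have "ioint (x i) (x (i + 1)) (\<lambda>y. u y * poly (pderiv q) y) - ioint (x i) (x (i + 1)) (\<lambda>y. poly (interior_part V i) y * poly (pderiv q) y)
        = ioint (x i) (x (i + 1)) (\<lambda>y. u y * poly (pderiv q) y - poly (interior_part V i) y * poly (pderiv q) y)"
      by (rule Bochner_Integration.integral_diff[OF L2_on_mult_integrable[OF L2_elem[OF L2s(1) i] poly_L2] poly_iointegrable, symmetric])
    also have "\<dots> = ioint (x i) (x (i + 1)) (\<lambda>y. \<zeta> y * poly (pderiv q) y)"
      by (rule ioint_cong) (use pw_elem[OF i] in \<open>auto simp: left_diff_distrib\<close>)
    finally show ?thesis by simp
  qed
  have "\<epsilon> n = ioint 0 (x n) Z" if "1 \<le> n" "n \<le> N" for n
    using that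
  proof (induction n rule: dec_induct)
    case base
    show ?case using u01(1) V by (simp add: \<epsilon>_def S_h0_def)
  next
    case (step n)
    have n: "n \<in> {1..<N}" using step by auto
    have "ioint 0 (x (Suc n)) Z = ioint 0 (x n) Z + ioint (x n) (x (Suc n)) Z"
      by (rule ioint_combine[OF iointegrable_subinterval[OF Zi(1)]])
         (use n node_bounds[of n] node_bounds[of "Suc n"] elem_less[of n] in auto)
    then show ?case using el[OF n, of 1] step by simp
  qed
  then have \<epsilon>: "\<bar>\<epsilon> n\<bar> \<le> z" if "1 \<le> n" "n \<le> N" for n
    using order_trans[OF abs_ioint_le ioint_mono_interval[OF Zi(2), of 0 "x n"]] node_bounds[OF that] that by (simp add: z_def)
  show ?thesis
    unfolding z_def[symmetric]
  proof (rule pw_le)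
    fix i y assume i: "i \<in> {1..<N}" and y: "y \<in> element x i"
    let ?a = "x i" and ?b = "x (i + 1)"
    have ab: "?a < ?b" by (rule elem_less[OF i])
    obtain P where P: "pderiv P = eF i" "poly_lt (Suc (Suc k)) P"
      using poly_antiderivative[of "Suc k" "eF i"] deg_eF[OF i] by (auto simp: poly_lt_Suc)
    define q where "q = P + [:- poly P ?a:]"
    have q: "pderiv q = eF i" "poly q ?a = 0" by (auto simp: q_def pderiv_add P(1) pderiv_pCons)
    have dq: "degree q \<le> k + 1" using P(2) unfolding q_def poly_lt_Suc by (intro degree_add_le) auto
    define s where "s = sqrt (ioint ?a ?b (\<lambda>y. (poly (eF i) y)\<^sup>2))"
    have s0: "0 \<le> s" unfolding s_def by (auto intro!: ioint_nonneg)
    have qs: "\<bar>poly q y\<bar> \<le> sqrt (?b - ?a) * s" if "y \<in> {?a..?b}" for y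
      using ioint_square_primitive_le(1)[OF is_primitive_poly[of ?a ?b q] q(2) _ _ that] ab unfolding q(1) s_def by simp
    have "ioint ?a ?b (\<lambda>y. \<zeta> y * poly (eF i) y) = s\<^sup>2"
    proof -
      have o: "ioint ?a ?b (\<lambda>y. (u y - poly (Pu i) y) * poly (eF i) y) = 0"
        using Pu i deg_eF[OF i] by (simp add: is_proj_def)
      have "ioint ?a ?b (\<lambda>y. \<zeta> y * poly (eF i) y) = ioint ?a ?b (\<lambda>y. (u y - poly (Pu i) y) * poly (eF i) y + (poly (eF i) y)\<^sup>2)"
        by (rule ioint_cong) (use pw_elem[OF i] in \<open>auto simp: err_def power2_eq_square algebra_simps\<close>)
      also have "\<dots> = ioint ?a ?b (\<lambda>y. (poly (eF i) y)\<^sup>2)"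
        using L2_on_mult_integrable[OF L2_on_diff[OF L2_elem[OF L2s(1) i] poly_L2] poly_L2] L2_onD(2)[OF poly_L2] o by simp
      also have "\<dots> = s\<^sup>2" unfolding s_def by (intro real_sqrt_pow2[symmetric] ioint_nonneg) simp
      finally show ?thesis .
    qed
    then have s2: "s\<^sup>2 = \<epsilon> (i + 1) * poly q ?b - ioint ?a ?b (\<lambda>y. Z y * poly q y)"
      using el[OF i dq] q by simp
    have "\<bar>ioint ?a ?b (\<lambda>y. Z y * poly q y)\<bar> \<le> ioint ?a ?b (\<lambda>y. \<bar>Z y * poly q y\<bar>)" by (rule abs_ioint_le)
    also have "\<dots> \<le> ioint ?a ?b (\<lambda>y. (sqrt (?b - ?a) * s) * \<bar>Z y\<bar>)"
    proof (rule ioint_mono)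
      show "iointegrable ?a ?b (\<lambda>y. \<bar>Z y * poly q y\<bar>)" using L2_on_mult_integrable[OF L2_elem[OF Z i] poly_L2] by simp
      show "iointegrable ?a ?b (\<lambda>y. (sqrt (?b - ?a) * s) * \<bar>Z y\<bar>)" using L2_on_integrable[OF L2_elem[OF Z i]] by simp
      fix y assume "?a < y" "y < ?b"
      then show "\<bar>Z y * poly q y\<bar> \<le> (sqrt (?b - ?a) * s) * \<bar>Z y\<bar>"
        using mult_left_mono[OF qs, of y "\<bar>Z y\<bar>"] by (simp add: abs_mult mult.commute)
    qed
    also have "\<dots> = (sqrt (?b - ?a) * s) * ioint ?a ?b (\<lambda>y. \<bar>Z y\<bar>)" by simp
    also have "\<dots> \<le> (sqrt (?b - ?a) * s) * z"
      unfolding z_def using s0 ab elem_bounds[OF i]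
      by (intro mult_left_mono ioint_mono_interval[OF Zi(2)]) auto
    finally have 1: "\<bar>ioint ?a ?b (\<lambda>y. Z y * poly q y)\<bar> \<le> (sqrt (?b - ?a) * s) * z" .
    have "\<bar>\<epsilon> (i + 1) * poly q ?b\<bar> \<le> z * (sqrt (?b - ?a) * s)"
      unfolding abs_mult using \<epsilon>[of "i + 1"] qs[of ?b] i ab z0 by (intro mult_mono) auto
    then have "s * s \<le> (2 * z * sqrt (?b - ?a)) * s"
      using s2 1 by (simp add: power2_eq_square algebra_simps)
    \<comment> \<open>The norm of \<open>e\<close> on an element of length b - a is at most a
      multiple of sqrt(b - a), which balances the inverse estimate exactly; no power of the mesh
      size is lost, however the mesh is graded.\<close>
    then have s: "s \<le> 2 * z * sqrt (?b - ?a)"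
      using s0 z0 ab by (cases "s = 0") (auto simp: mult_le_cancel_right)
    have "\<bar>poly (eF i) y\<bar> \<le> A / sqrt (?b - ?a) * s"
      unfolding s_def by (rule inverse[OF ab deg_eF[OF i]]) (use y in auto)
    also have "\<dots> \<le> A / sqrt (?b - ?a) * (2 * z * sqrt (?b - ?a))"
      using A1 ab by (intro mult_left_mono[OF s]) auto
    also have "\<dots> = 2 * A * z" using ab by simp
    finally show "\<bar>poly (eF i) y\<bar> \<le> 2 * A * z" .
  qed (use A1 z0 in simp)
qed

text \<open>A discrete Sobolev inequality: it serves to bound the discrete solution pointwise by a
  quantity whose square is controlled in time by the energy estimate.\<close>

lemma sup_e_E: "\<bar>e y\<bar> \<le> 2 * A * l2norm E"
proof -
  have "\<bar>e y\<bar> \<le> 2 * A * ioint 0 1 (\<lambda>y. \<bar>E y\<bar>)" by (rule sup_error[OF pw_L2 ip_vD])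
  also have "\<dots> \<le> 2 * A * l2norm E" using A1 by (intro mult_left_mono ioint_abs_le_l2norm pw_L2) auto
  finally show ?thesis .
qed

lemma sup_U: "\<bar>U y\<bar> \<le> A * (1 + 2 * l2norm E)"
  using sup(3)[of y] sup_e_E[of y] e_eq[of y] by (simp add: algebra_simps)

lemma evol_le:
  assumes q: "\<And>i. i \<in> {1..<N} \<Longrightarrow> degree (q i) \<le> k"
  shows "\<bar>ip (\<lambda>y. w y - pw dU y) (pw q)\<bar> \<le> (l2norm \<tau>' + l2norm g / 3) * l2norm (pw q)"
proof -
  have g3: "(\<lambda>y. g y / 3) \<in> L2" using L2_on_cmult[OF L2s(5), of "1/3"] by simp
  have n: "l2norm (\<lambda>y. g y / 3) = l2norm g / 3" using l2norm_cmult[of "1/3" g] by simp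
  have "ip (\<lambda>y. w y - pw dU y) (pw q) = ip (\<lambda>y. \<tau>' y - g y / 3) (pw q)" by (rule evol) (rule q)
  also have "\<dots> = ip \<tau>' (pw q) - ip (\<lambda>y. g y / 3) (pw q)" by (rule ip_diff[OF pw_L2 g3 pw_L2])
  finally have "ip (\<lambda>y. w y - pw dU y) (pw q) = ip \<tau>' (pw q) - ip (\<lambda>y. g y / 3) (pw q)" .
  then show ?thesis
    using ioint_le_l2norm[OF pw_L2[of "\<lambda>i. pderiv (tF i)"] pw_L2[of q]] ioint_le_l2norm[OF g3 pw_L2[of q], unfolded n]
    unfolding distrib_right by linarith
qed

text \<open>The derivative of the flux error has degree k and is thus an admissible test function;
  this is the source of the dissipation in the estimate of the flux error.\<close>

lemma evol_\<tau>': "ip (\<lambda>y. w y - pw dU y) \<tau>' \<ge> (l2norm \<tau>')\<^sup>2 - l2norm g / 3 * l2norm \<tau>'"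
proof -
  have g3: "(\<lambda>y. g y / 3) \<in> L2" using L2_on_cmult[OF L2s(5), of "1/3"] by simp
  have n: "l2norm (\<lambda>y. g y / 3) = l2norm g / 3" using l2norm_cmult[of "1/3" g] by simp
  have "ip (\<lambda>y. w y - pw dU y) \<tau>' = ip (\<lambda>y. \<tau>' y - g y / 3) \<tau>'" by (rule evol) (rule deg_tF')
  also have "\<dots> = ip \<tau>' \<tau>' - ip (\<lambda>y. g y / 3) \<tau>'" by (rule ip_diff[OF pw_L2 g3 pw_L2])
  finally have "ip (\<lambda>y. w y - pw dU y) \<tau>' = ip \<tau>' \<tau>' - ip (\<lambda>y. g y / 3) \<tau>'" .
  then show ?thesis
    using ioint_le_l2norm[OF g3 pw_L2[of "\<lambda>i. pderiv (tF i)"], unfolded n] l2_\<tau>' by linarith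
qed

text \<open>For continuous q the discrete derivative is eliminated. Every term on the right then
  depends on time only through the exact solution and the interior part, whose behaviour in time is
  known.\<close>

lemma flux_\<tau>_test:
  assumes "continuous_pw q" "\<And>i. i \<in> {1..<N} \<Longrightarrow> degree (q i) \<le> k + 1"
  shows "ip \<tau> (pw q) = - ip \<psi> (pw q) - \<nu> * ip \<zeta> (pw (\<lambda>i. pderiv (q i))) - ip S (pw q) / 3"
proof -
  have S3: "(\<lambda>y. S y / 3) \<in> L2" using L2_on_cmult[OF L2s(4), of "1/3"] by simp
  have "ip (\<lambda>y. \<psi> y + \<tau> y + S y / 3) (pw q) = ip \<psi> (pw q) + ip \<tau> (pw q) + ip (\<lambda>y. S y / 3) (pw q)"
    unfolding ip_add[OF L2_on_add[OF L2s(6) pw_L2] S3 pw_L2] ip_add[OF L2s(6) pw_L2 pw_L2] by simp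
  moreover have "ip (\<lambda>y. S y / 3) (pw q) = ip S (pw q) / 3" using ip_cmult[of "1/3" S "pw q"] by simp
  ultimately show ?thesis using flux[of q, OF assms(2)] green_error[OF assms] by simp
qed

text \<open>The parameter c is the constant of the estimate e = O(H). In \<open>C1\<close>, 2 A
  comes from \<open>sup_error\<close> and another A from 1/\<nu>; A + 1 accounts for \<psi> and
  \<tau>, and the product for S. \<open>C2\<close> arises in the same way, with the pointwise bound
  by \<open>C1\<close> inserted into S.\<close>

definition C1 where "C1 c = 2 * A\<^sup>2 * (A + 1 + (3 * A + c) * (A + c))"
definition C2 where "C2 c = A * (A + 1 + (A + c) * (2 * A + C1 c))"

context
  fixes c :: real
  assumes c: "1 \<le> c" and e_le: "l2norm e \<le> c * H"
begin

lemma C_pos: "0 \<le> C1 c" "0 \<le> C2 c"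
  using A1 c unfolding C1_def C2_def by (auto intro!: mult_nonneg_nonneg add_nonneg_nonneg)

lemma \<zeta>_le: "l2norm \<zeta> \<le> (A + c) * H"
  using l2_\<zeta> e_le by (simp add: algebra_simps)

text \<open>\<open>sup_error\<close> asks only for the L1 norm of the right-hand side. In L1 the
  quadratic part of S = 2 u \<zeta> - \<zeta>^2 is the square of the L2 norm of \<zeta>, so that no
  pointwise bound on the discrete solution has to be known beforehand; H \<le> 1 makes the square
  linear in H.\<close>

lemma sup_e_\<tau>: "\<bar>e y\<bar> \<le> C1 c * (l2norm \<tau> + H)"
proof -
  have S3: "(\<lambda>y. S y / 3) \<in> L2" using L2_on_cmult[OF L2s(4), of "1/3"] by simp
  define Y where "Y = (\<lambda>y. \<psi> y + \<tau> y + S y / 3)"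
  have YL: "Y \<in> L2" unfolding Y_def by (intro L2_on_add L2s pw_L2 S3)
  define Z where "Z = (\<lambda>y. (1 / \<nu>) * Y y)"
  have ZL: "Z \<in> L2" unfolding Z_def by (rule L2_on_cmult[OF YL])
  have Ze: "ip (\<lambda>y. v y - D y) (pw q) = ip Z (pw q)" if "\<And>i. i \<in> {1..<N} \<Longrightarrow> degree (q i) \<le> k + 1" for q
  proof -
    have "\<nu> * ip (\<lambda>y. v y - D y) (pw q) = ip Y (pw q)" unfolding Y_def by (rule flux) (rule that)
    moreover have "ip Z (pw q) = (1 / \<nu>) * ip Y (pw q)" unfolding Z_def by (rule ip_cmult)
    moreover have "a = b" if "\<nu> * a = c'" "b = (1 / \<nu>) * c'" for a b c' :: real
      using that \<nu>(1) by (auto simp: field_simps)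
    ultimately show ?thesis by blast
  qed
  have \<zeta>2: "iointegrable 0 1 (\<lambda>y. (\<zeta> y)\<^sup>2)" by (rule L2_onD(2)[OF L2s(3)])
  have ai: "iointegrable 0 1 (\<lambda>y. \<bar>f y\<bar>)" if "f \<in> L2" for f using L2_on_integrable[OF that] by simp
  have "ioint 0 1 (\<lambda>y. \<bar>S y\<bar>) \<le> ioint 0 1 (\<lambda>y. 2 * A * \<bar>\<zeta> y\<bar> + (\<zeta> y)\<^sup>2)"
  proof (rule ioint_mono)
    fix y :: real assume y: "0 < y" "y < 1"
    have "S y = 2 * u y * \<zeta> y - (\<zeta> y)\<^sup>2" by (simp add: power2_eq_square algebra_simps)
    then have "\<bar>S y\<bar> \<le> \<bar>2 * u y * \<zeta> y\<bar> + (\<zeta> y)\<^sup>2" using abs_triangle_ineq4[of "2 * u y * \<zeta> y" "(\<zeta> y)\<^sup>2"] by simp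
    also have "\<bar>2 * u y * \<zeta> y\<bar> = 2 * \<bar>u y\<bar> * \<bar>\<zeta> y\<bar>" by (simp only: abs_mult abs_numeral)
    also have "\<dots> \<le> 2 * A * \<bar>\<zeta> y\<bar>" using mult_right_mono[OF sup(1)[of y], of "2 * \<bar>\<zeta> y\<bar>"] y by (simp add: mult.assoc mult.left_commute)
    finally show "\<bar>S y\<bar> \<le> 2 * A * \<bar>\<zeta> y\<bar> + (\<zeta> y)\<^sup>2" by simp
  qed (use ai[OF L2s(4)] ai[OF L2s(3)] \<zeta>2 in auto)
  also have "\<dots> = 2 * A * ioint 0 1 (\<lambda>y. \<bar>\<zeta> y\<bar>) + (l2norm \<zeta>)\<^sup>2"
    using ai[OF L2s(3)] \<zeta>2 by (simp add: l2norm_square)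
  also have "\<dots> \<le> 2 * A * l2norm \<zeta> + l2norm \<zeta> * l2norm \<zeta>"
    using A1 ioint_abs_le_l2norm[OF L2s(3)] by (simp add: power2_eq_square)
  also have "\<dots> = (2 * A + l2norm \<zeta>) * l2norm \<zeta>" by (simp add: algebra_simps)
  also have "\<dots> \<le> (2 * A + (A + c)) * ((A + c) * H)"
  proof (rule mult_mono)
    have "(A + c) * H \<le> (A + c) * 1" using H A1 c by (intro mult_left_mono) auto
    then show "2 * A + l2norm \<zeta> \<le> 2 * A + (A + c)" using \<zeta>_le by simp
  qed (use \<zeta>_le A1 c in auto)
  finally have Sle: "ioint 0 1 (\<lambda>y. \<bar>S y\<bar>) \<le> (3 * A + c) * (A + c) * H" by (simp add: algebra_simps)
  have "ioint 0 1 (\<lambda>y. \<bar>Y y\<bar>) \<le> ioint 0 1 (\<lambda>y. \<bar>\<psi> y\<bar> + \<bar>\<tau> y\<bar> + \<bar>S y\<bar>)"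
  proof (rule ioint_mono)
    have "\<bar>p + t + s / 3\<bar> \<le> \<bar>p\<bar> + \<bar>t\<bar> + \<bar>s\<bar>" for p t s :: real by (auto simp: abs_if)
    then show "\<bar>Y y\<bar> \<le> \<bar>\<psi> y\<bar> + \<bar>\<tau> y\<bar> + \<bar>S y\<bar>" for y unfolding Y_def by blast
  qed (use ai[OF YL] ai[OF L2s(6)] ai[OF pw_L2[of tF]] ai[OF L2s(4)] in auto)
  also have "\<dots> = ioint 0 1 (\<lambda>y. \<bar>\<psi> y\<bar>) + ioint 0 1 (\<lambda>y. \<bar>\<tau> y\<bar>) + ioint 0 1 (\<lambda>y. \<bar>S y\<bar>)"
    using ai[OF L2s(6)] ai[OF pw_L2[of tF]] ai[OF L2s(4)] by simp
  also have "\<dots> \<le> A * H + l2norm \<tau> + (3 * A + c) * (A + c) * H"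
    using ioint_abs_le_l2norm[OF L2s(6)] approx(3) ioint_abs_le_l2norm[OF pw_L2[of tF]] Sle by simp
  also have "\<dots> \<le> (A + 1 + (3 * A + c) * (A + c)) * (l2norm \<tau> + H)"
  proof -
    have "0 \<le> (A + (3 * A + c) * (A + c)) * l2norm \<tau>" using A1 c by (intro mult_nonneg_nonneg add_nonneg_nonneg) auto
    then show ?thesis using H by (simp add: algebra_simps)
  qed
  finally have Yle: "ioint 0 1 (\<lambda>y. \<bar>Y y\<bar>) \<le> (A + 1 + (3 * A + c) * (A + c)) * (l2norm \<tau> + H)" .
  have "ioint 0 1 (\<lambda>y. \<bar>Z y\<bar>) = (1 / \<nu>) * ioint 0 1 (\<lambda>y. \<bar>Y y\<bar>)" unfolding Z_def using \<nu>(1) by (simp add: abs_mult)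
  also have "\<dots> \<le> A * ((A + 1 + (3 * A + c) * (A + c)) * (l2norm \<tau> + H))"
    by (rule mult_mono[OF _ Yle]) (use \<nu> A1 in \<open>auto simp: field_simps intro!: ioint_nonneg\<close>)
  finally have "2 * A * ioint 0 1 (\<lambda>y. \<bar>Z y\<bar>) \<le> 2 * A * (A * ((A + 1 + (3 * A + c) * (A + c)) * (l2norm \<tau> + H)))"
    using A1 by (intro mult_left_mono) auto
  also have "\<dots> = C1 c * (l2norm \<tau> + H)" by (simp add: C1_def power2_eq_square)
  finally have "2 * A * ioint 0 1 (\<lambda>y. \<bar>Z y\<bar>) \<le> C1 c * (l2norm \<tau> + H)" .
  moreover have "\<bar>e y\<bar> \<le> 2 * A * ioint 0 1 (\<lambda>y. \<bar>Z y\<bar>)"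
    by (rule sup_error[OF ZL Ze])
  ultimately show ?thesis by linarith
qed

lemma S_le: "l2norm S \<le> (2 * A + b) * l2norm \<zeta>" if b: "\<And>y. \<bar>e y\<bar> \<le> b" for b
proof -
  have b0: "0 \<le> b" using b[of 0] by simp
  have "S = (\<lambda>y. (u y + U y) * \<zeta> y)" by (simp add: fun_eq_iff power2_eq_square algebra_simps)
  moreover have "l2norm (\<lambda>y. (u y + U y) * \<zeta> y) \<le> (2 * A + b) * l2norm \<zeta>"
  proof (rule l2norm_bounded_mult(2)[OF L2s(3)])
    show "(\<lambda>y. u y + U y) \<in> borel_measurable (lebesgue_on {0<..<1})"
      using continuous_on_measurable_Ioo[OF uc] by measurable
    fix y :: real assume "0 < y" "y < 1"
    then show "\<bar>u y + U y\<bar> \<le> 2 * A + b" using sup(1)[of y] sup(3)[of y] b[of y] e_eq[of y] by auto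
  qed (use A1 b0 in simp)
  ultimately show ?thesis by simp
qed

text \<open>The flux relation is tested with \<open>E\<close>. The pointwise bound on
  \<open>e\<close> just obtained makes S square integrable with a bound linear in ||\<tau>|| + H,
  because \<zeta> itself is O(H) and H \<le> 1.\<close>

lemma E_le: "l2norm E \<le> C2 c * (l2norm \<tau> + H)"
proof -
  define Y where "Y = (\<lambda>y. \<psi> y + \<tau> y + S y / 3)"
  have S3: "(\<lambda>y. S y / 3) \<in> L2" using L2_on_cmult[OF L2s(4), of "1/3"] by simp
  have "l2norm (\<lambda>y. S y / 3) = l2norm S / 3" using l2norm_cmult[of "1/3" S] by simp
  then have n: "l2norm (\<lambda>y. S y / 3) \<le> l2norm S" using l2norm_nonneg[of S] by linarith
  have YL: "Y \<in> L2" unfolding Y_def by (intro L2_on_add L2s pw_L2 S3)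
  have m: "0 \<le> l2norm \<tau> + H" using H by simp
  have "l2norm Y \<le> (l2norm \<psi> + l2norm \<tau>) + l2norm S"
    unfolding Y_def
    using l2norm_triangle[OF L2_on_add[OF L2s(6) pw_L2[of tF]] S3] l2norm_triangle[OF L2s(6) pw_L2[of tF]] n by simp
  also have "l2norm S \<le> (2 * A + C1 c * (l2norm \<tau> + H)) * ((A + c) * H)"
    by (rule order_trans[OF S_le[OF sup_e_\<tau>] mult_left_mono[OF \<zeta>_le]]) (use A1 C_pos m in simp)
  also have "\<dots> \<le> (A + c) * (2 * A + C1 c) * (l2norm \<tau> + H)"
  proof -
    have 1: "H * (2 * A) \<le> (l2norm \<tau> + H) * (2 * A)" using A1 by (intro mult_right_mono) auto
    have 2: "H * (C1 c * (l2norm \<tau> + H)) \<le> 1 * (C1 c * (l2norm \<tau> + H))" using H C_pos m by (intro mult_right_mono) auto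
    have "H * (2 * A + C1 c * (l2norm \<tau> + H)) \<le> (2 * A + C1 c) * (l2norm \<tau> + H)"
      using 1 2 by (simp add: algebra_simps)
    then have "(A + c) * (H * (2 * A + C1 c * (l2norm \<tau> + H))) \<le> (A + c) * ((2 * A + C1 c) * (l2norm \<tau> + H))"
      using A1 c by (intro mult_left_mono) auto
    then show ?thesis by (simp add: mult.assoc mult.left_commute mult.commute)
  qed
  also have "(l2norm \<psi> + l2norm \<tau>) + (A + c) * (2 * A + C1 c) * (l2norm \<tau> + H) \<le> (A + 1 + (A + c) * (2 * A + C1 c)) * (l2norm \<tau> + H)"
  proof -
    have "p + t + Q * (t + H) \<le> (A + 1 + Q) * (t + H)" if "p \<le> A * H" "0 \<le> t" for p t Q
    proof -
      have "(A + 1 + Q) * (t + H) = A * t + A * H + t + H + Q * (t + H)" by (simp add: algebra_simps)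
      moreover have "0 \<le> A * t" using A1 that(2) by simp
      ultimately show ?thesis using that H by linarith
    qed
    from this[OF approx(3)] show ?thesis by simp
  qed
  finally have Yle: "l2norm Y \<le> (A + 1 + (A + c) * (2 * A + C1 c)) * (l2norm \<tau> + H)" by simp
  have "\<nu> * (l2norm E)\<^sup>2 \<le> l2norm Y * l2norm E"
    unfolding flux_E using ioint_le_l2norm[OF YL pw_L2[of EF]] by (simp add: Y_def)
  then have "(A * \<nu>) * (l2norm E * l2norm E) \<le> A * (l2norm Y * l2norm E)"
    using A1 by (simp add: power2_eq_square mult.assoc mult_left_mono)
  moreover have "1 * (l2norm E * l2norm E) \<le> (A * \<nu>) * (l2norm E * l2norm E)" by (rule mult_right_mono[OF \<nu>(3)]) simp
  ultimately have "l2norm E * l2norm E \<le> (A * l2norm Y) * l2norm E" by simp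
  then have "l2norm E \<le> A * l2norm Y"
    using A1 l2norm_nonneg[of E] by (cases "l2norm E = 0") (auto simp: mult_le_cancel_right)
  also have "\<dots> \<le> A * ((A + 1 + (A + c) * (2 * A + C1 c)) * (l2norm \<tau> + H))" using A1 Yle by (intro mult_left_mono) auto
  finally show ?thesis by (simp add: C2_def mult.assoc)
qed

definition "C3 = 2 * A + c + C2 c"

text \<open>The factor \<open>U\<close> is kept as A(1 + 2 ||E||). Inserting the bound by the flux
  error here would make the later differential inequality superlinear in \<tau>. The summands of
  \<open>C3\<close> come from \<zeta>, from the projection error of v and from
  \<open>E\<close>.\<close>

lemma g_le: "l2norm g \<le> A * (1 + 2 * l2norm E) * (C3 * (l2norm \<tau> + H))"
proof -
  define X where "X = A * (1 + 2 * l2norm E)"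
  have X: "A \<le> X" using A1 mult_nonneg_nonneg[of A "l2norm E"] by (simp add: X_def algebra_simps)
  let ?\<rho> = "\<lambda>y. v y - pw Pv y"
  have RL: "(\<lambda>y. ?\<rho> y + E y) \<in> L2" by (intro L2_on_add L2_minus_pw L2s pw_L2)
  have eq: "g = (\<lambda>y. v y * \<zeta> y + U y * (?\<rho> y + E y))" by (simp add: fun_eq_iff E_eq algebra_simps)
  have 1: "(\<lambda>y. v y * \<zeta> y) \<in> L2" "l2norm (\<lambda>y. v y * \<zeta> y) \<le> A * l2norm \<zeta>"
    using l2norm_bounded_mult[OF L2s(3) continuous_on_measurable_Ioo[OF vc], of A] sup(2) A1 by auto
  have 2: "(\<lambda>y. U y * (?\<rho> y + E y)) \<in> L2" "l2norm (\<lambda>y. U y * (?\<rho> y + E y)) \<le> X * l2norm (\<lambda>y. ?\<rho> y + E y)"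
    using l2norm_bounded_mult[OF RL pw_measurable, of "interior_part V" X] sup_U X A1 by (auto simp: X_def)
  have "l2norm g \<le> A * l2norm \<zeta> + X * l2norm (\<lambda>y. ?\<rho> y + E y)"
    unfolding eq using l2norm_triangle[OF 1(1) 2(1)] 1(2) 2(2) by simp
  also have "\<dots> \<le> X * ((A + c) * H) + X * (A * H + C2 c * (l2norm \<tau> + H))"
  proof (rule add_mono)
    show "A * l2norm \<zeta> \<le> X * ((A + c) * H)" using \<zeta>_le X A1 by (intro mult_mono) auto
    show "X * l2norm (\<lambda>y. ?\<rho> y + E y) \<le> X * (A * H + C2 c * (l2norm \<tau> + H))"
      using l2norm_triangle[OF L2_minus_pw[OF L2s(2)] pw_L2, of Pv EF] approx(2) E_le X A1 by (intro mult_left_mono) auto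
  qed
  also have "\<dots> \<le> X * (C3 * (l2norm \<tau> + H))"
  proof -
    have "0 \<le> (2 * A + c) * l2norm \<tau>" using A1 c by simp
    then have "(A + c) * H + (A * H + C2 c * (l2norm \<tau> + H)) \<le> C3 * (l2norm \<tau> + H)" by (simp add: C3_def algebra_simps)
    then show ?thesis using X A1 unfolding distrib_left[symmetric] by (intro mult_left_mono) auto
  qed
  finally show ?thesis by (simp add: X_def)
qed

text \<open>The factor 2 A from Young's inequality times 8 A^2 from the square of A(1 + 2 ||E||)
  gives 16 A^3.\<close>

definition "C4 = 16 * A ^ 3 * (2 * C3\<^sup>2 + 1)"

text \<open>The second summand anticipates a term of the time difference of S: twice
  \<open>U\<close> times the increment of \<open>e\<close>, tested with \<tau>, where that increment
  is bounded per unit of time by ||\<tau>'|| + ||g||/3. The dissipation 2 \<nu> ||\<tau>'||^2 of the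
  first summand absorbs everything that contains \<tau>'.\<close>

lemma flux_energy_static:
  "- 2 * \<nu> * ip (\<lambda>y. w y - pw dU y) \<tau>' + 4/3 * (A * (1 + 2 * l2norm E)) * l2norm \<tau> * (l2norm \<tau>' + l2norm g / 3)
    \<le> C4 * (1 + (l2norm E)\<^sup>2) * ((l2norm \<tau>)\<^sup>2 + H\<^sup>2)"
proof -
  define X p q t where "X = A * (1 + 2 * l2norm E)" and "p = l2norm \<tau>'" and "q = l2norm g" and "t = l2norm \<tau>"
  have nn: "0 \<le> p" "0 \<le> q" "0 \<le> t" "0 \<le> X" using A1 by (auto simp: p_def q_def t_def X_def)
  have "- 2 * \<nu> * ip (\<lambda>y. w y - pw dU y) \<tau>' \<le> - 2 * \<nu> * (p\<^sup>2 - q / 3 * p)"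
    using mult_left_mono[OF evol_\<tau>', of "2 * \<nu>"] \<nu>(1) by (simp add: p_def q_def)
  moreover have "- 2 * \<nu> * (p\<^sup>2 - q / 3 * p) + 4/3 * X * t * (p + q / 3) \<le> 2 * A * (q\<^sup>2 + (X * t)\<^sup>2)"
  proof -
    have 1: "2 * \<nu> / 3 * (q * p) \<le> \<nu> * p\<^sup>2 + \<nu> * q\<^sup>2"
    proof -
      have "2 * (q * p) \<le> q\<^sup>2 + p\<^sup>2" using sum_squares_bound[of q p] by simp
      then have "2 / 3 * (q * p) \<le> p\<^sup>2 + q\<^sup>2" using zero_le_power2[of p] zero_le_power2[of q] by linarith
      from mult_left_mono[OF this, of \<nu>] show ?thesis using \<nu>(1) by (simp add: algebra_simps)
    qed
    have 2: "4/3 * ((X * t) * p) \<le> \<nu> * p\<^sup>2 + A * (X * t)\<^sup>2 / 2"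
    proof -
      have "0 \<le> (3 * \<nu> * p - 2 * (X * t))\<^sup>2" by simp
      then have "12 * \<nu> * ((X * t) * p) \<le> 9 * \<nu> * \<nu> * p\<^sup>2 + 4 * (X * t)\<^sup>2" by (simp add: power2_eq_square algebra_simps)
      also have "4 * (X * t)\<^sup>2 \<le> (A * \<nu>) * (4 * (X * t)\<^sup>2)" using mult_right_mono[OF \<nu>(3), of "4 * (X * t)\<^sup>2"] by simp
      finally have "\<nu> * (12 * ((X * t) * p)) \<le> \<nu> * (9 * \<nu> * p\<^sup>2 + A * (4 * (X * t)\<^sup>2))" by (simp add: algebra_simps)
      then have "12 * ((X * t) * p) \<le> 9 * \<nu> * p\<^sup>2 + A * (4 * (X * t)\<^sup>2)" using \<nu>(1) by (simp only: mult_le_cancel_left_pos)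
      moreover have "0 \<le> A * (X * t)\<^sup>2" using A1 by simp
      ultimately show ?thesis by simp
    qed
    have 3: "4/9 * ((X * t) * q) \<le> q\<^sup>2 / 2 + (X * t)\<^sup>2 / 2"
      using sum_squares_bound[of "X * t" q] mult_nonneg_nonneg[OF mult_nonneg_nonneg[OF nn(4,3)] nn(2)] by simp
    have "- 2 * \<nu> * (p\<^sup>2 - q / 3 * p) + 4/3 * X * t * (p + q / 3)
        = - 2 * (\<nu> * p\<^sup>2) + 2 * \<nu> / 3 * (q * p) + 4/3 * ((X * t) * p) + 4/9 * ((X * t) * q)" by (simp add: algebra_simps)
    also have "\<dots> \<le> \<nu> * q\<^sup>2 + A * (X * t)\<^sup>2 / 2 + q\<^sup>2 / 2 + (X * t)\<^sup>2 / 2" using 1 2 3 by linarith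
    also have "\<dots> \<le> 2 * A * (q\<^sup>2 + (X * t)\<^sup>2)"
    proof -
      have "\<nu> * Q + A * Z / 2 + Q / 2 + Z / 2 \<le> 2 * A * (Q + Z)" if "0 \<le> Q" "0 \<le> Z" for Q Z
      proof -
        have "\<nu> * Q \<le> A * Q" "1 * Q \<le> A * Q" "1 * Z \<le> A * Z"
          by (rule mult_right_mono, (rule \<nu>(2) A1), rule that)+
        moreover have "2 * A * (Q + Z) = 2 * (A * Q) + 2 * (A * Z)" by (simp add: algebra_simps)
        ultimately show ?thesis using that by linarith
      qed
      then show ?thesis by simp
    qed
    finally show ?thesis .
  qed
  moreover have "2 * A * (q\<^sup>2 + (X * t)\<^sup>2) \<le> C4 * (1 + (l2norm E)\<^sup>2) * (t\<^sup>2 + H\<^sup>2)"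
  proof -
    have C3: "0 \<le> C3" using A1 c C_pos by (simp add: C3_def)
    have "q\<^sup>2 \<le> (X * (C3 * (t + H)))\<^sup>2" using g_le nn by (intro power_mono) (auto simp: q_def X_def t_def)
    also have "\<dots> = X\<^sup>2 * C3\<^sup>2 * (t + H)\<^sup>2" by (simp add: power_mult_distrib)
    also have "\<dots> \<le> X\<^sup>2 * C3\<^sup>2 * (2 * (t\<^sup>2 + H\<^sup>2))"
      using sum_squares_bound[of t H] by (intro mult_left_mono) (auto simp: power2_sum)
    finally have 1: "q\<^sup>2 + (X * t)\<^sup>2 \<le> X\<^sup>2 * (2 * C3\<^sup>2 * (t\<^sup>2 + H\<^sup>2) + t\<^sup>2)" by (simp add: power_mult_distrib algebra_simps)
    have "X\<^sup>2 * (2 * C3\<^sup>2 * (t\<^sup>2 + H\<^sup>2) + t\<^sup>2) \<le> X\<^sup>2 * ((2 * C3\<^sup>2 + 1) * (t\<^sup>2 + H\<^sup>2))"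
      by (intro mult_left_mono) (auto simp: algebra_simps)
    moreover have "X\<^sup>2 \<le> 8 * A\<^sup>2 * (1 + (l2norm E)\<^sup>2)"
    proof -
      have "(1 + 2 * l2norm E)\<^sup>2 \<le> 8 * (1 + (l2norm E)\<^sup>2)"
      proof -
        have "2 * l2norm E \<le> 1 + l2norm E * l2norm E"
          using zero_le_power2[of "1 - l2norm E"] by (simp add: power2_eq_square algebra_simps)
        moreover have "0 \<le> l2norm E * l2norm E" by simp
        moreover have "1 + 4 * l + 4 * q \<le> 8 * (1 + q)" if "2 * l \<le> 1 + q" "0 \<le> q" for l q :: real
          using that by (simp add: algebra_simps)
        ultimately have "1 + 4 * l2norm E + 4 * (l2norm E * l2norm E) \<le> 8 * (1 + l2norm E * l2norm E)" by blast
        then show ?thesis by (simp add: power2_eq_square algebra_simps)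
      qed
      from mult_left_mono[OF this zero_le_power2[of A]] have "A\<^sup>2 * (1 + 2 * l2norm E)\<^sup>2 \<le> 8 * A\<^sup>2 * (1 + (l2norm E)\<^sup>2)" by (simp only: mult.assoc mult.left_commute)
      then show ?thesis by (simp only: X_def power_mult_distrib)
    qed
    from mult_right_mono[OF this, of "(2 * C3\<^sup>2 + 1) * (t\<^sup>2 + H\<^sup>2)"]
    have "X\<^sup>2 * ((2 * C3\<^sup>2 + 1) * (t\<^sup>2 + H\<^sup>2)) \<le> 8 * A\<^sup>2 * (1 + (l2norm E)\<^sup>2) * ((2 * C3\<^sup>2 + 1) * (t\<^sup>2 + H\<^sup>2))" by simp
    ultimately have "q\<^sup>2 + (X * t)\<^sup>2 \<le> 8 * A\<^sup>2 * (1 + (l2norm E)\<^sup>2) * ((2 * C3\<^sup>2 + 1) * (t\<^sup>2 + H\<^sup>2))" using 1 by linarith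
    then have "2 * A * (q\<^sup>2 + (X * t)\<^sup>2) \<le> 2 * A * (8 * A\<^sup>2 * (1 + (l2norm E)\<^sup>2) * ((2 * C3\<^sup>2 + 1) * (t\<^sup>2 + H\<^sup>2)))"
      using A1 by (intro mult_left_mono) auto
    then show ?thesis by (simp add: C4_def power3_eq_cube power2_eq_square algebra_simps)
  qed
  ultimately show ?thesis by (simp add: X_def p_def q_def t_def)
qed

end

end

section \<open>Estimates in time\<close>

text \<open>Replaces the sign of a derivative. If f(s) < f(t), let c0 be the infimum of the points a
  with f \<ge> f(t) on [a,t]. By continuity f(c0) \<ge> f(t), so c0 differs from s, and the
  hypothesis at c0 extends the interval further to the left.\<close>

lemma antimono_left_local:
  fixes f :: "real \<Rightarrow> real"
  assumes st: "s \<le> t" and c: "continuous_on {s..t} f"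
    and loc: "\<And>b. s < b \<Longrightarrow> b \<le> t \<Longrightarrow> \<forall>\<^sub>F a in at_left b. f b \<le> f a"
  shows "f t \<le> f s"
proof (rule ccontr)
  assume "\<not> f t \<le> f s"
  then have ne: "f s < f t" by simp
  define S where "S = {a \<in> {s..t}. \<forall>y\<in>{a..t}. f t \<le> f y}"
  define c0 where "c0 = Inf S"
  have tS: "t \<in> S" using st by (auto simp: S_def)
  have bdd: "bdd_below S" unfolding bdd_below_def S_def by auto
  have c0: "s \<le> c0" "c0 \<le> t"
    unfolding c0_def using tS bdd by (auto intro!: cInf_greatest cInf_lower simp: S_def)
  have above: "f t \<le> f y" if y: "c0 < y" "y \<le> t" for y
  proof -
    obtain a where "a \<in> S" "a < y" using cInf_lessD[of S y] tS y(1) by (auto simp: c0_def)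
    then show ?thesis using y by (auto simp: S_def)
  qed
  have fc: "f t \<le> f c0"
  proof (cases "c0 = t")
    case False
    then have lt: "c0 < t" using c0 by simp
    have "(f \<longlongrightarrow> f c0) (at c0 within {s..t})" using c c0 by (auto simp: continuous_on_def)
    then have "(f \<longlongrightarrow> f c0) (at c0 within {c0..t})" by (rule tendsto_within_subset) (use c0 in auto)
    then have "(f \<longlongrightarrow> f c0) (at_right c0)" using at_within_Icc_at_right[OF lt] by simp
    moreover have "\<forall>\<^sub>F y in at_right c0. f t \<le> f y"
      using eventually_at_right_real[OF lt] by eventually_elim (use above in auto)
    ultimately show ?thesis by (rule tendsto_lowerbound) simp
  qed simp
  have "c0 \<noteq> s" using fc ne by auto
  then have "s < c0" using c0 by simp
  then obtain l where l: "l < c0" "\<And>a. l < a \<Longrightarrow> a < c0 \<Longrightarrow> f c0 \<le> f a"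
    using loc[of c0] c0 unfolding eventually_at_left_field by auto
  define a where "a = (max l s + c0) / 2"
  have a: "l < a" "s \<le> a" "a < c0" using l(1) \<open>s < c0\<close> by (auto simp: a_def max_def)
  have "a \<in> S" unfolding S_def
  proof (intro CollectI conjI ballI)
    show "a \<in> {s..t}" using a c0 by auto
    fix y assume y: "y \<in> {a..t}"
    consider "y < c0" | "y = c0" | "c0 < y" by linarith
    then show "f t \<le> f y"
    proof cases
      case 1
      then show ?thesis using l(2)[of y] a y fc by auto
    qed (use fc above y in auto)
  qed
  then have "c0 \<le> a" unfolding c0_def by (rule cInf_lower[OF _ bdd])
  then show False using a by simp
qed

lemma tendsto_at_left_Icc:
  fixes f :: "real \<Rightarrow> real"
  assumes "continuous_on {s..t} f" "s < b" "b \<le> t"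
  shows "(f \<longlongrightarrow> f b) (at_left b)"
proof -
  have "(f \<longlongrightarrow> f b) (at b within {s..t})" using assms by (auto simp: continuous_on_def)
  then have "(f \<longlongrightarrow> f b) (at b within {s..b})" by (rule tendsto_within_subset) (use assms in auto)
  then show ?thesis using at_within_Icc_at_left[OF assms(2)] by simp
qed

text \<open>$e^{-2z} \<le> 1 - z$ for $0 \<le> z \<le> 1/2$ makes $y e^{-2\Lambda}$ nonincreasing.\<close>

lemma left_gronwall:
  fixes y \<Lambda> :: "real \<Rightarrow> real"
  assumes st: "s \<le> t" and cy: "continuous_on {s..t} y" and c\<Lambda>: "continuous_on {s..t} \<Lambda>"
    and pos: "\<And>b. s \<le> b \<Longrightarrow> b \<le> t \<Longrightarrow> 0 \<le> y b"
    and loc: "\<And>b. s < b \<Longrightarrow> b \<le> t \<Longrightarrow> \<forall>\<^sub>F a in at_left b. 0 \<le> \<Lambda> b - \<Lambda> a \<and> y b - y a \<le> (\<Lambda> b - \<Lambda> a) * y b"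
  shows "y t \<le> y s * exp (2 * (\<Lambda> t - \<Lambda> s))"
proof -
  have "y t * exp (- 2 * \<Lambda> t) \<le> y s * exp (- 2 * \<Lambda> s)"
  proof (rule antimono_left_local[OF st])
    show "continuous_on {s..t} (\<lambda>t. y t * exp (- 2 * \<Lambda> t))" by (intro continuous_intros cy c\<Lambda>)
    fix b assume b: "s < b" "b \<le> t"
    have "((\<lambda>a. \<Lambda> b - \<Lambda> a) \<longlongrightarrow> \<Lambda> b - \<Lambda> b) (at_left b)"
      by (intro tendsto_intros tendsto_at_left_Icc[OF c\<Lambda> b])
    then have "\<forall>\<^sub>F a in at_left b. \<Lambda> b - \<Lambda> a < 1/2" by (rule order_tendstoD(2)) simp
    with loc[OF b] show "\<forall>\<^sub>F a in at_left b. y b * exp (- 2 * \<Lambda> b) \<le> y a * exp (- 2 * \<Lambda> a)"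
    proof eventually_elim
      case (elim a)
      define z where "z = \<Lambda> b - \<Lambda> a"
      have z: "0 \<le> z" "z \<le> 1/2" using elim by (auto simp: z_def)
      have "1 \<le> (1 - z) * (1 + 2 * z)"
        using mult_nonneg_nonneg[of z "1 - 2 * z"] z by (simp add: algebra_simps)
      also have "\<dots> \<le> (1 - z) * exp (2 * z)" using z exp_ge_add_one_self[of "2 * z"] by (intro mult_left_mono) auto
      finally have ez: "exp (- 2 * z) \<le> 1 - z" by (simp add: exp_minus field_simps)
      have "y b * exp (- 2 * \<Lambda> b) = (y b * exp (- 2 * z)) * exp (- 2 * \<Lambda> a)"
        by (simp add: z_def exp_add[symmetric] mult.assoc algebra_simps)
      also have "\<dots> \<le> (y b * (1 - z)) * exp (- 2 * \<Lambda> a)"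
        using pos[of b] b ez by (intro mult_right_mono mult_left_mono) auto
      also have "\<dots> \<le> y a * exp (- 2 * \<Lambda> a)"
        using elim by (intro mult_right_mono) (auto simp: z_def algebra_simps)
      finally show ?case .
    qed
  qed
  then have "y t * exp (- 2 * \<Lambda> t) * exp (2 * \<Lambda> t) \<le> y s * exp (- 2 * \<Lambda> s) * exp (2 * \<Lambda> t)" by (intro mult_right_mono) auto
  then show ?thesis by (simp add: mult.assoc exp_add[symmetric] algebra_simps)
qed

text \<open>From f^2 - g^2 = 2 (f - g) f - (f - g)^2. The increment is tested with the later
  function, so in difference quotients from the left the scheme is used at the right end point,
  where its equations hold.\<close>

lemma l2norm_square_diff_le:
  assumes f: "f \<in> L2" and g: "g \<in> L2"
  shows "(l2norm f)\<^sup>2 - (l2norm g)\<^sup>2 \<le> 2 * ip (\<lambda>y. f y - g y) f"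
proof -
  note i = L2_onD(2)[OF f] L2_onD(2)[OF g] L2_on_mult_integrable[OF f g]
  have "0 \<le> (l2norm (\<lambda>y. f y - g y))\<^sup>2" by simp
  also have "\<dots> = ioint 0 1 (\<lambda>y. (f y)\<^sup>2 + (g y)\<^sup>2 - 2 * (f y * g y))"
    unfolding l2norm_square by (rule ioint_cong) (simp add: power2_eq_square algebra_simps)
  also have "\<dots> = (l2norm f)\<^sup>2 + (l2norm g)\<^sup>2 - 2 * ip f g" using i by (simp add: l2norm_square)
  finally have "0 \<le> (l2norm f)\<^sup>2 + (l2norm g)\<^sup>2 - 2 * ip f g" .
  moreover have "ip (\<lambda>y. f y - g y) f = (l2norm f)\<^sup>2 - ip f g"
  proof -
    have "ip (\<lambda>y. f y - g y) f = ioint 0 1 (\<lambda>y. (f y)\<^sup>2 - f y * g y)"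
      by (rule ioint_cong) (simp add: power2_eq_square algebra_simps)
    then show ?thesis using i by (simp add: l2norm_square)
  qed
  ultimately show ?thesis by simp
qed

lemma l2norm_abs_diff_le:
  assumes f: "f \<in> L2" and g: "g \<in> L2"
  shows "\<bar>l2norm f - l2norm g\<bar> \<le> l2norm (\<lambda>y. f y - g y)"
proof -
  have "l2norm (\<lambda>y. g y + (f y - g y)) \<le> l2norm g + l2norm (\<lambda>y. f y - g y)"
    by (rule l2norm_triangle[OF g L2_on_diff[OF f g]])
  moreover have "l2norm (\<lambda>y. f y - (f y - g y)) \<le> l2norm f + l2norm (\<lambda>y. f y - g y)"
    by (rule l2norm_triangle_diff[OF f L2_on_diff[OF f g]])
  ultimately show ?thesis by simp
qed

lemma continuous_on_l2norm:
  assumes L: "\<And>t. t \<in> S \<Longrightarrow> f t \<in> L2"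
    and ev: "\<And>t e. t \<in> S \<Longrightarrow> 0 < e \<Longrightarrow> \<forall>\<^sub>F s in at t within S. l2norm (\<lambda>y. f s y - f t y) \<le> e"
  shows "continuous_on S (\<lambda>t :: real. l2norm (f t))"
  unfolding continuous_on_def
proof (intro ballI tendstoI)
  fix t and e :: real assume t: "t \<in> S" and e: "0 < e"
  have "\<forall>\<^sub>F s in at t within S. l2norm (\<lambda>y. f s y - f t y) \<le> e / 2" by (rule ev[OF t]) (use e in simp)
  moreover have "\<forall>\<^sub>F s in at t within S. s \<in> S" unfolding eventually_at_topological by (intro exI[of _ UNIV]) auto
  ultimately show "\<forall>\<^sub>F s in at t within S. dist (l2norm (f s)) (l2norm (f t)) < e"
  proof eventually_elim
    case (elim s)
    then show ?case using l2norm_abs_diff_le[OF L[OF elim(2)] L[OF t]] e by (simp add: dist_real_def)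
  qed
qed

lemma ip_le: "f \<in> L2 \<Longrightarrow> g \<in> L2 \<Longrightarrow> ip f g \<le> l2norm f * l2norm g" "f \<in> L2 \<Longrightarrow> g \<in> L2 \<Longrightarrow> - (l2norm f * l2norm g) \<le> ip f g"
  using ioint_le_l2norm[of f g] by auto

text \<open>The difference \<open>M b - M a\<close> stands for a multiple of $\int_a^b \Vert u_t \Vert_{k+2}$.\<close>

locale wg_time = mesh +
  fixes k :: nat and \<nu> A H T :: real and u v w :: "real \<Rightarrow> real \<Rightarrow> real" and M :: "real \<Rightarrow> real"
    and uh :: "real \<Rightarrow> weak_fun" and dU Pu Pv G tF :: "real \<Rightarrow> nat \<Rightarrow> real poly"
  assumes T: "0 < T"
    and stat: "\<And>t. 0 < t \<Longrightarrow> t \<le> T \<Longrightarrow>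
      wg_static N x k \<nu> A H (u t) (v t) (w t) (uh t) (dU t) (Pu t) (Pv t) (G t) (tF t)"
    and uh: "\<And>t. 0 \<le> t \<Longrightarrow> t \<le> T \<Longrightarrow> uh t \<in> S_h0 k N"
    and uc: "\<And>t. 0 \<le> t \<Longrightarrow> t \<le> T \<Longrightarrow> continuous_on {0..1} (u t)"
    and Mc: "continuous_on {0..T} M" and MA: "M T - M 0 \<le> A"
    and Mm: "\<And>a b. 0 \<le> a \<Longrightarrow> a \<le> b \<Longrightarrow> b \<le> T \<Longrightarrow> M a \<le> M b"
    and du: "\<And>a b y. 0 \<le> a \<Longrightarrow> a \<le> b \<Longrightarrow> b \<le> T \<Longrightarrow> y \<in> {0..1} \<Longrightarrow> \<bar>u b y - u a y\<bar> \<le> A * (M b - M a)"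
    and d\<eta>: "\<And>a b. 0 \<le> a \<Longrightarrow> a \<le> b \<Longrightarrow> b \<le> T \<Longrightarrow>
      l2norm (\<lambda>y. (u b y - u a y) - pw (\<lambda>i. Pu b i - Pu a i) y) \<le> A * H * (M b - M a)"
    and d\<eta>_sup: "\<And>a b y. 0 \<le> a \<Longrightarrow> a \<le> b \<Longrightarrow> b \<le> T \<Longrightarrow> y \<in> {0<..<1} \<Longrightarrow>
      \<bar>(u b y - u a y) - pw (\<lambda>i. Pu b i - Pu a i) y\<bar> \<le> A * (M b - M a)"
    and d\<psi>: "\<And>a b. 0 < a \<Longrightarrow> a \<le> b \<Longrightarrow> b \<le> T \<Longrightarrow>
      l2norm (\<lambda>y. (\<nu> * v b y - (u b y)\<^sup>2 / 3 - pw (G b) y) - (\<nu> * v a y - (u a y)\<^sup>2 / 3 - pw (G a) y)) \<le> A * H * (M b - M a)"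
    and strong: "\<And>b e. 0 < b \<Longrightarrow> b \<le> T \<Longrightarrow> 0 < e \<Longrightarrow>
      \<forall>\<^sub>F a in at_left b. l2norm (\<lambda>y. u b y - u a y - (b - a) * w b y) \<le> e * (b - a)"
    and U1: "\<And>i. i \<in> {1..<N} \<Longrightarrow> poly_C1_in_time T (\<lambda>t. interior_part (uh t) i) (\<lambda>t. dU t i)"
    and init: "\<And>i. i \<in> {1..<N} \<Longrightarrow> Pu 0 i = interior_part (uh 0) i"
begin

abbreviation "U t \<equiv> pw (interior_part (uh t))"
abbreviation "eF t \<equiv> err (Pu t) (interior_part (uh t))"
abbreviation "e t \<equiv> pw (eF t)"
abbreviation "E t \<equiv> pw (err (Pv t) (wd k (uh t)))"
abbreviation "\<tau> t \<equiv> pw (tF t)"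
abbreviation "\<tau>' t \<equiv> pw (\<lambda>i. pderiv (tF t i))"
abbreviation "\<zeta> t \<equiv> (\<lambda>y. u t y - U t y)"
abbreviation "\<psi> t \<equiv> (\<lambda>y. \<nu> * v t y - (u t y)\<^sup>2 / 3 - pw (G t) y)"
abbreviation "S t \<equiv> (\<lambda>y. (u t y)\<^sup>2 - (U t y)\<^sup>2)"

lemma A1: "1 \<le> A" and H: "0 < H" "H \<le> 1" and \<nu>: "0 < \<nu>" "\<nu> \<le> A" "1 \<le> A * \<nu>"
  using wg_static.A1[OF stat[of T]] wg_static.H[OF stat[of T]] wg_static.\<nu>[OF stat[of T]] T by auto

lemma uL2: "0 \<le> t \<Longrightarrow> t \<le> T \<Longrightarrow> u t \<in> L2"
  by (rule L2_on_continuous[OF uc])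

lemma \<zeta>L2: "0 \<le> t \<Longrightarrow> t \<le> T \<Longrightarrow> \<zeta> t \<in> L2"
  by (rule L2_minus_pw[OF uL2])

lemma e_eq: "e t y = pw (Pu t) y - U t y"
  by (rule pw_err)

lemma degU: "0 \<le> t \<Longrightarrow> t \<le> T \<Longrightarrow> i \<in> {1..<N} \<Longrightarrow> degree (interior_part (uh t) i) \<le> k"
  using uh[of t] by (auto simp: S_h0_def S_h_def)

text \<open>On (0,1) a piecewise polynomial of degree at most k is bounded by the sum of the moduli
  of its coefficients, of which there are at most N (k + 1). Coefficientwise limits in time thus
  become uniform ones at a fixed mesh.\<close>

lemma eventually_pw_le:
  assumes ev: "\<And>i j. i \<in> {1..<N} \<Longrightarrow> \<forall>\<^sub>F a in F. \<bar>coeff (p a i) j\<bar> \<le> d * m a"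
    and deg: "\<forall>\<^sub>F a in F. \<forall>i\<in>{1..<N}. degree (p a i) \<le> k" and m: "\<forall>\<^sub>F a in F. 0 \<le> m a" and d: "0 \<le> d"
  shows "\<forall>\<^sub>F a in F. \<forall>y. \<bar>pw (p a) y\<bar> \<le> (real N * (real k + 1) * d) * m a"
proof -
  have "\<forall>\<^sub>F a in F. \<forall>i\<in>{1..<N}. \<forall>j\<in>{..k}. \<bar>coeff (p a i) j\<bar> \<le> d * m a"
    by (intro eventually_ball_finite finite_atLeastLessThan finite_atMost ballI ev)
  then show ?thesis using deg m
  proof eventually_elim
    case (elim a)
    show ?case
    proof
      fix y
      have "\<bar>pw (p a) y\<bar> \<le> (\<Sum>i\<in>{1..<N}. \<Sum>j\<le>k. \<bar>coeff (p a i) j\<bar>)" by (rule pw_le_coeffs) (use elim in auto)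
      also have "\<dots> \<le> (\<Sum>i\<in>{1..<N}. \<Sum>j\<le>k. d * m a)" by (intro sum_mono) (use elim in auto)
      also have "\<dots> = (real (N - 1) * (real k + 1) * d) * m a" by (simp add: algebra_simps)
      also have "\<dots> \<le> (real N * (real k + 1) * d) * m a" using elim d by (intro mult_right_mono) auto
      finally show "\<bar>pw (p a) y\<bar> \<le> (real N * (real k + 1) * d) * m a" .
    qed
  qed
qed

lemma U_deriv:
  assumes b: "0 < b" "b \<le> T" and \<epsilon>: "0 < \<epsilon>"
  shows "\<forall>\<^sub>F a in at_left b. \<forall>y. \<bar>U b y - U a y - (b - a) * pw (dU b) y\<bar> \<le> \<epsilon> * (b - a)"
proof -
  define d where "d = \<epsilon> / (real N * (real k + 1))"
  have d: "0 < d" using \<epsilon> N2 by (simp add: d_def)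
  define p where "p = (\<lambda>a i. interior_part (uh b) i - interior_part (uh a) i - smult (b - a) (dU b i))"
  have ab: "\<forall>\<^sub>F a in at_left b. a \<in> {0<..<b}" by (rule eventually_at_left_real[OF b(1)])
  have "\<forall>\<^sub>F a in at_left b. \<bar>coeff (p a i) j\<bar> \<le> d * (b - a)" if i: "i \<in> {1..<N}" for i j
  proof -
    define f where "f = (\<lambda>s. coeff (interior_part (uh s) i) j)"
    have "(f has_real_derivative coeff (dU b i) j) (at b within {0<..T})"
      using U1[OF i] b unfolding poly_C1_in_time_def f_def by auto
    then have "(f has_real_derivative coeff (dU b i) j) (at b within {b / 2..b})"
      by (rule has_field_derivative_subset) (use b in auto)
    then have "((\<lambda>a. (f a - f b) / (a - b)) \<longlongrightarrow> coeff (dU b i) j) (at_left b)"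
      using at_within_Icc_at_left[of "b / 2" b] b by (simp add: has_field_derivative_iff)
    then have "\<forall>\<^sub>F a in at_left b. dist ((f a - f b) / (a - b)) (coeff (dU b i) j) < d"
      by (rule tendstoD[OF _ d])
    then show ?thesis using ab
    proof eventually_elim
      case (elim a)
      have "coeff (p a i) j = ((f a - f b) / (a - b) - coeff (dU b i) j) * (b - a)"
        using elim(2) by (simp add: p_def f_def field_simps)
      then have "\<bar>coeff (p a i) j\<bar> = \<bar>(f a - f b) / (a - b) - coeff (dU b i) j\<bar> * (b - a)"
        using elim(2) by (simp add: abs_mult)
      also have "\<dots> \<le> d * (b - a)" using elim by (intro mult_right_mono) (auto simp: dist_real_def)
      finally show ?case .
    qed
  qed
  moreover have "\<forall>\<^sub>F a in at_left b. \<forall>i\<in>{1..<N}. degree (p a i) \<le> k"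
    using ab
  proof eventually_elim
    case (elim a)
    show ?case
    proof
      fix i assume i: "i \<in> {1..<N}"
      show "degree (p a i) \<le> k"
        unfolding p_def using degU[of b i] degU[of a i] wg_static.dU[OF stat[OF b] i] elim b i
        by (intro degree_diff_le order_trans[OF degree_smult_le]) auto
    qed
  qed
  moreover have "\<forall>\<^sub>F a in at_left b. 0 \<le> b - a" using ab by eventually_elim auto
  ultimately have "\<forall>\<^sub>F a in at_left b. \<forall>y. \<bar>pw (p a) y\<bar> \<le> (real N * (real k + 1) * d) * (b - a)"
    by (rule eventually_pw_le) (use d in auto)
  moreover have "real N * (real k + 1) * d = \<epsilon>" using N2 by (simp add: d_def)
  moreover have "pw (p a) y = U b y - U a y - (b - a) * pw (dU b) y" for a y
    by (simp add: p_def pw_diff pw_smult)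
  ultimately show ?thesis by simp
qed

lemma U_cont:
  assumes t: "t \<in> {0..T}" and \<epsilon>: "0 < \<epsilon>"
  shows "\<forall>\<^sub>F s in at t within {0..T}. \<forall>y. \<bar>U s y - U t y\<bar> \<le> \<epsilon>"
proof -
  define d where "d = \<epsilon> / (real N * (real k + 1))"
  have d: "0 < d" using \<epsilon> N2 by (simp add: d_def)
  define p where "p = (\<lambda>s i. interior_part (uh s) i - interior_part (uh t) i)"
  have sT: "\<forall>\<^sub>F s in at t within {0..T}. s \<in> {0..T}" unfolding eventually_at_topological by (intro exI[of _ UNIV]) auto
  have "\<forall>\<^sub>F s in at t within {0..T}. \<bar>coeff (p s i) j\<bar> \<le> d * 1" if i: "i \<in> {1..<N}" for i j
  proof -
    have "((\<lambda>s. coeff (interior_part (uh s) i) j) \<longlongrightarrow> coeff (interior_part (uh t) i) j) (at t within {0..T})"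
      using U1[OF i] t unfolding poly_C1_in_time_def continuous_on_def by auto
    from tendstoD[OF this d] show ?thesis by eventually_elim (simp add: p_def dist_real_def)
  qed
  moreover have "\<forall>\<^sub>F s in at t within {0..T}. \<forall>i\<in>{1..<N}. degree (p s i) \<le> k"
    using sT by eventually_elim (use t degU in \<open>auto simp: p_def intro!: degree_diff_le\<close>)
  ultimately have "\<forall>\<^sub>F s in at t within {0..T}. \<forall>y. \<bar>pw (p s) y\<bar> \<le> (real N * (real k + 1) * d) * 1"
    by (rule eventually_pw_le) (use d in auto)
  moreover have "real N * (real k + 1) * d = \<epsilon>" using N2 by (simp add: d_def)
  moreover have "pw (p s) y = U s y - U t y" for s y by (simp add: p_def pw_diff)
  ultimately show ?thesis by simp
qed

lemma M_cont:
  assumes t: "t \<in> {0..T}" and \<epsilon>: "0 < \<epsilon>"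
  shows "\<forall>\<^sub>F s in at t within {0..T}. s \<in> {0..T} \<and> \<bar>M s - M t\<bar> \<le> \<epsilon>"
proof -
  have "(M \<longlongrightarrow> M t) (at t within {0..T})" using Mc t by (auto simp: continuous_on_def)
  from tendstoD[OF this \<epsilon>] have "\<forall>\<^sub>F s in at t within {0..T}. dist (M s) (M t) < \<epsilon>" .
  moreover have "\<forall>\<^sub>F s in at t within {0..T}. s \<in> {0..T}" unfolding eventually_at_topological by (intro exI[of _ UNIV]) auto
  ultimately show ?thesis by eventually_elim (auto simp: dist_real_def)
qed

lemma du_abs:
  assumes "s \<in> {0..T}" "t \<in> {0..T}" "y \<in> {0<..<1}"
  shows "\<bar>u s y - u t y\<bar> \<le> A * \<bar>M s - M t\<bar>" "\<bar>pw (Pu s) y - pw (Pu t) y\<bar> \<le> 2 * A * \<bar>M s - M t\<bar>"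
proof -
  have *: "\<bar>u b y - u a y\<bar> \<le> A * \<bar>M b - M a\<bar> \<and> \<bar>pw (Pu b) y - pw (Pu a) y\<bar> \<le> 2 * A * \<bar>M b - M a\<bar>"
    if "0 \<le> a" "a \<le> b" "b \<le> T" for a b
    using du[OF that, of y] d\<eta>_sup[OF that, of y] Mm[OF that] assms(3) by (auto simp: pw_diff)
  show "\<bar>u s y - u t y\<bar> \<le> A * \<bar>M s - M t\<bar>" "\<bar>pw (Pu s) y - pw (Pu t) y\<bar> \<le> 2 * A * \<bar>M s - M t\<bar>"
    using *[of s t] *[of t s] assms(1,2) by (cases "s \<le> t"; simp add: abs_minus_commute)+
qed

lemma e_cont:
  assumes t: "t \<in> {0..T}" and \<epsilon>: "0 < \<epsilon>"
  shows "\<forall>\<^sub>F s in at t within {0..T}. \<forall>y\<in>{0<..<1}. \<bar>e s y - e t y\<bar> \<le> \<epsilon>"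
proof -
  have "0 < \<epsilon> / (4 * A)" using \<epsilon> A1 by simp
  from M_cont[OF t this] U_cont[OF t, of "\<epsilon> / 2"] \<epsilon>
  have "\<forall>\<^sub>F s in at t within {0..T}. s \<in> {0..T} \<and> \<bar>M s - M t\<bar> \<le> \<epsilon> / (4 * A)"
    "\<forall>\<^sub>F s in at t within {0..T}. \<forall>y. \<bar>U s y - U t y\<bar> \<le> \<epsilon> / 2" by auto
  then show ?thesis
  proof eventually_elim
    case (elim s)
    show ?case
    proof
      fix y :: real assume y: "y \<in> {0<..<1}"
      have "\<bar>pw (Pu s) y - pw (Pu t) y\<bar> \<le> 2 * A * \<bar>M s - M t\<bar>" by (rule du_abs(2)[OF _ t y]) (use elim in auto)
      also have "\<dots> \<le> 2 * A * (\<epsilon> / (4 * A))" using elim A1 by (intro mult_left_mono) auto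
      also have "\<dots> = \<epsilon> / 2" using A1 by simp
      finally show "\<bar>e s y - e t y\<bar> \<le> \<epsilon>" using elim(2)[rule_format, of y] unfolding e_eq by linarith
    qed
  qed
qed

lemma e_l2_cont: "continuous_on {0..T} (\<lambda>t. l2norm (e t))"
proof (rule continuous_on_l2norm[OF pw_L2])
  fix t \<epsilon> :: real assume t: "t \<in> {0..T}" and \<epsilon>: "0 < \<epsilon>"
  from e_cont[OF t \<epsilon>] show "\<forall>\<^sub>F s in at t within {0..T}. l2norm (\<lambda>y. e s y - e t y) \<le> \<epsilon>"
    by eventually_elim (rule l2norm_le_sup(2), use \<epsilon> in auto)
qed

lemma e0: "e 0 y = 0"
  unfolding e_eq by (cases y rule: pw_cases) (use init in auto)

lemma \<zeta>_deriv:
  assumes b: "0 < b" "b \<le> T" and \<epsilon>: "0 < \<epsilon>"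
  shows "\<forall>\<^sub>F a in at_left b. a \<in> {0<..<b} \<and> (\<lambda>y. \<zeta> b y - \<zeta> a y - (b - a) * (w b y - pw (dU b) y)) \<in> L2 \<and>
    l2norm (\<lambda>y. \<zeta> b y - \<zeta> a y - (b - a) * (w b y - pw (dU b) y)) \<le> \<epsilon> * (b - a)"
proof -
  have "\<forall>\<^sub>F a in at_left b. l2norm (\<lambda>y. u b y - u a y - (b - a) * w b y) \<le> \<epsilon> / 2 * (b - a)"
    by (rule strong[OF b]) (use \<epsilon> in simp)
  moreover have "\<forall>\<^sub>F a in at_left b. \<forall>y. \<bar>U b y - U a y - (b - a) * pw (dU b) y\<bar> \<le> \<epsilon> / 2 * (b - a)"
    by (rule U_deriv[OF b]) (use \<epsilon> in simp)
  moreover have "\<forall>\<^sub>F a in at_left b. a \<in> {0<..<b}" by (rule eventually_at_left_real[OF b(1)])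
  ultimately show ?thesis
  proof eventually_elim
    case (elim a)
    have wL: "w b \<in> L2" by (rule wg_static.wL[OF stat[OF b]])
    have 1: "(\<lambda>y. u b y - u a y - (b - a) * w b y) \<in> L2"
      using elim b by (intro L2_on_diff L2_on_cmult uL2 wL) auto
    have 2: "(\<lambda>y. U b y - U a y - (b - a) * pw (dU b) y) \<in> L2" "l2norm (\<lambda>y. U b y - U a y - (b - a) * pw (dU b) y) \<le> \<epsilon> / 2 * (b - a)"
    proof -
      show L: "(\<lambda>y. U b y - U a y - (b - a) * pw (dU b) y) \<in> L2" by (intro L2_on_diff L2_on_cmult pw_L2)
      show "l2norm (\<lambda>y. U b y - U a y - (b - a) * pw (dU b) y) \<le> \<epsilon> / 2 * (b - a)"
        by (rule l2norm_le_sup(2)[OF L2_onD(1)[OF L]]) (use elim \<epsilon> in auto)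
    qed
    have eq: "(\<lambda>y. \<zeta> b y - \<zeta> a y - (b - a) * (w b y - pw (dU b) y))
      = (\<lambda>y. (u b y - u a y - (b - a) * w b y) - (U b y - U a y - (b - a) * pw (dU b) y))"
      by (simp add: fun_eq_iff algebra_simps)
    show ?case unfolding eq
      using L2_on_diff[OF 1 2(1)] l2norm_triangle_diff[OF 1 2(1)] 2(2) elim by simp
  qed
qed

section \<open>The energy estimate for the projected error\<close>

lemma ip_de:
  assumes a: "0 < a" "a < b" and b: "b \<le> T" and q: "\<And>i. i \<in> {1..<N} \<Longrightarrow> degree (q i) \<le> k"
  shows "ip (\<lambda>y. e b y - e a y) (pw q) = ip (\<lambda>y. \<zeta> b y - \<zeta> a y) (pw q)"
proof -
  have L: "u b \<in> L2" "u a \<in> L2" using uL2 a b by auto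
  have p: "is_proj k (\<lambda>y. u b y - u a y) (\<lambda>i. Pu b i - Pu a i)"
    by (rule is_proj_diff[OF wg_static.Pu[OF stat] wg_static.Pu[OF stat] L]) (use a b in auto)
  have 1: "ip (\<lambda>y. (u b y - u a y) - pw (\<lambda>i. Pu b i - Pu a i) y) (pw q) = 0"
    by (rule is_proj_orth[OF p L2_on_diff[OF L]]) (rule q)
  have "ip (\<lambda>y. \<zeta> b y - \<zeta> a y) (pw q) = ip (\<lambda>y. ((u b y - u a y) - pw (\<lambda>i. Pu b i - Pu a i) y) + (e b y - e a y)) (pw q)"
    by (rule ioint_cong) (simp add: e_eq pw_diff)
  also have "\<dots> = 0 + ip (\<lambda>y. e b y - e a y) (pw q)"
    unfolding ip_add[OF L2_minus_pw[OF L2_on_diff[OF L]] L2_on_diff[OF pw_L2 pw_L2] pw_L2] 1 ..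
  finally show ?thesis by simp
qed

text \<open>Twice the constant of \<open>energy_static\<close>; the extra 1 takes up the remainder
  of the difference quotient.\<close>

definition "K1 = 24 * A ^ 5 + 1"

lemma energy_step:
  assumes b: "0 < b" "b \<le> T"
  shows "\<forall>\<^sub>F a in at_left b. (l2norm (e b))\<^sup>2 - (l2norm (e a))\<^sup>2
    \<le> (b - a) * (- \<nu> * (l2norm (E b))\<^sup>2 + K1 * ((l2norm (e b))\<^sup>2 + H\<^sup>2))"
proof -
  note st = stat[OF b]
  \<comment> \<open>Chosen so that the remainder, tested with \<open>e b\<close>, contributes at
    most (b - a) H^2. That it depends on b is harmless, since only times close to b are
    compared.\<close>
  define \<epsilon> where "\<epsilon> = H\<^sup>2 / (2 * (l2norm (e b) + 1))"
  have pos: "0 < l2norm (e b) + 1" using l2norm_nonneg[of "e b"] by linarith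
  have \<epsilon>: "0 < \<epsilon>" using H pos by (simp add: \<epsilon>_def)
  have \<epsilon>e: "2 * (\<epsilon> * l2norm (e b)) \<le> H\<^sup>2"
  proof -
    have "2 * (\<epsilon> * l2norm (e b)) \<le> 2 * (\<epsilon> * (l2norm (e b) + 1))" using \<epsilon> by simp
    also have "2 * (H\<^sup>2 / (2 * p) * p) = H\<^sup>2" if "0 < p" for p :: real using that by simp
    then have "2 * (\<epsilon> * (l2norm (e b) + 1)) = H\<^sup>2" unfolding \<epsilon>_def using pos by blast
    finally show ?thesis .
  qed
  show ?thesis using \<zeta>_deriv[OF b \<epsilon>]
  proof eventually_elim
    case (elim a)
    let ?W = "\<lambda>y. w b y - pw (dU b) y"
    let ?R = "\<lambda>y. \<zeta> b y - \<zeta> a y - (b - a) * ?W y"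
    have a: "0 < a" "a < b" and RL: "?R \<in> L2" and R: "l2norm ?R \<le> \<epsilon> * (b - a)" using elim by auto
    have WL: "?W \<in> L2" by (rule L2_minus_pw[OF wg_static.wL[OF st]])
    have "(l2norm (e b))\<^sup>2 - (l2norm (e a))\<^sup>2 \<le> 2 * ip (\<lambda>y. e b y - e a y) (e b)"
      by (rule l2norm_square_diff_le[OF pw_L2 pw_L2])
    also have "ip (\<lambda>y. e b y - e a y) (e b) = ip (\<lambda>y. \<zeta> b y - \<zeta> a y) (e b)"
      by (rule ip_de[OF a b(2) wg_static.deg_eF[OF st]])
    also have "\<dots> = ip (\<lambda>y. (b - a) * ?W y + ?R y) (e b)" by (rule ioint_cong) (simp add: algebra_simps)
    also have "\<dots> = (b - a) * ip ?W (e b) + ip ?R (e b)"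
      unfolding ip_add[OF L2_on_cmult[OF WL] RL pw_L2] ip_cmult ..
    also have "2 * ((b - a) * ip ?W (e b) + ip ?R (e b)) \<le> 2 * ((b - a) * (- \<nu> / 2 * (l2norm (E b))\<^sup>2 + 12 * A ^ 5 * ((l2norm (e b))\<^sup>2 + H\<^sup>2)) + (\<epsilon> * (b - a)) * l2norm (e b))"
    proof (intro mult_left_mono add_mono)
      show "ip ?W (e b) \<le> - \<nu> / 2 * (l2norm (E b))\<^sup>2 + 12 * A ^ 5 * ((l2norm (e b))\<^sup>2 + H\<^sup>2)"
        by (rule wg_static.energy_static[OF st])
      show "ip ?R (e b) \<le> (\<epsilon> * (b - a)) * l2norm (e b)"
        by (rule order_trans[OF ip_le(1)[OF RL pw_L2] mult_right_mono[OF R]]) simp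
    qed (use a in auto)
    also have "\<dots> = (b - a) * (- \<nu> * (l2norm (E b))\<^sup>2 + 24 * A ^ 5 * ((l2norm (e b))\<^sup>2 + H\<^sup>2) + 2 * (\<epsilon> * l2norm (e b)))"
      by (simp add: field_simps)
    also have "\<dots> \<le> (b - a) * (- \<nu> * (l2norm (E b))\<^sup>2 + K1 * ((l2norm (e b))\<^sup>2 + H\<^sup>2))"
    proof (intro mult_left_mono)
      have "2 * (\<epsilon> * l2norm (e b)) \<le> (l2norm (e b))\<^sup>2 + H\<^sup>2" using \<epsilon>e by (simp add: add_increasing)
      then show "- \<nu> * (l2norm (E b))\<^sup>2 + 24 * A ^ 5 * ((l2norm (e b))\<^sup>2 + H\<^sup>2) + 2 * (\<epsilon> * l2norm (e b))
          \<le> - \<nu> * (l2norm (E b))\<^sup>2 + K1 * ((l2norm (e b))\<^sup>2 + H\<^sup>2)"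
        unfolding K1_def distrib_right by simp
    qed (use a in auto)
    finally show ?case .
  qed
qed

text \<open>The square of the norm grows at most by exp(2 K1 T), because
  \<open>left_gronwall\<close> doubles the exponent; hence exp(K1 T) for the norm itself.\<close>

definition "c = exp (K1 * T)"

lemma K1: "1 \<le> K1" and c1: "1 \<le> c"
  using A1 T by (auto simp: K1_def c_def)

lemma e_le:
  assumes t: "0 \<le> t" "t \<le> T"
  shows "l2norm (e t) \<le> c * H"
proof -
  let ?y = "\<lambda>t. (l2norm (e t))\<^sup>2 + H\<^sup>2"
  have "(l2norm (e t))\<^sup>2 \<le> ?y t" by simp
  also have "?y t \<le> ?y 0 * exp (2 * (K1 * t - K1 * 0))"
  proof (rule left_gronwall[where y = ?y and \<Lambda> = "\<lambda>t. K1 * t"])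
    show "continuous_on {0..t} ?y"
      by (intro continuous_intros continuous_on_subset[OF e_l2_cont]) (use t in auto)
    fix b assume b: "0 < b" "b \<le> t"
    have bT: "b \<le> T" using b t by simp
    from energy_step[OF b(1) bT] eventually_at_left_real[OF b(1)]
    show "\<forall>\<^sub>F a in at_left b. 0 \<le> K1 * b - K1 * a \<and> ?y b - ?y a \<le> (K1 * b - K1 * a) * ?y b"
    proof eventually_elim
      case (elim a)
      have "?y b - ?y a \<le> (b - a) * (- \<nu> * (l2norm (E b))\<^sup>2 + K1 * ?y b)" using elim(1) by simp
      also have "\<dots> \<le> (b - a) * (0 + K1 * ?y b)"
        using elim(2) \<nu> by (intro mult_left_mono add_right_mono) auto
      also have "\<dots> = (K1 * b - K1 * a) * ?y b" by (simp add: algebra_simps)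
      finally show ?case using elim(2) K1 by (auto simp: right_diff_distrib[symmetric])
    qed
  qed (use t in \<open>auto intro!: continuous_intros\<close>)
  also have "?y 0 = H\<^sup>2" using e0 by (simp add: l2norm_def)
  finally have "(l2norm (e t))\<^sup>2 \<le> H\<^sup>2 * exp (2 * (K1 * t))" by simp
  also have "\<dots> \<le> H\<^sup>2 * exp (2 * (K1 * T))" using t K1 by (intro mult_left_mono) auto
  also have "\<dots> = (c * H)\<^sup>2" by (simp add: c_def power_mult_distrib exp_double)
  finally show ?thesis by (rule power2_le_imp_le) (use H c1 in simp)
qed


lemma \<zeta>_le: "0 < t \<Longrightarrow> t \<le> T \<Longrightarrow> l2norm (\<zeta> t) \<le> (A + c) * H"
  using wg_static.\<zeta>_le[OF stat c1 e_le] by simp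

section \<open>The flux error in time\<close>

lemma \<tau>_diff:
  assumes s: "0 < s" "s \<le> T" and t: "0 < t" "t \<le> T"
    and q: "continuous_pw q" "\<And>i. i \<in> {1..<N} \<Longrightarrow> degree (q i) \<le> k + 1"
  shows "ip (\<lambda>y. \<tau> s y - \<tau> t y) (pw q) = - ip (\<lambda>y. \<psi> s y - \<psi> t y) (pw q)
    - \<nu> * ip (\<lambda>y. \<zeta> s y - \<zeta> t y) (pw (\<lambda>i. pderiv (q i))) - ip (\<lambda>y. S s y - S t y) (pw q) / 3"
proof -
  note ss = stat[OF s] and tt = stat[OF t]
  have 1: "ip (\<lambda>y. \<tau> s y - \<tau> t y) (pw q) = ip (\<tau> s) (pw q) - ip (\<tau> t) (pw q)"
    by (rule ip_diff[OF pw_L2 pw_L2 pw_L2])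
  have 2: "ip (\<lambda>y. \<psi> s y - \<psi> t y) (pw q) = ip (\<psi> s) (pw q) - ip (\<psi> t) (pw q)"
    by (rule ip_diff[OF wg_static.L2s(6)[OF ss] wg_static.L2s(6)[OF tt] pw_L2])
  have 3: "ip (\<lambda>y. \<zeta> s y - \<zeta> t y) (pw (\<lambda>i. pderiv (q i))) = ip (\<zeta> s) (pw (\<lambda>i. pderiv (q i))) - ip (\<zeta> t) (pw (\<lambda>i. pderiv (q i)))"
    by (rule ip_diff[OF wg_static.L2s(3)[OF ss] wg_static.L2s(3)[OF tt] pw_L2])
  have 4: "ip (\<lambda>y. S s y - S t y) (pw q) = ip (S s) (pw q) - ip (S t) (pw q)"
    by (rule ip_diff[OF wg_static.L2s(4)[OF ss] wg_static.L2s(4)[OF tt] pw_L2])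
  have 5: "ip (\<tau> s) (pw q) = - ip (\<psi> s) (pw q) - \<nu> * ip (\<zeta> s) (pw (\<lambda>i. pderiv (q i))) - ip (S s) (pw q) / 3"
    by (rule wg_static.flux_\<tau>_test[OF ss q(1)]) (rule q(2))
  have 6: "ip (\<tau> t) (pw q) = - ip (\<psi> t) (pw q) - \<nu> * ip (\<zeta> t) (pw (\<lambda>i. pderiv (q i))) - ip (S t) (pw q) / 3"
    by (rule wg_static.flux_\<tau>_test[OF tt q(1)]) (rule q(2))
  show ?thesis unfolding 1 2 3 4 5 6 right_diff_distrib diff_divide_distrib by linarith
qed

text \<open>Nothing is assumed about the flux in time. Its increment is used as test function in the
  difference of the flux relations, which bounds it by increments of \<psi>, \<zeta> and S.\<close>

lemma \<tau>_l2_cont: "continuous_on {0<..T} (\<lambda>t. l2norm (\<tau> t))"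
proof (rule continuous_on_l2norm[OF pw_L2])
  fix t \<epsilon> :: real assume t: "t \<in> {0<..T}" and \<epsilon>: "0 < \<epsilon>"
  have t': "0 < t" "t \<le> T" "t \<in> {0..T}" using t by auto
  \<comment> \<open>The constant of this inverse inequality depends on the mesh. As only continuity
    at a fixed mesh is claimed, it is compensated by the choice of d.\<close>
  obtain Cd where Cd: "0 \<le> Cd" "\<And>q. (\<And>i. i \<in> {1..<N} \<Longrightarrow> degree (q i) \<le> k + 1) \<Longrightarrow> l2norm (pw (\<lambda>i. pderiv (q i))) \<le> Cd * l2norm (pw q)"
    using pw_deriv_inverse[of "k + 1"] by blast
  obtain B where B: "0 \<le> B" "\<And>y. \<bar>U t y\<bar> \<le> B" using pw_bounded[of "interior_part (uh t)"] by metis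
  define Q where "Q = A + A * Cd * (A + 1) + (2 * A * A + (2 * B + 1))"
  have Q: "0 \<le> Q" using A1 Cd(1) B(1) by (simp add: Q_def)
  define d where "d = min 1 (\<epsilon> / (Q + 1))"
  have d: "0 < d" "d \<le> 1" "d * Q \<le> \<epsilon>"
  proof -
    show "0 < d" "d \<le> 1" using \<epsilon> Q by (auto simp: d_def)
    have "d * Q \<le> (\<epsilon> / (Q + 1)) * (Q + 1)" using \<epsilon> Q by (intro mult_mono) (auto simp: d_def)
    then show "d * Q \<le> \<epsilon>" using Q by simp
  qed
  have sub: "at t within {0<..T} \<le> at t within {0..T}" by (rule at_le) auto
  have "\<forall>\<^sub>F s in at t within {0<..T}. s \<in> {0..T} \<and> \<bar>M s - M t\<bar> \<le> d"
    "\<forall>\<^sub>F s in at t within {0<..T}. \<forall>y. \<bar>U s y - U t y\<bar> \<le> d"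
    using M_cont[OF t'(3) d(1)] U_cont[OF t'(3) d(1)] sub filter_leD by blast+
  moreover have "\<forall>\<^sub>F s in at t within {0<..T}. s \<in> {0<..T}" unfolding eventually_at_topological by (intro exI[of _ UNIV]) auto
  ultimately show "\<forall>\<^sub>F s in at t within {0<..T}. l2norm (\<lambda>y. \<tau> s y - \<tau> t y) \<le> \<epsilon>"
  proof eventually_elim
    case (elim s)
    have s: "0 < s" "s \<le> T" "s \<in> {0..T}" using elim by auto
    note ss = stat[OF s(1,2)] and tt = stat[OF t'(1,2)]
    define q where "q = (\<lambda>i. tF s i - tF t i)"
    have q: "continuous_pw q" "\<And>i. i \<in> {1..<N} \<Longrightarrow> degree (q i) \<le> k + 1"
      unfolding q_def using wg_static.tF(2)[OF ss] wg_static.tF(2)[OF tt] wg_static.tF(1)[OF ss] wg_static.tF(1)[OF tt]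
      by (auto intro!: continuous_pw_diff degree_diff_le)
    have pq: "(\<lambda>y. \<tau> s y - \<tau> t y) = pw q" by (simp add: q_def pw_diff fun_eq_iff)
    have du: "\<bar>u s y - u t y\<bar> \<le> A * d" if "0 < y" "y < 1" for y
      using order_trans[OF du_abs(1)[OF s(3) t'(3), of y] mult_left_mono[of _ d A]] elim A1 that by auto
    have L: "(\<lambda>y. \<psi> s y - \<psi> t y) \<in> L2" "(\<lambda>y. \<zeta> s y - \<zeta> t y) \<in> L2" "(\<lambda>y. S s y - S t y) \<in> L2"
      by (intro L2_on_diff wg_static.L2s[OF ss] wg_static.L2s[OF tt])+
    have L\<psi>: "l2norm (\<lambda>y. \<psi> s y - \<psi> t y) \<le> A * d"
    proof -
      have "l2norm (\<lambda>y. \<psi> s y - \<psi> t y) \<le> A * H * \<bar>M s - M t\<bar>"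
      proof (cases "t \<le> s")
        case True
        then show ?thesis using d\<psi>[of t s] Mm[of t s] s t' by simp
      next
        case False
        have "l2norm (\<lambda>y. \<psi> s y - \<psi> t y) = l2norm (\<lambda>y. - 1 * (\<psi> t y - \<psi> s y))" by simp
        also have "\<dots> = l2norm (\<lambda>y. \<psi> t y - \<psi> s y)" unfolding l2norm_cmult by simp
        also have "\<dots> \<le> A * H * (M t - M s)" by (rule d\<psi>) (use False s t' in auto)
        finally show ?thesis using Mm[of s t] False s t' by simp
      qed
      also have "\<dots> \<le> A * 1 * d" using elim A1 H by (intro mult_mono) auto
      finally show ?thesis by simp
    qed
    have L\<zeta>: "l2norm (\<lambda>y. \<zeta> s y - \<zeta> t y) \<le> (A + 1) * d"
    proof (rule l2norm_le_sup(2)[OF L2_onD(1)[OF L(2)]])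
      fix y :: real assume y: "0 < y" "y < 1"
      have "\<bar>\<zeta> s y - \<zeta> t y\<bar> \<le> \<bar>u s y - u t y\<bar> + \<bar>U s y - U t y\<bar>" by linarith
      then show "\<bar>\<zeta> s y - \<zeta> t y\<bar> \<le> (A + 1) * d" using du[OF y] elim(2)[rule_format, of y] unfolding distrib_right by linarith
    qed (use A1 d in simp)
    have LS: "l2norm (\<lambda>y. S s y - S t y) \<le> (2 * A * A + (2 * B + 1)) * d"
    proof (rule l2norm_le_sup(2)[OF L2_onD(1)[OF L(3)]])
      fix y :: real assume y: "0 < y" "y < 1"
      have uA: "\<bar>u s y\<bar> \<le> A" "\<bar>u t y\<bar> \<le> A" using wg_static.sup(1)[OF ss, of y] wg_static.sup(1)[OF tt, of y] y by auto
      have eq: "S s y - S t y = (u s y - u t y) * (u s y + u t y) - (U s y - U t y) * (U s y + U t y)"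
        by (simp add: power2_eq_square algebra_simps)
      have "\<bar>(u s y - u t y) * (u s y + u t y)\<bar> \<le> (A * d) * (2 * A)"
        unfolding abs_mult using du[OF y] uA d A1 by (intro mult_mono) auto
      moreover have "\<bar>(U s y - U t y) * (U s y + U t y)\<bar> \<le> d * (2 * B + 1)"
        unfolding abs_mult using elim(2)[rule_format, of y] B(2)[of y] d by (intro mult_mono) auto
      moreover have "(A * d) * (2 * A) + d * (2 * B + 1) = (2 * A * A + (2 * B + 1)) * d" by (simp add: algebra_simps)
      ultimately show "\<bar>S s y - S t y\<bar> \<le> (2 * A * A + (2 * B + 1)) * d" unfolding eq by linarith
    qed (use A1 B d in simp)
    let ?t = "l2norm (pw q)"
    have "?t * ?t = ip (pw q) (pw q)" using l2norm_square[of "pw q"] by (simp add: power2_eq_square)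
    also have "\<dots> = - ip (\<lambda>y. \<psi> s y - \<psi> t y) (pw q)
      - \<nu> * ip (\<lambda>y. \<zeta> s y - \<zeta> t y) (pw (\<lambda>i. pderiv (q i))) - ip (\<lambda>y. S s y - S t y) (pw q) / 3"
      unfolding pq[symmetric] by (rule \<tau>_diff[OF s(1,2) t'(1,2), of q, unfolded pq[symmetric]]) (use q in auto)
    also have "\<dots> \<le> (A * d) * ?t + A * (((A + 1) * d) * (Cd * ?t)) + ((2 * A * A + (2 * B + 1)) * d) * ?t"
    proof -
      have 1: "- ip (\<lambda>y. \<psi> s y - \<psi> t y) (pw q) \<le> (A * d) * ?t"
        using ip_le(2)[OF L(1) pw_L2[of q]] mult_right_mono[OF L\<psi> l2norm_nonneg[of "pw q"]] by linarith
      have "- ip (\<lambda>y. \<zeta> s y - \<zeta> t y) (pw (\<lambda>i. pderiv (q i))) \<le> l2norm (\<lambda>y. \<zeta> s y - \<zeta> t y) * l2norm (pw (\<lambda>i. pderiv (q i)))"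
        using ip_le(2)[OF L(2) pw_L2[of "\<lambda>i. pderiv (q i)"]] by linarith
      also have "\<dots> \<le> ((A + 1) * d) * (Cd * ?t)" using A1 d by (intro mult_mono L\<zeta> Cd(2) q(2)) auto
      finally have "\<nu> * (- ip (\<lambda>y. \<zeta> s y - \<zeta> t y) (pw (\<lambda>i. pderiv (q i)))) \<le> A * (((A + 1) * d) * (Cd * ?t))"
        using \<nu> A1 d Cd(1) by (intro order_trans[OF mult_left_mono mult_right_mono]) auto
      then have 2: "- (\<nu> * ip (\<lambda>y. \<zeta> s y - \<zeta> t y) (pw (\<lambda>i. pderiv (q i)))) \<le> A * (((A + 1) * d) * (Cd * ?t))" by simp
      have n: "0 \<le> l2norm (\<lambda>y. S s y - S t y) * ?t" by simp
      have 3: "- ip (\<lambda>y. S s y - S t y) (pw q) / 3 \<le> ((2 * A * A + (2 * B + 1)) * d) * ?t"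
        using ip_le(2)[OF L(3) pw_L2[of q]] mult_right_mono[OF LS l2norm_nonneg[of "pw q"]] n by linarith
      show ?thesis using 1 2 3 by linarith
    qed
    also have "\<dots> = (d * Q) * ?t" by (simp add: Q_def algebra_simps)
    also have "\<dots> \<le> \<epsilon> * ?t" by (rule mult_right_mono[OF d(3)]) simp
    finally have "?t \<le> \<epsilon>" using \<epsilon> l2norm_nonneg[of "pw q"] by (cases "?t = 0") (auto simp: mult_le_cancel_right)
    then show ?case unfolding pq .
  qed
qed

definition "C6 = A + (2 * A + 1) * (A + 1) + A"

text \<open>The flux is known for t > 0 only, so its initial size is a statement about small times.
  Since \<open>e\<close> vanishes at 0 and is continuous, it can be made smaller than H / (Cd + 1),
  which neutralises the inverse constant of the mesh. In \<open>C6\<close> the two summands A belong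
  to \<psi> and to \<nu> (e,\<tau>'), the product to S.\<close>

lemma \<tau>_start: "\<forall>\<^sub>F s in at_right 0. l2norm (\<tau> s) \<le> C6 * H"
proof -
  obtain Cd where Cd: "0 \<le> Cd" "\<And>q. (\<And>i. i \<in> {1..<N} \<Longrightarrow> degree (q i) \<le> k + 1) \<Longrightarrow> l2norm (pw (\<lambda>i. pderiv (q i))) \<le> Cd * l2norm (pw q)"
    using pw_deriv_inverse[of "k + 1"] by blast
  define d where "d = H / (Cd + 1)"
  have d: "0 < d" "d * Cd \<le> H" "d \<le> H"
  proof -
    show "0 < d" using H Cd(1) by (simp add: d_def)
    then have "d * Cd \<le> d * (Cd + 1)" "d * 1 \<le> d * (Cd + 1)" using Cd(1) by (auto intro!: mult_left_mono)
    moreover have "d * (Cd + 1) = H" using Cd(1) by (simp add: d_def)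
    ultimately show "d * Cd \<le> H" "d \<le> H" by auto
  qed
  have "\<forall>\<^sub>F s in at_right 0. \<forall>y\<in>{0<..<1}. \<bar>e s y - e 0 y\<bar> \<le> d"
    using e_cont[of 0 d] d T at_within_Icc_at_right[OF T] by simp
  moreover have "\<forall>\<^sub>F s in at_right 0. s \<in> {0<..<T}" by (rule eventually_at_right_real[OF T])
  ultimately show ?thesis
  proof eventually_elim
    case (elim s)
    have s: "0 < s" "s \<le> T" using elim by auto
    note ss = stat[OF s]
    have ed: "\<bar>e s y\<bar> \<le> d" for y
    proof (cases "y \<in> {0<..<1}")
      case True
      show ?thesis using elim(1)[rule_format, OF True] unfolding e0 by simp
    next
      case False
      have "y \<notin> element x i" if "i \<in> {1..<N}" for i using elem_subset[OF that] False by auto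
      then have "e s y = 0" by (cases y rule: pw_cases) auto
      then show ?thesis using d by simp
    qed
    have el: "l2norm (e s) \<le> d" by (rule l2norm_le_sup(2)[OF pw_measurable ed]) (use d in simp)
    have z: "l2norm (\<zeta> s) \<le> (A + 1) * H" using wg_static.l2_\<zeta>[OF ss] el d by (simp add: algebra_simps)
    have "l2norm (S s) \<le> (2 * A + d) * l2norm (\<zeta> s)" by (rule wg_static.S_le[OF ss c1 e_le[OF less_imp_le[OF s(1)] s(2)] ed])
    also have "\<dots> \<le> (2 * A + 1) * ((A + 1) * H)" using z d H A1 by (intro mult_mono) auto
    finally have Sb: "l2norm (S s) \<le> (2 * A + 1) * ((A + 1) * H)" .
    let ?t = "l2norm (\<tau> s)"
    have deg: "\<And>i. i \<in> {1..<N} \<Longrightarrow> degree (tF s i) \<le> k + 1" by (rule wg_static.tF(1)[OF ss])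
    have "?t * ?t = ip (\<tau> s) (\<tau> s)" using l2norm_square[of "\<tau> s"] by (simp add: power2_eq_square)
    also have "\<dots> = - ip (\<psi> s) (\<tau> s) - \<nu> * ip (\<zeta> s) (\<tau>' s) - ip (S s) (\<tau> s) / 3"
      by (rule wg_static.flux_\<tau>_test[OF ss wg_static.tF(2)[OF ss] deg])
    also have "ip (\<zeta> s) (\<tau>' s) = ip (e s) (\<tau>' s)" by (rule wg_static.ip_\<zeta>[OF ss wg_static.deg_tF'[OF ss]])
    also have "- ip (\<psi> s) (\<tau> s) - \<nu> * ip (e s) (\<tau>' s) - ip (S s) (\<tau> s) / 3 \<le> (A * H) * ?t + A * (d * (Cd * ?t)) + ((2 * A + 1) * ((A + 1) * H)) * ?t"
    proof -
      have 1: "- ip (\<psi> s) (\<tau> s) \<le> (A * H) * ?t"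
        using ip_le(2)[OF wg_static.L2s(6)[OF ss] pw_L2[of "tF s"]] mult_right_mono[OF wg_static.approx(3)[OF ss] l2norm_nonneg[of "\<tau> s"]] by linarith
      have "- ip (e s) (\<tau>' s) \<le> l2norm (e s) * l2norm (\<tau>' s)"
        using ip_le(2)[OF pw_L2[of "eF s"] pw_L2[of "\<lambda>i. pderiv (tF s i)"]] by linarith
      also have "\<dots> \<le> d * (Cd * ?t)" using d by (intro mult_mono el Cd(2) deg) auto
      finally have "\<nu> * (- ip (e s) (\<tau>' s)) \<le> A * (d * (Cd * ?t))"
        using \<nu> d Cd(1) by (intro order_trans[OF mult_left_mono mult_right_mono]) auto
      then have 2: "- (\<nu> * ip (e s) (\<tau>' s)) \<le> A * (d * (Cd * ?t))" by simp
      have n: "0 \<le> l2norm (S s) * ?t" by simp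
      have 3: "- ip (S s) (\<tau> s) / 3 \<le> ((2 * A + 1) * ((A + 1) * H)) * ?t"
        using ip_le(2)[OF wg_static.L2s(4)[OF ss] pw_L2[of "tF s"]] mult_right_mono[OF Sb l2norm_nonneg[of "\<tau> s"]] n by linarith
      show ?thesis using 1 2 3 by linarith
    qed
    also have "\<dots> = (A * H + A * (d * Cd) + (2 * A + 1) * ((A + 1) * H)) * ?t" by (simp add: algebra_simps)
    also have "\<dots> \<le> (A * H + A * H + (2 * A + 1) * ((A + 1) * H)) * ?t"
      using d A1 by (intro mult_right_mono add_mono mult_left_mono order_refl) auto
    also have "A * H + A * H + (2 * A + 1) * ((A + 1) * H) = C6 * H" by (simp add: C6_def algebra_simps)
    finally have le: "?t * ?t \<le> (C6 * H) * ?t" .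
    have "0 \<le> C6 * H" using A1 H by (simp add: C6_def)
    with le show ?case using l2norm_nonneg[of "\<tau> s"] by (cases "?t = 0") (auto simp: mult_le_cancel_right)
  qed
qed

text \<open>The coefficient of the increments of M: 2 A comes from \<psi>, and the three parts of
  the increment of S that contain data increments give 8/3 (A^2 + A c), rounded up to 3.\<close>

definition "C5 = 2 * A + 3 * (A * A + A * c)"

abbreviation "C4 \<equiv> wg_static.C4 A c"

text \<open>The increment of the flux relation is tested with \<open>\<tau> b\<close>. Up to a
  remainder of size \<epsilon> (b - a), the increment of \<zeta> is (b - a)(w - dU), to which the
  static estimate applies. Increments of the data enter as H (M b - M a) ||\<tau>||; as u_t is
  merely integrable in time, M cannot be replaced by a multiple of time.\<close>

lemma flux_energy_step:
  assumes b: "0 < b" "b \<le> T"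
  shows "\<forall>\<^sub>F a in at_left b. (l2norm (\<tau> b))\<^sup>2 - (l2norm (\<tau> a))\<^sup>2
    \<le> ((b - a) * (C4 * (1 + (l2norm (E b))\<^sup>2) + 1) + C5 * (M b - M a)) * ((l2norm (\<tau> b))\<^sup>2 + H\<^sup>2)"
proof -
  note sb = stat[OF b]
  let ?W = "\<lambda>y. w b y - pw (dU b) y"
  let ?g = "\<lambda>y. u b y * v b y - U b y * pw (wd k (uh b)) y"
  define X where "X = A * (1 + 2 * l2norm (E b))"
  define t p \<delta> W where "t = l2norm (\<tau> b)" and "p = l2norm (\<tau>' b)" and "\<delta> = l2norm (\<tau>' b) + l2norm ?g / 3" and "W = l2norm ?W"
  have X: "A \<le> X" using A1 by (simp add: X_def)
  have nn: "0 \<le> X" "0 \<le> t" "0 \<le> p" "0 \<le> \<delta>" "0 \<le> W" using A1 X by (auto simp: t_def p_def \<delta>_def W_def)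
  have UX: "\<bar>U b y\<bar> \<le> X" for y unfolding X_def by (rule wg_static.sup_U[OF sb])
  have WL: "?W \<in> L2" by (rule L2_minus_pw[OF wg_static.wL[OF sb]])
  \<comment> \<open>Collects what will be multiplied by \<epsilon>: the remainder against \<tau>',
    the remainder in the increment of \<open>e\<close>, and the part of S that is quadratic in the
    increments. With \<epsilon> B \<le> H^2 all of this is harmless.\<close>
  define B where "B = 2 * A * p + 4/3 * X * t + (W + 1) * t"
  have B: "0 \<le> B" using nn A1 by (simp add: B_def)
  define \<epsilon> where "\<epsilon> = min 1 (H\<^sup>2 / (B + 1))"
  have \<epsilon>: "0 < \<epsilon>" "\<epsilon> \<le> 1" "\<epsilon> * B \<le> H\<^sup>2"
  proof -
    show "0 < \<epsilon>" "\<epsilon> \<le> 1" using H B by (auto simp: \<epsilon>_def)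
    have "\<epsilon> * B \<le> (H\<^sup>2 / (B + 1)) * (B + 1)" using B by (intro mult_mono) (auto simp: \<epsilon>_def)
    then show "\<epsilon> * B \<le> H\<^sup>2" using B by simp
  qed
  have bT: "b \<in> {0..T}" using b by auto
  have lft: "at_left b \<le> at b within {0..T}"
  proof -
    have "at_left b = at b within {0..b}" using at_within_Icc_at_left[OF b(1)] by simp
    also have "\<dots> \<le> at b within {0..T}" by (rule at_le) (use b in auto)
    finally show ?thesis .
  qed
  have "0 < \<epsilon> / (4 * A)" "0 < \<epsilon> / 4" using \<epsilon> A1 by auto
  then have ev: "\<forall>\<^sub>F a in at_left b. a \<in> {0..T} \<and> \<bar>M a - M b\<bar> \<le> \<epsilon> / (4 * A)"
    "\<forall>\<^sub>F a in at_left b. \<forall>y. \<bar>U a y - U b y\<bar> \<le> \<epsilon> / 4"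
    using M_cont[OF bT] U_cont[OF bT] lft filter_leD by blast+
  show ?thesis using \<zeta>_deriv[OF b \<epsilon>(1)] ev
  proof eventually_elim
    case (elim a)
    let ?R = "\<lambda>y. \<zeta> b y - \<zeta> a y - (b - a) * ?W y"
    have a: "0 < a" "a < b" and RL: "?R \<in> L2" and R: "l2norm ?R \<le> \<epsilon> * (b - a)" using elim by auto
    have aT: "0 < a" "a \<le> T" "a \<in> {0..T}" using a b by auto
    note sa = stat[OF aT(1,2)]
    define m where "m = M b - M a"
    have m: "0 \<le> m" unfolding m_def using Mm[of a b] a b by simp
    have mm: "A * m \<le> \<epsilon> / 4"
    proof -
      have "A * m \<le> A * (\<epsilon> / (4 * A))" using elim A1 by (intro mult_left_mono) (auto simp: m_def)
      then show ?thesis using A1 by simp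
    qed
    let ?d\<zeta> = "\<lambda>y. \<zeta> b y - \<zeta> a y" and ?du = "\<lambda>y. u b y - u a y"
    let ?d\<eta> = "\<lambda>y. (u b y - u a y) - pw (\<lambda>i. Pu b i - Pu a i) y" and ?de = "\<lambda>y. e b y - e a y"
    have duL: "?du \<in> L2" using a b by (intro L2_on_diff uL2) auto
    have d\<zeta>L: "?d\<zeta> \<in> L2" using a b by (intro L2_on_diff \<zeta>L2) auto
    have d\<eta>L: "?d\<eta> \<in> L2" by (rule L2_minus_pw[OF duL])
    have deL: "?de \<in> L2" by (intro L2_on_diff pw_L2)
    have WR: "ip ?d\<zeta> f = (b - a) * ip ?W f + ip ?R f" if "f \<in> L2" for f
    proof -
      have "ip ?d\<zeta> f = ip (\<lambda>y. (b - a) * ?W y + ?R y) f" by (rule ioint_cong) (simp add: algebra_simps)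
      also have "\<dots> = (b - a) * ip ?W f + ip ?R f" unfolding ip_add[OF L2_on_cmult[OF WL] RL that] ip_cmult ..
      finally show ?thesis .
    qed
    have d\<zeta>n: "l2norm ?d\<zeta> \<le> (b - a) * (W + 1)"
    proof -
      have "l2norm ?d\<zeta> = l2norm (\<lambda>y. (b - a) * ?W y + ?R y)" by (simp add: algebra_simps)
      also have "\<dots> \<le> l2norm (\<lambda>y. (b - a) * ?W y) + l2norm ?R" by (rule l2norm_triangle[OF L2_on_cmult[OF WL] RL])
      also have "\<dots> = (b - a) * W + l2norm ?R" unfolding l2norm_cmult W_def using a by simp
      also have "\<dots> \<le> (b - a) * W + 1 * (b - a)"
        by (rule add_left_mono[OF order_trans[OF R mult_right_mono[OF \<epsilon>(2)]]]) (use a in simp)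
      finally show ?thesis by (simp add: algebra_simps)
    qed
    \<comment> \<open>The increment of \<open>e\<close> has degree k and is tested with itself in
      the evolution equation; this costs no inverse inequality.\<close>
    have den: "l2norm ?de \<le> (b - a) * (\<delta> + \<epsilon>)"
    proof -
      define q where "q = (\<lambda>i. eF b i - eF a i)"
      have pq: "?de = pw q" by (simp add: q_def pw_diff fun_eq_iff)
      have q: "degree (q i) \<le> k" if "i \<in> {1..<N}" for i
        unfolding q_def by (intro degree_diff_le wg_static.deg_eF[OF sb that] wg_static.deg_eF[OF sa that])
      have "l2norm (pw q) * l2norm (pw q) = ip ?de (pw q)"
        unfolding fun_cong[OF pq] using l2norm_square[of "pw q"] by (simp add: power2_eq_square)
      also have "\<dots> = (b - a) * ip ?W (pw q) + ip ?R (pw q)"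
        by (rule trans[OF ip_de[OF a b(2)] WR[OF pw_L2]]) (rule q)
      also have "\<dots> \<le> (b - a) * (\<delta> * l2norm (pw q)) + (\<epsilon> * (b - a)) * l2norm (pw q)"
      proof (rule add_mono)
        have "ip ?W (pw q) \<le> \<delta> * l2norm (pw q)" unfolding \<delta>_def using wg_static.evol_le[OF sb q] by (simp add: abs_le_iff)
        then show "(b - a) * ip ?W (pw q) \<le> (b - a) * (\<delta> * l2norm (pw q))" using a by (intro mult_left_mono) auto
        show "ip ?R (pw q) \<le> (\<epsilon> * (b - a)) * l2norm (pw q)"
          by (rule order_trans[OF ip_le(1)[OF RL pw_L2] mult_right_mono[OF R]]) simp
      qed
      also have "\<dots> = ((b - a) * (\<delta> + \<epsilon>)) * l2norm (pw q)" by (simp add: algebra_simps)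
      finally have le: "l2norm (pw q) * l2norm (pw q) \<le> ((b - a) * (\<delta> + \<epsilon>)) * l2norm (pw q)" .
      have "0 \<le> (b - a) * (\<delta> + \<epsilon>)" using a nn \<epsilon> by simp
      with le show ?thesis unfolding pq using l2norm_nonneg[of "pw q"] by (cases "l2norm (pw q) = 0") (auto simp: mult_le_cancel_right)
    qed
    have b1: "- 2 * ip (\<lambda>y. \<psi> b y - \<psi> a y) (\<tau> b) \<le> 2 * (A * H * m * t)"
    proof -
      have "(\<lambda>y. \<psi> b y - \<psi> a y) \<in> L2" by (intro L2_on_diff wg_static.L2s[OF sb] wg_static.L2s[OF sa])
      from ip_le(2)[OF this pw_L2[of "tF b"]] mult_right_mono[OF d\<psi>[of a b] l2norm_nonneg[of "\<tau> b"]] a b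
      show ?thesis unfolding m_def t_def by simp
    qed
    have b2: "- 2 * (\<nu> * ip ?d\<zeta> (\<tau>' b)) \<le> (b - a) * (- 2 * \<nu> * ip ?W (\<tau>' b)) + (b - a) * (\<epsilon> * (2 * A * p))"
    proof -
      have "- ip ?R (\<tau>' b) \<le> (\<epsilon> * (b - a)) * p"
        using ip_le(2)[OF RL pw_L2[of "\<lambda>i. pderiv (tF b i)"]] mult_right_mono[OF R l2norm_nonneg[of "\<tau>' b"]] unfolding p_def by linarith
      then have "\<nu> * (- ip ?R (\<tau>' b)) \<le> A * ((\<epsilon> * (b - a)) * p)"
        using \<nu> \<epsilon> a nn by (intro order_trans[OF mult_left_mono mult_right_mono]) auto
      moreover have "- 2 * (\<nu> * ip ?d\<zeta> (\<tau>' b)) = (b - a) * (- 2 * \<nu> * ip ?W (\<tau>' b)) + 2 * (\<nu> * (- ip ?R (\<tau>' b)))"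
        unfolding WR[OF pw_L2[of "\<lambda>i. pderiv (tF b i)"]] by (simp add: algebra_simps)
      moreover have "2 * (A * ((\<epsilon> * (b - a)) * p)) = (b - a) * (\<epsilon> * (2 * A * p))" by simp
      ultimately show ?thesis by linarith
    qed
    have m1: "(\<lambda>y. pw (Pu b) y * ?d\<eta> y) \<in> L2" "l2norm (\<lambda>y. pw (Pu b) y * ?d\<eta> y) \<le> A * (A * H * m)"
    proof -
      show "(\<lambda>y. pw (Pu b) y * ?d\<eta> y) \<in> L2" by (rule pw_mult_L2[OF d\<eta>L])
      have "l2norm (\<lambda>y. pw (Pu b) y * ?d\<eta> y) \<le> A * l2norm ?d\<eta>"
        by (rule l2norm_bounded_mult(2)[OF d\<eta>L pw_measurable]) (use wg_static.sup(3)[OF sb] A1 in auto)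
      also have "\<dots> \<le> A * (A * H * m)" unfolding m_def using A1 a b by (intro mult_left_mono d\<eta>) auto
      finally show "l2norm (\<lambda>y. pw (Pu b) y * ?d\<eta> y) \<le> A * (A * H * m)" .
    qed
    have m2: "(\<lambda>y. ?d\<eta> y * e b y) \<in> L2" "l2norm (\<lambda>y. ?d\<eta> y * e b y) \<le> (A * m) * (c * H)"
    proof -
      note bm = l2norm_bounded_mult[OF pw_L2[of "eF b"] L2_onD(1)[OF d\<eta>L], of "A * m"]
      have le: "\<bar>?d\<eta> y\<bar> \<le> A * m" if "0 < y" "y < 1" for y unfolding m_def by (rule d\<eta>_sup) (use a b that in auto)
      show "(\<lambda>y. ?d\<eta> y * e b y) \<in> L2" by (rule bm(1)) (use le A1 m in auto)
      have "l2norm (\<lambda>y. ?d\<eta> y * e b y) \<le> (A * m) * l2norm (e b)" by (rule bm(2)) (use le A1 m in auto)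
      also have "\<dots> \<le> (A * m) * (c * H)" using A1 m b by (intro mult_left_mono e_le) auto
      finally show "l2norm (\<lambda>y. ?d\<eta> y * e b y) \<le> (A * m) * (c * H)" .
    qed
    have m3: "(\<lambda>y. U b y * ?de y) \<in> L2" "l2norm (\<lambda>y. U b y * ?de y) \<le> X * ((b - a) * (\<delta> + \<epsilon>))"
    proof -
      show "(\<lambda>y. U b y * ?de y) \<in> L2" by (rule pw_mult_L2[OF deL])
      have "l2norm (\<lambda>y. U b y * ?de y) \<le> X * l2norm ?de"
        by (rule l2norm_bounded_mult(2)[OF deL pw_measurable]) (use UX nn in auto)
      also have "\<dots> \<le> X * ((b - a) * (\<delta> + \<epsilon>))" by (rule mult_left_mono[OF den nn(1)])
      finally show "l2norm (\<lambda>y. U b y * ?de y) \<le> X * ((b - a) * (\<delta> + \<epsilon>))" .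
    qed
    have dum: "?du \<in> borel_measurable (lebesgue_on {0<..<1})" using L2_onD(1)[OF duL] .
    have dub: "\<bar>?du y\<bar> \<le> A * m" if "0 < y" "y < 1" for y unfolding m_def by (rule du) (use a b that in auto)
    have m4: "(\<lambda>y. ?du y * \<zeta> b y) \<in> L2" "l2norm (\<lambda>y. ?du y * \<zeta> b y) \<le> (A * m) * ((A + c) * H)"
    proof -
      have zL: "\<zeta> b \<in> L2" using b by (intro \<zeta>L2) auto
      note bm = l2norm_bounded_mult[OF zL dum, of "A * m"]
      show "(\<lambda>y. ?du y * \<zeta> b y) \<in> L2" by (rule bm(1)) (use dub A1 m in auto)
      have "l2norm (\<lambda>y. ?du y * \<zeta> b y) \<le> (A * m) * l2norm (\<zeta> b)" by (rule bm(2)) (use dub A1 m in auto)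
      also have "\<dots> \<le> (A * m) * ((A + c) * H)" using A1 m b by (intro mult_left_mono \<zeta>_le) auto
      finally show "l2norm (\<lambda>y. ?du y * \<zeta> b y) \<le> (A * m) * ((A + c) * H)" .
    qed
    have m5: "(\<lambda>y. (?d\<zeta> y - 2 * ?du y) * ?d\<zeta> y) \<in> L2" "l2norm (\<lambda>y. (?d\<zeta> y - 2 * ?du y) * ?d\<zeta> y) \<le> \<epsilon> * ((b - a) * (W + 1))"
    proof -
      have mz: "(\<lambda>y. ?d\<zeta> y - 2 * ?du y) \<in> borel_measurable (lebesgue_on {0<..<1})"
        by (rule L2_onD(1)[OF L2_on_diff[OF d\<zeta>L L2_on_cmult[OF duL]]])
      note bm = l2norm_bounded_mult[OF d\<zeta>L mz, of \<epsilon>]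
      have le: "\<bar>?d\<zeta> y - 2 * ?du y\<bar> \<le> \<epsilon>" if "0 < y" "y < 1" for y
      proof -
        have "\<bar>?d\<zeta> y - 2 * ?du y\<bar> \<le> \<bar>?du y\<bar> + \<bar>U a y - U b y\<bar>"
          using abs_triangle_ineq[of "- ?du y" "U a y - U b y"] by (simp add: algebra_simps)
        then show ?thesis using dub[OF that] mm elim(3)[rule_format, of y] \<epsilon>(1) by linarith
      qed
      show "(\<lambda>y. (?d\<zeta> y - 2 * ?du y) * ?d\<zeta> y) \<in> L2" by (rule bm(1)) (use le \<epsilon> in auto)
      have "l2norm (\<lambda>y. (?d\<zeta> y - 2 * ?du y) * ?d\<zeta> y) \<le> \<epsilon> * l2norm ?d\<zeta>" by (rule bm(2)) (use le \<epsilon> in auto)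
      also have "\<dots> \<le> \<epsilon> * ((b - a) * (W + 1))" using \<epsilon> by (intro mult_left_mono d\<zeta>n) auto
      finally show "l2norm (\<lambda>y. (?d\<zeta> y - 2 * ?du y) * ?d\<zeta> y) \<le> \<epsilon> * ((b - a) * (W + 1))" .
    qed
    have b3: "- ip (\<lambda>y. S b y - S a y) (\<tau> b) \<le> (2 * (A * (A * H * m)) + 2 * ((A * m) * (c * H)) + 2 * (X * ((b - a) * (\<delta> + \<epsilon>)))
        + 2 * ((A * m) * ((A + c) * H)) + \<epsilon> * ((b - a) * (W + 1))) * t"
    proof -
      have tL: "\<tau> b \<in> L2" by (rule pw_L2)
      \<comment> \<open>With increments d, the difference of S is 2 \<zeta> du + 2 U d\<zeta> +
        (d\<zeta> - 2 du) d\<zeta>. Here d\<zeta> is split into d\<eta> and de, and in U d\<eta>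
        also U = Pu - e, because U has no uniform bound: \<open>Pu\<close> is bounded, and
        \<open>e\<close> is O(H) while d\<eta> is bounded pointwise. So each data term keeps a
        factor H.\<close>
      have eq: "ip (\<lambda>y. S b y - S a y) (\<tau> b) = ip (\<lambda>y. 2 * (pw (Pu b) y * ?d\<eta> y) - 2 * (?d\<eta> y * e b y) + 2 * (U b y * ?de y)
          + 2 * (?du y * \<zeta> b y) + (?d\<zeta> y - 2 * ?du y) * ?d\<zeta> y) (\<tau> b)"
        by (rule ioint_cong) (simp add: e_eq pw_diff power2_eq_square algebra_simps)
      note c1 = L2_on_cmult[OF m1(1), of 2] and c2 = L2_on_cmult[OF m2(1), of 2] and c3 = L2_on_cmult[OF m3(1), of 2] and c4 = L2_on_cmult[OF m4(1), of 2]
      note d1 = L2_on_diff[OF c1 c2] note d2 = L2_on_add[OF d1 c3] note d3 = L2_on_add[OF d2 c4]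
      have bd: "\<bar>ip f (\<tau> b)\<bar> \<le> C * t" if "f \<in> L2" "l2norm f \<le> C" for f C
        using ioint_le_l2norm[OF that(1) tL] mult_right_mono[OF that(2) l2norm_nonneg[of "\<tau> b"]] by (simp add: t_def)
      have "ip (\<lambda>y. S b y - S a y) (\<tau> b) = 2 * ip (\<lambda>y. pw (Pu b) y * ?d\<eta> y) (\<tau> b) - 2 * ip (\<lambda>y. ?d\<eta> y * e b y) (\<tau> b)
          + 2 * ip (\<lambda>y. U b y * ?de y) (\<tau> b) + 2 * ip (\<lambda>y. ?du y * \<zeta> b y) (\<tau> b) + ip (\<lambda>y. (?d\<zeta> y - 2 * ?du y) * ?d\<zeta> y) (\<tau> b)"
        unfolding eq ip_add[OF d3 m5(1) tL] ip_add[OF d2 c4 tL] ip_add[OF d1 c3 tL] ip_diff[OF c1 c2 tL] ip_cmult ..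
      moreover have "- s \<le> (2 * C1 + 2 * C2 + 2 * C3 + 2 * C4' + C5') * t"
        if "s = 2 * p1 - 2 * p2 + 2 * p3 + 2 * p4 + p5" "\<bar>p1\<bar> \<le> C1 * t" "\<bar>p2\<bar> \<le> C2 * t" "\<bar>p3\<bar> \<le> C3 * t"
          "\<bar>p4\<bar> \<le> C4' * t" "\<bar>p5\<bar> \<le> C5' * t" for s p1 p2 p3 p4 p5 C1 C2 C3 C4' C5' :: real
      proof -
        have "(2 * C1 + 2 * C2 + 2 * C3 + 2 * C4' + C5') * t = 2 * (C1 * t) + 2 * (C2 * t) + 2 * (C3 * t) + 2 * (C4' * t) + C5' * t"
          by (simp add: algebra_simps)
        then show ?thesis using that by linarith
      qed
      ultimately show ?thesis using bd[OF m1] bd[OF m2] bd[OF m3] bd[OF m4] bd[OF m5] by blast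
    qed
    have static: "- 2 * \<nu> * ip ?W (\<tau>' b) + 4/3 * X * t * \<delta> \<le> C4 * (1 + (l2norm (E b))\<^sup>2) * (t\<^sup>2 + H\<^sup>2)"
      unfolding X_def t_def \<delta>_def by (rule wg_static.flux_energy_static[OF sb c1 e_le]) (use b in auto)
    have "t\<^sup>2 - (l2norm (\<tau> a))\<^sup>2 \<le> 2 * ip (\<lambda>y. \<tau> b y - \<tau> a y) (\<tau> b)"
      unfolding t_def by (rule l2norm_square_diff_le[OF pw_L2 pw_L2])
    also have "\<dots> = - 2 * ip (\<lambda>y. \<psi> b y - \<psi> a y) (\<tau> b) + - 2 * (\<nu> * ip ?d\<zeta> (\<tau>' b)) + 2/3 * (- ip (\<lambda>y. S b y - S a y) (\<tau> b))"
    proof -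
      have "ip (\<lambda>y. \<tau> b y - \<tau> a y) (\<tau> b) = - ip (\<lambda>y. \<psi> b y - \<psi> a y) (\<tau> b)
          - \<nu> * ip ?d\<zeta> (\<tau>' b) - ip (\<lambda>y. S b y - S a y) (\<tau> b) / 3"
        by (rule \<tau>_diff[OF b aT(1,2) wg_static.tF(2)[OF sb]]) (rule wg_static.tF(1)[OF sb])
      moreover have "2 * r = - 2 * p + - 2 * q + 2/3 * (- z)" if "r = - p - q - z / 3" for r p q z :: real
        using that by simp
      ultimately show ?thesis by blast
    qed
    also have "\<dots> \<le> 2 * (A * H * m * t) + ((b - a) * (- 2 * \<nu> * ip ?W (\<tau>' b)) + (b - a) * (\<epsilon> * (2 * A * p)))
        + 2/3 * ((2 * (A * (A * H * m)) + 2 * ((A * m) * (c * H)) + 2 * (X * ((b - a) * (\<delta> + \<epsilon>)))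
        + 2 * ((A * m) * ((A + c) * H)) + \<epsilon> * ((b - a) * (W + 1))) * t)"
      by (intro add_mono b1 b2 mult_left_mono b3) simp
    also have "\<dots> = (b - a) * (- 2 * \<nu> * ip ?W (\<tau>' b) + 4/3 * X * t * \<delta>) + (2 * A + 8/3 * (A * A + A * c)) * (m * (H * t))
        + (b - a) * (\<epsilon> * (2 * A * p + 4/3 * X * t + 2/3 * ((W + 1) * t)))"
      by (simp add: algebra_simps add_divide_distrib diff_divide_distrib)
    also have "\<dots> \<le> (b - a) * (C4 * (1 + (l2norm (E b))\<^sup>2) * (t\<^sup>2 + H\<^sup>2)) + C5 * (m * (t\<^sup>2 + H\<^sup>2)) + (b - a) * (t\<^sup>2 + H\<^sup>2)"
    proof (intro add_mono)
      show "(b - a) * (- 2 * \<nu> * ip ?W (\<tau>' b) + 4/3 * X * t * \<delta>) \<le> (b - a) * (C4 * (1 + (l2norm (E b))\<^sup>2) * (t\<^sup>2 + H\<^sup>2))"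
        using static a by (intro mult_left_mono) auto
      have "2 * (H * t) \<le> t\<^sup>2 + H\<^sup>2" using sum_squares_bound[of H t] by simp
      then have Ht: "H * t \<le> t\<^sup>2 + H\<^sup>2" using mult_nonneg_nonneg[of H t] H nn by linarith
      have "8/3 * (A * A + A * c) \<le> 3 * (A * A + A * c)" using A1 c1 by (intro mult_right_mono) auto
      then show "(2 * A + 8/3 * (A * A + A * c)) * (m * (H * t)) \<le> C5 * (m * (t\<^sup>2 + H\<^sup>2))"
        unfolding C5_def using A1 c1 m H nn by (intro mult_mono mult_left_mono Ht) auto
      have "0 \<le> (W + 1) * t" using nn by simp
      then have "2 * A * p + 4/3 * X * t + 2/3 * ((W + 1) * t) \<le> B" unfolding B_def by linarith
      then have "\<epsilon> * (2 * A * p + 4/3 * X * t + 2/3 * ((W + 1) * t)) \<le> \<epsilon> * B" using \<epsilon> by (intro mult_left_mono) auto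
      also have "\<dots> \<le> t\<^sup>2 + H\<^sup>2" using \<epsilon>(3) by (rule order_trans) simp
      finally show "(b - a) * (\<epsilon> * (2 * A * p + 4/3 * X * t + 2/3 * ((W + 1) * t))) \<le> (b - a) * (t\<^sup>2 + H\<^sup>2)"
        using a by (intro mult_left_mono) auto
    qed
    also have "\<dots> = ((b - a) * (C4 * (1 + (l2norm (E b))\<^sup>2) + 1) + C5 * m) * (t\<^sup>2 + H\<^sup>2)" by (simp add: algebra_simps)
    finally show ?case unfolding t_def m_def .
  qed
qed

text \<open>The part of the Gronwall exponent that is linear in time: C4 + 1 is visible in the flux
  estimate, and the last summand is the growth that the energy estimate permits to (e,e) + H^2,
  multiplied by the weight C4 A.\<close>

definition "\<beta> = C4 + 1 + C4 * A * K1 * (c\<^sup>2 + 1)"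
definition "C7 = (C6 + 1) * exp (C5 * A + \<beta> * T + C4 * A * (c\<^sup>2 + 1))"

lemma C4_nonneg: "0 \<le> C4"
proof -
  have T': "0 \<le> T" using T by simp
  have "C4 = 16 * A ^ 3 * (2 * (wg_static.C3 A c)\<^sup>2 + 1)"
    by (rule wg_static.C4_def[OF stat[OF T order_refl] c1 e_le[OF T' order_refl]])
  then show ?thesis using A1 by simp
qed

lemma \<tau>_le:
  assumes t: "0 < t" "t \<le> T"
  shows "l2norm (\<tau> t) \<le> C7 * H"
proof -
  let ?y = "\<lambda>t. (l2norm (e t))\<^sup>2 + H\<^sup>2" and ?Y = "\<lambda>t. (l2norm (\<tau> t))\<^sup>2 + H\<^sup>2"
  \<comment> \<open>The last term is a potential. By the energy step, A times the decrease of (e,e)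
    + H^2, plus a multiple of b - a, dominates (b - a)(E,E); so the increments of \<Lambda> dominate
    the coefficient without any integral of (E,E), whose measurability in time is not at
    hand.\<close>
  define \<Lambda> where "\<Lambda> = (\<lambda>t. C5 * M t + \<beta> * t - C4 * A * ?y t)"
  \<comment> \<open>The flux error is not defined by the scheme at time 0; the argument starts at a
    small time at which it is already O(H).\<close>
  have "\<forall>\<^sub>F s in at_right 0. l2norm (\<tau> s) \<le> C6 * H \<and> s \<in> {0<..<t}"
    by (rule eventually_conj[OF \<tau>_start eventually_at_right_real[OF t(1)]])
  then obtain s where s: "l2norm (\<tau> s) \<le> C6 * H" "0 < s" "s < t"
    using eventually_happens[of _ "at_right (0::real)"] by auto
  have y_le: "?y b \<le> c\<^sup>2 + 1" if "0 \<le> b" "b \<le> T" for b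
  proof -
    have "l2norm (e b) \<le> c * 1" by (rule order_trans[OF e_le[OF that] mult_left_mono]) (use H c1 in auto)
    then have "(l2norm (e b))\<^sup>2 \<le> c\<^sup>2" by (intro power_mono) auto
    moreover have "H\<^sup>2 \<le> 1" using H by (simp add: power_le_one)
    ultimately show ?thesis by simp
  qed
  have CA: "0 \<le> C4 * A" using C4_nonneg A1 by simp
  have C5: "0 \<le> C5" using A1 c1 by (simp add: C5_def)
  have "?Y t \<le> ?Y s * exp (2 * (\<Lambda> t - \<Lambda> s))"
  proof (rule left_gronwall)
    show "continuous_on {s..t} ?Y"
      by (intro continuous_intros continuous_on_subset[OF \<tau>_l2_cont]) (use s t in auto)
    show "continuous_on {s..t} \<Lambda>" unfolding \<Lambda>_def
      by (intro continuous_intros continuous_on_subset[OF e_l2_cont] continuous_on_subset[OF Mc]) (use s t in auto)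
    fix b assume "s < b" "b \<le> t"
    then have b: "0 < b" "b \<le> T" using s t by auto
    from flux_energy_step[OF b] energy_step[OF b] eventually_at_left_real[OF b(1)]
    show "\<forall>\<^sub>F a in at_left b. 0 \<le> \<Lambda> b - \<Lambda> a \<and> ?Y b - ?Y a \<le> (\<Lambda> b - \<Lambda> a) * ?Y b"
    proof eventually_elim
      case (elim a)
      have a: "0 < a" "a < b" using elim by auto
      define E2 where "E2 = (l2norm (E b))\<^sup>2"
      have E2: "0 \<le> E2" by (simp add: E2_def)
      have "(b - a) * E2 \<le> (A * \<nu>) * ((b - a) * E2)" using mult_right_mono[OF \<nu>(3), of "(b - a) * E2"] a E2 by simp
      also have "\<dots> = A * ((b - a) * (\<nu> * E2))" by simp
      also have "\<dots> \<le> A * (?y a - ?y b + (b - a) * (K1 * ?y b))"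
      proof (rule mult_left_mono)
        show "(b - a) * (\<nu> * E2) \<le> ?y a - ?y b + (b - a) * (K1 * ?y b)"
          using elim(2) unfolding E2_def[symmetric] by (simp add: algebra_simps)
      qed (use A1 in simp)
      also have "\<dots> \<le> A * (?y a - ?y b + (b - a) * (K1 * (c\<^sup>2 + 1)))"
        using y_le[of b] b a A1 K1 by (intro mult_left_mono add_left_mono) auto
      finally have "C4 * ((b - a) * E2) \<le> C4 * (A * (?y a - ?y b + (b - a) * (K1 * (c\<^sup>2 + 1))))"
        by (rule mult_left_mono[OF _ C4_nonneg])
      then have le: "(b - a) * (C4 * (1 + E2) + 1) + C5 * (M b - M a) \<le> \<Lambda> b - \<Lambda> a"
        by (simp add: \<Lambda>_def \<beta>_def algebra_simps)
      have "0 \<le> (b - a) * (C4 * (1 + E2) + 1) + C5 * (M b - M a)"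
        using a C4_nonneg E2 C5 Mm[of a b] b by (intro add_nonneg_nonneg mult_nonneg_nonneg) auto
      then have 1: "0 \<le> \<Lambda> b - \<Lambda> a" using le by linarith
      have "?Y b - ?Y a \<le> ((b - a) * (C4 * (1 + E2) + 1) + C5 * (M b - M a)) * ?Y b"
        using elim(1) by (simp add: E2_def)
      also have "\<dots> \<le> (\<Lambda> b - \<Lambda> a) * ?Y b" by (rule mult_right_mono[OF le]) simp
      finally show ?case using 1 by simp
    qed
  qed (use s in auto)
  also have "\<dots> \<le> ((C6 + 1) * H)\<^sup>2 * exp (2 * (C5 * A + \<beta> * T + C4 * A * (c\<^sup>2 + 1)))"
  proof (rule mult_mono)
    have C6: "0 \<le> C6" using A1 by (simp add: C6_def)
    have "(l2norm (\<tau> s))\<^sup>2 \<le> (C6 * H)\<^sup>2" by (rule power_mono[OF s(1)]) simp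
    moreover have "(C6 * H)\<^sup>2 + H\<^sup>2 \<le> ((C6 + 1) * H)\<^sup>2" using C6 H by (simp add: power2_eq_square algebra_simps)
    ultimately show "?Y s \<le> ((C6 + 1) * H)\<^sup>2" by simp
    have 1: "C5 * (M t - M s) \<le> C5 * A"
      using MA Mm[of 0 s] Mm[of t T] s t C5 by (intro mult_left_mono) auto
    have \<beta>: "0 \<le> \<beta>" unfolding \<beta>_def using C4_nonneg A1 CA K1 by (intro add_nonneg_nonneg mult_nonneg_nonneg) auto
    have 2: "\<beta> * (t - s) \<le> \<beta> * T" using s t by (intro mult_left_mono \<beta>) auto
    have 3: "C4 * A * ?y s \<le> C4 * A * (c\<^sup>2 + 1)" using s t by (intro mult_left_mono y_le CA) auto
    have 4: "0 \<le> C4 * A * ?y t" by (rule mult_nonneg_nonneg[OF CA]) simp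
    have "\<Lambda> t - \<Lambda> s = C5 * (M t - M s) + \<beta> * (t - s) + C4 * A * ?y s - C4 * A * ?y t"
      by (simp add: \<Lambda>_def algebra_simps)
    then have "\<Lambda> t - \<Lambda> s \<le> C5 * A + \<beta> * T + C4 * A * (c\<^sup>2 + 1)" using 1 2 3 4 by linarith
    then show "exp (2 * (\<Lambda> t - \<Lambda> s)) \<le> exp (2 * (C5 * A + \<beta> * T + C4 * A * (c\<^sup>2 + 1)))" by simp
  qed simp_all
  also have "\<dots> = (C7 * H)\<^sup>2" unfolding C7_def power_mult_distrib exp_double by (simp only: mult_ac)
  finally have "?Y t \<le> (C7 * H)\<^sup>2" .
  then have "(l2norm (\<tau> t))\<^sup>2 \<le> (C7 * H)\<^sup>2" by (rule order_trans[rotated]) simp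
  then show ?thesis by (rule power2_le_imp_le) (use A1 H in \<open>simp add: C7_def C6_def\<close>)
qed

definition "C8 = A + wg_static.C2 A c * (C7 + 1)"

theorem gradient_error:
  assumes t: "0 < t" "t \<le> T"
  shows "l2norm (\<lambda>y. v t y - pw (wd k (uh t)) y) \<le> C8 * H"
proof -
  note st = stat[OF t]
  have et: "l2norm (e t) \<le> c * H" using t by (intro e_le) auto
  have eq: "(\<lambda>y. v t y - pw (wd k (uh t)) y) = (\<lambda>y. (v t y - pw (Pv t) y) + E t y)" by (simp add: pw_err)
  have "l2norm (\<lambda>y. v t y - pw (wd k (uh t)) y) \<le> l2norm (\<lambda>y. v t y - pw (Pv t) y) + l2norm (E t)"
    unfolding eq by (rule l2norm_triangle[OF L2_minus_pw[OF wg_static.L2s(2)[OF st]] pw_L2])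
  also have "\<dots> \<le> A * H + wg_static.C2 A c * (l2norm (\<tau> t) + H)"
    by (intro add_mono wg_static.approx(2)[OF st] wg_static.E_le[OF st c1 et])
  also have "\<dots> \<le> A * H + wg_static.C2 A c * (C7 * H + H)"
    by (intro add_left_mono mult_left_mono add_right_mono \<tau>_le[OF t] wg_static.C_pos(2)[OF st c1 et])
  also have "\<dots> = C8 * H" by (simp add: C8_def algebra_simps)
  finally show ?thesis .
qed

end

section \<open>The error bound\<close>

lemma (in mesh) norm_h_eq_l2norm:
  assumes f: "f \<in> L2"
  shows "norm_h N x (\<lambda>i y. f y - poly (p i) y) = l2norm (\<lambda>y. f y - pw p y)"
proof -
  have "inner_h N x (\<lambda>i y. f y - poly (p i) y) (\<lambda>i y. f y - poly (p i) y) = ioint 0 1 (\<lambda>y. (f y - pw p y)\<^sup>2)"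
    by (rule inner_h_eq[OF L2_onD(2)[OF L2_minus_pw[OF f]]]) (simp add: pw_elem power2_eq_square)
  then show ?thesis by (simp add: norm_h_def l2norm_def)
qed

lemma (in mesh) L2_projection_cong:
  assumes "\<And>y. y \<in> {0<..<1} \<Longrightarrow> f y = g y" "i \<in> {1..<N}"
  shows "L2_projection m x f i = L2_projection m x g i"
proof -
  have "ioint (x i) (x (i + 1)) (\<lambda>y. (f y - poly p y) * poly q y) = ioint (x i) (x (i + 1)) (\<lambda>y. (g y - poly p y) * poly q y)" for p q
    by (rule ioint_cong) (use assms elem_bounds[OF assms(2)] in auto)
  then show ?thesis unfolding L2_projection_def by simp
qed

text \<open>A time derivative is given coefficient by coefficient without a degree bound; the
  coefficients beyond k vanish at all positive times, hence so do their left difference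
  quotients.\<close>

lemma (in mesh) degree_time_derivative:
  assumes U: "poly_C1_in_time T p dp" and deg: "\<And>t. 0 < t \<Longrightarrow> t \<le> T \<Longrightarrow> degree (p t) \<le> k" and t: "0 < t" "t \<le> T"
  shows "degree (dp t) \<le> k"
proof (rule degree_le, intro allI impI)
  fix j assume j: "k < j"
  define f where "f = (\<lambda>s. coeff (p s) j)"
  have f0: "f s = 0" if "0 < s" "s \<le> T" for s
    unfolding f_def by (rule coeff_eq_0) (use deg[OF that] j in simp)
  have "(f has_real_derivative coeff (dp t) j) (at t within {0<..T})"
    using U t unfolding poly_C1_in_time_def f_def by auto
  then have "(f has_real_derivative coeff (dp t) j) (at t within {t / 2..t})"
    by (rule has_field_derivative_subset) (use t in auto)
  then have lim: "((\<lambda>a. (f a - f t) / (a - t)) \<longlongrightarrow> coeff (dp t) j) (at_left t)"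
    using at_within_Icc_at_left[of "t / 2" t] t by (simp add: has_field_derivative_iff)
  have "\<forall>\<^sub>F a in at_left t. a \<in> {0<..<t}" by (rule eventually_at_left_real[OF t(1)])
  then have "\<forall>\<^sub>F a in at_left t. (f a - f t) / (a - t) = 0"
    by eventually_elim (use f0 t in auto)
  then have "((\<lambda>a. (f a - f t) / (a - t)) \<longlongrightarrow> 0) (at_left t)" by (rule tendsto_eventually)
  from tendsto_unique[OF _ lim this] show "coeff (dp t) j = 0" by simp
qed

text \<open>These properties are collected apart from any equation for \<open>ut\<close> so that
  they can be instantiated twice: with the given solution, and with zero data in which B and M
  vanish.\<close>

locale burgers_data =
  fixes k :: nat and \<nu> T B :: real and u v w :: "real \<Rightarrow> real \<Rightarrow> real" and M :: "real \<Rightarrow> real"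
  assumes \<nu>: "0 < \<nu>" and T: "0 < T" and B: "0 \<le> B"
    and Hu: "\<And>t. t \<in> {0..T} \<Longrightarrow> Hbound (k + 2) B (u t)"
    and u01: "\<And>t. t \<in> {0..T} \<Longrightarrow> u t 0 = 0 \<and> u t 1 = 0"
    and prim: "\<And>t. t \<in> {0..T} \<Longrightarrow> is_primitive 0 1 (u t) (v t)"
    and Hv: "\<And>t. t \<in> {0..T} \<Longrightarrow> Hbound (k + 1) B (v t)"
    and prim2: "\<And>t. t \<in> {0..T} \<Longrightarrow> is_primitive 0 1 (v t) (\<lambda>y. (w t y + u t y * v t y) / \<nu>)"
    and wL: "\<And>t. t \<in> {0..T} \<Longrightarrow> w t \<in> L2"
    and Mc: "continuous_on {0..T} M"
    and Mm: "\<And>a b. 0 \<le> a \<Longrightarrow> a \<le> b \<Longrightarrow> b \<le> T \<Longrightarrow> M a \<le> M b"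
    and Hdu: "\<And>a b. 0 \<le> a \<Longrightarrow> a \<le> b \<Longrightarrow> b \<le> T \<Longrightarrow> Hbound (k + 2) (M b - M a) (\<lambda>y. u b y - u a y)"
    and Hdv: "\<And>a b. 0 \<le> a \<Longrightarrow> a \<le> b \<Longrightarrow> b \<le> T \<Longrightarrow> Hbound (k + 1) (M b - M a) (\<lambda>y. v b y - v a y)"
    and strong: "\<And>b e. 0 < b \<Longrightarrow> b \<le> T \<Longrightarrow> 0 < e \<Longrightarrow>
      \<forall>\<^sub>F a in at_left b. l2norm (\<lambda>y. u b y - u a y - (b - a) * w b y) \<le> e * (b - a)"
begin

lemma cont: "t \<in> {0..T} \<Longrightarrow> continuous_on {0..1} (u t)" "t \<in> {0..T} \<Longrightarrow> continuous_on {0..1} (v t)"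
  using is_primitive_continuous[OF prim] is_primitive_continuous[OF prim2] by auto

lemma L2: "t \<in> {0..T} \<Longrightarrow> u t \<in> L2" "t \<in> {0..T} \<Longrightarrow> v t \<in> L2"
  using L2_on_continuous[OF cont(1)] L2_on_continuous[OF cont(2)] by auto

lemma u_sup: "t \<in> {0..T} \<Longrightarrow> y \<in> {0..1} \<Longrightarrow> \<bar>u t y\<bar> \<le> (real k + 3) * B"
  using Hbound_sup[of "k + 1" B "u t" y] Hu[of t] by (simp add: algebra_simps del: Hbound.simps)

lemma v_sup: "t \<in> {0..T} \<Longrightarrow> y \<in> {0..1} \<Longrightarrow> \<bar>v t y\<bar> \<le> (real k + 3) * B"
  using Hbound_sup[of k B "v t" y] Hv[of t] B by (simp add: algebra_simps del: Hbound.simps)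

lemma du_sup: "0 \<le> a \<Longrightarrow> a \<le> b \<Longrightarrow> b \<le> T \<Longrightarrow> y \<in> {0..1} \<Longrightarrow> \<bar>u b y - u a y\<bar> \<le> (real k + 3) * (M b - M a)"
  using Hbound_sup[of "k + 1" "M b - M a" "\<lambda>y. u b y - u a y" y] Hdu[of a b] by (simp add: algebra_simps del: Hbound.simps)

lemma Hu1: "t \<in> {0..T} \<Longrightarrow> Hbound (k + 1) ((real k + 3) * B) (u t)"
  using Hbound_lower[of "k + 1" B "u t"] Hu[of t] by (simp add: add.commute del: Hbound.simps)

lemma Hdu1: "0 \<le> a \<Longrightarrow> a \<le> b \<Longrightarrow> b \<le> T \<Longrightarrow> Hbound (k + 1) ((real k + 3) * (M b - M a)) (\<lambda>y. u b y - u a y)"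
  using Hbound_lower[of "k + 1" "M b - M a" "\<lambda>y. u b y - u a y"] Hdu[of a b] by (simp add: add.commute del: Hbound.simps)

definition "F t = (\<lambda>y. \<nu> * v t y - (u t y)\<^sup>2 / 3)"
definition "F' t = (\<lambda>y. w t y + u t y * v t y / 3)"

lemma F: "t \<in> {0..T} \<Longrightarrow> is_primitive 0 1 (F t) (F' t)" "t \<in> {0..T} \<Longrightarrow> F' t \<in> L2"
proof -
  assume t: "t \<in> {0..T}"
  have "is_primitive 0 1 (\<lambda>y. \<nu> * v t y - 1/3 * (u t y * u t y))
      (\<lambda>y. \<nu> * ((w t y + u t y * v t y) / \<nu>) - 1/3 * (v t y * u t y + u t y * v t y))"
    by (intro is_primitive_diff is_primitive_cmult is_primitive_mult prim[OF t] prim2[OF t])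
  moreover have "(\<lambda>y. \<nu> * ((w t y + u t y * v t y) / \<nu>) - 1/3 * (v t y * u t y + u t y * v t y)) = F' t"
    using \<nu> by (auto simp: F'_def field_simps)
  ultimately show "is_primitive 0 1 (F t) (F' t)" by (simp add: F_def power2_eq_square)
  have "(\<lambda>y. u t y * v t y / 3) \<in> L2"
    by (rule L2_on_continuous) (intro continuous_intros cont[OF t], simp)
  then show "F' t \<in> L2" unfolding F'_def by (rule L2_on_add[OF wL[OF t]])
qed

text \<open>The product estimate wants one factor of order k + 1 and one of order k + 2; lowering u
  costs the factor k + 3. The increment of u^2 is factored as a difference times a sum, so that it
  is linear in the increment of M.\<close>

lemma HF:
  assumes C: "\<And>f g A B. Hbound (k + 1) A f \<Longrightarrow> Hbound (k + 2) B g \<Longrightarrow> Hbound (k + 1) (C * (A * B)) (\<lambda>x. f x * g x)"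
  shows "t \<in> {0..T} \<Longrightarrow> Hbound (k + 1) (\<nu> * B + 1/3 * (C * (((real k + 3) * B) * B))) (F t)"
    and "0 \<le> a \<Longrightarrow> a \<le> b \<Longrightarrow> b \<le> T \<Longrightarrow>
      Hbound (k + 1) (\<nu> * (M b - M a) + 1/3 * (C * (((real k + 3) * (M b - M a)) * (B + B)))) (\<lambda>y. F b y - F a y)"
proof -
  assume t: "t \<in> {0..T}"
  have "Hbound (k + 1) (\<bar>\<nu>\<bar> * B + \<bar>- 1/3\<bar> * (C * (((real k + 3) * B) * B))) (\<lambda>y. \<nu> * v t y + - 1/3 * (u t y * u t y))"
    by (intro Hbound_add Hbound_cmult Hv[OF t] C[OF Hu1[OF t] Hu[OF t]])
  then show "Hbound (k + 1) (\<nu> * B + 1/3 * (C * (((real k + 3) * B) * B))) (F t)"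
    using \<nu> by (simp add: F_def power2_eq_square del: Hbound.simps)
next
  assume ab: "0 \<le> a" "a \<le> b" "b \<le> T"
  have m: "a \<in> {0..T}" "b \<in> {0..T}" using ab by auto
  have "Hbound (k + 1) (\<bar>\<nu>\<bar> * (M b - M a) + \<bar>- 1/3\<bar> * (C * (((real k + 3) * (M b - M a)) * (B + B))))
      (\<lambda>y. \<nu> * (v b y - v a y) + - 1/3 * ((u b y - u a y) * (u b y + u a y)))"
    by (intro Hbound_add Hbound_cmult Hdv[OF ab] C[OF Hdu1[OF ab] Hbound_add[OF Hu[OF m(2)] Hu[OF m(1)]]])
  moreover have "(\<lambda>y. \<nu> * (v b y - v a y) + - 1/3 * ((u b y - u a y) * (u b y + u a y))) = (\<lambda>y. F b y - F a y)"
    by (simp add: F_def fun_eq_iff power2_eq_square field_simps)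
  moreover have "\<bar>\<nu>\<bar> = \<nu>" "\<bar>- 1/3\<bar> = (1/3 :: real)" using \<nu> by auto
  ultimately show "Hbound (k + 1) (\<nu> * (M b - M a) + 1/3 * (C * (((real k + 3) * (M b - M a)) * (B + B)))) (\<lambda>y. F b y - F a y)"
    by metis
qed

text \<open>The factor \<open>H\<close> stands for $h^{k+1}$ unless \<open>u\<close> vanishes identically.\<close>

lemma error_bound:
  "\<exists>C. \<forall>N x uh g H. is_mesh N x \<longrightarrow> 0 < H \<longrightarrow> H \<le> 1 \<longrightarrow> mesh_size N x ^ (k + 1) * B \<le> H * B \<longrightarrow>
     (\<forall>a b. 0 \<le> a \<longrightarrow> a \<le> b \<longrightarrow> b \<le> T \<longrightarrow> mesh_size N x ^ (k + 1) * (M b - M a) \<le> H * (M b - M a)) \<longrightarrow>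
     wg_solution k (k + 1) \<nu> T g N x uh \<longrightarrow> (\<forall>y\<in>{0<..<1}. u 0 y = g y) \<longrightarrow>
     (\<forall>t\<in>{0<..T}. norm_h N x (\<lambda>i y. v t y - poly (weak_derivative (k + 1) x (uh t) i) y) \<le> C * H)"
proof -
  obtain K1 where K1: "1 \<le> K1" and inv1: "\<And>a b p y. a < b \<Longrightarrow> degree p \<le> k \<Longrightarrow> y \<in> {a..b} \<Longrightarrow>
      \<bar>poly p y\<bar> \<le> K1 / sqrt (b - a) * sqrt (ioint a b (\<lambda>y. (poly p y)\<^sup>2))"
    using poly_inverse_estimate[of k] by blast
  obtain K2 where K2: "1 \<le> K2" and inv2: "\<And>a b p y. a < b \<Longrightarrow> degree p \<le> k + 1 \<Longrightarrow> y \<in> {a..b} \<Longrightarrow>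
      \<bar>poly p y\<bar> \<le> K2 / sqrt (b - a) * sqrt (ioint a b (\<lambda>y. (poly p y)\<^sup>2))"
    using poly_inverse_estimate[of "k + 1"] by blast
  obtain C where C0: "0 \<le> C" and C: "\<And>f g A B. Hbound (k + 1) A f \<Longrightarrow> Hbound (k + 2) B g \<Longrightarrow> Hbound (k + 1) (C * (A * B)) (\<lambda>x. f x * g x)"
    using Hbound_mult[of "k + 1"] by auto
  define n where "n = real k + 3"
  define D where "D = M T - M 0"
  have n: "1 \<le> n" and D: "0 \<le> D" using Mm[of 0 T] T by (auto simp: n_def D_def)
  \<comment> \<open>A sum that dominates every constant required below, including 1/\<nu> and the
    total variation of M. It involves k, \<nu>, B and M but no mesh, since both inverse constants
    are free of the interval.\<close>
  define A where "A = 1 + \<nu> + 1 / \<nu> + (1 + K1 + K2) * n + (1 + K1 + K2) * (n * B) + C * n * B + C * n * B * B + \<nu> * B + D"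
  have nn: "0 \<le> 1 / \<nu>" "0 \<le> n * B" "0 \<le> C * n * B" "0 \<le> C * n * B * B" "0 \<le> \<nu> * B" "0 \<le> K1 * n" "0 \<le> K2 * n"
      "0 \<le> K1 * (n * B)" "0 \<le> K2 * (n * B)" "K1 * 1 \<le> K1 * n"
    using \<nu> B C0 K1 K2 n by auto
  have ex: "(1 + K1 + K2) * q = q + K1 * q + K2 * q" for q by (simp add: algebra_simps)
  have A: "1 \<le> A" "\<nu> \<le> A" "1 / \<nu> \<le> A" "K1 \<le> A" "n + K1 * n \<le> A" "n * B \<le> A" "K1 * (n * B) \<le> A" "K2 * (n * B) \<le> A" "D \<le> A"
      "\<nu> + C * n * B \<le> A" "\<nu> * B + C * n * B * B \<le> A" "n \<le> A"
    using nn D n \<nu> K1 K2 unfolding A_def ex by linarith+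
  show ?thesis
  proof (intro exI[of _ "wg_time.C8 A T"] allI impI ballI)
    fix N x uh g H t
    assume m: "is_mesh N x" and H: "0 < H" "H \<le> 1" and HB: "mesh_size N x ^ (k + 1) * B \<le> H * B"
      and HM: "\<forall>a b. 0 \<le> a \<longrightarrow> a \<le> b \<longrightarrow> b \<le> T \<longrightarrow> mesh_size N x ^ (k + 1) * (M b - M a) \<le> H * (M b - M a)"
      and wg: "wg_solution k (k + 1) \<nu> T g N x uh" and ug: "\<forall>y\<in>{0<..<1}. u 0 y = g y" and t: "t \<in> {0<..T}"
    interpret mesh N x by unfold_locales (rule m)
    let ?h = "mesh_size N x ^ (k + 1)"
    define Pu Pv where "Pu = (\<lambda>t. L2_projection k x (u t))" and "Pv = (\<lambda>t. L2_projection (k + 1) x (v t))"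
    have Pu: "is_proj k (u t) (Pu t)" if "t \<in> {0..T}" for t unfolding Pu_def by (rule is_proj_exists[OF L2(1)[OF that]])
    have Pv: "is_proj (k + 1) (v t) (Pv t)" if "t \<in> {0..T}" for t unfolding Pv_def by (rule is_proj_exists[OF L2(2)[OF that]])
    have S: "uh t \<in> S_h0 k N" if "t \<in> {0..T}" for t using wg that by (auto simp: wg_solution_def)
    obtain dU where dU: "\<And>i. i \<in> {1..<N} \<Longrightarrow> poly_C1_in_time T (\<lambda>t. interior_part (uh t) i) (\<lambda>t. dU t i)"
      and scheme: "\<And>t V. t \<in> {0<..T} \<Longrightarrow> V \<in> S_h0 k N \<Longrightarrow>
           inner_h N x (\<lambda>i. poly (dU t i)) (\<lambda>i. poly (interior_part V i))
           + \<nu> * inner_h N x (\<lambda>i. poly (weak_derivative (k + 1) x (uh t) i)) (\<lambda>i. poly (weak_derivative (k + 1) x V i))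
           + 1/3 * inner_h N x (\<lambda>i y. poly (interior_part (uh t) i) y * poly (weak_derivative (k + 1) x (uh t) i) y)
               (\<lambda>i. poly (interior_part V i))
           - 1/3 * inner_h N x (\<lambda>i y. poly (interior_part (uh t) i) y * poly (interior_part (uh t) i) y)
               (\<lambda>i. poly (weak_derivative (k + 1) x V i)) = 0"
      using wg unfolding wg_solution_def by blast
    have degU: "degree (interior_part (uh t) i) \<le> k" if "t \<in> {0..T}" "i \<in> {1..<N}" for t i
      using S[OF that(1)] that(2) by (auto simp: S_h0_def S_h_def)
    have deg_dU: "degree (dU t i) \<le> k" if "t \<in> {0<..T}" "i \<in> {1..<N}" for t i
      by (rule degree_time_derivative[OF dU[OF that(2)]]) (use degU that in auto)
    have "\<forall>t\<in>{0..T}. \<exists>G. is_interp k (F t) G"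
      using is_interp_exists[OF F(1) F(2)] by metis
    from bchoice[OF this] obtain G where G: "\<And>t. t \<in> {0..T} \<Longrightarrow> is_interp k (F t) (G t)" by blast
    have hB: "?h * (c * B) \<le> A * H" if "0 \<le> c" "c * B \<le> A" for c
    proof -
      have "?h * (c * B) = c * (?h * B)" by simp
      also have "\<dots> \<le> c * (H * B)" using HB that by (intro mult_left_mono) auto
      also have "\<dots> = (c * B) * H" by simp
      also have "\<dots> \<le> A * H" using that H by (intro mult_right_mono) auto
      finally show ?thesis .
    qed
    have hM: "?h * (c * (M b - M a)) \<le> A * H * (M b - M a)" if "0 \<le> c" "c \<le> A" "0 \<le> a" "a \<le> b" "b \<le> T" for c a b
    proof -
      have "?h * (c * (M b - M a)) = c * (?h * (M b - M a))" by simp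
      also have "\<dots> \<le> c * (H * (M b - M a))" using HM that by (intro mult_left_mono) auto
      also have "\<dots> \<le> A * (H * (M b - M a))" using that H Mm[of a b] by (intro mult_right_mono) auto
      finally show ?thesis by simp
    qed
    have "\<forall>t\<in>{0<..T}. \<exists>tF. wg_static N x k \<nu> A H (u t) (v t) (w t) (uh t) (dU t) (Pu t) (Pv t) (G t) tF"
    proof
      fix t assume t: "t \<in> {0<..T}"
      then have t': "t \<in> {0..T}" by auto
      have Gt: "is_interp k (\<lambda>y. \<nu> * v t y - (u t y)\<^sup>2 / 3) (G t)" using G[OF t'] by (simp add: F_def)
      obtain tF where tF: "\<And>i. i \<in> {1..<N} \<Longrightarrow> degree (tF i) \<le> k + 1" "continuous_pw tF"
        "\<And>q :: nat \<Rightarrow> real poly. (\<And>i. i \<in> {1..<N} \<Longrightarrow> degree (q i) \<le> k + 1) \<Longrightarrow>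
          \<nu> * ip (\<lambda>y. v t y - pw (weak_derivative (k + 1) x (uh t)) y) (pw q)
          = ip (\<lambda>y. (\<nu> * v t y - (u t y)\<^sup>2 / 3 - pw (G t) y) + pw tF y + ((u t y)\<^sup>2 - (pw (interior_part (uh t)) y)\<^sup>2) / 3) (pw q)"
        "\<And>q :: nat \<Rightarrow> real poly. (\<And>i. i \<in> {1..<N} \<Longrightarrow> degree (q i) \<le> k) \<Longrightarrow>
          ip (\<lambda>y. w t y - pw (dU t) y) (pw q)
          = ip (\<lambda>y. pw (\<lambda>i. pderiv (tF i)) y - (u t y * v t y - pw (interior_part (uh t)) y * pw (weak_derivative (k + 1) x (uh t)) y) / 3) (pw q)"
        using flux_identities[OF prim[OF t'] prim2[OF t'] wL[OF t'] \<nu> Gt S[OF t'] scheme[OF t]] by blast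
      have "wg_static N x k \<nu> A H (u t) (v t) (w t) (uh t) (dU t) (Pu t) (Pv t) (G t) tF"
      proof (rule wg_static.intro[OF mesh.intro[OF m]], rule wg_static_axioms.intro)
        show "0 < \<nu>" "\<nu> \<le> A" "1 \<le> A" "0 < H" "H \<le> 1" by (fact \<nu> A H)+
        show "1 \<le> A * \<nu>" using A(3) \<nu> by (simp add: field_simps)
        show "is_primitive 0 1 (u t) (v t)" "continuous_on {0..1} (v t)" "w t \<in> L2" by (fact prim[OF t'] cont(2)[OF t'] wL[OF t'])+
        show "u t 0 = 0" "u t 1 = 0" using u01[OF t'] by auto
        show "is_proj k (u t) (Pu t)" "is_proj (k + 1) (v t) (Pv t)" by (fact Pu[OF t'] Pv[OF t'])+
        show "\<bar>u t y\<bar> \<le> A" if "y \<in> {0..1}" for y using u_sup[OF t' that] A(6) by (simp add: n_def)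
        show "\<bar>v t y\<bar> \<le> A" if "y \<in> {0..1}" for y using v_sup[OF t' that] A(6) by (simp add: n_def)
        show "\<bar>pw (Pu t) y\<bar> \<le> A" for y
          by (rule order_trans[OF is_proj_sup[OF inv1 _ Pu[OF t'] L2(1)[OF t'], of "n * B"] A(7)])
            (use K1 u_sup[OF t'] nn in \<open>auto simp: n_def\<close>)
        show "\<bar>pw (Pv t) y\<bar> \<le> A" for y
          by (rule order_trans[OF is_proj_sup[OF inv2 _ Pv[OF t'] L2(2)[OF t'], of "n * B"] A(8)])
            (use K2 v_sup[OF t'] nn in \<open>auto simp: n_def\<close>)
        show "l2norm (\<lambda>y. u t y - pw (Pu t) y) \<le> A * H"
          by (rule order_trans[OF is_proj_error[OF Pu[OF t'] Hu1[OF t']]]) (use hB[of n] A(6) n in \<open>simp_all add: n_def\<close>)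
        show "l2norm (\<lambda>y. v t y - pw (Pv t) y) \<le> A * H"
        proof (rule order_trans[OF is_proj_error[OF Pv[OF t'] Hv[OF t']]])
          have "1 * B \<le> n * B" using n B by (rule mult_right_mono)
          then show "?h * B \<le> A * H" using hB[of 1] A(6) by simp
        qed simp
        show "l2norm (\<lambda>y. \<nu> * v t y - (u t y)\<^sup>2 / 3 - pw (G t) y) \<le> A * H"
        proof (rule order_trans[OF is_interp_error[OF Gt HF(1)[OF C t', unfolded F_def]]])
          have "(\<nu> + 1/3 * (C * n * B)) * B \<le> \<nu> * B + C * n * B * B" using nn by (simp add: algebra_simps)
          then have "?h * ((\<nu> + 1/3 * (C * n * B)) * B) \<le> A * H"
            using A(11) \<nu> nn by (intro hB) auto
          then show "?h * (\<nu> * B + 1/3 * (C * (((real k + 3) * B) * B))) \<le> A * H"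
            by (simp add: n_def algebra_simps)
        qed
        fix a b y :: real and p :: "real poly" assume "a < b" "degree p \<le> k" "y \<in> {a..b}"
        then have "\<bar>poly p y\<bar> \<le> K1 / sqrt (b - a) * sqrt (ioint a b (\<lambda>y. (poly p y)\<^sup>2))" by (rule inv1)
        also have "\<dots> \<le> A / sqrt (b - a) * sqrt (ioint a b (\<lambda>y. (poly p y)\<^sup>2))"
          using A(4) \<open>a < b\<close> by (intro mult_right_mono divide_right_mono real_sqrt_ge_zero ioint_nonneg) auto
        finally show "\<bar>poly p y\<bar> \<le> A / sqrt (b - a) * sqrt (ioint a b (\<lambda>y. (poly p y)\<^sup>2))" .
      qed (use S[OF t'] deg_dU[OF t] tF in \<open>simp_all add: wd_def\<close>)
      then show "\<exists>tF. wg_static N x k \<nu> A H (u t) (v t) (w t) (uh t) (dU t) (Pu t) (Pv t) (G t) tF" by (intro exI[of _ tF])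
    qed
    from bchoice[OF this] obtain tF where
      st: "\<And>t. t \<in> {0<..T} \<Longrightarrow> wg_static N x k \<nu> A H (u t) (v t) (w t) (uh t) (dU t) (Pu t) (Pv t) (G t) (tF t)" by blast
    have wt: "wg_time N x k \<nu> A H T u v w M uh dU Pu Pv G tF"
    proof (rule wg_time.intro[OF mesh.intro[OF m]], rule wg_time_axioms.intro)
      show "0 < T" "continuous_on {0..T} M" by (fact T Mc)+
      show "M T - M 0 \<le> A" using A(9) by (simp add: D_def)
      \<comment> \<open>The discrete initial value is the projection of g; agreement of g with
        \<open>u 0\<close> in the open interval suffices, because projections ignore the
        nodes.\<close>
      show "Pu 0 i = interior_part (uh 0) i" if "i \<in> {1..<N}" for i
        using wg that L2_projection_cong[of "u 0" g i k] ug by (simp add: Pu_def wg_solution_def Q_h_def)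
      show "l2norm (\<lambda>y. \<nu> * v b y - (u b y)\<^sup>2 / 3 - pw (G b) y - (\<nu> * v a y - (u a y)\<^sup>2 / 3 - pw (G a) y)) \<le> A * H * (M b - M a)"
        if "0 < a" "a \<le> b" "b \<le> T" for a b
      proof -
        have ab: "0 \<le> a" "a \<le> b" "b \<le> T" and abT: "a \<in> {0..T}" "b \<in> {0..T}" using that by auto
        have "l2norm (\<lambda>y. (F b y - F a y) - pw (\<lambda>i. G b i - G a i) y)
            \<le> ?h * (\<nu> * (M b - M a) + 1/3 * (C * (((real k + 3) * (M b - M a)) * (B + B))))"
          by (rule is_interp_error[OF is_interp_diff[OF G[OF abT(2)] G[OF abT(1)]] HF(2)[OF C ab]])
        also have "\<nu> * (M b - M a) + 1/3 * (C * (((real k + 3) * (M b - M a)) * (B + B))) = (\<nu> + 2/3 * (C * n * B)) * (M b - M a)"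
          by (simp add: n_def algebra_simps add_divide_distrib diff_divide_distrib)
        also have "?h * \<dots> \<le> A * H * (M b - M a)"
          by (rule hM) (use A(10) nn \<nu> ab in auto)
        also have "(\<lambda>y. (F b y - F a y) - pw (\<lambda>i. G b i - G a i) y)
            = (\<lambda>y. \<nu> * v b y - (u b y)\<^sup>2 / 3 - pw (G b) y - (\<nu> * v a y - (u a y)\<^sup>2 / 3 - pw (G a) y))"
          by (simp add: F_def pw_diff fun_eq_iff)
        finally show ?thesis .
      qed
      fix a b assume ab: "0 \<le> a" "a \<le> b" "b \<le> T"
      then have abT: "a \<in> {0..T}" "b \<in> {0..T}" by auto
      have M: "0 \<le> M b - M a" using Mm[OF ab] by simp
      show "M a \<le> M b" by (rule Mm[OF ab])
      have le: "\<bar>u b y - u a y\<bar> \<le> n * (M b - M a)" if "y \<in> {0..1}" for y using du_sup[OF ab that] by (simp add: n_def)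
      show "\<bar>u b y - u a y\<bar> \<le> A * (M b - M a)" if "y \<in> {0..1}" for y
        by (rule order_trans[OF le[OF that] mult_right_mono[OF A(12) M]])
      have L: "(\<lambda>y. u b y - u a y) \<in> L2" by (intro L2_on_diff L2 abT)
      have P: "is_proj k (\<lambda>y. u b y - u a y) (\<lambda>i. Pu b i - Pu a i)" by (rule is_proj_diff[OF Pu[OF abT(2)] Pu[OF abT(1)] L2(1)[OF abT(2)] L2(1)[OF abT(1)]])
      show "l2norm (\<lambda>y. u b y - u a y - pw (\<lambda>i. Pu b i - Pu a i) y) \<le> A * H * (M b - M a)"
        by (rule order_trans[OF is_proj_error[OF P Hdu1[OF ab]]]) (use hM[of n a b] A(12) n ab in \<open>simp_all add: n_def\<close>)
      show "\<bar>u b y - u a y - pw (\<lambda>i. Pu b i - Pu a i) y\<bar> \<le> A * (M b - M a)" if "y \<in> {0<..<1}" for y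
      proof -
        have "\<bar>pw (\<lambda>i. Pu b i - Pu a i) y\<bar> \<le> K1 * (n * (M b - M a))"
          by (rule is_proj_sup[OF inv1 _ P L]) (use K1 le M n in auto)
        then have "\<bar>u b y - u a y - pw (\<lambda>i. Pu b i - Pu a i) y\<bar> \<le> n * (M b - M a) + K1 * (n * (M b - M a))"
          using le[of y] that by auto
        also have "\<dots> = (n + K1 * n) * (M b - M a)" by (simp add: algebra_simps)
        also have "\<dots> \<le> A * (M b - M a)" by (rule mult_right_mono[OF A(5) M])
        finally show ?thesis .
      qed
    qed (use st S cont(1) strong dU in auto)
    have "t \<in> {0..T}" using t by auto
    from norm_h_eq_l2norm[OF L2(2)[OF this]]
    have "norm_h N x (\<lambda>i y. v t y - poly (weak_derivative (k + 1) x (uh t) i) y) = l2norm (\<lambda>y. v t y - pw (wd k (uh t)) y)"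
      by (simp only: wd_def)
    also have "\<dots> \<le> wg_time.C8 A T * H" by (rule wg_time.gradient_error[OF wt]) (use t in auto)
    finally show "norm_h N x (\<lambda>i y. v t y - poly (weak_derivative (k + 1) x (uh t) i) y) \<le> wg_time.C8 A T * H" .
  qed
qed

section \<open>Vanishing initial data\<close>

lemma l2norm_u_cont: "continuous_on {0..T} (\<lambda>t. l2norm (u t))"
proof (rule continuous_on_l2norm[OF L2(1)])
  fix t e :: real assume t: "t \<in> {0..T}" and e: "0 < e"
  have "(M \<longlongrightarrow> M t) (at t within {0..T})" using Mc t by (auto simp: continuous_on_def)
  from tendstoD[OF this, of "e / (real k + 3)"] e have "\<forall>\<^sub>F s in at t within {0..T}. dist (M s) (M t) < e / (real k + 3)" by simp
  moreover have "\<forall>\<^sub>F s in at t within {0..T}. s \<in> {0..T}" unfolding eventually_at_topological by (intro exI[of _ UNIV]) auto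
  ultimately show "\<forall>\<^sub>F s in at t within {0..T}. l2norm (\<lambda>y. u s y - u t y) \<le> e"
  proof eventually_elim
    case (elim s)
    have d: "(real k + 3) * \<bar>M s - M t\<bar> \<le> e" using elim by (simp add: dist_real_def field_simps)
    have "\<bar>u s y - u t y\<bar> \<le> (real k + 3) * \<bar>M s - M t\<bar>" if "0 < y" "y < 1" for y
      using du_sup[of s t y] du_sup[of t s y] Mm[of s t] Mm[of t s] t elim(2) that
      by (cases "s \<le> t") (auto simp: abs_minus_commute)
    then show ?case
      by (intro l2norm_le_sup(2)[OF L2_onD(1)[OF L2_on_diff[OF L2(1)[OF elim(2)] L2(1)[OF t]]]])
        (use d e in force)+
  qed
qed

text \<open>Here (w,u) = -\<nu> (v,v): the convection term u^2 v is the derivative of u^3/3, and u v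
  is a primitive, both vanishing at the ends of the interval.\<close>

lemma ip_w_u: "t \<in> {0..T} \<Longrightarrow> ip (w t) (u t) \<le> 0"
proof -
  assume t: "t \<in> {0..T}"
  have i: "iointegrable 0 1 (\<lambda>y. w t y * u t y)" by (rule L2_on_mult_integrable[OF wL[OF t] L2(1)[OF t]])
  have c: "iointegrable 0 1 (\<lambda>y. (v t y)\<^sup>2)" "iointegrable 0 1 (\<lambda>y. (u t y)\<^sup>2 * v t y)"
    by (rule continuous_iointegrable, intro continuous_intros cont[OF t])+
  have "is_primitive 0 1 (\<lambda>y. (u t y * u t y) * u t y) (\<lambda>y. (v t y * u t y + u t y * v t y) * u t y + (u t y * u t y) * v t y)"
    by (intro is_primitive_mult prim[OF t])
  from is_primitive_integral[OF this, of 0 1] u01[OF t]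
  have "ioint 0 1 (\<lambda>y. (v t y * u t y + u t y * v t y) * u t y + (u t y * u t y) * v t y) = 0" by simp
  moreover have "ioint 0 1 (\<lambda>y. (v t y * u t y + u t y * v t y) * u t y + (u t y * u t y) * v t y) = 3 * ioint 0 1 (\<lambda>y. (u t y)\<^sup>2 * v t y)"
    unfolding integral_mult_right_zero[symmetric] by (rule ioint_cong) (simp add: power2_eq_square algebra_simps)
  ultimately have 0: "ioint 0 1 (\<lambda>y. (u t y)\<^sup>2 * v t y) = 0" by simp
  have "is_primitive 0 1 (\<lambda>y. u t y * v t y) (\<lambda>y. v t y * v t y + u t y * ((w t y + u t y * v t y) / \<nu>))"
    by (intro is_primitive_mult prim[OF t] prim2[OF t])
  from is_primitive_integral[OF this, of 0 1] u01[OF t]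
  have "ioint 0 1 (\<lambda>y. v t y * v t y + u t y * ((w t y + u t y * v t y) / \<nu>)) = 0" by simp
  moreover have "ioint 0 1 (\<lambda>y. v t y * v t y + u t y * ((w t y + u t y * v t y) / \<nu>))
      = ioint 0 1 (\<lambda>y. (v t y)\<^sup>2 + (1 / \<nu>) * (w t y * u t y + (u t y)\<^sup>2 * v t y))"
    by (rule ioint_cong) (simp add: power2_eq_square algebra_simps add_divide_distrib)
  moreover have "\<dots> = ioint 0 1 (\<lambda>y. (v t y)\<^sup>2) + (1 / \<nu>) * (ip (w t) (u t) + 0)"
    using i c 0 by simp
  ultimately have "ioint 0 1 (\<lambda>y. (v t y)\<^sup>2) + (1 / \<nu>) * ip (w t) (u t) = 0" by simp
  moreover have "0 \<le> ioint 0 1 (\<lambda>y. (v t y)\<^sup>2)" by (rule ioint_nonneg) simp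
  ultimately have "(1 / \<nu>) * ip (w t) (u t) \<le> 0" by linarith
  then show ?thesis using \<nu> by (simp add: divide_le_0_iff)
qed

text \<open>Decay of energy, again from left difference quotients: the derivative of the square of
  the norm is 2 (w,u), which is nonpositive.\<close>

lemma l2norm_u_le: "t \<in> {0..T} \<Longrightarrow> (l2norm (u t))\<^sup>2 \<le> (l2norm (u 0))\<^sup>2"
proof (rule field_le_epsilon)
  fix e :: real assume t: "t \<in> {0..T}" and e: "0 < e"
  \<comment> \<open>A linear slack d t pays for the remainders of the difference quotients; over the
    whole time interval it amounts to at most e.\<close>
  define d where "d = e / T"
  have d: "0 < d" "d * t \<le> e" using e T t by (auto simp: d_def field_simps)
  have "(l2norm (u t))\<^sup>2 - d * t \<le> (l2norm (u 0))\<^sup>2 - d * 0"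
  proof (rule antimono_left_local[where f = "\<lambda>t. (l2norm (u t))\<^sup>2 - d * t"])
    show "0 \<le> t" using t by simp
    show "continuous_on {0..t} (\<lambda>t. (l2norm (u t))\<^sup>2 - d * t)"
      by (intro continuous_intros continuous_on_subset[OF l2norm_u_cont]) (use t in auto)
    fix b assume b: "0 < b" "b \<le> t"
    then have bT: "b \<le> T" "b \<in> {0..T}" using t by auto
    define q where "q = l2norm (u b)"
    have q: "0 \<le> q" by (simp add: q_def)
    define \<epsilon> where "\<epsilon> = d / (2 * (q + 1))"
    have \<epsilon>: "0 < \<epsilon>" "2 * (\<epsilon> * q) \<le> d"
    proof -
      show "0 < \<epsilon>" using d q by (simp add: \<epsilon>_def)
      then have "2 * (\<epsilon> * q) \<le> 2 * (\<epsilon> * (q + 1))" by simp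
      also have "\<dots> = d" using q by (simp add: \<epsilon>_def field_simps)
      finally show "2 * (\<epsilon> * q) \<le> d" .
    qed
    from strong[OF b(1) bT(1) \<epsilon>(1)] eventually_at_left_real[OF b(1)]
    show "\<forall>\<^sub>F a in at_left b. (l2norm (u b))\<^sup>2 - d * b \<le> (l2norm (u a))\<^sup>2 - d * a"
    proof eventually_elim
      case (elim a)
      have a: "0 < a" "a < b" "a \<in> {0..T}" using elim(2) bT by auto
      let ?R = "\<lambda>y. u b y - u a y - (b - a) * w b y"
      have RL: "?R \<in> L2" by (intro L2_on_diff L2_on_cmult L2 wL bT a)
      have "(l2norm (u b))\<^sup>2 - (l2norm (u a))\<^sup>2 \<le> 2 * ip (\<lambda>y. u b y - u a y) (u b)"
        by (rule l2norm_square_diff_le[OF L2(1)[OF bT(2)] L2(1)[OF a(3)]])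
      also have "ip (\<lambda>y. u b y - u a y) (u b) = ip (\<lambda>y. (b - a) * w b y + ?R y) (u b)"
        by (rule ioint_cong) (simp add: algebra_simps)
      also have "\<dots> = (b - a) * ip (w b) (u b) + ip ?R (u b)"
        unfolding ip_add[OF L2_on_cmult[OF wL[OF bT(2)]] RL L2(1)[OF bT(2)]] ip_cmult ..
      also have "2 * \<dots> \<le> 2 * ((b - a) * 0 + (\<epsilon> * (b - a)) * q)"
      proof (intro mult_left_mono add_mono)
        show "ip ?R (u b) \<le> (\<epsilon> * (b - a)) * q" unfolding q_def
          by (rule order_trans[OF ip_le(1)[OF RL L2(1)[OF bT(2)]] mult_right_mono[OF elim(1)]]) simp
      qed (use ip_w_u[OF bT(2)] a in auto)
      also have "\<dots> = (b - a) * (2 * (\<epsilon> * q))" by simp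
      also have "\<dots> \<le> (b - a) * d" using \<epsilon> a by (intro mult_left_mono) auto
      finally show ?case by (simp add: algebra_simps)
    qed
  qed
  then show "(l2norm (u t))\<^sup>2 \<le> (l2norm (u 0))\<^sup>2 + e" using d by simp
qed

lemma vanishing:
  assumes 0: "l2norm (u 0) = 0" and t: "t \<in> {0..T}"
  shows "\<forall>y\<in>{0..1}. u t y = 0" "AE y in lebesgue_on {0<..<1}. v t y = 0"
proof -
  have "l2norm (u t) = 0" using l2norm_u_le[OF t] 0 by simp
  from AE_eq_continuous[OF l2norm_zero_AE[OF L2(1)[OF t] this] _ cont(1)[OF t]]
  show z: "\<forall>y\<in>{0..1}. u t y = 0" by simp
  show "AE y in lebesgue_on {0<..<1}. v t y = 0"
  proof (rule ioint_zero_AE)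
    show "iointegrable 0 1 (v t)" by (rule is_primitiveD[OF prim[OF t]])
    show "ioint 0 s (v t) = 0" if "0 \<le> s" "s \<le> 1" for s
      using is_primitive_integral[OF prim[OF t], of 0 s] z that by simp
  qed
qed

end

lemma Hbound_zero: "Hbound m 0 (\<lambda>y. 0)"
proof (induction m)
  case 0
  show ?case using L2_on_continuous[of 0 1 "\<lambda>_. 0"] by (simp add: l2norm_def)
next
  case (Suc m)
  have "is_primitive 0 1 (\<lambda>y. 0) (\<lambda>y. 0)" by (simp add: is_primitive_def)
  with Suc show ?case by auto
qed

text \<open>With B = 0 and constant M the conditions that relate H to the mesh size are trivially
  true, so the error bound holds with arbitrarily small H.\<close>

lemma zero_data:
  assumes "0 < \<nu>" "0 < T"
  shows "burgers_data k \<nu> T 0 (\<lambda>t y. 0) (\<lambda>t y. 0) (\<lambda>t y. 0) (\<lambda>t. 0)"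
proof -
  have "is_primitive 0 1 (\<lambda>y. 0) (\<lambda>y. 0)" "(\<lambda>y. 0) \<in> L2" "l2norm (\<lambda>y. 0) = 0"
    using L2_on_continuous[of 0 1 "\<lambda>_. 0"] by (simp_all add: is_primitive_def l2norm_def)
  then show ?thesis
    by (intro burgers_data.intro)
      (use assms Hbound_zero in \<open>auto simp del: Hbound.simps intro!: eventually_at_leftI[of 0]\<close>)
qed

theorem theorem2:
  fixes k r :: nat and \<nu> T :: real
    and g :: "real \<Rightarrow> real" and u ut :: "real \<Rightarrow> real \<Rightarrow> real"
  assumes "r = k + 1" and "\<nu> > 0" and "T > 0"
    and "is_H1_sobolev_with_deriv T (1 + r) u ut"
    and "continuous_representative T (1 + r) u"
    and "continuous_on {0..1} g"
    and "burgers_solution \<nu> T g u ut"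
  shows "\<exists>C::real. \<forall>N x uh. is_mesh N x \<longrightarrow> wg_solution k r \<nu> T g N x uh \<longrightarrow>
    (\<forall>t\<in>{0<..T}.
       (norm_h N x (\<lambda>i y. wderiv 1 (u t) y - poly (weak_derivative r x (uh t) i) y))\<^sup>2
       \<le> C * mesh_size N x ^ (2 * (k + 1)) *
           ((sobolev_norm (k + 2) (u 0))\<^sup>2
            + (LINT s|lebesgue_on {0<..<t}. (sobolev_norm (k + 2) (ut s))\<^sup>2)))"
proof -
  have r: "r = k + 1" "1 + r = k + 2" using assms(1) by auto
  have H1: "is_H1_sobolev_with_deriv T (k + 2) u ut" and cr: "continuous_representative T (k + 2) u"
    using assms(4,5) unfolding r(2) .
  obtain B M v w where a: "0 \<le> B" "\<And>t. t \<in> {0..T} \<Longrightarrow> Hbound (k + 2) B (u t)" "\<And>t. t \<in> {0..T} \<Longrightarrow> u t 0 = 0 \<and> u t 1 = 0"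
      "\<And>t. t \<in> {0..T} \<Longrightarrow> is_primitive 0 1 (u t) (v t)" "\<And>t. t \<in> {0..T} \<Longrightarrow> Hbound (k + 1) B (v t)"
      "\<And>t. t \<in> {0..T} \<Longrightarrow> is_primitive 0 1 (v t) (\<lambda>y. (w t y + u t y * v t y) / \<nu>)"
    and wd: "\<And>t. t \<in> {0..T} \<Longrightarrow> AE y in lebesgue_on {0<..<1}. wderiv 1 (u t) y = v t y"
    and b: "\<And>t. t \<in> {0..T} \<Longrightarrow> w t \<in> L2" "continuous_on {0..T} M" "\<And>a b. 0 \<le> a \<Longrightarrow> a \<le> b \<Longrightarrow> b \<le> T \<Longrightarrow> M a \<le> M b"
      "\<And>a b. 0 \<le> a \<Longrightarrow> a \<le> b \<Longrightarrow> b \<le> T \<Longrightarrow> Hbound (k + 2) (M b - M a) (\<lambda>y. u b y - u a y)"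
      "\<And>a b. 0 \<le> a \<Longrightarrow> a \<le> b \<Longrightarrow> b \<le> T \<Longrightarrow> Hbound (k + 1) (M b - M a) (\<lambda>y. v b y - v a y)"
      "\<And>b e. 0 < b \<Longrightarrow> b \<le> T \<Longrightarrow> 0 < e \<Longrightarrow>
        \<forall>\<^sub>F a in at_left b. l2norm (\<lambda>y. u b y - u a y - (b - a) * w b y) \<le> e * (b - a)"
    by (rule burgers_regularity[OF assms(2,3) H1 cr assms(7)]) (rule that)
  interpret burgers_data k \<nu> T B u v w M
    by (rule burgers_data.intro) (fact assms(2,3) a b)+
  have wL2: "wderiv 1 (u t) \<in> L2" if "t \<in> {0..T}" for t
    using cr that by (intro wderiv_L2[of _ "k + 2"]) (auto simp: continuous_representative_def)
  \<comment> \<open>\<open>wderiv 1 (u t)\<close> is an arbitrary representative; the norm does not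
    change when it is replaced by the continuous derivative or, for the zero solution, by 0.\<close>
  have norm_eq: "norm_h N x (\<lambda>i y. wderiv 1 (u t) y - poly (p i) y) = norm_h N x (\<lambda>i y. f y - poly (p i) y)"
    if "is_mesh N x" "t \<in> {0..T}" "AE y in lebesgue_on {0<..<1}. v t y = f y" "f \<in> L2" for N x t p f
  proof -
    interpret mesh N x by unfold_locales (rule that)
    have "AE y in lebesgue_on {0<..<1}. wderiv 1 (u t) y - pw p y = f y - pw p y"
      using wd[OF that(2)] that(3) by eventually_elim simp
    then show ?thesis
      unfolding norm_h_eq_l2norm[OF wL2[OF that(2)]] norm_h_eq_l2norm[OF that(4)]
      by (rule l2norm_AE[OF _ L2_onD(1)[OF L2_minus_pw[OF wL2[OF that(2)]]] L2_onD(1)[OF L2_minus_pw[OF that(4)]]])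
  qed
  have g: "u 0 y = g y" if "y \<in> {0<..<1}" for y using assms(7) that by (auto simp: burgers_solution_def)
  define n where "n = sobolev_norm (k + 2) (u 0)"
  show ?thesis
  proof (cases "n = 0")
    case False
    then have n: "0 < n" using sobolev_norm_nonneg[of "k + 2" "u 0"] unfolding n_def by linarith
    from error_bound obtain C where C: "\<And>N x uh g H t. is_mesh N x \<Longrightarrow> 0 < H \<Longrightarrow> H \<le> 1 \<Longrightarrow> mesh_size N x ^ (k + 1) * B \<le> H * B \<Longrightarrow>
        (\<forall>a b. 0 \<le> a \<longrightarrow> a \<le> b \<longrightarrow> b \<le> T \<longrightarrow> mesh_size N x ^ (k + 1) * (M b - M a) \<le> H * (M b - M a)) \<Longrightarrow>
        wg_solution k (k + 1) \<nu> T g N x uh \<Longrightarrow> (\<forall>y\<in>{0<..<1}. u 0 y = g y) \<Longrightarrow> t \<in> {0<..T} \<Longrightarrow>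
        norm_h N x (\<lambda>i y. v t y - poly (weak_derivative (k + 1) x (uh t) i) y) \<le> C * H"
      by blast
    show ?thesis
    \<comment> \<open>The initial norm n is positive, so dividing by n^2 lets the first summand on
      the right alone absorb the whole bound; the time integral only has to be nonnegative.\<close>
    proof (intro exI[of _ "C\<^sup>2 / n\<^sup>2"] allI impI ballI)
      fix N x uh t assume m: "is_mesh N x" and wg: "wg_solution k r \<nu> T g N x uh" and t: "t \<in> {0<..T}"
      interpret mesh N x by unfold_locales (rule m)
      let ?h = "mesh_size N x ^ (k + 1)"
      have h: "0 < ?h" "?h \<le> 1" using mesh_size_pos mesh_size_le by (auto intro: power_le_one simp del: power_Suc)
      have t': "t \<in> {0..T}" using t by auto
      have le: "norm_h N x (\<lambda>i y. wderiv 1 (u t) y - poly (weak_derivative r x (uh t) i) y) \<le> C * ?h"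
        unfolding norm_eq[OF m t' AE_I2[OF refl] L2(2)[OF t']] r(1)
        by (rule C[OF m h order_refl]) (use wg g t r(1) in auto)
      have "0 \<le> norm_h N x (\<lambda>i y. wderiv 1 (u t) y - poly (weak_derivative r x (uh t) i) y)"
        unfolding norm_h_eq_l2norm[OF wL2[OF t']] by simp
      then have "(norm_h N x (\<lambda>i y. wderiv 1 (u t) y - poly (weak_derivative r x (uh t) i) y))\<^sup>2 \<le> (C * ?h)\<^sup>2"
        by (rule power_mono[OF le])
      also have "\<dots> = C\<^sup>2 / n\<^sup>2 * mesh_size N x ^ (2 * (k + 1)) * n\<^sup>2"
        using n unfolding power_mult_distrib power_mult[symmetric] mult.commute[of "k + 1" 2] by simp
      also have "\<dots> \<le> C\<^sup>2 / n\<^sup>2 * mesh_size N x ^ (2 * (k + 1)) * (n\<^sup>2 + ioint 0 t (\<lambda>s. (sobolev_norm (k + 2) (ut s))\<^sup>2))"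
        using mesh_size_pos by (intro mult_left_mono) (auto intro!: ioint_nonneg)
      finally show "(norm_h N x (\<lambda>i y. wderiv 1 (u t) y - poly (weak_derivative r x (uh t) i) y))\<^sup>2
        \<le> C\<^sup>2 / n\<^sup>2 * mesh_size N x ^ (2 * (k + 1)) * ((sobolev_norm (k + 2) (u 0))\<^sup>2
            + (LINT s|lebesgue_on {0<..<t}. (sobolev_norm (k + 2) (ut s))\<^sup>2))"
        unfolding n_def .
    qed
  next
    case True
    have T0: "0 \<in> {0..T}" using assms(3) by simp
    have "l2norm (u 0) = l2norm (wderiv 0 (u 0))"
    proof (rule l2norm_AE)
      show "AE y in lebesgue_on {0<..<1}. u 0 y = wderiv 0 (u 0) y"
        using wderiv_0_AE[OF L2(1)[OF T0]] by eventually_elim simp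
      show "wderiv 0 (u 0) \<in> borel_measurable (lebesgue_on {0<..<1})"
        using cr T0 by (intro L2_onD(1)[OF wderiv_L2[of _ "k + 2"]]) (auto simp: continuous_representative_def)
    qed (rule L2_onD(1)[OF L2(1)[OF T0]])
    then have "l2norm (u 0) = 0"
      using wderiv_l2norm_le[of 0 "k + 2" "u 0"] l2norm_nonneg[of "u 0"] True unfolding n_def by linarith
    note van = vanishing[OF this]
    interpret Z: burgers_data k \<nu> T 0 "\<lambda>t y. 0" "\<lambda>t y. 0" "\<lambda>t y. 0" "\<lambda>t. 0"
      by (rule zero_data[OF assms(2,3)])
    from Z.error_bound obtain C where C: "\<And>N x uh g H t. is_mesh N x \<Longrightarrow> 0 < H \<Longrightarrow> H \<le> 1 \<Longrightarrow> mesh_size N x ^ (k + 1) * 0 \<le> H * 0 \<Longrightarrow>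
        (\<forall>a b. 0 \<le> a \<longrightarrow> a \<le> b \<longrightarrow> b \<le> T \<longrightarrow> mesh_size N x ^ (k + 1) * (0 - 0) \<le> H * (0 - 0)) \<Longrightarrow>
        wg_solution k (k + 1) \<nu> T g N x uh \<Longrightarrow> (\<forall>y\<in>{0<..<1}. 0 = g y) \<Longrightarrow> t \<in> {0<..T} \<Longrightarrow>
        norm_h N x (\<lambda>i y. 0 - poly (weak_derivative (k + 1) x (uh t) i) y) \<le> C * H"
      by blast
    show ?thesis
    \<comment> \<open>For zero data the right-hand side may vanish, so the error itself must be
      shown to be zero, and the constant 0 will do.\<close>
    proof (intro exI[of _ 0] allI impI ballI)
      fix N x uh t assume m: "is_mesh N x" and wg: "wg_solution k r \<nu> T g N x uh" and t: "t \<in> {0<..T}"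
      interpret mesh N x by unfold_locales (rule m)
      have t': "t \<in> {0..T}" using t by auto
      let ?n = "norm_h N x (\<lambda>i y. wderiv 1 (u t) y - poly (weak_derivative r x (uh t) i) y)"
      have le: "?n \<le> C * H" if "0 < H" "H \<le> 1" for H
        unfolding norm_eq[OF m t' van(2)[OF t'] L2_on_continuous[OF continuous_on_const]] r(1)
      proof (rule C[OF m that])
        show "wg_solution k (k + 1) \<nu> T g N x uh" using wg r(1) by simp
        show "\<forall>y\<in>{0<..<1}. 0 = g y" using van(1)[OF T0] g by force
        show "t \<in> {0<..T}" by (rule t)
      qed simp_all
      \<comment> \<open>The bound C H holds for every H in (0,1) with the same C; letting H tend to
        0 leaves no error.\<close>
      have "((\<lambda>H. C * H) \<longlongrightarrow> C * 0) (at_right 0)" by (intro tendsto_intros)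
      moreover have "\<forall>\<^sub>F H in at_right (0::real). ?n \<le> C * H"
        using eventually_at_right_real[of 0 1] by (rule eventually_mono) (use le in auto)
      ultimately have "?n \<le> C * 0" by (rule tendsto_lowerbound) simp
      moreover have "0 \<le> ?n" unfolding norm_h_eq_l2norm[OF wL2[OF t']] by simp
      ultimately show "?n\<^sup>2 \<le> 0 * mesh_size N x ^ (2 * (k + 1)) * ((sobolev_norm (k + 2) (u 0))\<^sup>2
            + (LINT s|lebesgue_on {0<..<t}. (sobolev_norm (k + 2) (ut s))\<^sup>2))" by simp
    qed
  qed
qed

end
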